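(* Let $\Omega$ be a bounded open set in $\mathbb R^n$, $n\geq3$, and let $A$ be any Young function. Then there exists a constant $C$ such that $$\|\mathbf u\|_{L^A(\Omega,\mathbb R^n)}\leq C\|\mathcal E^D\mathbf u\|_{L^A(\Omega,\mathbb R^{n\times n})}$$ for every $\mathbf u\in E^{D,A}_0(\Omega,\mathbb R^n)$. Assume in addition that $\Omega$ is connected and has the cone property. Then there exists a constant $C$ such that $$\inf_{\mathbf w\in\Sigma}\|\mathbf u-\mathbf w\|_{L^A(\Omega,\mathbb R^n)}\leq C\|\mathcal E^D\mathbf u\|_{L^A(\Omega,\mathbb R^{n\times n})}$$ for every $\mathbf u\in E^{D,A}(\Omega,\mathbb R^n)$.
   Context: A Young function is a convex, left-continuous function $A:[0,\infty)\to[0,\infty]$ with $A(0)=0$, not identically $0$ nor $\infty$. $L^A$ is the Orlicz space with Luxemburg norm $\|u\|_{L^A(\Omega)}=\inf\{\lambda>0:\int_\Omega A(|u|/\lambda)dx\leq1\}$ (Euclidean norm for vector/matrix values). $\mathcal E^D\mathbf u=\frac12(\nabla\mathbf u+(\nabla\mathbf u)^T)-\frac{\mathrm{div}\,\mathbf u}{n}I$ (distributional); $E^{D,A}(\Omega,\mathbb R^n)$ is the space of $\mathbf u\in L^A(\Omega,\mathbb R^n)$ with $\mathcal E^D\mathbf u\in L^A(\Omega,\mathbb R^{n\times n})$, and $E^{D,A}_0(\Omega,\mathbb R^n)$ those whose extension by zero outside $\Omega$ lies in $E^{D,A}(\mathbb R^n,\mathbb R^n)$. $\Sigma=\mathcal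 D\oplus\mathcal R\oplus\mathcal S$ with $\mathcal D=\{\rho x:\rho\in\mathbb R\}$, $\mathcal R=\{\mathbf b+\mathbf Qx:\mathbf b\in\mathbb R^n,\mathbf Q=-\mathbf Q^T\}$, $\mathcal S=\{2(\mathbf a\cdot x)x-|x|^2\mathbf a:\mathbf a\in\mathbb R^n\}$. An open set has the cone property if there is a finite cone $\Lambda$ such that each point of $\Omega$ is the vertex of a finite cone contained in $\Omega$ congruent to $\Lambda$. *)

theory Defs
  imports "HOL-Analysis.Analysis"
begin

text \<open>A Young function A : [0,inf) -> [0,inf]; values in ennreal (only arguments t >= 0 matter).\<close>
definition young_function :: "(real \<Rightarrow> ennreal) \<Rightarrow> bool" where
  "young_function A \<longleftrightarrow>
     A 0 = 0
   \<and> (\<forall>s t l. 0 \<le> s \<longrightarrow> 0 \<le> t \<longrightarrow> 0 < l \<longrightarrow> l < 1 \<longrightarrow>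
        A (l * s + (1 - l) * t) \<le> ennreal l * A s + ennreal (1 - l) * A t)
   \<and> (\<forall>t>0. (A \<longlongrightarrow> A t) (at_left t))
   \<and> (\<exists>t>0. A t \<noteq> 0)
   \<and> (\<exists>t>0. A t \<noteq> top)"

definition orlicz_space :: "(real \<Rightarrow> ennreal) \<Rightarrow> 'a::euclidean_space set
      \<Rightarrow> ('a \<Rightarrow> 'b::euclidean_space) set" where
  "orlicz_space A \<Omega> =
     {u. u \<in> borel_measurable (lebesgue_on \<Omega>) \<and>
         (\<exists>l>0. (\<integral>\<^sup>+ x. A (norm (u x) / l) \<partial>lebesgue_on \<Omega>) \<le> 1)}"

text \<open>Luxemburg norm (Euclidean norm of the values; for matrices real^'n^'n this is the Frobenius norm).\<close>
definition lux_norm :: "(real \<Rightarrow> ennreal) \<Rightarrow> 'a::euclidean_space set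
      \<Rightarrow> ('a \<Rightarrow> 'b::euclidean_space) \<Rightarrow> real" where
  "lux_norm A \<Omega> u =
     Inf {l::real. l > 0 \<and> (\<integral>\<^sup>+ x. A (norm (u x) / l) \<partial>lebesgue_on \<Omega>) \<le> 1}"

definition partial_deriv :: "'n::finite \<Rightarrow> (real^'n \<Rightarrow> real) \<Rightarrow> real^'n \<Rightarrow> real" where
  "partial_deriv j f = (\<lambda>x. frechet_derivative f (at x) (axis j 1))"

fun iter_partial :: "'n::finite list \<Rightarrow> (real^'n \<Rightarrow> real) \<Rightarrow> real^'n \<Rightarrow> real" where
  "iter_partial [] f = f"
| "iter_partial (j # js) f = partial_deriv j (iter_partial js f)"

definition smooth_fun :: "(real^'n::finite \<Rightarrow> real) \<Rightarrow> bool" where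
  "smooth_fun f \<longleftrightarrow> (\<forall>js x. iter_partial js f differentiable (at x))"

definition test_fun :: "(real^'n::finite) set \<Rightarrow> (real^'n \<Rightarrow> real) \<Rightarrow> bool" where
  "test_fun \<Omega> \<phi> \<longleftrightarrow> smooth_fun \<phi> \<and> compact (closure {x. \<phi> x \<noteq> 0})
      \<and> closure {x. \<phi> x \<noteq> 0} \<subseteq> \<Omega>"

text \<open>G is (a representative of) the distribution E^D u on Omega, where
  E^D u = 1/2 (grad u + grad u^T) - (div u / n) I.  Componentwise, for every test function phi:
  int G_ij phi = -1/2 int (u_i d_j phi + u_j d_i phi) + delta_ij / n sum_k int u_k d_k phi.\<close>
definition weak_EDgrad :: "(real^'n::finite) set \<Rightarrow> (real^'n \<Rightarrow> real^'n)
      \<Rightarrow> (real^'n \<Rightarrow> real^'n^'n) \<Rightarrow> bool" where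
  "weak_EDgrad \<Omega> u G \<longleftrightarrow>
     (\<forall>\<phi>. test_fun \<Omega> \<phi> \<longrightarrow>
       (\<forall>i j. integrable (lebesgue_on \<Omega>) (\<lambda>x. u x $ i * partial_deriv j \<phi> x)
            \<and> integrable (lebesgue_on \<Omega>) (\<lambda>x. G x $ i $ j * \<phi> x))
     \<and> (\<forall>i j. (\<integral>x. G x $ i $ j * \<phi> x \<partial>lebesgue_on \<Omega>) =
            - (1/2) * ((\<integral>x. u x $ i * partial_deriv j \<phi> x \<partial>lebesgue_on \<Omega>)
                     + (\<integral>x. u x $ j * partial_deriv i \<phi> x \<partial>lebesgue_on \<Omega>))
            + (if i = j then (1 / real CARD('n)) *
                 (\<Sum>k\<in>UNIV. \<integral>x. u x $ k * partial_deriv k \<phi> x \<partial>lebesgue_on \<Omega>)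
               else 0)))"

definition ED_space :: "(real \<Rightarrow> ennreal) \<Rightarrow> (real^'n::finite) set \<Rightarrow> (real^'n \<Rightarrow> real^'n) set" where
  "ED_space A \<Omega> = {u. u \<in> orlicz_space A \<Omega> \<and>
      (\<exists>G. G \<in> orlicz_space A \<Omega> \<and> weak_EDgrad \<Omega> u G)}"

definition ED0_space :: "(real \<Rightarrow> ennreal) \<Rightarrow> (real^'n::finite) set \<Rightarrow> (real^'n \<Rightarrow> real^'n) set" where
  "ED0_space A \<Omega> = {u. (\<lambda>x. if x \<in> \<Omega> then u x else 0) \<in> ED_space A UNIV}"

definition Sigma_fields :: "(real^'n::finite \<Rightarrow> real^'n) set" where
  "Sigma_fields = {(\<lambda>x. \<rho> *\<^sub>R x + (b + Q *v x) + (2 * (a \<bullet> x)) *\<^sub>R x - (norm x)\<^sup>2 *\<^sub>R a)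
      | \<rho> b Q a. transpose Q = - Q}"

text \<open>Finite (circular) cone with vertex 0, axis d, radius h, half-aperture theta
  (intersection of a ball around the vertex with an open circular cone; vertex omitted).\<close>
definition finite_cone :: "'a::euclidean_space \<Rightarrow> real \<Rightarrow> real \<Rightarrow> 'a set" where
  "finite_cone d h \<theta> = {y. norm y < h \<and> y \<bullet> d > norm y * norm d * cos \<theta>}"

definition cone_property :: "'a::euclidean_space set \<Rightarrow> bool" where
  "cone_property \<Omega> \<longleftrightarrow>
     (\<exists>d h \<theta>. d \<noteq> 0 \<and> h > 0 \<and> 0 < \<theta> \<and> \<theta> < pi / 2 \<and>
        (\<forall>x\<in>\<Omega>. \<exists>f::'a \<Rightarrow> 'a. orthogonal_transformation f \<and> (\<lambda>y. x + f y) ` finite_cone d h \<theta> \<subseteq> \<Omega>))"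

end

theory Submission
  imports Defs
begin

text \<open>
  For smooth fields, Saint-Venant's relations express all third derivatives of \<open>u\<close> through second
  derivatives of \<open>E\<^sup>D u\<close> once \<open>n \<ge> 3\<close>. Hence the part of the second order Taylor polynomial of \<open>u\<close>
  at \<open>z\<close> that is not controlled by \<open>E\<^sup>D u\<close> belongs to \<open>\<Sigma>\<close>, and averaging over \<open>z\<close> in a ball
  \<open>B\<close>, with all derivatives of \<open>E\<^sup>D u\<close> integrated by parts onto the averaging weight, bounds \<open>u - w\<close> at \<open>x\<close> by averages of
  \<open>|E\<^sup>D u|\<close> over the segments from \<open>x\<close> to \<open>B\<close>. No singular integrals occur, so Jensen's inequality
  gives the modular inequality for an arbitrary Young function on sets that are star-shaped with
  respect to a ball; the constants survive mollification. A bounded set with the cone property is a finite union of such sets, and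
  for a connected union the local elements of \<open>\<Sigma>\<close> can be matched on overlaps because
  \<open>\<Sigma>\<close> is finite-dimensional.

  For a field extended by zero one works in a large ball: the element of \<open>\<Sigma>\<close> is controlled
  on a ball where the field vanishes. Since the boundary of \<open>\<Omega>\<close> may have positive measure, one also
  needs that the distribution \<open>E\<^sup>D u\<close> vanishes almost everywhere outside \<open>\<Omega>\<close>; this follows from
  the \<open>L\<^sup>1\<close> inequality by blow-up at Lebesgue points.
\<close>

section \<open>Smooth kernels with all their partial derivatives\<close>

text \<open>For a general Young function there are no bounds for singular integrals (they already
  fail in L^1 and L^infinity), so every operator must be an average with bounded density. What makes
  this possible is a count of powers: the cubic Taylor remainder carries the weight t^2/2, and the
  third derivatives in it are second derivatives of E^D u with universal coefficients. For fixed t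
  these are functions of x + t(z - x); each integration by parts in z costs 1/t, so two of them use
  up exactly t^2 and the kernel stays bounded uniformly in t. The second constraint is the order of
  quantifiers: constants must be fixed before the field, the mollifier and the mollification radius
  are known. Estimates are therefore stated for all points whose segments to one fixed ball keep a
  margin from the boundary. All inequalities are normalised to modular at most 1. There convexity
  and A(0) = 0 give A(t/M) \<le> A(t)/M for M \<ge> 1, which absorbs every factor; homogeneity then
  restores the norms. Fields of \<Sigma> are handled through their coefficients, which the L^1 norm
  on any one ball controls: this yields compactness in the limit and the comparison on
  overlaps.\<close>

text \<open>The member \<open>\<Phi> m\<close> of a kernel family is the partial derivative of multi-index \<open>m\<close> of \<open>\<Phi> (\<lambda>_. 0)\<close>.\<close>

definition inc :: "'n \<Rightarrow> ('n \<Rightarrow> nat) \<Rightarrow> 'n \<Rightarrow> nat" where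
  "inc i m = m(i := Suc (m i))"

lemma inc_commute: "inc i (inc j m) = inc j (inc i m)"
  by (auto simp: inc_def fun_eq_iff)

definition kernel_family :: "real \<Rightarrow> (('n::finite \<Rightarrow> nat) \<Rightarrow> real^'n \<Rightarrow> real) \<Rightarrow> bool" where
  "kernel_family s \<Phi> \<longleftrightarrow>
     (\<forall>m x. (\<Phi> m has_derivative (\<lambda>h. \<Sum>j\<in>UNIV. h$j * \<Phi> (inc j m) x)) (at x)) \<and>
     (\<forall>m x. s \<le> norm x \<longrightarrow> \<Phi> m x = 0)"

text \<open>The span of everything that differentiating exp(-1/(1 - t^2)) can produce. Closure under
  differentiation replaces the computation of higher derivatives.\<close>

inductive_set bump_class :: "(real \<Rightarrow> real) set" where
  base: "(\<lambda>t. if \<bar>t\<bar> < 1 then t ^ a * exp (- 1 / (1 - t\<^sup>2)) / (1 - t\<^sup>2) ^ k else 0) \<in> bump_class"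
| add: "f \<in> bump_class \<Longrightarrow> g \<in> bump_class \<Longrightarrow> (\<lambda>t. f t + g t) \<in> bump_class"
| scale: "f \<in> bump_class \<Longrightarrow> (\<lambda>t. c * f t) \<in> bump_class"

text \<open>A single term of the exponential series at 1/w beats the pole of order k. The order k +
  2 is chosen so that a factor w^2 survives, which makes difference quotients vanish at the edge of
  the support.\<close>

lemma exp_inverse_bound:
  fixes w :: real
  assumes "0 < w" "w \<le> 1"
  shows "exp (- 1 / w) / w ^ k \<le> fact (k + 2) * w\<^sup>2"
proof -
  have "(1/w) ^ (k+2) / fact (k+2) \<le> exp (1/w)"
  proof -
    have "(\<lambda>n. (1/w)^n /\<^sub>R fact n) sums exp (1/w)" by (rule exp_converges)
    moreover have "\<And>n. (1/w)^n /\<^sub>R fact n \<ge> 0" using assms by simp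
    ultimately have "(1/w)^(k+2) /\<^sub>R fact (k+2) \<le> exp (1/w)"
      using sum_le_suminf[of "\<lambda>n. (1/w)^n /\<^sub>R fact n" "{k+2}"] by (simp add: sums_iff)
    then show ?thesis by (simp add: divide_inverse mult.commute)
  qed
  then have "1 \<le> fact (k+2) * w ^ (k+2) * exp (1/w)"
    using assms by (simp add: power_divide pos_divide_le_eq mult_ac del: fact_Suc power_Suc add_2_eq_Suc')
  then have "exp (-1/w) \<le> fact (k+2) * w ^ (k+2)"
    using mult_right_mono[of 1 "fact (k+2) * w ^ (k+2) * exp (1/w)" "exp (-1/w)"]
    by (simp add: mult.assoc exp_add[symmetric] del: fact_Suc power_Suc add_2_eq_Suc')
  also have "\<dots> = (fact (k+2) * w\<^sup>2) * w ^ k" by (simp only: power_add mult_ac)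
  finally have "exp (-1/w) \<le> (fact (k+2) * w\<^sup>2) * w ^ k" .
  then show ?thesis using assms
    by (subst pos_divide_le_eq) auto
qed

text \<open>Inside the interval this is the product rule, outside it is trivial; at |t| = 1 the
  quadratic bound from \<open>exp_inverse_bound\<close> forces derivative 0. For a = 0 the truncated
  exponent a - 1 is harmless because its coefficient is 0.\<close>

lemma bump_base_deriv:
  fixes a k :: nat
  defines "F \<equiv> \<lambda>a k t. if \<bar>t\<bar> < 1 then t ^ a * exp (- 1 / (1 - t\<^sup>2)) / (1 - t\<^sup>2) ^ k else (0::real)"
  shows "(F a k has_real_derivative
           (real a * F (a - 1) k t + (2 * real k) * F (a+1) (k+1) t + (-2) * F (a+1) (k+2) t)) (at t)"
proof -
  consider "\<bar>t\<bar> < 1" | "\<bar>t\<bar> = 1" | "\<bar>t\<bar> > 1" by linarith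
  then show ?thesis
  proof cases
    case 1
    then have w: "1 - t\<^sup>2 > 0" by (simp add: abs_square_less_1)
    have "((\<lambda>t. t ^ a * exp (- 1 / (1 - t\<^sup>2)) / (1 - t\<^sup>2) ^ k) has_real_derivative
           (real a * F (a - 1) k t + (2 * real k) * F (a+1) (k+1) t + (-2) * F (a+1) (k+2) t)) (at t)"
    proof -
      let ?w = "1 - t\<^sup>2"
      have d: "((\<lambda>t. t ^ a * exp (- 1 / (1 - t\<^sup>2)) * inverse ((1 - t\<^sup>2) ^ k)) has_real_derivative
         (real a * t ^ (a - 1) * exp (- 1 / ?w) + t ^ a * (exp (- 1 / ?w) * (- 2 * t / ?w\<^sup>2))) * inverse (?w ^ k)
          + t ^ a * exp (- 1 / ?w) * (- (inverse (?w ^ k) * (real k * (-2*t) * ?w ^ (k-1)) * inverse (?w ^ k)))) (at t)"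
      proof -
        have dw: "((\<lambda>t. 1 - t\<^sup>2) has_real_derivative - 2 * t) (at t)"
          by (auto intro!: derivative_eq_intros)
        have di: "((\<lambda>t. - 1 / (1 - t\<^sup>2)) has_real_derivative - 2 * t / ?w\<^sup>2) (at t)"
          using DERIV_minus[OF DERIV_inverse'[OF dw]] w
          by (simp add: divide_inverse power2_eq_square mult_ac)
        have dk: "((\<lambda>t. (1 - t\<^sup>2) ^ k) has_real_derivative real k * (-2*t) * ?w ^ (k-1)) (at t)"
          using DERIV_power[OF dw, of k] by (simp add: mult_ac)
        have dp: "((\<lambda>t. t ^ a) has_real_derivative real a * t ^ (a - 1)) (at t)"
          using DERIV_pow[of a t] by simp
        show ?thesis
          by (rule DERIV_cong[OF DERIV_mult'[OF DERIV_mult'[OF dp DERIV_chain2[OF DERIV_exp di]] DERIV_inverse'[OF dk]]])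
             (use w in \<open>simp_all add: algebra_simps\<close>)
      qed
      have e: "inverse (?w ^ k) * (real k * (-2*t) * ?w ^ (k-1)) * inverse (?w ^ k) = - 2 * t * real k / ?w ^ (k+1)"
      proof -
        have "inverse (w ^ k) * (real k * (-2*t) * w ^ (k-1)) * inverse (w ^ k) = - 2 * t * real k / w ^ (k+1)"
          if "w > 0" for w
          using that by (cases k) (simp_all add: divide_simps)
        then show ?thesis using w by blast
      qed
      have f: "(real a * t ^ (a - 1) * E + t ^ a * (E * (- 2 * t / w\<^sup>2))) * inverse (w ^ k)
          + t ^ a * E * (- (- 2 * t * real k / w ^ (k+1)))
        = real a * (t ^ (a-1) * E / w ^ k) + (2 * real k) * (t ^ (a+1) * E / w ^ (k+1)) + (-2) * (t ^ (a+1) * E / w ^ (k+2))"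
        if "w > 0" for w E
      proof -
        have "(real a * T' + T * (- 2 * t / (w * w))) * inverse W + T * (- (- 2 * t * real k / (W * w)))
          = real a * (T' / W) + (2 * real k) * (t * T / (W * w)) + (-2) * (t * T / (W * (w * w)))"
          if "W > 0" for T T' W :: real
          using that \<open>w > 0\<close> by (simp add: field_simps)
        from this[of "w ^ k" "t ^ (a-1) * E" "t ^ a * E"] that show ?thesis
          by (simp add: power_add power2_eq_square mult_ac)
      qed
      have g: "real a * (t ^ (a-1) * exp (- 1 / ?w) / ?w ^ k) + (2 * real k) * (t ^ (a+1) * exp (- 1 / ?w) / ?w ^ (k+1))
           + (-2) * (t ^ (a+1) * exp (- 1 / ?w) / ?w ^ (k+2))
         = real a * F (a - 1) k t + (2 * real k) * F (a+1) (k+1) t + (-2) * F (a+1) (k+2) t"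
        using 1 by (simp add: F_def)
      show ?thesis
        using d[unfolded e f[OF w] g] by (simp add: divide_inverse)
    qed
    then show ?thesis
    proof (rule has_field_derivative_transform_within_open[of _ _ _ "{-1<..<1}"])
    qed (use 1 in \<open>auto simp: F_def\<close>)
  next
    case 2
    \<comment> \<open>The 4 comes from 1 - y^2 = (t - y)(t + y), hence |1 - y^2| \<le> 2 |y - t|,
      after squaring; the factorial comes from \<open>exp_inverse_bound\<close>.\<close>
    define C where "C = 4 * (fact (k+2)::real)"
    have b: "\<bar>F a k y\<bar> \<le> C * (y - t)\<^sup>2" for y
    proof (cases "\<bar>y\<bar> < 1")
      case True
      then have w: "1 - y\<^sup>2 > 0" "1 - y\<^sup>2 \<le> 1" by (auto simp: abs_square_less_1)
      have "\<bar>F a k y\<bar> = \<bar>y\<bar>^a * (exp (- 1 / (1-y\<^sup>2)) / (1-y\<^sup>2)^k)"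
        using True w by (simp add: F_def abs_mult power_abs)
      also have "\<dots> \<le> 1 * (fact (k+2) * (1-y\<^sup>2)\<^sup>2)"
        by (intro mult_mono exp_inverse_bound w) (use True w in \<open>auto simp: power_le_one\<close>)
      also have "(1-y\<^sup>2)\<^sup>2 \<le> 4 * (y - t)\<^sup>2"
      proof -
        have "\<bar>1 - y\<^sup>2\<bar> \<le> 2 * \<bar>y - t\<bar>"
        proof -
          have "1 - y\<^sup>2 = (t - y) * (t + y)" using 2 by (simp add: algebra_simps power2_eq_square abs_if split: if_splits)
          then have "\<bar>1 - y\<^sup>2\<bar> = \<bar>y - t\<bar> * \<bar>t + y\<bar>" by (simp add: abs_mult abs_minus_commute)
          also have "\<dots> \<le> \<bar>y - t\<bar> * 2" by (intro mult_left_mono) (use 2 True in auto)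
          finally show ?thesis by simp
        qed
        then have "\<bar>1 - y\<^sup>2\<bar>\<^sup>2 \<le> (2 * \<bar>y - t\<bar>)\<^sup>2" by (intro power_mono) auto
        then show ?thesis by (simp add: power_mult_distrib)
      qed
      finally show ?thesis by (simp add: C_def mult.assoc)
    next
      case False
      then show ?thesis by (simp add: F_def C_def)
    qed
    have Ft: "F a k t = 0" for a k using 2 by (simp add: F_def)
    have "(F a k has_real_derivative 0) (at t)"
      unfolding has_field_derivative_iff
    proof (rule Lim_null_comparison)
      show "\<forall>\<^sub>F y in at t. norm ((F a k y - F a k t) / (y - t)) \<le> C * \<bar>y - t\<bar>"
      proof (rule eventually_at_filter[THEN iffD2], rule always_eventually, intro allI impI)
        fix y assume "y \<noteq> t"
        then show "norm ((F a k y - F a k t) / (y - t)) \<le> C * \<bar>y - t\<bar>"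
          using b[of y] Ft[of a k] by (simp add: field_simps power2_eq_square abs_mult[symmetric])
      qed
      show "((\<lambda>y. C * \<bar>y - t\<bar>) \<longlongrightarrow> 0) (at t)"
        by (auto intro!: tendsto_eq_intros)
    qed
    then show ?thesis using Ft by simp
  next
    case 3
    have "(F a k has_real_derivative 0) (at t)"
    proof (rule has_field_derivative_transform_within_open[of "\<lambda>_. 0" _ _ "- {-1..1}"])
    qed (use 3 in \<open>auto simp: F_def\<close>)
    moreover have "F a k t = 0" for a k using 3 by (simp add: F_def)
    ultimately show ?thesis by simp
  qed
qed

lemma bump_class_deriv:
  assumes "f \<in> bump_class"
  shows "\<exists>g\<in>bump_class. \<forall>t. (f has_real_derivative g t) (at t)"
  using assms
proof induction
  case (base a k)
  show ?case
    by (rule bexI[OF _ bump_class.add[OF bump_class.add]], rule allI, rule bump_base_deriv)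
       (intro bump_class.scale bump_class.base)+
next
  case (add f g)
  then obtain f' g' where "f' \<in> bump_class" "g' \<in> bump_class"
    "\<And>t. (f has_real_derivative f' t) (at t)" "\<And>t. (g has_real_derivative g' t) (at t)" by blast
  then show ?case
    by (intro bexI[of _ "\<lambda>t. f' t + g' t"] allI DERIV_add bump_class.add)
next
  case (scale f c)
  then obtain f' where "f' \<in> bump_class" "\<And>t. (f has_real_derivative f' t) (at t)" by blast
  then show ?case
    by (intro bexI[of _ "\<lambda>t. c * f' t"] allI DERIV_cmult bump_class.scale)
qed

lemma bump_class_support: "f \<in> bump_class \<Longrightarrow> 1 \<le> \<bar>t\<bar> \<Longrightarrow> f t = 0"
  by (induction rule: bump_class.induct) auto

lemma bump_sequence:
  obtains \<beta> :: "nat \<Rightarrow> real \<Rightarrow> real"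
  where "\<And>k t. (\<beta> k has_real_derivative \<beta> (Suc k) t) (at t)"
    and "\<And>k t. 1 \<le> \<bar>t\<bar> \<Longrightarrow> \<beta> k t = 0" and "\<And>t. \<beta> 0 t \<ge> 0" and "\<beta> 0 0 > 0"
proof -
  define b where "b = (\<lambda>t::real. if \<bar>t\<bar> < 1 then t ^ 0 * exp (- 1 / (1 - t\<^sup>2)) / (1 - t\<^sup>2) ^ 0 else 0)"
  obtain \<beta> where \<beta>: "\<beta> 0 = b" "\<And>k. \<beta> k \<in> bump_class" "\<And>k. \<forall>t. (\<beta> k has_real_derivative \<beta> (Suc k) t) (at t)"
  proof -
    have "\<exists>\<beta>. \<forall>n::nat. (\<beta> n \<in> bump_class \<and> (n = 0 \<longrightarrow> \<beta> n = b)) \<and> (\<forall>t. (\<beta> n has_real_derivative \<beta> (Suc n) t) (at t))"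
    proof (rule dependent_nat_choice)
      show "\<exists>x. x \<in> bump_class \<and> ((0::nat) = 0 \<longrightarrow> x = b)"
        unfolding b_def using bump_class.base by blast
      fix x and n :: nat assume "x \<in> bump_class \<and> (n = 0 \<longrightarrow> x = b)"
      then obtain g where "g \<in> bump_class" "\<forall>t. (x has_real_derivative g t) (at t)"
        using bump_class_deriv by blast
      then show "\<exists>y. (y \<in> bump_class \<and> (Suc n = 0 \<longrightarrow> y = b)) \<and> (\<forall>t. (x has_real_derivative y t) (at t))"
        by auto
    qed
    then show ?thesis using that by metis
  qed
  show ?thesis
    by (rule that[of \<beta>]) (use \<beta>(2,3) in \<open>auto intro: bump_class_support\<close>, auto simp: \<beta>(1) b_def)
qed

lemma has_derivative_vec_prod:
  fixes g g' :: "'n::finite \<Rightarrow> real \<Rightarrow> real" and x :: "real^'n"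
  assumes "\<And>i. (g i has_real_derivative g' i (x$i)) (at (x$i))"
  shows "((\<lambda>x. \<Prod>i\<in>UNIV. g i (x$i)) has_derivative
     (\<lambda>h. \<Sum>j\<in>UNIV. h$j * (g' j (x$j) * (\<Prod>i\<in>UNIV-{j}. g i (x$i))))) (at x)"
proof -
  have 1: "((\<lambda>x. g i (x$i)) has_derivative (\<lambda>h. g' i (x$i) * h$i)) (at x)" for i
  proof -
    have "(g i has_derivative (*) (g' i (x$i))) (at (x$i))"
      using assms[of i] by (simp add: has_field_derivative_def)
    from has_derivative_compose[OF bounded_linear.has_derivative[OF bounded_linear_vec_nth[of i] has_derivative_ident] this]
    show ?thesis by simp
  qed
  show ?thesis
    by (rule has_derivative_eq_rhs[OF has_derivative_prod[OF 1]]) (simp add: fun_eq_iff mult_ac)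
qed

text \<open>Contracting each factor of a product bump by the dimension makes its cube of support fit
  into the unit ball; the reason is the comparison of the Euclidean norm with the sum of the
  components.\<close>

lemma norm_ge_1_component:
  fixes x :: "real^'n::finite"
  assumes "1 \<le> norm x" shows "\<exists>i. 1 \<le> \<bar>real CARD('n) * x$i\<bar>"
proof (rule ccontr)
  assume "\<not> ?thesis"
  then have "\<And>i. \<bar>x$i\<bar> < 1 / real CARD('n)" by (simp add: abs_mult field_simps not_le)
  then have "(\<Sum>i\<in>UNIV. \<bar>x$i\<bar>) < (\<Sum>i\<in>(UNIV::'n set). 1 / real CARD('n))"
    by (intro sum_strict_mono) auto
  then show False using norm_le_l1_cart[of x] assms by simp
qed

lemma kernel_family_continuous:
  assumes "kernel_family s \<Phi>" shows "continuous_on A (\<Phi> m)"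
proof -
  have "\<And>x. isCont (\<Phi> m) x"
    using assms unfolding kernel_family_def by (blast intro: has_derivative_continuous)
  then show ?thesis by (simp add: continuous_at_imp_continuous_on)
qed

lemma kernel_family_bounded:
  fixes \<Phi> :: "('n::finite \<Rightarrow> nat) \<Rightarrow> real^'n \<Rightarrow> real"
  assumes "kernel_family s \<Phi>"
  obtains K where "K > 0" "\<And>x. \<bar>\<Phi> m x\<bar> \<le> K"
proof -
  have "compact (\<Phi> m ` cball 0 s)"
    by (intro compact_continuous_image kernel_family_continuous[OF assms]) auto
  then obtain K where K: "K > 0" "\<And>y. y \<in> \<Phi> m ` cball 0 s \<Longrightarrow> norm y \<le> K"
    using compact_imp_bounded bounded_pos by metis
  have "\<bar>\<Phi> m x\<bar> \<le> K" for x
  proof (cases "norm x \<le> s")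
    case True then show ?thesis using K(2)[of "\<Phi> m x"] by auto
  next
    case False then show ?thesis using K(1) assms unfolding kernel_family_def by auto
  qed
  then show ?thesis using that K(1) by blast
qed

text \<open>Each derivative contributes one factor 1/r, so the exponent is the order of the
  multi-index. The free factor c is used both for normalising the mass and for the usual dilation
  factor.\<close>

lemma kernel_family_scale:
  fixes \<Phi> :: "('n::finite \<Rightarrow> nat) \<Rightarrow> real^'n \<Rightarrow> real"
  assumes "kernel_family s \<Phi>" and r: "r > 0"
  shows "kernel_family (r * s) (\<lambda>m x. c / r ^ (\<Sum>i\<in>UNIV. m i) * \<Phi> m (x /\<^sub>R r))"
  unfolding kernel_family_def
proof (intro conjI allI impI)
  fix m :: "'n \<Rightarrow> nat" and x :: "real^'n"
  have s: "(\<Sum>i\<in>UNIV. inc j m i) = Suc (\<Sum>i\<in>UNIV. m i)" for j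
  proof -
    have "(\<Sum>i\<in>UNIV. inc j m i) = (\<Sum>i\<in>UNIV. m i + (if i = j then 1 else 0))"
      by (intro sum.cong) (auto simp: inc_def)
    then show ?thesis by (simp add: sum.distrib sum.delta)
  qed
  have "((\<lambda>x. \<Phi> m (x /\<^sub>R r)) has_derivative (\<lambda>h. \<Sum>j\<in>UNIV. (h /\<^sub>R r)$j * \<Phi> (inc j m) (x /\<^sub>R r))) (at x)"
    by (rule has_derivative_compose[of "\<lambda>x. x /\<^sub>R r" "\<lambda>x. x /\<^sub>R r"])
       (use assms in \<open>auto simp: kernel_family_def intro!: derivative_eq_intros\<close>)
  then have "((\<lambda>x. c / r ^ (\<Sum>i\<in>UNIV. m i) * \<Phi> m (x /\<^sub>R r)) has_derivative
      (\<lambda>h. c / r ^ (\<Sum>i\<in>UNIV. m i) * (\<Sum>j\<in>UNIV. (h /\<^sub>R r)$j * \<Phi> (inc j m) (x /\<^sub>R r)))) (at x)"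
    by (rule has_derivative_mult_right)
  then show "((\<lambda>x. c / r ^ (\<Sum>i\<in>UNIV. m i) * \<Phi> m (x /\<^sub>R r)) has_derivative
      (\<lambda>h. \<Sum>j\<in>UNIV. h$j * (c / r ^ (\<Sum>i\<in>UNIV. inc j m i) * \<Phi> (inc j m) (x /\<^sub>R r)))) (at x)"
    by (rule has_derivative_eq_rhs) (use r in \<open>simp add: s fun_eq_iff sum_distrib_left field_simps\<close>)
next
  fix m and x :: "real^'n" assume "r * s \<le> norm x"
  then show "c / r ^ (\<Sum>i\<in>UNIV. m i) * \<Phi> m (x /\<^sub>R r) = 0"
    using assms by (auto simp: kernel_family_def field_simps)
qed

lemma kernel_family_integrable:
  fixes \<Phi> :: "('n::finite \<Rightarrow> nat) \<Rightarrow> real^'n \<Rightarrow> real"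
  assumes "kernel_family s \<Phi>"
  shows "integrable lborel (\<Phi> m)"
proof -
  have "set_integrable lborel (cball 0 s) (\<Phi> m)"
    unfolding set_integrable_def
    by (rule borel_integrable_compact) (auto intro: kernel_family_continuous[OF assms])
  moreover have "(\<lambda>x. indicator (cball 0 s) x *\<^sub>R \<Phi> m x) = \<Phi> m"
    using assms by (auto simp: kernel_family_def fun_eq_iff indicator_def)
  ultimately show ?thesis unfolding set_integrable_def by simp
qed

lemma mollifier_exists:
  obtains \<Phi> :: "('n::finite \<Rightarrow> nat) \<Rightarrow> real^'n \<Rightarrow> real"
  where "kernel_family 1 \<Phi>" "\<And>x. \<Phi> (\<lambda>_. 0) x \<ge> 0" "(\<integral>x. \<Phi> (\<lambda>_. 0) x \<partial>lborel) = 1"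
proof -
  obtain \<beta> :: "nat \<Rightarrow> real \<Rightarrow> real"
    where \<beta>: "\<And>k t. (\<beta> k has_real_derivative \<beta> (Suc k) t) (at t)"
      "\<And>k t. 1 \<le> \<bar>t\<bar> \<Longrightarrow> \<beta> k t = 0" "\<And>t. \<beta> 0 t \<ge> 0" "\<beta> 0 0 > 0"
    using bump_sequence by blast
  define N where "N = real CARD('n)"
  have N: "N > 0" by (simp add: N_def)
  define \<gamma> where "\<gamma> k t = N ^ k * \<beta> k (N * t)" for k t
  have \<gamma>: "(\<gamma> k has_real_derivative \<gamma> (Suc k) t) (at t)" for k t
    unfolding \<gamma>_def by (auto intro!: derivative_eq_intros DERIV_chain'[OF _ \<beta>(1)])
  define P where "P m x = (\<Prod>i\<in>UNIV. \<gamma> (m i) (x$i))" for m :: "'n \<Rightarrow> nat" and x :: "real^'n"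
  have PK: "kernel_family 1 P"
    unfolding kernel_family_def
  proof (intro conjI allI impI)
    fix m :: "'n \<Rightarrow> nat" and x :: "real^'n"
    have "(P m has_derivative
     (\<lambda>h. \<Sum>j\<in>UNIV. h$j * (\<gamma> (Suc (m j)) (x$j) * (\<Prod>i\<in>UNIV-{j}. \<gamma> (m i) (x$i))))) (at x)"
      using has_derivative_vec_prod[of "\<lambda>i. \<gamma> (m i)" "\<lambda>i. \<gamma> (Suc (m i))" x] \<gamma>
      unfolding P_def[abs_def] by auto
    moreover have "\<gamma> (Suc (m j)) (x$j) * (\<Prod>i\<in>UNIV-{j}. \<gamma> (m i) (x$i)) = P (inc j m) x" for j
    proof -
      have "P (inc j m) x = \<gamma> (inc j m j) (x$j) * (\<Prod>i\<in>UNIV-{j}. \<gamma> (inc j m i) (x$i))"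
        unfolding P_def by (subst prod.remove[of UNIV j]) auto
      moreover have "(\<Prod>i\<in>UNIV-{j}. \<gamma> (inc j m i) (x$i)) = (\<Prod>i\<in>UNIV-{j}. \<gamma> (m i) (x$i))"
        by (intro prod.cong) (auto simp: inc_def)
      ultimately show ?thesis by (simp add: inc_def)
    qed
    ultimately show "(P m has_derivative (\<lambda>h. \<Sum>j\<in>UNIV. h$j * P (inc j m) x)) (at x)" by simp
  next
    fix m :: "'n \<Rightarrow> nat" and x :: "real^'n" assume "1 \<le> norm x"
    then obtain i where "1 \<le> \<bar>N * x$i\<bar>" using norm_ge_1_component N_def by blast
    then have "\<gamma> (m i) (x$i) = 0" using \<beta>(2) by (simp add: \<gamma>_def)
    then show "P m x = 0" unfolding P_def by (subst prod_zero_iff) auto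
  qed
  have P0: "P (\<lambda>_. 0) x \<ge> 0" for x unfolding P_def \<gamma>_def using \<beta>(3) by (auto intro!: prod_nonneg)
  define c where "c = (\<integral>x. P (\<lambda>_. 0) x \<partial>lborel)"
  have "c \<noteq> 0"
  proof
    assume "c = 0"
    then have ae: "AE x in lborel. P (\<lambda>_. 0) x = 0"
      using integral_nonneg_eq_0_iff_AE[OF kernel_family_integrable[OF PK, of "\<lambda>_. 0"]] P0 by (auto simp: c_def)
    have "open {x. P (\<lambda>_. 0) x > 0}"
      by (intro open_Collect_less continuous_on_const kernel_family_continuous[OF PK])
    moreover have "0 \<in> {x. P (\<lambda>_. 0) x > 0}"
      using \<beta>(4) by (auto simp: P_def \<gamma>_def intro!: prod_pos)
    moreover have "{x. P (\<lambda>_. 0) x > 0} \<in> null_sets lborel"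
    proof (rule AE_iff_null_sets[THEN iffD2])
      show "{x. P (\<lambda>_. 0) x > 0} \<in> sets lborel" using \<open>open _\<close> by auto
      show "AE x in lborel. x \<notin> {x. P (\<lambda>_. 0) x > 0}" using ae by eventually_elim auto
    qed
    ultimately show False
      using open_not_negligible[of "{x. P (\<lambda>_. 0) x > 0}"] 
      by (auto simp: negligible_iff_null_sets null_sets_completionI)
  qed
  moreover have "c \<ge> 0" unfolding c_def using P0 by (intro Bochner_Integration.integral_nonneg) auto
  ultimately have c: "c > 0" by simp
  \<comment> \<open>Scaling by r = 1 only divides the family by its mass.\<close>
  have "kernel_family 1 (\<lambda>m x. (1/c) / 1 ^ (\<Sum>i\<in>UNIV. m i) * P m (x /\<^sub>R 1))"
    using kernel_family_scale[OF PK, of 1 "1/c"] by simp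
  then have "kernel_family 1 (\<lambda>m x. (1/c) * P m x)" by simp
  then show ?thesis
    by (rule that) (use c P0 in \<open>auto simp: c_def\<close>)
qed

section \<open>Reflected translates of kernels as test functions\<close>

lemma partial_deriv_eqI:
  assumes "(f has_derivative (\<lambda>h. \<Sum>j\<in>UNIV. h$j * g j)) (at x)"
  shows "partial_deriv i f x = g i"
proof -
  have "frechet_derivative f (at x) = (\<lambda>h. \<Sum>j\<in>UNIV. h$j * g j)"
    using frechet_derivative_at[OF assms] by simp
  then show ?thesis by (simp add: partial_deriv_def axis_def if_distrib [where f="\<lambda>u. u * _"] cong: if_cong)
qed

lemma has_derivative_reflect:
  fixes \<Phi> :: "('n::finite \<Rightarrow> nat) \<Rightarrow> real^'n \<Rightarrow> real"
  assumes "kernel_family s \<Phi>"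
  shows "((\<lambda>y. c * \<Phi> m (x - y)) has_derivative (\<lambda>h. \<Sum>j\<in>UNIV. h$j * (- c * \<Phi> (inc j m) (x - y)))) (at y)"
proof -
  have "((\<lambda>y. \<Phi> m (x - y)) has_derivative (\<lambda>h. \<Sum>j\<in>UNIV. (- h)$j * \<Phi> (inc j m) (x - y))) (at y)"
    by (rule has_derivative_compose[of "\<lambda>y. x - y" "\<lambda>y. - y"])
       (use assms in \<open>auto simp: kernel_family_def intro!: derivative_eq_intros\<close>)
  from has_derivative_mult_right[OF this, of c] show ?thesis
    by (rule has_derivative_eq_rhs) (simp add: fun_eq_iff sum_distrib_left sum_negf mult_ac)
qed

text \<open>The family is closed under differentiation up to a sign, so every iterated derivative of
  a reflected translate is again a multiple of a member. This is what reduces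
  \<open>smooth_fun\<close> to one derivative formula.\<close>

lemma iter_partial_reflect:
  fixes \<Phi> :: "('n::finite \<Rightarrow> nat) \<Rightarrow> real^'n \<Rightarrow> real"
  assumes "kernel_family s \<Phi>"
  shows "\<exists>c m'. iter_partial js (\<lambda>y. \<Phi> m (x - y)) = (\<lambda>y. c * \<Phi> m' (x - y))"
proof (induction js)
  case Nil
  show ?case by (rule exI[of _ 1]) auto
next
  case (Cons j js)
  then obtain c m' where 1: "iter_partial js (\<lambda>y. \<Phi> m (x - y)) = (\<lambda>y. c * \<Phi> m' (x - y))" by blast
  then have "iter_partial (j # js) (\<lambda>y. \<Phi> m (x - y)) = (\<lambda>y. - c * \<Phi> (inc j m') (x - y))"
    using partial_deriv_eqI[OF has_derivative_reflect[OF assms]]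
    by (simp only: iter_partial.simps 1) (simp add: fun_eq_iff)
  then show ?case by blast
qed

lemma test_fun_reflect:
  fixes \<Phi> :: "('n::finite \<Rightarrow> nat) \<Rightarrow> real^'n \<Rightarrow> real"
  assumes "kernel_family s \<Phi>" "cball x s \<subseteq> \<Omega>"
  shows "test_fun \<Omega> (\<lambda>y. \<Phi> m (x - y))"
proof -
  have "{y. \<Phi> m (x - y) \<noteq> 0} \<subseteq> cball x s"
    using assms(1) by (force simp: kernel_family_def dist_norm not_le)
  then have *: "closure {y. \<Phi> m (x - y) \<noteq> 0} \<subseteq> cball x s"
    by (simp add: closure_minimal)
  moreover have "smooth_fun (\<lambda>y. \<Phi> m (x - y))"
    unfolding smooth_fun_def
  proof (intro allI)
    fix js y
    obtain c m' where "iter_partial js (\<lambda>y. \<Phi> m (x - y)) = (\<lambda>y. c * \<Phi> m' (x - y))"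
      using iter_partial_reflect[OF assms(1)] by blast
    then show "iter_partial js (\<lambda>y. \<Phi> m (x - y)) differentiable at y"
      using differentiableI[OF has_derivative_reflect[OF assms(1)]] by simp
  qed
  moreover have "compact (closure {y. \<Phi> m (x - y) \<noteq> 0})"
    using * bounded_subset[OF bounded_cball] by (auto simp: compact_eq_bounded_closed)
  ultimately show ?thesis using assms(2) by (auto simp: test_fun_def)
qed

lemma partial_deriv_reflect:
  fixes \<Phi> :: "('n::finite \<Rightarrow> nat) \<Rightarrow> real^'n \<Rightarrow> real"
  assumes "kernel_family s \<Phi>"
  shows "partial_deriv j (\<lambda>y. \<Phi> m (x - y)) y = - \<Phi> (inc j m) (x - y)"
  using partial_deriv_eqI[OF has_derivative_reflect[OF assms, of 1 m x y]] by simp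

section \<open>Affine changes of variables and Lebesgue points\<close>

lemma nn_integral_lborel_affine:
  fixes f :: "'a::euclidean_space \<Rightarrow> ennreal"
  assumes [measurable]: "f \<in> borel_measurable borel" and c: "c \<noteq> 0"
  shows "(\<integral>\<^sup>+x. f x \<partial>lborel) = \<bar>c\<bar> ^ DIM('a) * (\<integral>\<^sup>+x. f (t + c *\<^sub>R x) \<partial>lborel)"
proof -
  have "ennreal \<bar>c\<bar> ^ DIM('a) = ennreal (\<bar>c\<bar> ^ DIM('a))" by (simp add: ennreal_power)
  then show ?thesis
    by (subst lborel_affine[OF c, of t]) (simp add: nn_integral_density nn_integral_distr nn_integral_cmult)
qed

lemma integrable_lborel_affine:
  fixes f :: "'a::euclidean_space \<Rightarrow> 'b :: {banach, second_countable_topology}"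
  assumes f: "integrable lborel f" and c: "c \<noteq> 0"
  shows "integrable lborel (\<lambda>x. f (t + c *\<^sub>R x))"
proof -
  have [measurable]: "f \<in> borel_measurable borel" using f by simp
  have "(\<integral>\<^sup>+x. norm (f x) \<partial>lborel) < \<infinity>" using f by (simp add: integrable_iff_bounded)
  then have "(\<integral>\<^sup>+x. norm (f (t + c *\<^sub>R x)) \<partial>lborel) < \<infinity>"
    using c by (subst (asm) nn_integral_lborel_affine[of _ c t]) (auto simp: ennreal_mult_less_top)
  then show ?thesis by (auto simp: integrable_iff_bounded)
qed

lemma integral_lborel_affine:
  fixes f :: "'a::euclidean_space \<Rightarrow> 'b :: {banach, second_countable_topology}"
  assumes [measurable]: "f \<in> borel_measurable borel" and c: "c \<noteq> 0"
  shows "(\<integral>x. f x \<partial>lborel) = (\<bar>c\<bar> ^ DIM('a)) *\<^sub>R (\<integral>x. f (t + c *\<^sub>R x) \<partial>lborel)"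
proof -
  have "ennreal \<bar>c\<bar> ^ DIM('a) = ennreal (\<bar>c\<bar> ^ DIM('a))" by (simp add: ennreal_power)
  then show ?thesis
    by (subst lborel_affine[OF c, of t]) (simp add: integral_density integral_distr)
qed

section \<open>Continuity of translations in L^1\<close>

lemma integrable_lborel_translate:
  fixes f :: "'a::euclidean_space \<Rightarrow> 'b :: {banach, second_countable_topology}"
  shows "integrable lborel f \<Longrightarrow> integrable lborel (\<lambda>x. f (x + h))"
  using integrable_lborel_affine[of f 1 h] by (simp add: add.commute)

lemma integral_lborel_translate:
  fixes f :: "'a::euclidean_space \<Rightarrow> 'b :: {banach, second_countable_topology}"
  assumes "f \<in> borel_measurable borel"
  shows "(\<integral>x. f (x + h) \<partial>lborel) = (\<integral>x. f x \<partial>lborel)"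
  using integral_lborel_affine[OF assms, of 1 h] by (simp add: add.commute)

text \<open>For indicators, |a' - a| = (a' - a) + 2 a (1 - a'), and the first term integrates to 0
  by translation invariance. In the second, openness makes the integrand vanish eventually at every
  point, so dominated convergence applies and nothing has to be known about the boundary.\<close>

lemma L1_translation_open:
  fixes U :: "'a::euclidean_space set"
  assumes U: "open U" "emeasure lborel U < \<infinity>" and h: "h \<longlonglongrightarrow> 0"
  shows "(\<lambda>k. \<integral>x. \<bar>indicator U (x + h k) - indicator U x\<bar> \<partial>lborel) \<longlonglongrightarrow> (0::real)"
proof -
  have [measurable]: "U \<in> sets borel" using U by auto
  have int: "integrable lborel (indicator U :: 'a \<Rightarrow> real)" using U by (simp add: integrable_indicator_iff)
  have int2: "integrable lborel (\<lambda>x. indicator U x * (1 - indicator U (x + k)) :: real)" for k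
    by (rule Bochner_Integration.integrable_bound[OF int]) (auto simp: indicator_def)
  have eq: "(\<integral>x. \<bar>indicator U (x + k) - indicator U x :: real\<bar> \<partial>lborel) = 2 * (\<integral>x. indicator U x * (1 - indicator U (x + k)) \<partial>lborel)" (is "?l = ?r") for k
  proof -
    have "?l = (\<integral>x. (indicator U (x + k) - indicator U x) + 2 * (indicator U x * (1 - indicator U (x + k))) \<partial>lborel)"
      by (intro Bochner_Integration.integral_cong) (auto simp: indicator_def)
    also have "\<dots> = (\<integral>x. (indicator U (x + k) - indicator U x) \<partial>lborel) + ?r"
      using integrable_lborel_translate[OF int] int int2 by simp
    also have "(\<integral>x. (indicator U (x + k) - indicator U x::real) \<partial>lborel) = 0"
      using integrable_lborel_translate[OF int] int int2 integral_lborel_translate[of "indicator U :: 'a \<Rightarrow> real"]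
      by simp
    finally show ?thesis by simp
  qed
  have "(\<lambda>k. \<integral>x. indicator U x * (1 - indicator U (x + h k)) \<partial>lborel) \<longlonglongrightarrow> (\<integral>x. (0::real) \<partial>(lborel::'a measure))"
  proof (rule integral_dominated_convergence[where w="indicator U"])
    show "AE x in lborel. (\<lambda>k. indicator U x * (1 - indicator U (x + h k))) \<longlonglongrightarrow> (0::real)"
    proof (rule AE_I2)
      fix x :: 'a
      show "(\<lambda>k. indicator U x * (1 - indicator U (x + h k))) \<longlonglongrightarrow> (0::real)"
      proof (cases "x \<in> U")
        case True
        have "(\<lambda>k. x + h k) \<longlonglongrightarrow> x" using tendsto_add[OF tendsto_const h, of x] by simp
        then have "eventually (\<lambda>k. x + h k \<in> U) sequentially" using U(1) True by (rule topological_tendstoD)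
        then have "eventually (\<lambda>k. indicator U x * (1 - indicator U (x + h k)) = (0::real)) sequentially"
          by eventually_elim simp
        then show ?thesis by (rule tendsto_eventually)
      qed simp
    qed
  qed (use int in \<open>auto simp: indicator_def\<close>)
  then have "(\<lambda>k. 2 * (\<integral>x. indicator U x * (1 - indicator U (x + h k)) \<partial>lborel)) \<longlonglongrightarrow> (0::real)"
    by (auto intro: tendsto_mult_right_zero)
  then show ?thesis by (simp add: eq)
qed

lemma L1_translation_approx:
  fixes f g :: "'a::euclidean_space \<Rightarrow> 'b::euclidean_space"
  assumes f: "integrable lborel f" and g: "integrable lborel g"
  shows "(\<integral>x. norm (f (x + h) - f x) \<partial>lborel) \<le> 2 * (\<integral>x. norm (f x - g x) \<partial>lborel) + (\<integral>x. norm (g (x + h) - g x) \<partial>lborel)"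
proof -
  note [simp] = f g integrable_lborel_translate[OF f] integrable_lborel_translate[OF g]
  have [simp]: "integrable lborel (\<lambda>x. f (x+h) - g (x+h))"
    using integrable_lborel_translate[of "\<lambda>x. f x - g x" h] by simp
  have "(\<integral>x. norm (f (x + h) - f x) \<partial>lborel) \<le> (\<integral>x. norm (f (x+h) - g (x+h)) + (norm (f x - g x) + norm (g (x + h) - g x)) \<partial>lborel)"
  proof (rule integral_mono)
    fix x
    show "norm (f (x + h) - f x) \<le> norm (f (x+h) - g (x+h)) + (norm (f x - g x) + norm (g (x + h) - g x))"
      using norm_triangle_ineq[of "f (x+h) - g (x+h)" "(g x - f x) + (g (x + h) - g x)"]
        norm_triangle_ineq[of "g x - f x" "g (x+h) - g x"] by (simp add: norm_minus_commute)
  qed (intro Bochner_Integration.integrable_add integrable_norm Bochner_Integration.integrable_diff; simp)+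
  also have "\<dots> = (\<integral>x. norm (f (x+h) - g (x+h)) \<partial>lborel) + (\<integral>x. norm (f x - g x) \<partial>lborel) + (\<integral>x. norm (g (x + h) - g x) \<partial>lborel)"
    by (simp add: add.assoc)
  also have "(\<integral>x. norm (f (x+h) - g (x+h)) \<partial>lborel) = (\<integral>x. norm (f x - g x) \<partial>lborel)"
    by (rule integral_lborel_translate[of "\<lambda>x. norm (f x - g x)"])
       (use borel_measurable_integrable[OF f] borel_measurable_integrable[OF g] in simp)
  finally show ?thesis by simp
qed

lemma L1_translation_closed:
  fixes f :: "'a::euclidean_space \<Rightarrow> 'b::euclidean_space" and s :: "nat \<Rightarrow> 'a \<Rightarrow> 'b"
  assumes f: "integrable lborel f" and s: "\<And>i. integrable lborel (s i)"
    and lim: "(\<lambda>i. \<integral>x. norm (f x - s i x) \<partial>lborel) \<longlonglongrightarrow> 0"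
    and t: "\<And>i. (\<lambda>k. \<integral>x. norm (s i (x + h k) - s i x) \<partial>lborel) \<longlonglongrightarrow> 0"
  shows "(\<lambda>k. \<integral>x. norm (f (x + h k) - f x) \<partial>lborel) \<longlonglongrightarrow> 0"
proof (rule LIMSEQ_I)
  fix e :: real assume e: "e > 0"
  obtain i where i: "(\<integral>x. norm (f x - s i x) \<partial>lborel) < e/4"
    using order_tendstoD(2)[OF lim, of "e/4"] e by (auto simp: eventually_sequentially)
  obtain N where N: "\<And>k. k \<ge> N \<Longrightarrow> (\<integral>x. norm (s i (x + h k) - s i x) \<partial>lborel) < e/2"
    using order_tendstoD(2)[OF t[of i], of "e/2"] e by (auto simp: eventually_sequentially)
  show "\<exists>N. \<forall>k\<ge>N. norm ((\<integral>x. norm (f (x + h k) - f x) \<partial>lborel) - 0) < e"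
  proof (intro exI allI impI)
    fix k assume "N \<le> k"
    have "(\<integral>x. norm (f (x + h k) - f x) \<partial>lborel) < e"
      using L1_translation_approx[OF f s[of i], of "h k"] N[OF \<open>N \<le> k\<close>] i by linarith
    moreover have "(\<integral>x. norm (f (x + h k) - f x) \<partial>lborel) \<ge> 0" by simp
    ultimately show "norm ((\<integral>x. norm (f (x + h k) - f x) \<partial>lborel) - 0) < e" by simp
  qed
qed

text \<open>Outer regularity reduces to open sets: the L^1 distance of the two indicators is the
  measure of the difference.\<close>

lemma L1_translation_indicator:
  fixes A :: "'a::euclidean_space set"
  assumes A: "A \<in> sets borel" "emeasure lborel A < \<infinity>" and h: "h \<longlonglongrightarrow> 0"
  shows "(\<lambda>k. \<integral>x. norm (indicator A (x + h k) - indicator A x :: real) \<partial>lborel) \<longlonglongrightarrow> 0"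
proof -
  have "\<exists>U. open U \<and> A \<subseteq> U \<and> emeasure lborel (U - A) < ennreal (1 / Suc i)" for i :: nat
    using outer_regular_lborel[of A "1 / Suc i"] A(1) by (auto simp: sets_completionI_sets)
  then obtain U where U: "\<And>i. open (U i)" "\<And>i. A \<subseteq> U i" "\<And>i. emeasure lborel (U i - A) < ennreal (1 / Suc i)"
    by metis
  have [measurable]: "U i \<in> sets borel" "A \<in> sets borel" for i using U A by auto
  have fin: "emeasure lborel (U i) < \<infinity>" for i
  proof -
    have "emeasure lborel (U i) = emeasure lborel (A \<union> (U i - A))" using U(2) by (auto intro!: arg_cong[of _ _ "emeasure lborel"])
    also have "\<dots> \<le> emeasure lborel A + emeasure lborel (U i - A)" by (rule emeasure_subadditive) auto
    also have "\<dots> < \<infinity>" using A(2) U(3)[of i] by (auto simp: less_top[symmetric] intro: less_trans)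
    finally show ?thesis .
  qed
  show ?thesis
  proof (rule L1_translation_closed[where s="\<lambda>i. indicator (U i)"])
    show "(\<lambda>i. \<integral>x. norm (indicator A x - indicator (U i) x :: real) \<partial>lborel) \<longlonglongrightarrow> 0"
    proof (rule tendsto_sandwich[OF _ _ tendsto_const LIMSEQ_inverse_real_of_nat])
      show "\<forall>\<^sub>F i in sequentially. (\<integral>x. norm (indicator A x - indicator (U i) x :: real) \<partial>lborel) \<le> inverse (real (Suc i))"
      proof (intro always_eventually allI)
        fix i
        have "(\<integral>x. norm (indicator A x - indicator (U i) x :: real) \<partial>lborel) = (\<integral>x. indicator (U i - A) x \<partial>lborel)"
          by (intro Bochner_Integration.integral_cong) (use U(2)[of i] in \<open>auto simp: indicator_def\<close>)
        also have "\<dots> = measure lborel (U i - A)" by simp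
        also have "\<dots> \<le> 1 / Suc i"
          unfolding measure_def using U(3)[of i] by (intro enn2real_leI) auto
        finally show "(\<integral>x. norm (indicator A x - indicator (U i) x :: real) \<partial>lborel) \<le> inverse (real (Suc i))"
          by (simp add: inverse_eq_divide)
      qed
    qed auto
    show "(\<lambda>k. \<integral>x. norm (indicator (U i) (x + h k) - indicator (U i) x :: real) \<partial>lborel) \<longlonglongrightarrow> 0" for i
      using L1_translation_open[OF U(1) fin h, of i] by simp
  qed (use A fin in \<open>auto simp: integrable_indicator_iff\<close>)
qed

theorem L1_translation_continuous:
  fixes f :: "'a::euclidean_space \<Rightarrow> 'b::euclidean_space"
  assumes "integrable lborel f" and h: "h \<longlonglongrightarrow> 0"
  shows "(\<lambda>k. \<integral>x. norm (f (x + h k) - f x) \<partial>lborel) \<longlonglongrightarrow> 0"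
  using assms(1)
proof (induction rule: integrable_induct)
  case (base A c)
  have "norm (indicator A (x + h k) *\<^sub>R c - indicator A x *\<^sub>R c) = norm c * norm (indicator A (x + h k) - indicator A x :: real)" for x k
    by (simp only: scaleR_diff_left[symmetric] norm_scaleR mult.commute real_norm_def)
  moreover have "(\<lambda>k. norm c * (\<integral>x. norm (indicator A (x + h k) - indicator A x :: real) \<partial>lborel)) \<longlonglongrightarrow> 0"
    using L1_translation_indicator[OF _ _ h, of A] base by (auto intro!: tendsto_mult_right_zero)
  ultimately show ?case by simp
next
  case (add f g)
  have "(\<lambda>k. (\<integral>x. norm (f (x + h k) - f x) \<partial>lborel) + (\<integral>x. norm (g (x + h k) - g x) \<partial>lborel)) \<longlonglongrightarrow> 0 + 0"
    by (intro tendsto_add add)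
  then have *: "(\<lambda>k. (\<integral>x. norm (f (x + h k) - f x) \<partial>lborel) + (\<integral>x. norm (g (x + h k) - g x) \<partial>lborel)) \<longlonglongrightarrow> 0" by simp
  show ?case
  proof (rule tendsto_sandwich[OF _ _ tendsto_const *])
    show "\<forall>\<^sub>F k in sequentially. (\<integral>x. norm (f (x + h k) + g (x + h k) - (f x + g x)) \<partial>lborel)
       \<le> (\<integral>x. norm (f (x + h k) - f x) \<partial>lborel) + (\<integral>x. norm (g (x + h k) - g x) \<partial>lborel)"
    proof (intro always_eventually allI)
      fix k
      note [simp] = integrable_lborel_translate[OF add(1)] integrable_lborel_translate[OF add(2)] add(1,2)
      have "(\<integral>x. norm (f (x + h k) + g (x + h k) - (f x + g x)) \<partial>lborel) \<le> (\<integral>x. norm (f (x + h k) - f x) + norm (g (x + h k) - g x) \<partial>lborel)"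
        by (intro integral_mono) (auto simp: norm_diff_triangle_ineq)
      then show "(\<integral>x. norm (f (x + h k) + g (x + h k) - (f x + g x)) \<partial>lborel)
       \<le> (\<integral>x. norm (f (x + h k) - f x) \<partial>lborel) + (\<integral>x. norm (g (x + h k) - g x) \<partial>lborel)" by simp
    qed
  qed auto
next
  case (lim f s)
  show ?case
  proof (rule L1_translation_closed[OF lim(4) lim(1)])
    have "(\<lambda>i. \<integral>x. norm (f x - s i x) \<partial>lborel) \<longlonglongrightarrow> (\<integral>x. 0 \<partial>(lborel::'a measure))"
    proof (rule integral_dominated_convergence[where w="\<lambda>x. 3 * norm (f x)"])
      show "AE x in lborel. (\<lambda>i. norm (f x - s i x)) \<longlonglongrightarrow> 0"
        using lim(2) by (auto intro!: AE_I2 tendsto_norm_zero tendsto_eq_intros)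
      show "AE x in lborel. norm (norm (f x - s i x)) \<le> 3 * norm (f x)" for i
      proof (rule AE_I2)
        fix x :: 'a
        show "norm (norm (f x - s i x)) \<le> 3 * norm (f x)"
          using norm_triangle_ineq4[of "f x" "s i x"] lim(3)[of x i] by simp
      qed
    qed (use lim in \<open>auto\<close>)
    then show "(\<lambda>i. \<integral>x. norm (f x - s i x) \<partial>lborel) \<longlonglongrightarrow> 0" by simp
  qed (use lim in auto)
qed

section \<open>Lebesgue points along a sequence of radii\<close>

lemma measurable_lborel_pairI:
  "f \<in> borel \<Otimes>\<^sub>M borel \<rightarrow>\<^sub>M N \<Longrightarrow> f \<in> lborel \<Otimes>\<^sub>M lborel \<rightarrow>\<^sub>M N"
  by (simp cong: measurable_cong_sets sets_pair_measure_cong)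

lemma integrable_indicator_ball: "integrable lborel (indicator (ball (x::'a::euclidean_space) r) :: 'a \<Rightarrow> real)"
  using emeasure_lborel_ball_finite[of x r] by (simp add: integrable_indicator_iff)

lemma integrable_indicator_shift:
  fixes f :: "'a::euclidean_space \<Rightarrow> 'b::euclidean_space"
  assumes f: "integrable lborel f" and r: "r \<noteq> 0"
  shows "integrable lborel (\<lambda>y. indicator (ball 0 1) y * norm (f (x + r *\<^sub>R y) - c))"
proof -
  have [measurable]: "f \<in> borel_measurable borel" using f by simp
  have "integrable lborel (\<lambda>y. indicator (ball 0 1) y * norm c :: real)"
    by (intro integrable_mult_left) (auto simp: integrable_indicator_ball)
  then have 1: "integrable lborel (\<lambda>y. norm (f (x + r *\<^sub>R y)) + indicator (ball 0 1) y * norm c)"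
    using integrable_lborel_affine[OF f r, of x] by auto
  show ?thesis
    by (rule Bochner_Integration.integrable_bound[OF 1]) (auto simp: indicator_def norm_triangle_ineq4)
qed

text \<open>By Fubini the integral over x of the mean oscillation is an average of L^1 moduli of
  translation, so it tends to 0 with the radius; L^1 convergence to 0 gives convergence almost
  everywhere along a subsequence. No covering argument is involved, and one sequence of radii is
  enough for mollification and for blow-up.\<close>

theorem Lebesgue_points_along_sequence:
  fixes f :: "'a::euclidean_space \<Rightarrow> 'b::euclidean_space"
  assumes f: "integrable lborel f"
  obtains r :: "nat \<Rightarrow> real" where "\<And>k. 0 < r k" "r \<longlonglongrightarrow> 0"
    "AE x in lborel. (\<lambda>k. \<integral>y. indicator (ball 0 1) y * norm (f (x + r k *\<^sub>R y) - f x) \<partial>lborel) \<longlonglongrightarrow> 0"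
proof -
  have [measurable]: "f \<in> borel_measurable borel" using f by simp
  define q where "q k = 1 / real (Suc k)" for k
  have q: "q k > 0" for k by (simp add: q_def)
  have q0: "q \<longlonglongrightarrow> 0" unfolding q_def using LIMSEQ_inverse_real_of_nat by (simp only: inverse_eq_divide)
  define H where "H k x y = indicator (ball 0 1) y * norm (f (x + q k *\<^sub>R y) - f x)" for k x y
  have ind: "indicator (ball 0 1) y = (if norm y < 1 then 1 else 0 :: real)" for y :: 'a by (simp add: indicator_def)
  have Hm: "case_prod (H k) \<in> borel_measurable (lborel \<Otimes>\<^sub>M lborel)" for k
    unfolding H_def ind by (intro measurable_lborel_pairI) measurable
  define T where "T h = (\<integral>x. norm (f (x + h) - f x) \<partial>lborel)" for h
  have T0: "T h \<ge> 0" for h by (simp add: T_def)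
  have Tb: "T h \<le> 2 * (\<integral>x. norm (f x) \<partial>lborel)" for h
    using L1_translation_approx[OF f, of "\<lambda>_. 0" h] by (simp add: T_def)
  have Tint: "integrable lborel (\<lambda>x. norm (f (x + h) - f x))" for h
    using integrable_lborel_translate[OF f] f by auto
  have inner: "(\<integral>x. H k x y \<partial>lborel) = indicator (ball 0 1) y * T (q k *\<^sub>R y)" for k y
    by (simp add: H_def T_def)
  have [measurable]: "T \<in> borel_measurable borel" unfolding T_def by measurable
  have Hint: "integrable (lborel \<Otimes>\<^sub>M lborel) (case_prod (H k))" for k
  proof -
    have "integrable (lborel \<Otimes>\<^sub>M lborel) (\<lambda>(y,x). H k x y)"
    proof (rule lborel_pair.Fubini_integrable)
      show "(\<lambda>(y, x). H k x y) \<in> borel_measurable (lborel \<Otimes>\<^sub>M lborel)" unfolding H_def ind by (intro measurable_lborel_pairI) measurable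
      have "integrable lborel (\<lambda>y. indicator (ball 0 1) y * (2 * (\<integral>x. norm (f x) \<partial>lborel)))"
        by (intro integrable_mult_left) (auto simp: integrable_indicator_ball)
      then have "integrable lborel (\<lambda>y. indicator (ball 0 1) y * T (q k *\<^sub>R y))"
        by (rule Bochner_Integration.integrable_bound) (use T0 Tb in \<open>auto simp: indicator_def\<close>)
      moreover have "norm (H k x y) = H k x y" for x y by (simp add: H_def)
      ultimately show "integrable lborel (\<lambda>y. \<integral>x. norm (case (y,x) of (y,x) \<Rightarrow> H k x y) \<partial>lborel)"
        by (simp add: inner)
      show "AE y in lborel. integrable lborel (\<lambda>x. case (y,x) of (y,x) \<Rightarrow> H k x y)"
        using Tint by (auto simp: H_def)
    qed
    from lborel_pair.integrable_product_swap[OF this] show ?thesis by (simp add: case_prod_unfold)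
  qed
  define F where "F k x = (\<integral>y. H k x y \<partial>lborel)" for k x
  have F0: "F k x \<ge> 0" for k x unfolding F_def H_def by (intro Bochner_Integration.integral_nonneg) auto
  have Fint: "integrable lborel (F k)" for k
    unfolding F_def using lborel_pair.integrable_fst[OF Hint] by simp
  have "(\<integral>x. norm (F k x) \<partial>lborel) = (\<integral>y. indicator (ball 0 1) y * T (q k *\<^sub>R y) \<partial>lborel)" for k
    using lborel_pair.Fubini_integral[OF Hint, of k] F0 by (simp add: F_def inner)
  moreover have "(\<lambda>k. \<integral>y. indicator (ball 0 1) y * T (q k *\<^sub>R y) \<partial>lborel) \<longlonglongrightarrow> (\<integral>y. 0 \<partial>(lborel::'a measure))"
  proof (rule integral_dominated_convergence[where w="\<lambda>y. indicator (ball 0 1) y * (2 * (\<integral>x. norm (f x) \<partial>lborel))"])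
    show "integrable lborel (\<lambda>y. indicator (ball (0::'a) 1) y * (2 * (\<integral>x. norm (f x) \<partial>lborel)) :: real)"
      by (intro integrable_mult_left) (auto simp: integrable_indicator_ball)
    show "AE y in lborel. (\<lambda>k. indicator (ball 0 1) y * T (q k *\<^sub>R y)) \<longlonglongrightarrow> 0"
    proof (rule AE_I2)
      fix y :: 'a
      have "(\<lambda>k. q k *\<^sub>R y) \<longlonglongrightarrow> 0" using tendsto_scaleR[OF q0 tendsto_const, of y] by simp
      from L1_translation_continuous[OF f this]
      show "(\<lambda>k. indicator (ball 0 1) y * T (q k *\<^sub>R y)) \<longlonglongrightarrow> 0"
        unfolding T_def by (rule tendsto_mult_right_zero)
    qed
    show "AE y in lborel. norm (indicator (ball 0 1) y * T (q k *\<^sub>R y)) \<le> indicator (ball 0 1) y * (2 * (\<integral>x. norm (f x) \<partial>lborel))" for k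
      using T0 Tb by (auto simp: indicator_def)
  qed (auto simp: ind)
  ultimately have "(\<lambda>k. \<integral>x. norm (F k x) \<partial>lborel) \<longlonglongrightarrow> 0" by simp
  from tendsto_L1_AE_subseq[OF Fint this] obtain s :: "nat \<Rightarrow> nat" where
    s: "strict_mono s" "AE x in lborel. (\<lambda>n. F (s n) x) \<longlonglongrightarrow> 0" by blast
  show ?thesis
  proof (rule that[of "\<lambda>n. q (s n)"])
    show "(\<lambda>n. q (s n)) \<longlonglongrightarrow> 0" using LIMSEQ_subseq_LIMSEQ[OF q0 s(1)] by (simp add: o_def)
  qed (use q s in \<open>auto simp: F_def H_def\<close>)
qed

section \<open>Convolutions and the deviatoric symmetric gradient\<close>

definition cv :: "(real^'n::finite \<Rightarrow> real) \<Rightarrow> (real^'n \<Rightarrow> real) \<Rightarrow> real^'n \<Rightarrow> real" where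
  "cv u \<phi> x = (\<integral>y. u y * \<phi> (x - y) \<partial>lborel)"

lemma onorm_gradient_le:
  fixes a :: "'n::finite \<Rightarrow> real"
  shows "onorm (\<lambda>h::real^'n. \<Sum>j\<in>UNIV. h$j * a j) \<le> (\<Sum>j\<in>UNIV. \<bar>a j\<bar>)"
proof (rule onorm_bound)
  fix h :: "real^'n"
  have "norm (\<Sum>j\<in>UNIV. h$j * a j) \<le> (\<Sum>j\<in>UNIV. \<bar>h$j\<bar> * \<bar>a j\<bar>)"
    by (rule sum_norm_le) (simp add: abs_mult)
  also have "\<dots> \<le> (\<Sum>j\<in>UNIV. norm h * \<bar>a j\<bar>)"
    by (intro sum_mono mult_right_mono component_le_norm_cart) auto
  finally show "norm (\<Sum>j\<in>UNIV. h$j * a j) \<le> (\<Sum>j\<in>UNIV. \<bar>a j\<bar>) * norm h"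
    by (simp add: sum_distrib_left mult.commute)
qed (simp add: sum_nonneg)

lemma bounded_gradient_Lipschitz:
  fixes f :: "real^'n::finite \<Rightarrow> real"
  assumes "\<And>x. (f has_derivative (\<lambda>h. \<Sum>j\<in>UNIV. h$j * f1 j x)) (at x)" and "\<And>j x. \<bar>f1 j x\<bar> \<le> K"
  shows "\<bar>f x - f y\<bar> \<le> (real CARD('n) * K) * norm (x - y)"
proof -
  have "norm (f x - f y) \<le> (real CARD('n) * K) * norm (x - y)"
  proof (rule differentiable_bound[of UNIV f "\<lambda>x h. \<Sum>j\<in>UNIV. h$j * f1 j x"])
    fix x
    have "onorm (\<lambda>h. \<Sum>j\<in>UNIV. h$j * f1 j x) \<le> (\<Sum>j\<in>UNIV. \<bar>f1 j x\<bar>)" by (rule onorm_gradient_le)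
    also have "\<dots> \<le> (\<Sum>j\<in>(UNIV::'n set). K)" using assms(2) by (intro sum_mono)
    finally show "onorm (\<lambda>h. \<Sum>j\<in>UNIV. h$j * f1 j x) \<le> real CARD('n) * K" by simp
  qed (use assms in auto)
  then show ?thesis by simp
qed

text \<open>The constant is uniform in x, so that integrating the expansion against an integrable
  function differentiates a convolution.\<close>

lemma kernel_family_Taylor:
  fixes \<Phi> :: "('n::finite \<Rightarrow> nat) \<Rightarrow> real^'n \<Rightarrow> real"
  assumes \<Phi>: "kernel_family s \<Phi>"
  obtains K where "K \<ge> 0" "\<And>x h. \<bar>\<Phi> m (x + h) - \<Phi> m x - (\<Sum>j\<in>UNIV. h$j * \<Phi> (inc j m) x)\<bar> \<le> K * (norm h)\<^sup>2"
proof -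
  have der: "(\<Phi> m has_derivative (\<lambda>h. \<Sum>j\<in>UNIV. h$j * \<Phi> (inc j m) x)) (at x)" for x m
    using \<Phi> by (auto simp: kernel_family_def)
  have "\<exists>K>0. \<forall>x. \<bar>\<Phi> (inc i (inc j m)) x\<bar> \<le> K" for i j
    using kernel_family_bounded[OF \<Phi>] by metis
  then obtain k where k: "\<And>i j. k i j > 0" "\<And>i j x. \<bar>\<Phi> (inc i (inc j m)) x\<bar> \<le> k i j" by metis
  define K where "K = Max (range (\<lambda>(i,j). k i j))"
  have kK: "k i j \<le> K" for i j unfolding K_def by (intro Max_ge) auto
  have K0: "K \<ge> 0" using kK[of undefined undefined] k(1)[of undefined undefined] by linarith
  define N where "N = real CARD('n)"
  have L: "\<bar>\<Phi> (inc j m) x - \<Phi> (inc j m) y\<bar> \<le> (N * K) * norm (x - y)" for j x y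
    unfolding N_def
    by (rule bounded_gradient_Lipschitz[OF der order_trans[OF k(2) kK]])
  have "\<bar>\<Phi> m (x + h) - \<Phi> m x - (\<Sum>j\<in>UNIV. h$j * \<Phi> (inc j m) x)\<bar> \<le> (N * (N * K)) * (norm h)\<^sup>2" for x h
  proof -
    have "norm (\<Phi> m (x + h) - \<Phi> m x - (\<lambda>k. \<Sum>j\<in>UNIV. k$j * \<Phi> (inc j m) x) ((x + h) - x)) \<le> norm ((x+h) - x) * (N * (N * K) * norm h)"
    proof (rule differentiable_bound_linearization[where S="cball x (norm h)" and f'="\<lambda>x k. \<Sum>j\<in>UNIV. k$j * \<Phi> (inc j m) x"])
      fix y assume y: "y \<in> cball x (norm h)"
      have "(\<lambda>k. \<Sum>j\<in>UNIV. k$j * \<Phi> (inc j m) y) - (\<lambda>k. \<Sum>j\<in>UNIV. k$j * \<Phi> (inc j m) x)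
          = (\<lambda>k. \<Sum>j\<in>UNIV. k$j * (\<Phi> (inc j m) y - \<Phi> (inc j m) x))"
        by (simp add: fun_eq_iff algebra_simps sum_subtractf)
      then have "onorm ((\<lambda>k. \<Sum>j\<in>UNIV. k$j * \<Phi> (inc j m) y) - (\<lambda>k. \<Sum>j\<in>UNIV. k$j * \<Phi> (inc j m) x))
        \<le> (\<Sum>j\<in>UNIV. \<bar>\<Phi> (inc j m) y - \<Phi> (inc j m) x\<bar>)"
        using onorm_gradient_le[of "\<lambda>j. \<Phi> (inc j m) y - \<Phi> (inc j m) x"] by simp
      also have "\<dots> \<le> (\<Sum>j\<in>(UNIV::'n set). (N * K) * norm h)"
      proof (intro sum_mono)
        fix j
        have "norm (y - x) \<le> norm h" using y by (simp add: dist_norm norm_minus_commute)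
        then show "\<bar>\<Phi> (inc j m) y - \<Phi> (inc j m) x\<bar> \<le> (N * K) * norm h"
          by (rule order_trans[OF L mult_left_mono]) (simp add: K0 N_def)
      qed
      finally show "onorm ((\<lambda>k. \<Sum>j\<in>UNIV. k$j * \<Phi> (inc j m) y) - (\<lambda>k. \<Sum>j\<in>UNIV. k$j * \<Phi> (inc j m) x)) \<le> N * (N * K) * norm h"
        by (simp add: N_def)
    next
      fix t :: real assume "t \<in> {0..1}"
      then show "x + t *\<^sub>R (x + h - x) \<in> cball x (norm h)"
        by (auto simp: dist_norm mult_left_le_one_le)
    qed (auto intro: has_derivative_at_withinI der)
    then show ?thesis by (simp add: power2_eq_square mult_ac)
  qed
  moreover have "N * (N * K) \<ge> 0" using K0 by (simp add: N_def)
  ultimately show ?thesis using that by blast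
qed

lemma cv_integrable:
  fixes \<Phi> :: "('n::finite \<Rightarrow> nat) \<Rightarrow> real^'n \<Rightarrow> real"
  assumes u: "integrable lborel u" and \<Phi>: "kernel_family s \<Phi>"
  shows "integrable lborel (\<lambda>y. u y * \<Phi> m (x - y))"
proof -
  obtain K where K: "K > 0" "\<And>x. \<bar>\<Phi> m x\<bar> \<le> K" using kernel_family_bounded[OF \<Phi>] by metis
  have [measurable]: "\<Phi> m \<in> borel_measurable borel" "u \<in> borel_measurable borel"
    using kernel_family_continuous[OF \<Phi>] u by (auto intro: borel_measurable_continuous_onI)
  have "integrable lborel (\<lambda>y. K * u y)" using u by simp
  then show ?thesis
    by (rule Bochner_Integration.integrable_bound) 
       (use K in \<open>auto simp: abs_mult mult.commute[of K] intro!: mult_left_mono\<close>)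
qed

lemma cv_has_derivative:
  fixes \<Phi> :: "('n::finite \<Rightarrow> nat) \<Rightarrow> real^'n \<Rightarrow> real"
  assumes u: "integrable lborel u" and \<Phi>: "kernel_family s \<Phi>"
  shows "(cv u (\<Phi> m) has_derivative (\<lambda>h. \<Sum>j\<in>UNIV. h$j * cv u (\<Phi> (inc j m)) x)) (at x)"
  unfolding has_derivative_iff_norm
proof (intro conjI)
  show "bounded_linear (\<lambda>h::real^'n. \<Sum>j\<in>UNIV. h$j * cv u (\<Phi> (inc j m)) x)"
    by (intro bounded_linear_sum bounded_linear_mult_const bounded_linear_vec_nth)
  obtain K where K: "K \<ge> 0" "\<And>x h. \<bar>\<Phi> m (x + h) - \<Phi> m x - (\<Sum>j\<in>UNIV. h$j * \<Phi> (inc j m) x)\<bar> \<le> K * (norm h)\<^sup>2"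
    using kernel_family_Taylor[OF \<Phi>] by metis
  define C where "C = K * (\<integral>y. \<bar>u y\<bar> \<partial>lborel)"
  have C: "\<bar>cv u (\<Phi> m) y - cv u (\<Phi> m) x - (\<Sum>j\<in>UNIV. (y-x)$j * cv u (\<Phi> (inc j m)) x)\<bar> \<le> C * (norm (y - x))\<^sup>2" for y
  proof -
    define h where "h = y - x"
    note [simp] = cv_integrable[OF u \<Phi>]
    have eq: "cv u (\<Phi> m) y - cv u (\<Phi> m) x - (\<Sum>j\<in>UNIV. h$j * cv u (\<Phi> (inc j m)) x)
       = (\<integral>w. u w * (\<Phi> m ((x - w) + h) - \<Phi> m (x - w) - (\<Sum>j\<in>UNIV. h$j * \<Phi> (inc j m) (x-w))) \<partial>lborel)"
    proof -
      have "(\<integral>w. u w * (\<Phi> m ((x - w) + h) - \<Phi> m (x - w) - (\<Sum>j\<in>UNIV. h$j * \<Phi> (inc j m) (x-w))) \<partial>lborel)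
         = (\<integral>w. u w * \<Phi> m (y - w) - u w * \<Phi> m (x - w) - (\<Sum>j\<in>UNIV. h$j * (u w * \<Phi> (inc j m) (x-w))) \<partial>lborel)"
        by (intro Bochner_Integration.integral_cong) (auto simp: h_def algebra_simps sum_distrib_left)
      then show ?thesis by (simp add: cv_def)
    qed
    have "\<bar>\<integral>w. u w * (\<Phi> m ((x - w) + h) - \<Phi> m (x - w) - (\<Sum>j\<in>UNIV. h$j * \<Phi> (inc j m) (x-w))) \<partial>lborel\<bar>
      \<le> (\<integral>w. (K * (norm h)\<^sup>2) * \<bar>u w\<bar> \<partial>lborel)"
    proof (rule order_trans[OF integral_abs_bound integral_mono_AE'])
      show "integrable lborel (\<lambda>w. (K * (norm h)\<^sup>2) * \<bar>u w\<bar>)" using u by simp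
      show "AE w in lborel. \<bar>u w * (\<Phi> m ((x - w) + h) - \<Phi> m (x - w) - (\<Sum>j\<in>UNIV. h$j * \<Phi> (inc j m) (x-w)))\<bar> \<le> (K * (norm h)\<^sup>2) * \<bar>u w\<bar>"
        using K(2) by (auto simp: abs_mult mult.commute[of _ "\<bar>u _\<bar>"] intro!: mult_left_mono)
    qed (use K in auto)
    then show ?thesis unfolding h_def[symmetric] eq C_def by (simp add: mult_ac)
  qed
  show "((\<lambda>y. norm (cv u (\<Phi> m) y - cv u (\<Phi> m) x - (\<Sum>j\<in>UNIV. (y-x)$j * cv u (\<Phi> (inc j m)) x)) / norm (y - x)) \<longlongrightarrow> 0) (at x)"
  proof (rule Lim_null_comparison)
    show "((\<lambda>y. C * norm (y - x)) \<longlongrightarrow> 0) (at x)" by (auto intro!: tendsto_eq_intros)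
    show "\<forall>\<^sub>F y in at x. norm (norm (cv u (\<Phi> m) y - cv u (\<Phi> m) x - (\<Sum>j\<in>UNIV. (y-x)$j * cv u (\<Phi> (inc j m)) x)) / norm (y - x)) \<le> C * norm (y - x)"
      unfolding eventually_at_filter
    proof (intro always_eventually allI impI)
      fix y assume "y \<noteq> x"
      then have "norm (y - x) > 0" by simp
      then show "norm (norm (cv u (\<Phi> m) y - cv u (\<Phi> m) x - (\<Sum>j\<in>UNIV. (y-x)$j * cv u (\<Phi> (inc j m)) x)) / norm (y - x)) \<le> C * norm (y - x)"
        using C[of y] by (simp add: pos_divide_le_eq power2_eq_square mult.assoc)
    qed
  qed
qed

lemma cv_continuous [continuous_intros]:
  fixes \<Phi> :: "('n::finite \<Rightarrow> nat) \<Rightarrow> real^'n \<Rightarrow> real"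
  assumes "integrable lborel u" "kernel_family s \<Phi>"
  shows "continuous_on A (cv u (\<Phi> m))"
  using has_derivative_continuous[OF cv_has_derivative[OF assms]] by (simp add: continuous_at_imp_continuous_on)

text \<open>The fields are Borel and integrable on the whole space, and only the test functions see
  the domain. Convolutions are thus defined everywhere, and the same pair can be used on every
  subdomain.\<close>

definition weak_ED_Borel :: "(real^'n::finite) set \<Rightarrow> (real^'n \<Rightarrow> real^'n) \<Rightarrow> (real^'n \<Rightarrow> real^'n^'n) \<Rightarrow> bool" where
  "weak_ED_Borel \<Omega> u G \<longleftrightarrow> integrable lborel u \<and> integrable lborel G \<and>
     (\<forall>\<phi>. test_fun \<Omega> \<phi> \<longrightarrow> (\<forall>i j. (\<integral>x. G x $ i $ j * \<phi> x \<partial>lborel) =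
            - (1/2) * ((\<integral>x. u x $ i * partial_deriv j \<phi> x \<partial>lborel)
                     + (\<integral>x. u x $ j * partial_deriv i \<phi> x \<partial>lborel))
            + (if i = j then (1 / real CARD('n)) *
                 (\<Sum>k\<in>UNIV. \<integral>x. u x $ k * partial_deriv k \<phi> x \<partial>lborel) else 0)))"

text \<open>\<open>U\<close> is the jet of a vector field at one point: \<open>U l m\<close> stands
  for the derivative of multi-index \<open>m\<close> of component \<open>l\<close>. The value is
  then the corresponding derivative of (div u)/n.\<close>

definition trace_part :: "('n::finite \<Rightarrow> ('n \<Rightarrow> nat) \<Rightarrow> real) \<Rightarrow> ('n \<Rightarrow> nat) \<Rightarrow> real" where
  "trace_part U m = (1 / real CARD('n)) * (\<Sum>k\<in>UNIV. U k (inc k m))"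

text \<open>A formal version of \<Gamma> = E^D u between jets at one point, for all derivatives at
  once. It turns the differential identities into linear algebra.\<close>

definition dev_sym_rel :: "('n::finite \<Rightarrow> ('n \<Rightarrow> nat) \<Rightarrow> real) \<Rightarrow> ('n \<Rightarrow> 'n \<Rightarrow> ('n \<Rightarrow> nat) \<Rightarrow> real) \<Rightarrow> bool" where
  "dev_sym_rel U \<Gamma> \<longleftrightarrow> (\<forall>m i j. \<Gamma> i j m = (1/2) * (U i (inc j m) + U j (inc i m)) - (if i = j then trace_part U m else 0))"

lemma dev_sym_rel_cv:
  assumes w: "weak_ED_Borel \<Omega> u G" and \<Phi>: "kernel_family s \<Phi>" and x: "cball x s \<subseteq> \<Omega>"
  shows "dev_sym_rel (\<lambda>l m. cv (\<lambda>y. u y $ l) (\<Phi> m) x) (\<lambda>i j m. cv (\<lambda>y. G y $ i $ j) (\<Phi> m) x)"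
  unfolding dev_sym_rel_def
proof (intro allI)
  fix m i j
  have "test_fun \<Omega> (\<lambda>y. \<Phi> m (x - y))" by (rule test_fun_reflect[OF \<Phi> x])
  with w have "(\<integral>y. G y $ i $ j * \<Phi> m (x - y) \<partial>lborel) =
            - (1/2) * ((\<integral>y. u y $ i * partial_deriv j (\<lambda>y. \<Phi> m (x - y)) y \<partial>lborel)
                     + (\<integral>y. u y $ j * partial_deriv i (\<lambda>y. \<Phi> m (x - y)) y \<partial>lborel))
            + (if i = j then (1 / real CARD('a)) *
                 (\<Sum>k\<in>UNIV. \<integral>y. u y $ k * partial_deriv k (\<lambda>y. \<Phi> m (x - y)) y \<partial>lborel) else 0)"
    unfolding weak_ED_Borel_def by blast
  then show "cv (\<lambda>y. G y $ i $ j) (\<Phi> m) x = (1/2) * (cv (\<lambda>y. u y $ i) (\<Phi> (inc j m)) x + cv (\<lambda>y. u y $ j) (\<Phi> (inc i m)) x)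
    - (if i = j then trace_part (\<lambda>l m. cv (\<lambda>y. u y $ l) (\<Phi> m) x) m else 0)"
    by (simp add: partial_deriv_reflect[OF \<Phi>] cv_def trace_part_def sum_negf algebra_simps)
qed

text \<open>The classical identity d_i d_j u_l = d_i e_jl + d_j e_il - d_l e_ij for the full
  symmetric gradient e, which is \<Gamma> plus the trace part on the diagonal.\<close>

lemma dev_sym_rel_second:
  assumes "dev_sym_rel U \<Gamma>"
  shows "U l (inc i (inc j m)) = (\<Gamma> j l (inc i m) + (if j = l then trace_part U (inc i m) else 0))
     + (\<Gamma> i l (inc j m) + (if i = l then trace_part U (inc j m) else 0))
     - (\<Gamma> i j (inc l m) + (if i = j then trace_part U (inc l m) else 0))"
proof -
  have g: "\<Gamma> i j m + (if i = j then trace_part U m else 0) = (1/2) * (U i (inc j m) + U j (inc i m))" for m i j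
    using assms by (simp add: dev_sym_rel_def)
  show ?thesis
    unfolding g inc_commute[of l i] inc_commute[of l j] inc_commute[of j i] by (simp add: field_simps)
qed

text \<open>The coefficients \<open>\<kappa>\<close> are chosen before the jets and the multi-index,
  so they depend on the functional \<open>F\<close> alone. All later constants inherit this
  uniformity.\<close>

definition from_second :: "(('n::finite \<Rightarrow> ('n \<Rightarrow> nat) \<Rightarrow> real) \<Rightarrow> ('n \<Rightarrow> nat) \<Rightarrow> real) \<Rightarrow> bool" where
  "from_second F \<longleftrightarrow> (\<exists>\<kappa>. \<forall>U \<Gamma> m. dev_sym_rel U \<Gamma> \<longrightarrow>
     F U m = (\<Sum>(a,b,c,d)\<in>UNIV. \<kappa> (a,b,c,d) * \<Gamma> a b (inc c (inc d m))))"

lemma from_second_add: "from_second F \<Longrightarrow> from_second H \<Longrightarrow> from_second (\<lambda>U m. F U m + H U m)"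
  unfolding from_second_def
  by (elim exE, rule_tac x="\<lambda>p. \<kappa> p + \<kappa>' p" in exI)
     (simp add: sum.distrib case_prod_unfold distrib_right)

lemma from_second_mult: "from_second F \<Longrightarrow> from_second (\<lambda>U m. c * F U m)"
  unfolding from_second_def
  by (elim exE, rule_tac x="\<lambda>p. c * \<kappa> p" in exI)
     (simp add: sum_distrib_left case_prod_unfold mult.assoc)

lemma from_second_diff: "from_second F \<Longrightarrow> from_second H \<Longrightarrow> from_second (\<lambda>U m. F U m - H U m)"
  using from_second_add[OF _ from_second_mult[of H "-1"], of F] by simp

lemma from_second_if: "(P \<Longrightarrow> from_second F) \<Longrightarrow> (\<not> P \<Longrightarrow> from_second H) \<Longrightarrow> from_second (\<lambda>U m. if P then F U m else H U m)"
  by (cases P) simp_all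

lemma from_second_zero: "from_second (\<lambda>U m. 0)"
  unfolding from_second_def by (rule exI[of _ "\<lambda>_. 0"]) (simp add: case_prod_unfold)

lemma from_second_base:
  "from_second (\<lambda>U m. (1/2) * (U a (inc b (inc c (inc d m))) + U b (inc a (inc c (inc d m)))) - (if a = b then trace_part U (inc c (inc d m)) else 0))"
  unfolding from_second_def
proof (rule exI[of _ "\<lambda>p. if p = (a,b,c,d) then 1 else 0"], intro allI impI)
  fix U :: "'a \<Rightarrow> ('a \<Rightarrow> nat) \<Rightarrow> real" and \<Gamma> m
  assume r: "dev_sym_rel U \<Gamma>"
  have "(\<Sum>(a',b',c',d')\<in>UNIV. (if (a',b',c',d') = (a,b,c,d) then 1 else 0) * \<Gamma> a' b' (inc c' (inc d' m)))
    = (\<Sum>p\<in>UNIV. if p = (a,b,c,d) then \<Gamma> a b (inc c (inc d m)) else 0)"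
    by (intro sum.cong) (auto split: if_splits)
  also have "\<dots> = \<Gamma> a b (inc c (inc d m))" by simp
  finally show "(1/2) * (U a (inc b (inc c (inc d m))) + U b (inc a (inc c (inc d m)))) - (if a = b then trace_part U (inc c (inc d m)) else 0) =
    (\<Sum>(a',b',c',d')\<in>UNIV. (if (a',b',c',d') = (a,b,c,d) then 1 else 0) * \<Gamma> a' b' (inc c' (inc d' m)))"
    using r by (simp add: dev_sym_rel_def)
qed

lemma third_index:
  fixes i j :: "'n::finite"
  assumes "CARD('n) \<ge> 3" obtains k :: 'n where "k \<noteq> i" "k \<noteq> j"
proof -
  have "card {i,j} \<le> 2" by (simp add: card_insert_if)
  then have "{i,j} \<noteq> (UNIV::'n set)" using assms by (metis not_less_eq_eq numeral_2_eq_2 numeral_3_eq_3)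
  then show ?thesis using that by blast
qed

text \<open>Saint-Venant's compatibility relations determine the Hessian of the trace part once a third index is available.\<close>
lemma from_second_trace:
  fixes i j :: "'n::finite"
  assumes n: "CARD('n) \<ge> 3"
  shows "from_second (\<lambda>U m. trace_part U (inc i (inc j m)))"
proof -
  define E where "E a b c d = (\<lambda>U m. (1/2) * (U a (inc b (inc c (inc d m))) + U b (inc a (inc c (inc d m)))) - (if a = b then trace_part U (inc c (inc d m)) else 0))"
    for a b c d :: 'n
  have E: "from_second (E a b c d)" for a b c d unfolding E_def by (rule from_second_base)
  \<comment> \<open>The Saint-Venant combination vanishes for the full symmetric gradient; for its
    deviatoric part the terms left over are exactly second derivatives of the trace part.\<close>
  have sv: "E i j k l U m + E k l i j U m - E i l j k U m - E j k i l U m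
     = (if j = k then trace_part U (inc i (inc l m)) else 0) + (if i = l then trace_part U (inc j (inc k m)) else 0)
       - (if i = j then trace_part U (inc k (inc l m)) else 0) - (if k = l then trace_part U (inc i (inc j m)) else 0)" for i j k l U m
  proof -
    show ?thesis unfolding E_def inc_commute[of j i] inc_commute[of k i] inc_commute[of l i] inc_commute[of k j] inc_commute[of l j] inc_commute[of l k]
      by (simp add: field_simps)
  qed
  \<comment> \<open>Repeating an index k different from i and j leaves a single trace term in
    \<open>sv\<close>.\<close>
  have off: "from_second (\<lambda>U m. trace_part U (inc i (inc j m)))" if "i \<noteq> j" for i j :: 'n
  proof -
    obtain k where k: "k \<noteq> i" "k \<noteq> j" using third_index[OF n] by metis
    have "trace_part U (inc i (inc j m)) = E i k j k U m + E j k i k U m - E i j k k U m - E k k i j U m" for U m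
      using sv[of i j k k U m] k that by simp
    then show ?thesis using E by (simp only:) (intro from_second_add from_second_diff E)
  qed
  have two: "from_second (\<lambda>U m. trace_part U (inc i (inc i m)) + trace_part U (inc k (inc k m)))" if "i \<noteq> k" for i k :: 'n
  proof -
    have "trace_part U (inc i (inc i m)) + trace_part U (inc k (inc k m)) = E i k i k U m + E i k i k U m - E i i k k U m - E k k i i U m" for U m
      using sv[of i i k k U m] that by simp
    then show ?thesis using E by (simp only:) (intro from_second_add from_second_diff E)
  qed
  show ?thesis
  proof (cases "i = j")
    case False then show ?thesis by (rule off)
  next
    case True
    obtain k where k: "k \<noteq> i" using third_index[OF n] by metis
    obtain l where l: "l \<noteq> i" "l \<noteq> k" using third_index[OF n] by metis
    \<comment> \<open>With i, k, l distinct, the three pairwise sums of diagonal second derivatives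
      determine each of them.\<close>
    have "from_second (\<lambda>U m. (1/2) * ((trace_part U (inc i (inc i m)) + trace_part U (inc k (inc k m)))
       + (trace_part U (inc i (inc i m)) + trace_part U (inc l (inc l m)))
       - (trace_part U (inc k (inc k m)) + trace_part U (inc l (inc l m)))))"
      using k l by (intro from_second_mult from_second_add[OF two two] from_second_diff[OF from_second_add[OF two two] two]) auto
    then show ?thesis using True by simp
  qed
qed

text \<open>The identity of \<open>dev_sym_rel_second\<close>, one order higher: third derivatives
  of u are second derivatives of the symmetric gradient, whose trace part is covered by
  \<open>from_second_trace\<close>.\<close>

lemma from_second_third:
  fixes i j k l :: "'n::finite"
  assumes n: "CARD('n) \<ge> 3"
  shows "from_second (\<lambda>U m. U l (inc i (inc j (inc k m))))"
proof -
  define S where "S a b c d = (\<lambda>(U :: 'n \<Rightarrow> ('n \<Rightarrow> nat) \<Rightarrow> real) m. (1/2) * (U a (inc b (inc c (inc d m))) + U b (inc a (inc c (inc d m)))))" for a b c d :: 'n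
  have S: "from_second (S a b c d)" for a b c d
  proof -
    have "from_second (\<lambda>U m. ((1/2) * (U a (inc b (inc c (inc d m))) + U b (inc a (inc c (inc d m)))) - (if a = b then trace_part U (inc c (inc d m)) else 0))
      + (if a = b then trace_part U (inc c (inc d m)) else 0))"
      by (intro from_second_add from_second_base from_second_if from_second_trace n from_second_zero)
    then show ?thesis by (simp add: S_def)
  qed
  have "U l (inc i (inc j (inc k m))) = S j l i k U m + S i l j k U m - S i j l k U m" for U m
    unfolding S_def inc_commute[of l i] inc_commute[of l j] inc_commute[of l k] inc_commute[of j i] by (simp add: field_simps)
  then have eq: "(\<lambda>U m. U l (inc i (inc j (inc k m)))) = (\<lambda>U m. S j l i k U m + S i l j k U m - S i j l k U m)"
    by (intro ext)
  show ?thesis unfolding eq by (intro from_second_add from_second_diff S)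
qed

section \<open>Integration by parts with compactly supported weights\<close>

lemma integrable_continuous_compact_support:
  fixes f :: "'a::euclidean_space \<Rightarrow> real"
  assumes "continuous_on UNIV f" "compact S" "\<And>z. z \<notin> S \<Longrightarrow> f z = 0"
  shows "integrable lborel f"
proof -
  have "set_integrable lborel S f"
    unfolding set_integrable_def
    by (rule borel_integrable_compact) (use assms in \<open>auto intro: continuous_on_subset\<close>)
  moreover have "(\<lambda>x. indicator S x *\<^sub>R f x) = f"
    using assms(3) by (auto simp: fun_eq_iff indicator_def)
  ultimately show ?thesis unfolding set_integrable_def by simp
qed

text \<open>Every difference quotient integrates to 0 by translation invariance, and the quotients
  converge dominatedly because a compactly supported C^1 function is Lipschitz.\<close>

lemma integral_partial_zero:
  fixes F :: "real^'n::finite \<Rightarrow> real"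
  assumes F: "\<And>z. (F has_derivative (\<lambda>h. \<Sum>j\<in>UNIV. h$j * F1 j z)) (at z)"
    and F1: "\<And>j. continuous_on UNIV (F1 j)"
    and supp: "\<And>z. R < norm z \<Longrightarrow> F z = 0" "\<And>j z. R < norm z \<Longrightarrow> F1 j z = 0"
  shows "(\<integral>z. F1 c z \<partial>lborel) = 0"
proof -
  have contF: "continuous_on UNIV F"
    using has_derivative_continuous[OF F] by (simp add: continuous_at_imp_continuous_on)
  have intF: "integrable lborel F"
    by (rule integrable_continuous_compact_support[OF contF compact_cball[of 0 R]]) (use supp in auto)
  have "\<exists>K. \<forall>z. \<bar>F1 j z\<bar> \<le> K" for j
  proof -
    have "bounded (F1 j ` cball 0 R)"
      by (intro compact_imp_bounded compact_continuous_image continuous_on_subset[OF F1]) auto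
    then obtain K where "\<And>z. z \<in> cball 0 R \<Longrightarrow> \<bar>F1 j z\<bar> \<le> K" by (force simp: bounded_iff)
    then have "\<bar>F1 j z\<bar> \<le> max K 0" for z
      using supp(2)[of z j] by (cases "norm z \<le> R") (auto simp: le_max_iff_disj)
    then show ?thesis by blast
  qed
  then obtain k where k: "\<And>j z. \<bar>F1 j z\<bar> \<le> k j" by metis
  define K where "K = Max (range k)"
  have K: "\<bar>F1 j z\<bar> \<le> K" for j z
    unfolding K_def using k[of j z] by (rule order_trans) (auto intro: Max_ge)
  define L where "L = real CARD('n) * K"
  have Lip: "\<bar>F x - F y\<bar> \<le> L * norm (x - y)" for x y
    unfolding L_def by (rule bounded_gradient_Lipschitz[OF F K])
  have L0: "L \<ge> 0" unfolding L_def using K[of c 0] by simp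
  define q where "q k = 1 / real (Suc k)" for k
  have q: "0 < q k" "q k \<le> 1" for k by (simp_all add: q_def)
  have q0: "q \<longlonglongrightarrow> 0" unfolding q_def using LIMSEQ_inverse_real_of_nat by (simp only: inverse_eq_divide)
  define e :: "real^'n" where "e = axis c 1"
  define D where "D k z = (F (z + q k *\<^sub>R e) - F z) / q k" for k z
  have "(\<lambda>k. \<integral>z. D k z \<partial>lborel) \<longlonglongrightarrow> (\<integral>z. F1 c z \<partial>lborel)"
  \<comment> \<open>Shifts have length at most 1; the second unit in R + 2 provides the strict
    inequality that the support hypothesis asks for.\<close>
  proof (rule integral_dominated_convergence[where w="\<lambda>z. L * indicator (ball 0 (R + 2)) z"])
    show "integrable lborel (\<lambda>z::real^'n. L * indicator (ball 0 (R + 2)) z)"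
      by (intro integrable_mult_right integrable_indicator_ball)
    show "AE z in lborel. (\<lambda>k. D k z) \<longlonglongrightarrow> F1 c z"
    proof (rule AE_I2)
      fix z
      have g: "((\<lambda>t. F (z + t *\<^sub>R e)) has_real_derivative F1 c z) (at 0)"
      proof -
        have "((\<lambda>t. z + t *\<^sub>R e) has_derivative (\<lambda>t. t *\<^sub>R e)) (at 0)" by (auto intro!: derivative_eq_intros)
        from has_derivative_compose[OF this, of F "\<lambda>h. \<Sum>j\<in>UNIV. h$j * F1 j z"] F[of z]
        have "((\<lambda>t. F (z + t *\<^sub>R e)) has_derivative (\<lambda>t. \<Sum>j\<in>UNIV. (t *\<^sub>R e)$j * F1 j z)) (at 0)" by simp
        moreover have "(\<Sum>j\<in>UNIV. (t *\<^sub>R e)$j * F1 j z) = F1 c z * t" for t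
        proof -
          have "(\<Sum>j\<in>UNIV. (t *\<^sub>R e)$j * F1 j z) = (\<Sum>j\<in>UNIV. if j = c then t * F1 j z else 0)"
            by (intro sum.cong) (auto simp: e_def axis_def)
          then show ?thesis by (simp add: mult.commute)
        qed
        ultimately show ?thesis by (simp add: has_field_derivative_def)
      qed
      have "((\<lambda>t. (F (z + t *\<^sub>R e) - F z) / t) \<longlongrightarrow> F1 c z) (at 0)"
        using g by (simp add: has_field_derivative_iff)
      moreover have "filterlim q (at 0) sequentially"
        using q0 q by (auto simp: filterlim_at intro!: always_eventually less_imp_neq[symmetric])
      ultimately show "(\<lambda>k. D k z) \<longlonglongrightarrow> F1 c z"
        unfolding D_def by (rule filterlim_compose)
    qed
    show "AE z in lborel. norm (D k z) \<le> L * indicator (ball 0 (R + 2)) z" for k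
    proof (rule AE_I2)
      fix z
      have ne: "norm (q k *\<^sub>R e) \<le> 1" using q[of k] by (simp add: e_def norm_axis_1)
      show "norm (D k z) \<le> L * indicator (ball 0 (R + 2)) z"
      proof (cases "norm z < R + 2")
        case True
        have "\<bar>F (z + q k *\<^sub>R e) - F z\<bar> \<le> L * q k"
          using Lip[of "z + q k *\<^sub>R e" z] q[of k] by (simp add: e_def norm_axis_1)
        then show ?thesis using True q[of k] by (simp add: D_def pos_divide_le_eq)
      next
        case False
        then have "R < norm (z + q k *\<^sub>R e)"
          using ne norm_triangle_ineq4[of "z + q k *\<^sub>R e" "q k *\<^sub>R e"] by simp
        then show ?thesis using False supp(1) by (simp add: D_def)
      qed
    qed
    show "F1 c \<in> borel_measurable lborel" using F1 by (auto intro: borel_measurable_continuous_onI)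
    show "D k \<in> borel_measurable lborel" for k
      unfolding D_def using intF by (auto intro!: borel_measurable_continuous_onI continuous_intros continuous_on_compose2[OF contF])
  qed
  moreover have "(\<integral>z. D k z \<partial>lborel) = 0" for k
    using intF integrable_lborel_translate[OF intF, of "q k *\<^sub>R e"] integral_lborel_translate[of F "q k *\<^sub>R e"]
    by (simp add: D_def)
  ultimately show ?thesis by (simp add: LIMSEQ_const_iff)
qed

lemma integration_by_parts:
  fixes \<psi> f :: "real^'n::finite \<Rightarrow> real"
  assumes \<psi>: "\<And>z. (\<psi> has_derivative (\<lambda>h. \<Sum>j\<in>UNIV. h$j * \<psi>1 j z)) (at z)" "\<And>j. continuous_on UNIV (\<psi>1 j)"
    and supp: "\<And>z. R < norm z \<Longrightarrow> \<psi> z = 0" "\<And>j z. R < norm z \<Longrightarrow> \<psi>1 j z = 0"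
    and f: "\<And>z. (f has_derivative (\<lambda>h. \<Sum>j\<in>UNIV. h$j * f1 j z)) (at z)" "\<And>j. continuous_on UNIV (f1 j)"
  shows "(\<integral>z. \<psi> z * f1 c z \<partial>lborel) = - (\<integral>z. \<psi>1 c z * f z \<partial>lborel)"
proof -
  have c: "continuous_on UNIV \<psi>" "continuous_on UNIV f"
    using has_derivative_continuous[OF \<psi>(1)] has_derivative_continuous[OF f(1)] by (simp_all add: continuous_at_imp_continuous_on)
  have "(\<integral>z. \<psi> z * f1 c z + \<psi>1 c z * f z \<partial>lborel) = 0"
  proof (rule integral_partial_zero[where F="\<lambda>z. \<psi> z * f z" and ?F1.0="\<lambda>c z. \<psi> z * f1 c z + \<psi>1 c z * f z" and R=R])
    show "((\<lambda>z. \<psi> z * f z) has_derivative (\<lambda>h. \<Sum>j\<in>UNIV. h$j * (\<psi> z * f1 j z + \<psi>1 j z * f z))) (at z)" for z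
      by (rule has_derivative_eq_rhs[OF has_derivative_mult[OF \<psi>(1) f(1)]])
         (simp add: fun_eq_iff sum_distrib_left sum_distrib_right sum.distrib[symmetric] algebra_simps)
  qed (use supp \<psi> f c in \<open>auto intro!: continuous_intros\<close>)
  moreover have "integrable lborel (\<lambda>z. \<psi> z * f1 c z)" "integrable lborel (\<lambda>z. \<psi>1 c z * f z)"
    by (rule integrable_continuous_compact_support[OF _ compact_cball[of 0 R]]; use supp \<psi> f c in \<open>auto intro!: continuous_intros\<close>)+
  ultimately show ?thesis by simp
qed

section \<open>Averaged Taylor polynomials\<close>

text \<open>Weights come with their derivatives as data and one common bound. Order two matches the
  two integrations by parts that a weight has to take.\<close>

definition C2_bounded :: "(real^'n::finite) set \<Rightarrow> real \<Rightarrow> (real^'n \<Rightarrow> real) \<Rightarrow> ('n \<Rightarrow> real^'n \<Rightarrow> real)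
    \<Rightarrow> ('n \<Rightarrow> 'n \<Rightarrow> real^'n \<Rightarrow> real) \<Rightarrow> bool" where
  "C2_bounded B K \<psi> \<psi>1 \<psi>2 \<longleftrightarrow>
     (\<forall>z. (\<psi> has_derivative (\<lambda>h. \<Sum>j\<in>UNIV. h$j * \<psi>1 j z)) (at z)) \<and>
     (\<forall>j z. (\<psi>1 j has_derivative (\<lambda>h. \<Sum>i\<in>UNIV. h$i * \<psi>2 i j z)) (at z)) \<and>
     (\<forall>i j. continuous_on UNIV (\<psi>2 i j)) \<and>
     (\<forall>z. \<bar>\<psi> z\<bar> \<le> K) \<and> (\<forall>j z. \<bar>\<psi>1 j z\<bar> \<le> K) \<and> (\<forall>i j z. \<bar>\<psi>2 i j z\<bar> \<le> K) \<and>
     (\<forall>z. z \<notin> B \<longrightarrow> \<psi> z = 0 \<and> (\<forall>j. \<psi>1 j z = 0) \<and> (\<forall>i j. \<psi>2 i j z = 0))"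

lemma C2_boundedD:
  assumes "C2_bounded B K \<psi> \<psi>1 \<psi>2"
  shows "(\<psi> has_derivative (\<lambda>h. \<Sum>j\<in>UNIV. h$j * \<psi>1 j z)) (at z)"
    and "(\<psi>1 j has_derivative (\<lambda>h. \<Sum>i\<in>UNIV. h$i * \<psi>2 i j z)) (at z)"
    and "continuous_on UNIV \<psi>" "continuous_on UNIV (\<psi>1 j)" "continuous_on UNIV (\<psi>2 i j)"
    and "\<bar>\<psi> z\<bar> \<le> K" "\<bar>\<psi>1 j z\<bar> \<le> K" "\<bar>\<psi>2 i j z\<bar> \<le> K" "0 \<le> K"
    and "z \<notin> B \<Longrightarrow> \<psi> z = 0" "z \<notin> B \<Longrightarrow> \<psi>1 j z = 0" "z \<notin> B \<Longrightarrow> \<psi>2 i j z = 0"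
proof -
  have d: "\<And>z. (\<psi> has_derivative (\<lambda>h. \<Sum>j\<in>UNIV. h$j * \<psi>1 j z)) (at z)"
    "\<And>j z. (\<psi>1 j has_derivative (\<lambda>h. \<Sum>i\<in>UNIV. h$i * \<psi>2 i j z)) (at z)"
    using assms by (auto simp: C2_bounded_def)
  show "continuous_on UNIV \<psi>" "continuous_on UNIV (\<psi>1 j)"
    using has_derivative_continuous[OF d(1)] has_derivative_continuous[OF d(2)] by (simp_all add: continuous_at_imp_continuous_on)
  have "\<bar>\<psi> z\<bar> \<le> K" using assms by (auto simp: C2_bounded_def)
  then show "0 \<le> K" by linarith
qed (use assms in \<open>auto simp: C2_bounded_def\<close>)

text \<open>In D + 2, the D bounds the new factor on \<open>B\<close>, where alone the weight lives,
  and the 2 counts the two mixed terms in the second derivative of the product.\<close>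

lemma C2_bounded_mult:
  assumes \<psi>: "C2_bounded B K \<psi> \<psi>1 \<psi>2" and D: "\<And>z. z \<in> B \<Longrightarrow> \<bar>(z - x)$i\<bar> \<le> D" "0 \<le> D"
  shows "\<exists>\<phi>1 \<phi>2. C2_bounded B (K * (D + 2)) (\<lambda>z. \<psi> z * (z - x)$i) \<phi>1 \<phi>2"
proof (intro exI)
  let ?\<delta> = "\<lambda>j. if j = i then 1 else 0 :: real"
  note C = C2_boundedD[OF \<psi>]
  have der: "((\<lambda>z. (z - x)$i) has_derivative (\<lambda>h. h$i)) (at z)" for z :: "real^'a"
    using bounded_linear.has_derivative[OF bounded_linear_vec_nth has_derivative_diff[OF has_derivative_ident has_derivative_const[of x]], of i]
    by simp
  have s: "(\<Sum>j\<in>UNIV. h$j * ?\<delta> j) = h$i" for h :: "real^'a" by (simp add: if_distrib cong: if_cong)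
  have b: "\<bar>f z * (z - x)$i\<bar> \<le> K * D" if "\<And>z. \<bar>f z\<bar> \<le> K" "\<And>z. z \<notin> B \<Longrightarrow> f z = 0" for f z
  proof (cases "z \<in> B")
    case True then show ?thesis unfolding abs_mult by (intro mult_mono that D C abs_ge_zero)
  next
    case False then show ?thesis using that(2) C(9) D(2) by simp
  qed
  have bd: "\<bar>y * ?\<delta> j\<bar> \<le> K" if "\<bar>y\<bar> \<le> K" for y j
    using that C(9) by auto
  show "C2_bounded B (K * (D + 2)) (\<lambda>z. \<psi> z * (z - x)$i) (\<lambda>j z. \<psi>1 j z * (z - x)$i + \<psi> z * ?\<delta> j)
     (\<lambda>k j z. \<psi>2 k j z * (z - x)$i + \<psi>1 j z * ?\<delta> k + \<psi>1 k z * ?\<delta> j)"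
    unfolding C2_bounded_def
  proof (intro conjI allI impI)
    fix z
    show "((\<lambda>z. \<psi> z * (z - x)$i) has_derivative (\<lambda>h. \<Sum>j\<in>UNIV. h$j * (\<psi>1 j z * (z - x)$i + \<psi> z * ?\<delta> j))) (at z)"
    proof (rule has_derivative_eq_rhs[OF has_derivative_mult[OF C(1) der]], rule ext)
      fix h :: "real^'a"
      have "(\<Sum>j\<in>UNIV. h$j * (\<psi>1 j z * (z - x)$i + \<psi> z * ?\<delta> j))
         = (\<Sum>j\<in>UNIV. h$j * \<psi>1 j z) * (z - x)$i + \<psi> z * (\<Sum>j\<in>UNIV. h$j * ?\<delta> j)"
        by (simp only: sum_distrib_left sum_distrib_right sum.distrib[symmetric]) (simp only: algebra_simps)
      then show "\<psi> z * h$i + (\<Sum>j\<in>UNIV. h$j * \<psi>1 j z) * (z - x)$i = (\<Sum>j\<in>UNIV. h$j * (\<psi>1 j z * (z - x)$i + \<psi> z * ?\<delta> j))"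
        unfolding s by simp
    qed
    show "((\<lambda>z. \<psi>1 j z * (z - x)$i + \<psi> z * ?\<delta> j) has_derivative (\<lambda>h. \<Sum>k\<in>UNIV. h$k * (\<psi>2 k j z * (z - x)$i + \<psi>1 j z * ?\<delta> k + \<psi>1 k z * ?\<delta> j))) (at z)" for j
    proof (rule has_derivative_eq_rhs[OF has_derivative_add[OF has_derivative_mult[OF C(2) der] has_derivative_mult_left[OF C(1)]]], rule ext)
      fix h :: "real^'a"
      have "(\<Sum>k\<in>UNIV. h$k * (\<psi>2 k j z * (z - x)$i + \<psi>1 j z * ?\<delta> k + \<psi>1 k z * ?\<delta> j))
         = (\<Sum>k\<in>UNIV. h$k * \<psi>2 k j z) * (z - x)$i + \<psi>1 j z * (\<Sum>k\<in>UNIV. h$k * ?\<delta> k) + (\<Sum>k\<in>UNIV. h$k * \<psi>1 k z) * ?\<delta> j"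
        by (simp only: sum_distrib_left sum_distrib_right sum.distrib[symmetric]) (simp only: algebra_simps)
      then show "\<psi>1 j z * h$i + (\<Sum>k\<in>UNIV. h$k * \<psi>2 k j z) * (z - x)$i + (\<Sum>k\<in>UNIV. h$k * \<psi>1 k z) * ?\<delta> j
        = (\<Sum>k\<in>UNIV. h$k * (\<psi>2 k j z * (z - x)$i + \<psi>1 j z * ?\<delta> k + \<psi>1 k z * ?\<delta> j))"
        unfolding s by simp
    qed
    show "continuous_on UNIV (\<lambda>z. \<psi>2 k j z * (z - x)$i + \<psi>1 j z * ?\<delta> k + \<psi>1 k z * ?\<delta> j)" for k j
      by (intro continuous_intros C)
    show "\<bar>\<psi> z * (z - x)$i\<bar> \<le> K * (D + 2)"
      using b[of \<psi> z, OF C(6) C(10)] C(9) by (simp add: distrib_left)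
    show "\<bar>\<psi>1 j z * (z - x)$i + \<psi> z * ?\<delta> j\<bar> \<le> K * (D + 2)" for j
    proof -
      have "\<bar>\<psi>1 j z * (z - x)$i + \<psi> z * ?\<delta> j\<bar> \<le> K * D + K"
        by (rule order_trans[OF abs_triangle_ineq add_mono[OF b[of "\<psi>1 j", OF C(7) C(11)] bd[OF C(6)]]])
      then show ?thesis using C(9) by (simp add: distrib_left)
    qed
    show "\<bar>\<psi>2 k j z * (z - x)$i + \<psi>1 j z * ?\<delta> k + \<psi>1 k z * ?\<delta> j\<bar> \<le> K * (D + 2)" for k j
    proof -
      have "\<bar>\<psi>2 k j z * (z - x)$i + \<psi>1 j z * ?\<delta> k + \<psi>1 k z * ?\<delta> j\<bar> \<le> (K * D + K) + K"
        by (rule order_trans[OF abs_triangle_ineq add_mono[OF order_trans[OF abs_triangle_ineq add_mono[OF b[of "\<psi>2 k j", OF C(8) C(12)] bd[OF C(7)]]] bd[OF C(7)]]])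
      then show ?thesis by (simp add: distrib_left)
    qed
  qed (use C in auto)
qed

lemma cv_affine_has_derivative:
  fixes \<Phi> :: "('n::finite \<Rightarrow> nat) \<Rightarrow> real^'n \<Rightarrow> real"
  assumes u: "integrable lborel u" and \<Phi>: "kernel_family s \<Phi>"
  shows "((\<lambda>z. cv u (\<Phi> m) (x + t *\<^sub>R (z - x))) has_derivative
     (\<lambda>h. \<Sum>j\<in>UNIV. h$j * (t * cv u (\<Phi> (inc j m)) (x + t *\<^sub>R (z - x))))) (at z)"
proof -
  have "((\<lambda>z. x + t *\<^sub>R (z - x)) has_derivative (\<lambda>h. t *\<^sub>R h)) (at z)" by (auto intro!: derivative_eq_intros)
  from has_derivative_compose[OF this cv_has_derivative[OF u \<Phi>]] show ?thesis
    by (rule has_derivative_eq_rhs) (simp add: fun_eq_iff mult_ac)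
qed

lemma cv_affine_continuous [continuous_intros]:
  fixes \<Phi> :: "('n::finite \<Rightarrow> nat) \<Rightarrow> real^'n \<Rightarrow> real"
  assumes u: "integrable lborel u" and \<Phi>: "kernel_family s \<Phi>" and f: "continuous_on A f"
  shows "continuous_on A (\<lambda>z. cv u (\<Phi> m) (f z))"
  by (rule continuous_on_compose2[OF cv_continuous[OF u \<Phi>, of UNIV] f]) auto

lemma abs_integral_le_kernel:
  fixes \<psi> f :: "real^'n::finite \<Rightarrow> real"
  assumes "compact B" "\<And>z. \<bar>\<psi> z\<bar> \<le> K" "\<And>z. z \<notin> B \<Longrightarrow> \<psi> z = 0" "continuous_on UNIV \<psi>" "continuous_on UNIV f"
  shows "\<bar>\<integral>z. \<psi> z * f z \<partial>lborel\<bar> \<le> K * (\<integral>z. indicator B z * \<bar>f z\<bar> \<partial>lborel)"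
proof -
  have "0 \<le> K" using assms(2)[of undefined] by linarith
  have "\<bar>\<integral>z. \<psi> z * f z \<partial>lborel\<bar> \<le> (\<integral>z. K * (indicator B z * \<bar>f z\<bar>) \<partial>lborel)"
  proof (rule order_trans[OF integral_abs_bound integral_mono_AE'])
    have "integrable lborel (\<lambda>z. indicator B z *\<^sub>R \<bar>f z\<bar>)"
      by (rule borel_integrable_compact) (use assms in \<open>auto intro!: continuous_intros intro: continuous_on_subset\<close>)
    then show "integrable lborel (\<lambda>z. K * (indicator B z * \<bar>f z\<bar>))" by auto
    show "AE z in lborel. \<bar>\<psi> z * f z\<bar> \<le> K * (indicator B z * \<bar>f z\<bar>)"
      using assms(2,3) by (auto simp: abs_mult indicator_def intro!: mult_right_mono)
  qed (use \<open>0 \<le> K\<close> in auto)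
  then show ?thesis by simp
qed

text \<open>The chain rule for z \<mapsto> x + t(z - x) gives one factor t for each derivative moved
  onto the weight. The prefactor t^2 is therefore consumed exactly and the bound does not degenerate
  as t tends to 0.\<close>

lemma kernel_second_order_bound:
  fixes \<Phi> :: "('n::finite \<Rightarrow> nat) \<Rightarrow> real^'n \<Rightarrow> real"
  assumes w: "integrable lborel w" and \<Phi>: "kernel_family s \<Phi>" and \<psi>: "C2_bounded (cball p r) K \<psi> \<psi>1 \<psi>2"
  shows "\<bar>t\<^sup>2 * (\<integral>z. \<psi> z * cv w (\<Phi> (inc c (inc d m))) (x + t *\<^sub>R (z - x)) \<partial>lborel)\<bar>
     \<le> K * (\<integral>z. indicator (cball p r) z * \<bar>cv w (\<Phi> m) (x + t *\<^sub>R (z - x))\<bar> \<partial>lborel)"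
proof -
  note C = C2_boundedD[OF \<psi>]
  have out: "z \<notin> cball p r" if "norm p + r < norm z" for z
    using that norm_triangle_ineq4[of z p] norm_triangle_ineq2[of z p] by (auto simp: dist_norm norm_minus_commute)
  have cc: "continuous_on UNIV (\<lambda>z. cv w (\<Phi> m) (x + t *\<^sub>R (z - x)))" for m
    by (intro continuous_intros cv_affine_continuous[OF w \<Phi>])
  have 1: "t * (\<integral>z. \<psi> z * cv w (\<Phi> (inc c (inc d m))) (x + t *\<^sub>R (z - x)) \<partial>lborel)
     = - (\<integral>z. \<psi>1 c z * cv w (\<Phi> (inc d m)) (x + t *\<^sub>R (z - x)) \<partial>lborel)"
  proof -
    have "(\<integral>z. \<psi> z * (t * cv w (\<Phi> (inc c (inc d m))) (x + t *\<^sub>R (z - x))) \<partial>lborel)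
       = - (\<integral>z. \<psi>1 c z * cv w (\<Phi> (inc d m)) (x + t *\<^sub>R (z - x)) \<partial>lborel)"
      by (rule integration_by_parts[OF C(1) C(4) C(10)[OF out] C(11)[OF out] cv_affine_has_derivative[OF w \<Phi>]])
         (auto intro!: continuous_intros cc)
    then show ?thesis by (simp add: mult.left_commute)
  qed
  have 2: "t * (\<integral>z. \<psi>1 c z * cv w (\<Phi> (inc d m)) (x + t *\<^sub>R (z - x)) \<partial>lborel)
     = - (\<integral>z. \<psi>2 d c z * cv w (\<Phi> m) (x + t *\<^sub>R (z - x)) \<partial>lborel)"
  proof -
    have "(\<integral>z. \<psi>1 c z * (t * cv w (\<Phi> (inc d m)) (x + t *\<^sub>R (z - x))) \<partial>lborel)
       = - (\<integral>z. \<psi>2 d c z * cv w (\<Phi> m) (x + t *\<^sub>R (z - x)) \<partial>lborel)"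
      by (rule integration_by_parts[OF C(2) C(5) C(11)[OF out] C(12)[OF out] cv_affine_has_derivative[OF w \<Phi>]])
         (auto intro!: continuous_intros cc)
    then show ?thesis by (simp add: mult.left_commute)
  qed
  have "t\<^sup>2 * (\<integral>z. \<psi> z * cv w (\<Phi> (inc c (inc d m))) (x + t *\<^sub>R (z - x)) \<partial>lborel)
     = t * (t * (\<integral>z. \<psi> z * cv w (\<Phi> (inc c (inc d m))) (x + t *\<^sub>R (z - x)) \<partial>lborel))"
    by (simp add: power2_eq_square)
  also have "\<dots> = (\<integral>z. \<psi>2 d c z * cv w (\<Phi> m) (x + t *\<^sub>R (z - x)) \<partial>lborel)"
    unfolding 1 using 2 by simp
  finally show ?thesis
    using abs_integral_le_kernel[OF compact_cball C(8) C(12) C(5) cc, of p r d c m] by simp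
qed

lemma kernel_first_order_bound:
  fixes \<Phi> :: "('n::finite \<Rightarrow> nat) \<Rightarrow> real^'n \<Rightarrow> real"
  assumes w: "integrable lborel w" and \<Phi>: "kernel_family s \<Phi>" and \<psi>: "C2_bounded (cball p r) K \<psi> \<psi>1 \<psi>2"
  shows "\<bar>\<integral>z. \<psi> z * cv w (\<Phi> (inc c m)) z \<partial>lborel\<bar>
     \<le> K * (\<integral>z. indicator (cball p r) z * \<bar>cv w (\<Phi> m) z\<bar> \<partial>lborel)"
proof -
  note C = C2_boundedD[OF \<psi>]
  have out: "z \<notin> cball p r" if "norm p + r < norm z" for z
    using that norm_triangle_ineq4[of z p] norm_triangle_ineq2[of z p] by (auto simp: dist_norm norm_minus_commute)
  have "(\<integral>z. \<psi> z * cv w (\<Phi> (inc c m)) z \<partial>lborel) = - (\<integral>z. \<psi>1 c z * cv w (\<Phi> m) z \<partial>lborel)"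
    by (rule integration_by_parts[OF C(1) C(4) C(10)[OF out] C(11)[OF out] cv_has_derivative[OF w \<Phi>] cv_continuous[OF w \<Phi>]])
  then show ?thesis
    using abs_integral_le_kernel[OF compact_cball C(7) C(11) C(4) cv_continuous[OF w \<Phi>], of p r c m] by simp
qed

text \<open>Expansion about x + e, evaluated at x: along the segment, v - t v' + t^2 v''/2 has
  derivative t^2 v'''/2, since the lower order terms telescope. The weight t^2 is small near x,
  where the averaging over the base point concentrates.\<close>

lemma cv_Taylor:
  fixes \<Phi> :: "('n::finite \<Rightarrow> nat) \<Rightarrow> real^'n \<Rightarrow> real" and x e :: "real^'n"
  assumes u: "integrable lborel u" and \<Phi>: "kernel_family s \<Phi>"
  defines "V \<equiv> \<lambda>m z. cv u (\<Phi> m) z"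
  shows "V m x = (V m (x + e) - (\<Sum>i\<in>UNIV. e$i * V (inc i m) (x + e))
       + (1/2) * (\<Sum>i\<in>UNIV. e$i * (\<Sum>j\<in>UNIV. e$j * V (inc j (inc i m)) (x + e))))
     - (\<integral>t. (t\<^sup>2 / 2 * (\<Sum>i\<in>UNIV. e$i * (\<Sum>j\<in>UNIV. e$j * (\<Sum>k\<in>UNIV. e$k * V (inc k (inc j (inc i m))) (x + t *\<^sub>R e)))))
         * indicator {0..1} t \<partial>lborel)"
proof -
  have d: "((\<lambda>t. V m (x + t *\<^sub>R e)) has_real_derivative (\<Sum>i\<in>UNIV. e$i * V (inc i m) (x + t *\<^sub>R e))) (at t)" for m t
  proof -
    have "((\<lambda>t. x + t *\<^sub>R e) has_derivative (\<lambda>t. t *\<^sub>R e)) (at t)" by (auto intro!: derivative_eq_intros)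
    from has_derivative_compose[OF this cv_has_derivative[OF u \<Phi>, of m]]
    have "((\<lambda>t. V m (x + t *\<^sub>R e)) has_derivative (\<lambda>h. \<Sum>i\<in>UNIV. (h *\<^sub>R e)$i * V (inc i m) (x + t *\<^sub>R e))) (at t)"
      unfolding V_def .
    moreover have "(\<lambda>h. \<Sum>i\<in>UNIV. (h *\<^sub>R e)$i * V (inc i m) (x + t *\<^sub>R e)) = (*) (\<Sum>i\<in>UNIV. e$i * V (inc i m) (x + t *\<^sub>R e))"
      by (simp add: fun_eq_iff sum_distrib_left mult_ac)
    ultimately show ?thesis by (simp add: has_field_derivative_def)
  qed
  define g1 where "g1 t = (\<Sum>i\<in>UNIV. e$i * V (inc i m) (x + t *\<^sub>R e))" for t
  define g2 where "g2 t = (\<Sum>i\<in>UNIV. e$i * (\<Sum>j\<in>UNIV. e$j * V (inc j (inc i m)) (x + t *\<^sub>R e)))" for t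
  define g3 where "g3 t = (\<Sum>i\<in>UNIV. e$i * (\<Sum>j\<in>UNIV. e$j * (\<Sum>k\<in>UNIV. e$k * V (inc k (inc j (inc i m))) (x + t *\<^sub>R e))))" for t
  have d1: "(g1 has_real_derivative g2 t) (at t)" for t
    unfolding g1_def g2_def by (intro DERIV_sum DERIV_cmult d)
  have d2: "(g2 has_real_derivative g3 t) (at t)" for t
    unfolding g2_def g3_def by (intro DERIV_sum DERIV_cmult d)
  have c3: "isCont g3 t" for t
  proof -
    have "continuous_on UNIV g3" unfolding g3_def V_def
      by (intro continuous_intros cv_affine_continuous[OF u \<Phi>])
    then show ?thesis by (simp add: continuous_on_eq_continuous_at)
  qed
  define h where "h t = V m (x + t *\<^sub>R e) - t * g1 t + t\<^sup>2 / 2 * g2 t" for t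
  have dh: "(h has_real_derivative t\<^sup>2 / 2 * g3 t) (at t)" for t
  proof -
    have q: "((\<lambda>t. t\<^sup>2 / 2) has_real_derivative t) (at t)" by (auto intro!: derivative_eq_intros)
    show ?thesis unfolding h_def[abs_def]
      by (rule DERIV_cong[OF DERIV_add[OF DERIV_diff[OF d DERIV_mult[OF DERIV_ident d1]] DERIV_mult[OF q d2]]])
         (simp add: g1_def algebra_simps)
  qed
  have int: "(\<integral>t. (t\<^sup>2 / 2 * g3 t) * indicator {0..1} t \<partial>lborel) = h 1 - h 0"
    by (rule integral_FTC_Icc_real[OF _ dh]) (auto intro!: continuous_intros c3)
  have "h 0 = V m x" by (simp add: h_def)
  then have "V m x = h 1 - (\<integral>t. (t\<^sup>2 / 2 * g3 t) * indicator {0..1} t \<partial>lborel)" using int by linarith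
  then show ?thesis unfolding h_def g1_def g2_def g3_def by (simp add: mult.commute)
qed

lemma integrable_pair_compact:
  fixes f :: "'a::euclidean_space \<times> 'b::euclidean_space \<Rightarrow> real"
  assumes "continuous_on UNIV f" "compact S"
  shows "integrable (lborel \<Otimes>\<^sub>M lborel) (\<lambda>p. indicator S p * f p)"
  using borel_integrable_compact[OF assms(2) continuous_on_subset[OF assms(1)]] by (simp add: lborel_prod)

text \<open>The skew half of the gradient and all trace terms form the first bracket, the expression
  that \<open>Taylor_poly_in_Sigma\<close> rewrites; the symmetric half and the remaining second
  derivatives are expressed by \<Gamma> through \<open>dev_sym_rel\<close> and
  \<open>dev_sym_rel_second\<close>.\<close>

lemma Taylor_poly_decomposition:
  fixes e :: "real^'n::finite"
  assumes r: "dev_sym_rel U \<Gamma>"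
  shows "U l m + (\<Sum>i\<in>UNIV. e$i * U l (inc i m)) + (1/2) * (\<Sum>i\<in>UNIV. e$i * (\<Sum>j\<in>UNIV. e$j * U l (inc j (inc i m))))
   = (U l m + (\<Sum>i\<in>UNIV. (1/2) * (U l (inc i m) - U i (inc l m)) * e$i) + trace_part U m * e$l
       + (\<Sum>i\<in>UNIV. trace_part U (inc i m) * e$i) * e$l - (1/2) * (e \<bullet> e) * trace_part U (inc l m))
     + (\<Sum>i\<in>UNIV. e$i * \<Gamma> l i m)
     + (1/2) * (\<Sum>i\<in>UNIV. \<Sum>j\<in>UNIV. e$i * e$j * (\<Gamma> i l (inc j m) + \<Gamma> j l (inc i m) - \<Gamma> j i (inc l m)))"
proof -
  let ?a = "\<lambda>i. trace_part U (inc i m)"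
  have 1: "(\<Sum>i\<in>UNIV. e$i * U l (inc i m)) = (\<Sum>i\<in>UNIV. (1/2) * (U l (inc i m) - U i (inc l m)) * e$i) + trace_part U m * e$l + (\<Sum>i\<in>UNIV. e$i * \<Gamma> l i m)"
  proof -
    have "e$i * U l (inc i m) = (1/2) * (U l (inc i m) - U i (inc l m)) * e$i + e$i * \<Gamma> l i m + (if i = l then trace_part U m * e$i else 0)" for i
    proof -
      have "(1/2) * (U l (inc i m) + U i (inc l m)) = \<Gamma> l i m + (if l = i then trace_part U m else 0)"
        using r by (simp add: dev_sym_rel_def)
      then have "U l (inc i m) = (1/2) * (U l (inc i m) - U i (inc l m)) + \<Gamma> l i m + (if l = i then trace_part U m else 0)"
        by (simp add: field_simps)
      then have "e$i * U l (inc i m) = e$i * ((1/2) * (U l (inc i m) - U i (inc l m)) + \<Gamma> l i m + (if l = i then trace_part U m else 0))"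
        by (rule arg_cong)
      then show ?thesis by (simp only: distrib_left) (auto simp: algebra_simps)
    qed
    then have "(\<Sum>i\<in>UNIV. e$i * U l (inc i m)) = (\<Sum>i\<in>UNIV. (1/2) * (U l (inc i m) - U i (inc l m)) * e$i + e$i * \<Gamma> l i m + (if i = l then trace_part U m * e$i else 0))"
      by (intro sum.cong refl)
    then show ?thesis unfolding sum.distrib by simp
  qed
  have 2: "(\<Sum>i\<in>UNIV. e$i * (\<Sum>j\<in>UNIV. e$j * U l (inc j (inc i m))))
    = (\<Sum>i\<in>UNIV. \<Sum>j\<in>UNIV. e$i * e$j * (\<Gamma> i l (inc j m) + \<Gamma> j l (inc i m) - \<Gamma> j i (inc l m)))
      + 2 * (\<Sum>i\<in>UNIV. ?a i * e$i) * e$l - (e \<bullet> e) * ?a l"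
  proof -
    have "e$i * (e$j * U l (inc j (inc i m))) = e$i * e$j * (\<Gamma> i l (inc j m) + \<Gamma> j l (inc i m) - \<Gamma> j i (inc l m))
       + (if i = l then e$i * e$j * ?a j else 0) + (if j = l then e$i * e$j * ?a i else 0) - (if j = i then e$i * e$j * ?a l else 0)" for i j
      unfolding dev_sym_rel_second[OF r, of l j i m] by (simp add: algebra_simps)
    then have "(\<Sum>i\<in>UNIV. e$i * (\<Sum>j\<in>UNIV. e$j * U l (inc j (inc i m)))) = (\<Sum>i\<in>UNIV. \<Sum>j\<in>UNIV.
        e$i * e$j * (\<Gamma> i l (inc j m) + \<Gamma> j l (inc i m) - \<Gamma> j i (inc l m))
       + (if i = l then e$i * e$j * ?a j else 0) + (if j = l then e$i * e$j * ?a i else 0) - (if j = i then e$i * e$j * ?a l else 0))"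
      unfolding sum_distrib_left by (intro sum.cong refl)
    also have "\<dots> = (\<Sum>i\<in>UNIV. \<Sum>j\<in>UNIV. e$i * e$j * (\<Gamma> i l (inc j m) + \<Gamma> j l (inc i m) - \<Gamma> j i (inc l m)))
      + (\<Sum>i\<in>UNIV. \<Sum>j\<in>UNIV. (if i = l then e$i * e$j * ?a j else 0)) + (\<Sum>i\<in>UNIV. \<Sum>j\<in>UNIV. (if j = l then e$i * e$j * ?a i else 0))
      - (\<Sum>i\<in>UNIV. \<Sum>j\<in>UNIV. (if j = i then e$i * e$j * ?a l else 0))"
      by (simp only: sum.distrib sum_subtractf)
    also have "(\<Sum>i\<in>UNIV. \<Sum>j\<in>UNIV. (if i = l then e$i * e$j * ?a j else 0)) = (\<Sum>i\<in>UNIV. ?a i * e$i) * e$l"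
      by (subst sum.swap) (simp add: sum_distrib_left sum_distrib_right mult_ac)
    also have "(\<Sum>i\<in>UNIV. \<Sum>j\<in>UNIV. (if j = l then e$i * e$j * ?a i else 0)) = (\<Sum>i\<in>UNIV. ?a i * e$i) * e$l"
      by (simp add: sum_distrib_left sum_distrib_right mult_ac)
    also have "(\<Sum>i\<in>UNIV. \<Sum>j\<in>UNIV. (if j = i then e$i * e$j * ?a l else 0)) = (e \<bullet> e) * ?a l"
      by (simp add: inner_vec_def sum_distrib_right)
    finally show ?thesis by simp
  qed
  show ?thesis unfolding 1 2 by (simp add: algebra_simps)
qed

text \<open>Re-expansion at the origin instead of at z. The special conformal part gets the vector
  a/2 because \<Sigma> is written with 2(a.x)x - |x|^2 a; moving the centre adds a skew matrix, a
  multiple of x and a constant, so \<Sigma> is not left.\<close>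

lemma Taylor_poly_in_Sigma:
  fixes x z a :: "real^'n::finite"
  assumes e: "e = x - z"
  shows "v + (\<Sum>i\<in>UNIV. W i * e$i) + \<sigma> * e$l + (\<Sum>i\<in>UNIV. a$i * e$i) * e$l - (1/2) * (e \<bullet> e) * a$l
    = (\<sigma> - a \<bullet> z) * x$l + (v - (\<Sum>i\<in>UNIV. W i * z$i) - \<sigma> * z$l + (a \<bullet> z) * z$l - (1/2) * (z \<bullet> z) * a$l)
      + (\<Sum>i\<in>UNIV. (W i + (z$i * a$l - a$i * z$l)) * x$i) + (\<Sum>i\<in>UNIV. (a$i/2) * (2 * x$i * x$l)) - (x \<bullet> x) * (a$l / 2)"
proof -
  have 1: "(\<Sum>i\<in>UNIV. W i * e$i) = (\<Sum>i\<in>UNIV. W i * x$i) - (\<Sum>i\<in>UNIV. W i * z$i)"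
    by (simp add: e algebra_simps sum_subtractf)
  have 2: "(\<Sum>i\<in>UNIV. a$i * e$i) = a \<bullet> x - a \<bullet> z"
    by (simp add: e inner_vec_def algebra_simps sum_subtractf)
  have 3: "e \<bullet> e = x \<bullet> x - 2 * (z \<bullet> x) + z \<bullet> z"
    by (simp add: e inner_diff_left inner_diff_right inner_commute)
  have 4: "(\<Sum>i\<in>UNIV. (W i + (z$i * a$l - a$i * z$l)) * x$i) = (\<Sum>i\<in>UNIV. W i * x$i) + (z \<bullet> x) * a$l - (a \<bullet> x) * z$l"
    by (simp add: inner_vec_def algebra_simps sum.distrib sum_subtractf sum_distrib_left)
  have 5: "(\<Sum>i\<in>UNIV. (a$i/2) * (2 * x$i * x$l)) = (a \<bullet> x) * x$l"
    by (simp add: inner_vec_def sum_distrib_left sum_distrib_right mult_ac)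
  show ?thesis unfolding 1 2 3 4 5 by (simp add: e field_simps)
qed

text \<open>The zero multi-index, which selects the kernel itself; it has nothing to do with the
  centres of expansion \<open>z\<close>.\<close>

abbreviation z0 :: "'n \<Rightarrow> nat" where "z0 \<equiv> (\<lambda>_. 0)"

lemma averaging_kernel_exists:
  fixes p :: "real^'n::finite"
  assumes r: "r > 0"
  obtains K \<theta> \<theta>1 \<theta>2 where "C2_bounded (cball p r) K \<theta> \<theta>1 \<theta>2" "(\<integral>z. \<theta> z \<partial>lborel) = 1"
proof -
  obtain \<Phi> :: "('n \<Rightarrow> nat) \<Rightarrow> real^'n \<Rightarrow> real" where
    \<Phi>: "kernel_family 1 \<Phi>" "\<And>x. \<Phi> z0 x \<ge> 0" "(\<integral>x. \<Phi> z0 x \<partial>lborel) = 1" using mollifier_exists by blast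
  define \<Theta> where "\<Theta> = (\<lambda>m x. (1 / r ^ CARD('n)) / r ^ (\<Sum>i\<in>UNIV. m i) * \<Phi> m (x /\<^sub>R r))"
  have k: "kernel_family r \<Theta>"
    using kernel_family_scale[OF \<Phi>(1) r, of "1 / r ^ CARD('n)"] by (simp add: \<Theta>_def)
  have der: "((\<lambda>z. \<Theta> m (z - p)) has_derivative (\<lambda>h. \<Sum>j\<in>UNIV. h$j * \<Theta> (inc j m) (z - p))) (at z)" for m z
    by (rule has_derivative_compose[of "\<lambda>z. z - p" "\<lambda>h. h"])
       (use k in \<open>auto simp: kernel_family_def intro!: derivative_eq_intros\<close>)
  have "\<exists>K>0. \<forall>x. \<bar>\<Theta> m x\<bar> \<le> K" for m using kernel_family_bounded[OF k] by metis
  then obtain b where b: "\<And>m. b m > 0" "\<And>m x. \<bar>\<Theta> m x\<bar> \<le> b m" by metis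
  define K where "K = b z0 + (\<Sum>j\<in>UNIV. b (inc j z0)) + (\<Sum>i\<in>UNIV. \<Sum>j\<in>UNIV. b (inc i (inc j z0)))"
  note b0 = less_imp_le[OF b(1)]
  have s1: "b (inc j z0) \<le> (\<Sum>j\<in>UNIV. b (inc j z0))" for j
    by (rule member_le_sum) (auto simp: b0)
  have s2: "b (inc i (inc j z0)) \<le> (\<Sum>i\<in>UNIV. \<Sum>j\<in>UNIV. b (inc i (inc j z0)))" for i j
  proof -
    have "b (inc i (inc j z0)) \<le> (\<Sum>j\<in>UNIV. b (inc i (inc j z0)))" by (rule member_le_sum) (auto simp: b0)
    also have "\<dots> \<le> (\<Sum>i\<in>UNIV. \<Sum>j\<in>UNIV. b (inc i (inc j z0)))"
      by (rule member_le_sum[of i UNIV "\<lambda>i. \<Sum>j\<in>UNIV. b (inc i (inc j z0))"]) (auto simp: b0 sum_nonneg)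
    finally show ?thesis .
  qed
  have n1: "0 \<le> (\<Sum>j\<in>UNIV. b (inc j z0))" "0 \<le> (\<Sum>i\<in>UNIV. \<Sum>j\<in>UNIV. b (inc i (inc j z0)))"
    by (auto simp: b0 sum_nonneg)
  have "C2_bounded (cball p r) K (\<lambda>z. \<Theta> z0 (z - p)) (\<lambda>j z. \<Theta> (inc j z0) (z - p)) (\<lambda>i j z. \<Theta> (inc i (inc j z0)) (z - p))"
    unfolding C2_bounded_def
  proof (intro conjI allI impI der)
    fix i j z
    show "continuous_on UNIV (\<lambda>z. \<Theta> (inc i (inc j z0)) (z - p))"
      by (rule continuous_on_compose2[OF kernel_family_continuous[OF k, of UNIV]]) (auto intro!: continuous_intros)
    show "\<bar>\<Theta> z0 (z - p)\<bar> \<le> K" using b(2)[of z0 "z - p"] n1 unfolding K_def by linarith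
    show "\<bar>\<Theta> (inc j z0) (z - p)\<bar> \<le> K" using b(2)[of "inc j z0" "z - p"] s1[of j] b0[of z0] n1 unfolding K_def by linarith
    show "\<bar>\<Theta> (inc i (inc j z0)) (z - p)\<bar> \<le> K" using b(2)[of "inc i (inc j z0)" "z - p"] s2[of i j] b0[of z0] n1 unfolding K_def by linarith
  next
    fix z i j assume "z \<notin> cball p r"
    then have "r \<le> norm (z - p)" by (simp add: dist_norm norm_minus_commute)
    then show "\<Theta> z0 (z - p) = 0" "\<Theta> (inc j z0) (z - p) = 0" "\<Theta> (inc i (inc j z0)) (z - p) = 0"
      using k by (auto simp: kernel_family_def)
  qed
  moreover have "(\<integral>z. \<Theta> z0 (z - p) \<partial>lborel) = 1"
  proof -
    have "continuous_on UNIV (\<lambda>z. \<Theta> z0 (z - p))"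
      by (rule continuous_on_compose2[OF kernel_family_continuous[OF k, of UNIV]]) (auto intro!: continuous_intros)
    then have "(\<integral>z. \<Theta> z0 (z - p) \<partial>lborel) = (\<bar>r\<bar> ^ DIM(real^'n)) *\<^sub>R (\<integral>x. \<Theta> z0 ((p + r *\<^sub>R x) - p) \<partial>lborel)"
      using r by (intro integral_lborel_affine[of "\<lambda>z. \<Theta> z0 (z - p)" r p]) (auto intro: borel_measurable_continuous_onI)
    also have "\<dots> = 1" using r \<Phi>(3) by (simp add: \<Theta>_def)
    finally show ?thesis .
  qed
  ultimately show ?thesis using that by blast
qed

lemma integrable_indicator_continuous:
  fixes f :: "'a::euclidean_space \<Rightarrow> real"
  assumes "compact S" "continuous_on UNIV f"
  shows "integrable lborel (\<lambda>z. indicator S z * f z)"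
  using borel_integrable_compact[OF assms(1) continuous_on_subset[OF assms(2)]] by simp

lemma trace_part_cv_continuous:
  fixes \<Phi> :: "('n::finite \<Rightarrow> nat) \<Rightarrow> real^'n \<Rightarrow> real"
  assumes "\<And>l. integrable lborel (\<lambda>y. u y $ l)" and "kernel_family s \<Phi>"
  shows "continuous_on A (\<lambda>z. trace_part (\<lambda>l m. cv (\<lambda>y. u y $ l) (\<Phi> m) z) m)"
  unfolding trace_part_def by (intro continuous_intros cv_continuous[OF assms])

text \<open>The coefficients of the polynomial in x are continuous in z and enter linearly, so
  averaging acts on them one by one; skewness of the matrix is a pointwise relation that
  survives.\<close>

lemma averaged_Taylor_in_Sigma:
  fixes \<Phi> :: "('n::finite \<Rightarrow> nat) \<Rightarrow> real^'n \<Rightarrow> real"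
  assumes u: "\<And>l. integrable lborel (\<lambda>y. u y $ l)" and \<Phi>: "kernel_family s \<Phi>"
    and \<theta>: "C2_bounded (cball p r) K \<theta> \<theta>1 \<theta>2"
  defines "U \<equiv> \<lambda>z l m. cv (\<lambda>y. u y $ l) (\<Phi> m) z"
  shows "\<exists>w\<in>Sigma_fields. \<forall>x l. w x $ l = (\<integral>z. \<theta> z * (U z l z0 + (\<Sum>i\<in>UNIV. (1/2) * (U z l (inc i z0) - U z i (inc l z0)) * (x - z)$i)
       + trace_part (U z) z0 * (x - z)$l
       + (\<Sum>i\<in>UNIV. trace_part (U z) (inc i z0) * (x - z)$i) * (x - z)$l - (1/2) * ((x - z) \<bullet> (x - z)) * trace_part (U z) (inc l z0)) \<partial>lborel)"
proof -
  define L where "L f = (\<integral>z. \<theta> z * f z \<partial>lborel)" for f :: "real^'n \<Rightarrow> real"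
  define a where "a z = (\<chi> i. trace_part (U z) (inc i z0))" for z
  define W where "W z l i = (1/2) * (U z l (inc i z0) - U z i (inc l z0))" for z l i
  define \<sigma> where "\<sigma> z = trace_part (U z) z0" for z
  have cU: "continuous_on UNIV (\<lambda>z. U z l m)" for l m unfolding U_def by (rule cv_continuous[OF u \<Phi>])
  have ca: "continuous_on UNIV (\<lambda>z. a z $ i)" for i
    using trace_part_cv_continuous[OF u \<Phi>] by (simp add: a_def U_def)
  have c\<sigma>: "continuous_on UNIV \<sigma>"
    using trace_part_cv_continuous[OF u \<Phi>] by (simp add: \<sigma>_def[abs_def] U_def)
  have cW: "continuous_on UNIV (\<lambda>z. W z l i)" for l i unfolding W_def by (intro continuous_intros cU)
  have int: "integrable lborel (\<lambda>z. \<theta> z * f z)" if "continuous_on UNIV f" for f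
    by (rule integrable_continuous_compact_support[OF _ compact_cball[of p r]])
       (use C2_boundedD[OF \<theta>] that in \<open>auto intro!: continuous_intros\<close>)
  have Ladd: "L (\<lambda>z. f z + g z) = L f + L g" if "continuous_on UNIV f" "continuous_on UNIV g" for f g
    unfolding L_def using int[OF that(1)] int[OF that(2)] by (simp add: distrib_left)
  have Lsub: "L (\<lambda>z. f z - g z) = L f - L g" if "continuous_on UNIV f" "continuous_on UNIV g" for f g
    unfolding L_def using int[OF that(1)] int[OF that(2)] by (simp add: right_diff_distrib)
  have Lmul: "L (\<lambda>z. f z * c) = L f * c" for f c
    unfolding L_def by (simp add: mult.assoc[symmetric])
  have Lsum: "L (\<lambda>z. \<Sum>i\<in>UNIV. f i z) = (\<Sum>i\<in>UNIV. L (f i))" if "\<And>i. continuous_on UNIV (f i)" for f :: "'n \<Rightarrow> _"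
    unfolding L_def using int[OF that] by (simp add: sum_distrib_left)
  have cin: "continuous_on UNIV (\<lambda>z. a z \<bullet> z)" unfolding inner_vec_def by (auto intro!: continuous_intros ca)
  define b where "b z l = U z l z0 - (\<Sum>i\<in>UNIV. W z l i * z$i) - \<sigma> z * z$l + (a z \<bullet> z) * z$l - (1/2) * (z \<bullet> z) * a z$l" for z l
  define q where "q z l i = W z l i + (z$i * a z$l - a z$i * z$l)" for z l i
  have cb: "continuous_on UNIV (\<lambda>z. b z l)" for l
    unfolding b_def by (intro continuous_intros cU cW c\<sigma> ca cin)
  have cq: "continuous_on UNIV (\<lambda>z. q z l i)" for l i
    unfolding q_def by (intro continuous_intros cW ca)
  define Q where "Q = (\<chi> l i. L (\<lambda>z. q z l i))"
  define w where "w x = (L (\<lambda>z. \<sigma> z - a z \<bullet> z)) *\<^sub>R x + ((\<chi> l. L (\<lambda>z. b z l)) + Q *v x)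
     + (2 * ((\<chi> i. L (\<lambda>z. a z$i / 2)) \<bullet> x)) *\<^sub>R x - (norm x)\<^sup>2 *\<^sub>R (\<chi> i. L (\<lambda>z. a z$i / 2))" for x
  have "transpose Q = - Q"
  proof -
    have *: "(\<lambda>z. q z i l) = (\<lambda>z. q z l i * - 1)" for l i by (simp add: q_def W_def field_simps)
    have LQ: "L (\<lambda>z. q z i l) = L (\<lambda>z. q z l i) * - 1" for l i
      using arg_cong[OF *, of L i l] Lmul[of "\<lambda>z. q z l i" "-1"] by (rule trans)
    have "transpose Q $ l $ i = (- Q) $ l $ i" for l i
      using LQ[of i l] by (simp only: Q_def transpose_def vec_lambda_beta vector_uminus_component mult_minus1_right)
    then show ?thesis unfolding vec_eq_iff by blast
  qed
  then have "w \<in> Sigma_fields" unfolding Sigma_fields_def w_def[abs_def] by blast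
  moreover have "w x $ l = L (\<lambda>z. U z l z0 + (\<Sum>i\<in>UNIV. W z l i * (x - z)$i)
       + \<sigma> z * (x - z)$l + (\<Sum>i\<in>UNIV. a z$i * (x - z)$i) * (x - z)$l - (1/2) * ((x - z) \<bullet> (x - z)) * a z$l)" for x l
  proof -
    have "L (\<lambda>z. U z l z0 + (\<Sum>i\<in>UNIV. W z l i * (x - z)$i)
       + \<sigma> z * (x - z)$l + (\<Sum>i\<in>UNIV. a z$i * (x - z)$i) * (x - z)$l - (1/2) * ((x - z) \<bullet> (x - z)) * a z$l)
      = L (\<lambda>z. (\<sigma> z - a z \<bullet> z) * x$l + b z l + (\<Sum>i\<in>UNIV. q z l i * x$i) + (\<Sum>i\<in>UNIV. (a z$i/2) * (2 * x$i * x$l)) - (a z$l/2) * (x \<bullet> x))"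
    proof (rule arg_cong[of _ _ L], rule ext)
      fix z
      show "U z l z0 + (\<Sum>i\<in>UNIV. W z l i * (x - z)$i)
         + \<sigma> z * (x - z)$l + (\<Sum>i\<in>UNIV. a z$i * (x - z)$i) * (x - z)$l - (1/2) * ((x - z) \<bullet> (x - z)) * a z$l
        = (\<sigma> z - a z \<bullet> z) * x$l + b z l + (\<Sum>i\<in>UNIV. q z l i * x$i) + (\<Sum>i\<in>UNIV. (a z$i/2) * (2 * x$i * x$l)) - (a z$l/2) * (x \<bullet> x)"
        using Taylor_poly_in_Sigma[OF refl, of "U z l z0" "W z l" x z "\<sigma> z" l "a z"]
        unfolding b_def q_def by (simp only: mult.commute[of "x \<bullet> x" "a z$l/2"])
    qed
    also have "\<dots> = L (\<lambda>z. \<sigma> z - a z \<bullet> z) * x$l + L (\<lambda>z. b z l) + (\<Sum>i\<in>UNIV. L (\<lambda>z. q z l i) * x$i)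
       + (\<Sum>i\<in>UNIV. L (\<lambda>z. a z$i/2) * (2 * x$i * x$l)) - L (\<lambda>z. a z$l/2) * (x \<bullet> x)"
    proof -
      define A1 where "A1 z = (\<sigma> z - a z \<bullet> z) * x$l" for z
      define A3 where "A3 z = (\<Sum>i\<in>UNIV. q z l i * x$i)" for z
      define A4 where "A4 z = (\<Sum>i\<in>UNIV. (a z$i/2) * (2 * x$i * x$l))" for z
      define A5 where "A5 z = (a z$l/2) * (x \<bullet> x)" for z
      have c: "continuous_on UNIV A1" "continuous_on UNIV A3" "continuous_on UNIV A4" "continuous_on UNIV A5"
        unfolding A1_def[abs_def] A3_def[abs_def] A4_def[abs_def] A5_def[abs_def]
        by (auto intro!: continuous_intros cq ca cin c\<sigma>)
      have "L (\<lambda>z. A1 z + b z l + A3 z + A4 z - A5 z) = L A1 + L (\<lambda>z. b z l) + L A3 + L A4 - L A5"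
        using Lsub[OF continuous_on_add[OF continuous_on_add[OF continuous_on_add[OF c(1) cb] c(2)] c(3)] c(4)]
          Ladd[OF continuous_on_add[OF continuous_on_add[OF c(1) cb] c(2)] c(3)] Ladd[OF continuous_on_add[OF c(1) cb] c(2)] Ladd[OF c(1) cb]
        by simp
      moreover have "L A1 = L (\<lambda>z. \<sigma> z - a z \<bullet> z) * x$l" unfolding A1_def[abs_def] by (rule Lmul)
      moreover have "L A3 = (\<Sum>i\<in>UNIV. L (\<lambda>z. q z l i) * x$i)"
        unfolding A3_def[abs_def] Lmul[symmetric] by (rule Lsum) (intro continuous_intros cq)
      moreover have "L A4 = (\<Sum>i\<in>UNIV. L (\<lambda>z. a z$i/2) * (2 * x$i * x$l))"
        unfolding A4_def[abs_def] Lmul[symmetric] by (rule Lsum) (intro continuous_intros ca; simp)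
      moreover have "L A5 = L (\<lambda>z. a z$l/2) * (x \<bullet> x)" unfolding A5_def[abs_def] by (rule Lmul)
      ultimately show ?thesis by (simp only: A1_def A3_def A4_def A5_def)
    qed
    also have "\<dots> = w x $ l"
    proof -
      have "(\<Sum>i\<in>UNIV. L (\<lambda>z. a z$i/2) * (2 * x$i * x$l)) = 2 * (\<Sum>i\<in>UNIV. L (\<lambda>z. a z$i/2) * x$i) * x$l"
        by (simp add: sum_distrib_left sum_distrib_right mult_ac)
      moreover have "x \<bullet> x = (norm x)\<^sup>2" by (rule dot_square_norm)
      moreover have "(\<chi> i. L (\<lambda>z. a z$i / 2)) \<bullet> x = (\<Sum>i\<in>UNIV. L (\<lambda>z. a z$i/2) * x$i)"
        by (simp add: inner_vec_def)
      ultimately show ?thesis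
        by (simp only: w_def Q_def matrix_vector_mult_def vector_add_component vector_minus_component vector_scaleR_component vec_lambda_beta)
           (simp only: real_scaleR_def mult.commute[of "(norm x)\<^sup>2"] add.assoc)
    qed
    finally show ?thesis by simp
  qed
  ultimately show ?thesis unfolding L_def a_def W_def \<sigma>_def by (intro bexI[of _ w]) auto
qed

text \<open>After exchanging the integrals, the z-integral for fixed t is of the form treated in
  \<open>kernel_second_order_bound\<close>: third derivatives of u are second derivatives of G, with
  the factor t^2 at hand.\<close>

lemma Taylor_remainder_bound:
  fixes \<Phi> :: "('n::finite \<Rightarrow> nat) \<Rightarrow> real^'n \<Rightarrow> real" and x :: "real^'n"
  assumes w: "weak_ED_Borel \<Omega> u G" and \<Phi>: "kernel_family s \<Phi>"
    and \<theta>: "C2_bounded (cball p r) K \<theta> \<theta>1 \<theta>2"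
    and D: "\<And>z i. z \<in> cball p r \<Longrightarrow> \<bar>(z - x)$i\<bar> \<le> D" "0 \<le> D"
    and x: "\<And>z t. z \<in> cball p r \<Longrightarrow> t \<in> {0..1} \<Longrightarrow> cball (x + t *\<^sub>R (z - x)) s \<subseteq> \<Omega>"
    and \<kappa>: "\<And>i j k U \<Gamma> m. dev_sym_rel U \<Gamma> \<Longrightarrow> U l (inc k (inc j (inc i m))) = (\<Sum>(a,b,c,d)\<in>UNIV. \<kappa> i j k (a,b,c,d) * \<Gamma> a b (inc c (inc d m)))"
  defines "V \<equiv> \<lambda>m z. cv (\<lambda>y. u y $ l) (\<Phi> m) z"
  defines "g \<equiv> \<lambda>y. \<Sum>a\<in>UNIV. \<Sum>b\<in>UNIV. \<bar>cv (\<lambda>y. G y $ a $ b) (\<Phi> z0) y\<bar>"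
  defines "C \<equiv> (\<Sum>i\<in>UNIV. \<Sum>j\<in>UNIV. \<Sum>k\<in>UNIV. \<Sum>q\<in>UNIV. \<bar>\<kappa> i j k q\<bar>) * (K * (D + 2) * (D + 2) * (D + 2))"
  shows "\<bar>\<integral>z. \<theta> z * (\<integral>t. (t\<^sup>2 / 2 * (\<Sum>i\<in>UNIV. (z - x)$i * (\<Sum>j\<in>UNIV. (z - x)$j * (\<Sum>k\<in>UNIV. (z - x)$k * V (inc k (inc j (inc i z0))) (x + t *\<^sub>R (z - x))))))
         * indicator {0..1} t \<partial>lborel) \<partial>lborel\<bar>
     \<le> C * (\<integral>t. indicator {0..1} t * (\<integral>z. indicator (cball p r) z * g (x + t *\<^sub>R (z - x)) \<partial>lborel) \<partial>lborel)"
proof -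
  have u: "integrable lborel (\<lambda>y. u y $ l)" for l
    using w integrable_bounded_linear[OF bounded_linear_vec_nth] unfolding weak_ED_Borel_def by blast
  have G: "integrable lborel (\<lambda>y. G y $ a $ b)" for a b
    using w integrable_bounded_linear[OF bounded_linear_vec_nth integrable_bounded_linear[OF bounded_linear_vec_nth]]
    unfolding weak_ED_Borel_def by blast
  note T = C2_boundedD[OF \<theta>]
  define g3 where "g3 z t = (\<Sum>i\<in>UNIV. (z - x)$i * (\<Sum>j\<in>UNIV. (z - x)$j * (\<Sum>k\<in>UNIV. (z - x)$k * V (inc k (inc j (inc i z0))) (x + t *\<^sub>R (z - x)))))" for z t
  define F where "F z t = \<theta> z * (t\<^sup>2 / 2 * g3 z t * indicator {0..1} t)" for z and t :: real
  define S where "S = cball p r \<times> {0..1::real}"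
  have S: "compact S" unfolding S_def by (intro compact_Times) auto
  have cg: "continuous_on UNIV g"
    unfolding g_def by (intro continuous_intros cv_continuous[OF G \<Phi>])
  have g0: "g y \<ge> 0" for y unfolding g_def by (intro sum_nonneg) auto
  have intF: "integrable (lborel \<Otimes>\<^sub>M lborel) (case_prod F)"
  proof -
    have "continuous_on UNIV (\<lambda>p. \<theta> (fst p) * ((snd p)\<^sup>2 / 2 * g3 (fst p) (snd p)))"
      unfolding g3_def V_def
      by (intro continuous_intros cv_affine_continuous[OF u \<Phi>] continuous_on_compose2[OF T(3)]) auto
    from integrable_pair_compact[OF this S]
    have "integrable (lborel \<Otimes>\<^sub>M lborel) (\<lambda>p. indicator S p * (\<theta> (fst p) * ((snd p)\<^sup>2 / 2 * g3 (fst p) (snd p))))" .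
    moreover have "(\<lambda>p. indicator S p * (\<theta> (fst p) * ((snd p)\<^sup>2 / 2 * g3 (fst p) (snd p)))) = case_prod F"
      using T(10) by (auto simp: fun_eq_iff F_def S_def indicator_def)
    ultimately show ?thesis by simp
  qed
  have intg: "integrable (lborel \<Otimes>\<^sub>M lborel) (\<lambda>(z,t). indicator (cball p r) z * indicator {0..1} t * g (x + t *\<^sub>R (z - x)))"
  proof -
    have "continuous_on UNIV (\<lambda>p. g (x + snd p *\<^sub>R (fst p - x)))"
      by (intro continuous_on_compose2[OF cg] continuous_intros) auto
    from integrable_pair_compact[OF this S]
    have "integrable (lborel \<Otimes>\<^sub>M lborel) (\<lambda>q. indicator S q * g (x + snd q *\<^sub>R (fst q - x)))" .
    moreover have "(\<lambda>q. indicator S q * g (x + snd q *\<^sub>R (fst q - x))) = (\<lambda>(z,t). indicator (cball p r) z * indicator {0..1} t * g (x + t *\<^sub>R (z - x)))"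
      by (auto simp: fun_eq_iff S_def indicator_def)
    ultimately show ?thesis by simp
  qed
  have inner: "\<bar>\<integral>z. F z t \<partial>lborel\<bar> \<le> C * (indicator {0..1} t * (\<integral>z. indicator (cball p r) z * g (x + t *\<^sub>R (z - x)) \<partial>lborel))" for t
  proof (cases "t \<in> {0..1}")
    case t: True
    define I where "I = (\<integral>z. indicator (cball p r) z * g (x + t *\<^sub>R (z - x)) \<partial>lborel)"
    have I: "(\<integral>z. indicator (cball p r) z * \<bar>cv (\<lambda>y. G y $ a $ b) (\<Phi> z0) (x + t *\<^sub>R (z - x))\<bar> \<partial>lborel) \<le> I" for a b
      unfolding I_def
    proof (rule integral_mono)
      have c: "continuous_on UNIV (\<lambda>z. g (x + t *\<^sub>R (z - x)))"
        by (intro continuous_on_compose2[OF cg] continuous_intros) auto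
      have "continuous_on UNIV (\<lambda>z. \<bar>cv (\<lambda>y. G y $ a $ b) (\<Phi> z0) (x + t *\<^sub>R (z - x))\<bar>)"
        by (intro continuous_intros cv_affine_continuous[OF G \<Phi>])
      then show "integrable lborel (\<lambda>z. indicator (cball p r) z * \<bar>cv (\<lambda>y. G y $ a $ b) (\<Phi> z0) (x + t *\<^sub>R (z - x))\<bar>)"
        by (rule integrable_indicator_continuous[OF compact_cball])
      show "integrable lborel (\<lambda>z. indicator (cball p r) z * g (x + t *\<^sub>R (z - x)))"
        by (rule integrable_indicator_continuous[OF compact_cball c])
      have "\<bar>cv (\<lambda>y. G y $ a $ b) (\<Phi> z0) y\<bar> \<le> g y" for y
      proof -
        have "\<bar>cv (\<lambda>y. G y $ a $ b) (\<Phi> z0) y\<bar> \<le> (\<Sum>b\<in>UNIV. \<bar>cv (\<lambda>y. G y $ a $ b) (\<Phi> z0) y\<bar>)"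
          by (rule member_le_sum) auto
        also have "\<dots> \<le> g y"
          unfolding g_def by (rule member_le_sum[of a UNIV "\<lambda>a. \<Sum>b\<in>UNIV. \<bar>cv (\<lambda>y. G y $ a $ b) (\<Phi> z0) y\<bar>"]) (auto intro: sum_nonneg)
        finally show ?thesis .
      qed
      then show "indicator (cball p r) z * \<bar>cv (\<lambda>y. G y $ a $ b) (\<Phi> z0) (x + t *\<^sub>R (z - x))\<bar> \<le> indicator (cball p r) z * g (x + t *\<^sub>R (z - x))" for z
        by (intro mult_left_mono) auto
    qed
    have I0: "I \<ge> 0" unfolding I_def by (intro Bochner_Integration.integral_nonneg) (simp add: g0)
    define K3 where "K3 = K * (D + 2) * (D + 2) * (D + 2)"
    have "K3 \<ge> 0" unfolding K3_def using T(9) D(2) by simp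
    \<comment> \<open>The three factors of the cubic remainder are moved into the weight, so that
      only derivatives of G remain to be integrated by parts; this is why the constant contains (D +
      2) three times.\<close>
    define \<psi> where "\<psi> i j k z = \<theta> z * (z - x)$i * (z - x)$j * (z - x)$k" for i j k z
    have \<psi>: "\<exists>\<psi>1 \<psi>2. C2_bounded (cball p r) K3 (\<psi> i j k) \<psi>1 \<psi>2" for i j k
    proof -
      obtain a1 a2 where a: "C2_bounded (cball p r) (K * (D + 2)) (\<lambda>z. \<theta> z * (z - x)$i) a1 a2"
        using C2_bounded_mult[OF \<theta> D] by blast
      obtain b1 b2 where b: "C2_bounded (cball p r) (K * (D + 2) * (D + 2)) (\<lambda>z. \<theta> z * (z - x)$i * (z - x)$j) b1 b2"
        using C2_bounded_mult[OF a D] by blast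
      show ?thesis
        using C2_bounded_mult[OF b D] unfolding \<psi>_def[abs_def] K3_def .
    qed
    define \<Gamma> where "\<Gamma> a b c d z = cv (\<lambda>y. G y $ a $ b) (\<Phi> (inc c (inc d z0))) (x + t *\<^sub>R (z - x))" for a b c d z
    have eq: "F z t = (1/2) * (\<Sum>i\<in>UNIV. \<Sum>j\<in>UNIV. \<Sum>k\<in>UNIV. \<Sum>(a,b,c,d)\<in>UNIV. \<kappa> i j k (a,b,c,d) * (t\<^sup>2 * (\<psi> i j k z * \<Gamma> a b c d z)))" for z
    proof (cases "z \<in> cball p r")
      case True
      have V: "V (inc k (inc j (inc i z0))) (x + t *\<^sub>R (z - x)) = (\<Sum>(a,b,c,d)\<in>UNIV. \<kappa> i j k (a,b,c,d) * \<Gamma> a b c d z)" for i j k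
        unfolding V_def \<Gamma>_def by (rule \<kappa>[OF dev_sym_rel_cv[OF w \<Phi> x[OF True t]]])
      show ?thesis
        using t unfolding F_def g3_def V
        by (simp add: \<psi>_def sum_distrib_left case_prod_unfold mult_ac)
    next
      case False
      then show ?thesis using T(10) by (simp add: F_def \<psi>_def case_prod_unfold)
    qed
    have int1: "integrable lborel (\<lambda>z. \<psi> i j k z * \<Gamma> a b c d z)" for i j k a b c d
    proof (rule integrable_continuous_compact_support[OF _ compact_cball[of p r]])
      show "continuous_on UNIV (\<lambda>z. \<psi> i j k z * \<Gamma> a b c d z)"
        unfolding \<psi>_def \<Gamma>_def by (intro continuous_intros cv_affine_continuous[OF G \<Phi>] T(3))
    qed (use T(10) in \<open>auto simp: \<psi>_def\<close>)
    have "(\<integral>z. F z t \<partial>lborel) = (1/2) * (\<Sum>i\<in>UNIV. \<Sum>j\<in>UNIV. \<Sum>k\<in>UNIV. \<Sum>(a,b,c,d)\<in>UNIV. \<kappa> i j k (a,b,c,d) * (t\<^sup>2 * (\<integral>z. \<psi> i j k z * \<Gamma> a b c d z \<partial>lborel)))"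
      unfolding eq by (simp add: case_prod_unfold int1)
    also have "\<bar>\<dots>\<bar> \<le> (1/2) * (\<Sum>i\<in>UNIV. \<Sum>j\<in>UNIV. \<Sum>k\<in>UNIV. \<Sum>q\<in>UNIV. \<bar>\<kappa> i j k q\<bar> * (K3 * I))"
      unfolding abs_mult
    proof (intro mult_mono order_trans[OF sum_abs sum_mono])
      fix i j k and q :: "'n \<times> 'n \<times> 'n \<times> 'n"
      obtain a b c d where q: "q = (a,b,c,d)" by (cases q)
      have "\<bar>t\<^sup>2 * (\<integral>z. \<psi> i j k z * \<Gamma> a b c d z \<partial>lborel)\<bar> \<le> K3 * I"
      proof -
        obtain \<psi>1 \<psi>2 where "C2_bounded (cball p r) K3 (\<psi> i j k) \<psi>1 \<psi>2" using \<psi> by blast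
        from kernel_second_order_bound[OF G \<Phi> this, of t a b c d z0 x]
        show ?thesis unfolding \<Gamma>_def using mult_left_mono[OF I[of a b] \<open>K3 \<ge> 0\<close>] by linarith
      qed
      then show "\<bar>case q of (a,b,c,d) \<Rightarrow> \<kappa> i j k (a,b,c,d) * (t\<^sup>2 * (\<integral>z. \<psi> i j k z * \<Gamma> a b c d z \<partial>lborel))\<bar> \<le> \<bar>\<kappa> i j k q\<bar> * (K3 * I)"
        unfolding q by (simp only: prod.case abs_mult[of "\<kappa> _ _ _ _"]) (intro mult_left_mono; simp)
    qed auto
    also have "\<dots> = (1/2) * (C * I)"
      unfolding C_def K3_def[symmetric] sum_distrib_right by (simp add: mult_ac)
    also have "\<dots> \<le> C * I"
    proof -
      have "C \<ge> 0" unfolding C_def K3_def[symmetric] using \<open>K3 \<ge> 0\<close> by (intro mult_nonneg_nonneg sum_nonneg) auto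
      then show ?thesis using I0 by simp
    qed
    finally show ?thesis using t by (simp add: I_def)
  next
    case False
    then show ?thesis by (simp add: F_def)
  qed
  have "(\<integral>z. \<theta> z * (\<integral>t. (t\<^sup>2 / 2 * g3 z t) * indicator {0..1} t \<partial>lborel) \<partial>lborel) = (\<integral>z. (\<integral>t. F z t \<partial>lborel) \<partial>lborel)"
    by (simp add: F_def)
  also have "\<dots> = (\<integral>t. (\<integral>z. F z t \<partial>lborel) \<partial>lborel)"
    by (rule lborel_pair.Fubini_integral[OF intF, symmetric])
  also have "\<bar>\<dots>\<bar> \<le> (\<integral>t. C * (indicator {0..1} t * (\<integral>z. indicator (cball p r) z * g (x + t *\<^sub>R (z - x)) \<partial>lborel)) \<partial>lborel)"
  proof (rule order_trans[OF integral_abs_bound integral_mono])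
    show "integrable lborel (\<lambda>t. \<bar>\<integral>z. F z t \<partial>lborel\<bar>)"
      using lborel_pair.integrable_snd[OF intF] by simp
    have "integrable lborel (\<lambda>t. \<integral>z. indicator (cball p r) z * indicator {0..1} t * g (x + t *\<^sub>R (z - x)) \<partial>lborel)"
      using lborel_pair.integrable_snd[OF intg] by simp
    also have "(\<lambda>t. \<integral>z. indicator (cball p r) z * indicator {0..1} t * g (x + t *\<^sub>R (z - x)) \<partial>lborel)
       = (\<lambda>t. indicator {0..1} t * (\<integral>z. indicator (cball p r) z * g (x + t *\<^sub>R (z - x)) \<partial>lborel))"
      by (simp add: fun_eq_iff indicator_def)
    finally show "integrable lborel (\<lambda>t. C * (indicator {0..1} t * (\<integral>z. indicator (cball p r) z * g (x + t *\<^sub>R (z - x)) \<partial>lborel)))"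
      by (rule integrable_mult_right)
  qed (rule inner)
  finally show ?thesis by (simp add: g3_def)
qed

text \<open>The weight is fixed by the ball alone, so the constant precedes the domain, the fields
  and the kernel, and one w serves all points x and all components. The condition on x asks that the
  mollified relation \<open>dev_sym_rel\<close> hold along every segment from x to the ball.\<close>

theorem pointwise_Korn_estimate:
  fixes p :: "real^'n::finite"
  assumes n: "CARD('n) \<ge> 3" and r: "r > 0" and R: "R \<ge> 0"
  obtains C where "C \<ge> 0"
    "\<And>\<Omega> u G s (\<Phi> :: ('n \<Rightarrow> nat) \<Rightarrow> real^'n \<Rightarrow> real). weak_ED_Borel \<Omega> u G \<Longrightarrow> kernel_family s \<Phi> \<Longrightarrow>
      (\<And>z. z \<in> cball p r \<Longrightarrow> cball z s \<subseteq> \<Omega>) \<Longrightarrow>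
      \<exists>w\<in>Sigma_fields. \<forall>x l. norm x \<le> R \<longrightarrow> (\<forall>z\<in>cball p r. \<forall>t\<in>{0..1}. cball (x + t *\<^sub>R (z - x)) s \<subseteq> \<Omega>) \<longrightarrow>
        \<bar>cv (\<lambda>y. u y $ l) (\<Phi> z0) x - w x $ l\<bar> \<le> C * (
          (\<integral>t. indicator {0..1} t * (\<integral>z. indicator (cball p r) z *
              (\<Sum>a\<in>UNIV. \<Sum>b\<in>UNIV. \<bar>cv (\<lambda>y. G y $ a $ b) (\<Phi> z0) (x + t *\<^sub>R (z - x))\<bar>) \<partial>lborel) \<partial>lborel)
        + (\<integral>z. indicator (cball p r) z * (\<Sum>a\<in>UNIV. \<Sum>b\<in>UNIV. \<bar>cv (\<lambda>y. G y $ a $ b) (\<Phi> z0) z\<bar>) \<partial>lborel))"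
proof -
  obtain K \<theta> \<theta>1 \<theta>2 where \<theta>: "C2_bounded (cball p r) K \<theta> \<theta>1 \<theta>2" "(\<integral>z. \<theta> z \<partial>lborel) = 1"
    using averaging_kernel_exists[OF r] by blast
  note T = C2_boundedD[OF \<theta>(1)]
  define D where "D = norm p + r + R"
  have D0: "D \<ge> 0" using r R by (simp add: D_def)
  have D: "\<bar>(z - x)$i\<bar> \<le> D" if "z \<in> cball p r" "norm x \<le> R" for z x i
  proof -
    have "norm z \<le> norm p + r" using that(1) norm_triangle_sub[of z p] by (simp add: dist_norm norm_minus_commute)
    then have "norm (z - x) \<le> D" using norm_triangle_ineq4[of z x] that(2) by (simp add: D_def)
    then show ?thesis using component_le_norm_cart[of "z - x" i] by linarith
  qed
  have "\<exists>\<kappa>. \<forall>U \<Gamma> m. dev_sym_rel U \<Gamma> \<longrightarrow>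
     U l (inc k (inc j (inc i m))) = (\<Sum>(a,b,c,d)\<in>UNIV. \<kappa> (a,b,c,d) * \<Gamma> a b (inc c (inc d m)))" for i j k l :: 'n
    using from_second_third[OF n, of l k j i] unfolding from_second_def .
  note ex = this
  \<comment> \<open>A choice of universal coefficients made before any field is given; the constant
    \<open>C1\<close> is built from it.\<close>
  define \<kappa> where "\<kappa> l i j k = (SOME \<kappa>. \<forall>U \<Gamma> m. dev_sym_rel U \<Gamma> \<longrightarrow>
     U l (inc k (inc j (inc i m))) = (\<Sum>(a,b,c,d)\<in>UNIV. \<kappa> (a,b,c,d) * \<Gamma> a b (inc c (inc d m))))" for l i j k :: 'n
  have \<kappa>: "U l (inc k (inc j (inc i m))) = (\<Sum>(a,b,c,d)\<in>UNIV. \<kappa> l i j k (a,b,c,d) * \<Gamma> a b (inc c (inc d m)))"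
    if "dev_sym_rel U \<Gamma>" for i j k l U \<Gamma> m
    using someI_ex[OF ex[of l k j i]] that unfolding \<kappa>_def[symmetric] by blast
  define K3 where "K3 = K * (D + 2) * (D + 2) * (D + 2)"
  define K2 where "K2 = K * (D + 2) * (D + 2)"
  define K1 where "K1 = K * (D + 2)"
  have K: "K1 \<ge> 0" "K2 \<ge> 0" "K3 \<ge> 0" using T(9) D0 by (auto simp: K1_def K2_def K3_def)
  define N where "N = real CARD('n)"
  \<comment> \<open>\<open>C1\<close> belongs to the remainder, and summing over l makes it serve
    every component. \<open>C2\<close> below belongs to the polynomial: one sum of first order
    terms, and half of a double sum in which three derivatives of G occur.\<close>
  define C1 where "C1 = (\<Sum>l\<in>UNIV. \<Sum>i\<in>UNIV. \<Sum>j\<in>UNIV. \<Sum>k\<in>UNIV. \<Sum>q\<in>UNIV. \<bar>\<kappa> l i j k q\<bar>) * K3"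
  define C2 where "C2 = N * K1 + (1/2) * (N * (N * (3 * K2)))"
  define C where "C = max C1 C2"
  have C1l: "(\<Sum>i\<in>UNIV. \<Sum>j\<in>UNIV. \<Sum>k\<in>UNIV. \<Sum>q\<in>UNIV. \<bar>\<kappa> l i j k q\<bar>) * K3 \<le> C1" for l
    unfolding C1_def
    by (intro mult_right_mono K member_le_sum[of l UNIV "\<lambda>l. \<Sum>i\<in>UNIV. \<Sum>j\<in>UNIV. \<Sum>k\<in>UNIV. \<Sum>q\<in>UNIV. \<bar>\<kappa> l i j k q\<bar>"])
       (auto intro!: sum_nonneg)
  have C2: "C2 \<ge> 0" using K by (simp add: C2_def N_def)
  show ?thesis
  proof (rule that[of C])
    show "C \<ge> 0" using C2 by (simp add: C_def)
    fix \<Omega> u G s and \<Phi> :: "('n \<Rightarrow> nat) \<Rightarrow> real^'n \<Rightarrow> real"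
    assume w: "weak_ED_Borel \<Omega> u G" and \<Phi>: "kernel_family s \<Phi>" and B: "\<And>z. z \<in> cball p r \<Longrightarrow> cball z s \<subseteq> \<Omega>"
    have u: "integrable lborel (\<lambda>y. u y $ l)" for l
      using w integrable_bounded_linear[OF bounded_linear_vec_nth] unfolding weak_ED_Borel_def by blast
    have G: "integrable lborel (\<lambda>y. G y $ a $ b)" for a b
      using w integrable_bounded_linear[OF bounded_linear_vec_nth integrable_bounded_linear[OF bounded_linear_vec_nth]]
      unfolding weak_ED_Borel_def by blast
    define U where "U z l m = cv (\<lambda>y. u y $ l) (\<Phi> m) z" for z l m
    define \<Gamma> where "\<Gamma> z a b m = cv (\<lambda>y. G y $ a $ b) (\<Phi> m) z" for z a b m
    have cU: "continuous_on UNIV (\<lambda>z. U z l m)" for l m unfolding U_def by (rule cv_continuous[OF u \<Phi>])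
    have c\<Gamma>: "continuous_on UNIV (\<lambda>z. \<Gamma> z a b m)" for a b m unfolding \<Gamma>_def by (rule cv_continuous[OF G \<Phi>])
    have ct: "continuous_on UNIV (\<lambda>z. trace_part (U z) m)" for m
      unfolding U_def by (rule trace_part_cv_continuous[OF u \<Phi>])
    define g where "g y = (\<Sum>a\<in>UNIV. \<Sum>b\<in>UNIV. \<bar>\<Gamma> y a b z0\<bar>)" for y
    have cg: "continuous_on UNIV g" unfolding g_def by (intro continuous_intros c\<Gamma>)
    have g0: "g y \<ge> 0" for y unfolding g_def by (intro sum_nonneg) auto
    define J where "J = (\<integral>z. indicator (cball p r) z * g z \<partial>lborel)"
    define I where "I x = (\<integral>t. indicator {0..1} t * (\<integral>z. indicator (cball p r) z * g (x + t *\<^sub>R (z - x)) \<partial>lborel) \<partial>lborel)" for x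
    have J0: "J \<ge> 0" unfolding J_def by (intro Bochner_Integration.integral_nonneg) (simp add: g0)
    have I0: "I x \<ge> 0" for x
      unfolding I_def by (intro Bochner_Integration.integral_nonneg mult_nonneg_nonneg) (simp_all add: g0 Bochner_Integration.integral_nonneg)
    have J\<Gamma>: "(\<integral>z. indicator (cball p r) z * \<bar>\<Gamma> z a b z0\<bar> \<partial>lborel) \<le> J" for a b
      unfolding J_def
    proof (rule integral_mono)
      show "integrable lborel (\<lambda>z. indicator (cball p r) z * \<bar>\<Gamma> z a b z0\<bar>)"
        by (intro integrable_indicator_continuous compact_cball continuous_intros c\<Gamma>)
      show "integrable lborel (\<lambda>z. indicator (cball p r) z * g z)"
        by (intro integrable_indicator_continuous compact_cball cg)
      have "\<bar>\<Gamma> y a b z0\<bar> \<le> g y" for y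
      proof -
        have "\<bar>\<Gamma> y a b z0\<bar> \<le> (\<Sum>b\<in>UNIV. \<bar>\<Gamma> y a b z0\<bar>)" by (rule member_le_sum) auto
        also have "\<dots> \<le> g y"
          unfolding g_def by (rule member_le_sum[of a UNIV "\<lambda>a. \<Sum>b\<in>UNIV. \<bar>\<Gamma> y a b z0\<bar>"]) (auto intro: sum_nonneg)
        finally show ?thesis .
      qed
      then show "indicator (cball p r) z * \<bar>\<Gamma> z a b z0\<bar> \<le> indicator (cball p r) z * g z" for z
        by (intro mult_left_mono) auto
    qed
    define P where "P z x l = U z l z0 + (\<Sum>i\<in>UNIV. (1/2) * (U z l (inc i z0) - U z i (inc l z0)) * (x - z)$i)
       + trace_part (U z) z0 * (x - z)$l
       + (\<Sum>i\<in>UNIV. trace_part (U z) (inc i z0) * (x - z)$i) * (x - z)$l - (1/2) * ((x - z) \<bullet> (x - z)) * trace_part (U z) (inc l z0)" for z x l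
    obtain v where v: "v \<in> Sigma_fields" "\<And>x l. v x $ l = (\<integral>z. \<theta> z * P z x l \<partial>lborel)"
      using averaged_Taylor_in_Sigma[OF u \<Phi> \<theta>(1)] unfolding P_def U_def by auto
    have int: "integrable lborel (\<lambda>z. \<theta> z * f z)" if "continuous_on UNIV f" for f
      by (rule integrable_continuous_compact_support[OF _ compact_cball[of p r]])
         (use T that in \<open>auto intro!: continuous_intros\<close>)
    have main: "\<bar>cv (\<lambda>y. u y $ l) (\<Phi> z0) x - v x $ l\<bar> \<le> C1 * I x + C2 * J"
      if x: "norm x \<le> R" "\<And>z t. z \<in> cball p r \<Longrightarrow> t \<in> {0..1} \<Longrightarrow> cball (x + t *\<^sub>R (z - x)) s \<subseteq> \<Omega>" for x l
    proof -
      define E1 where "E1 z = (\<Sum>i\<in>UNIV. (x - z)$i * \<Gamma> z l i z0)" for z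
      define E2 where "E2 z = (1/2) * (\<Sum>i\<in>UNIV. \<Sum>j\<in>UNIV. (x - z)$i * (x - z)$j *
         (\<Gamma> z i l (inc j z0) + \<Gamma> z j l (inc i z0) - \<Gamma> z j i (inc l z0)))" for z
      define Rem where "Rem z = (\<integral>t. (t\<^sup>2 / 2 * (\<Sum>i\<in>UNIV. (z - x)$i * (\<Sum>j\<in>UNIV. (z - x)$j * (\<Sum>k\<in>UNIV. (z - x)$k * U (x + t *\<^sub>R (z - x)) l (inc k (inc j (inc i z0)))))))
         * indicator {0..1} t \<partial>lborel)" for z
      have cP: "continuous_on UNIV (\<lambda>z. P z x l)" unfolding P_def by (intro continuous_intros cU ct)
      have cE: "continuous_on UNIV E1" "continuous_on UNIV E2"
        unfolding E1_def[abs_def] E2_def[abs_def] by (intro continuous_intros c\<Gamma>)+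
      have pt: "\<theta> z * U x l z0 = \<theta> z * P z x l + \<theta> z * E1 z + \<theta> z * E2 z - \<theta> z * Rem z" for z
      proof (cases "z \<in> cball p r")
        case True
        have rel: "dev_sym_rel (U z) (\<Gamma> z)"
          unfolding U_def[abs_def] \<Gamma>_def[abs_def] by (rule dev_sym_rel_cv[OF w \<Phi> B[OF True]])
        have "U x l z0 = (U z l z0 - (\<Sum>i\<in>UNIV. (z - x)$i * U z l (inc i z0))
           + (1/2) * (\<Sum>i\<in>UNIV. (z - x)$i * (\<Sum>j\<in>UNIV. (z - x)$j * U z l (inc j (inc i z0))))) - Rem z"
          using cv_Taylor[OF u[of l] \<Phi>, of z0 x "z - x"] unfolding U_def Rem_def by simp
        also have "U z l z0 - (\<Sum>i\<in>UNIV. (z - x)$i * U z l (inc i z0))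
           + (1/2) * (\<Sum>i\<in>UNIV. (z - x)$i * (\<Sum>j\<in>UNIV. (z - x)$j * U z l (inc j (inc i z0))))
          = U z l z0 + (\<Sum>i\<in>UNIV. (x - z)$i * U z l (inc i z0))
           + (1/2) * (\<Sum>i\<in>UNIV. (x - z)$i * (\<Sum>j\<in>UNIV. (x - z)$j * U z l (inc j (inc i z0))))"
        proof -
          have m: "(z - x)$i = - ((x - z)$i)" for i by simp
          show ?thesis unfolding m by (simp only: mult_minus_left sum_negf mult_minus_right minus_minus diff_minus_eq_add)
        qed
        also have "\<dots> = P z x l + E1 z + E2 z"
          unfolding P_def E1_def E2_def by (rule Taylor_poly_decomposition[OF rel])
        finally have "U x l z0 = P z x l + E1 z + E2 z - Rem z" .
        then show ?thesis by (simp only: distrib_left right_diff_distrib)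
      next
        case False then show ?thesis using T(10) by simp
      qed
      have intU: "integrable lborel (\<lambda>z. \<theta> z * U x l z0)" by (rule int) auto
      have intR: "integrable lborel (\<lambda>z. \<theta> z * Rem z)"
      proof -
        have "(\<lambda>z. \<theta> z * Rem z) = (\<lambda>z. \<theta> z * P z x l + \<theta> z * E1 z + \<theta> z * E2 z - \<theta> z * U x l z0)"
        proof
          fix z
          show "\<theta> z * Rem z = \<theta> z * P z x l + \<theta> z * E1 z + \<theta> z * E2 z - \<theta> z * U x l z0" using pt[of z] by linarith
        qed
        then show ?thesis
          by (simp only:) (intro Bochner_Integration.integrable_add Bochner_Integration.integrable_diff intU int cP cE)
      qed
      \<comment> \<open>The weight has mass 1 and the value at x does not depend on z, so the
        pointwise identity \<open>pt\<close> can be averaged.\<close>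
      have "U x l z0 = (\<integral>z. \<theta> z * U x l z0 \<partial>lborel)" unfolding integral_mult_left_zero \<theta>(2) by simp
      also have "\<dots> = v x $ l + (\<integral>z. \<theta> z * E1 z \<partial>lborel) + (\<integral>z. \<theta> z * E2 z \<partial>lborel) - (\<integral>z. \<theta> z * Rem z \<partial>lborel)"
        unfolding pt v(2) using int[OF cP] int[OF cE(1)] int[OF cE(2)] intR by simp
      finally have eq: "cv (\<lambda>y. u y $ l) (\<Phi> z0) x - v x $ l = (\<integral>z. \<theta> z * E1 z \<partial>lborel) + (\<integral>z. \<theta> z * E2 z \<partial>lborel) - (\<integral>z. \<theta> z * Rem z \<partial>lborel)"
        by (simp add: U_def)
      have bE1: "\<bar>\<integral>z. \<theta> z * E1 z \<partial>lborel\<bar> \<le> N * K1 * J"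
      proof -
        have "(\<integral>z. \<theta> z * E1 z \<partial>lborel) = - (\<Sum>i\<in>UNIV. \<integral>z. (\<theta> z * (z - x)$i) * \<Gamma> z l i z0 \<partial>lborel)"
        proof -
          have "integrable lborel (\<lambda>z. (\<theta> z * (z - x)$i) * \<Gamma> z l i z0)" for i
            using int[of "\<lambda>z. (z - x)$i * \<Gamma> z l i z0"] by (simp add: mult.assoc continuous_intros c\<Gamma>)
          then have "- (\<Sum>i\<in>UNIV. \<integral>z. (\<theta> z * (z - x)$i) * \<Gamma> z l i z0 \<partial>lborel) = (\<integral>z. - (\<Sum>i\<in>UNIV. (\<theta> z * (z - x)$i) * \<Gamma> z l i z0) \<partial>lborel)"
            by simp
          also have "(\<lambda>z. - (\<Sum>i\<in>UNIV. (\<theta> z * (z - x)$i) * \<Gamma> z l i z0)) = (\<lambda>z. \<theta> z * E1 z)"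
            unfolding E1_def by (simp add: fun_eq_iff sum_distrib_left sum_negf[symmetric] algebra_simps)
          finally show ?thesis by simp
        qed
        then have "\<bar>\<integral>z. \<theta> z * E1 z \<partial>lborel\<bar> \<le> (\<Sum>i\<in>UNIV. \<bar>\<integral>z. (\<theta> z * (z - x)$i) * \<Gamma> z l i z0 \<partial>lborel\<bar>)"
          by (simp add: sum_abs)
        also have "\<dots> \<le> (\<Sum>i\<in>(UNIV::'n set). K1 * J)"
        proof (intro sum_mono)
          fix i
          obtain \<psi>1 \<psi>2 where \<psi>: "C2_bounded (cball p r) K1 (\<lambda>z. \<theta> z * (z - x)$i) \<psi>1 \<psi>2"
            using C2_bounded_mult[OF \<theta>(1) D[OF _ x(1)] D0] unfolding K1_def by blast
          note P = C2_boundedD[OF \<psi>]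
          show "\<bar>\<integral>z. (\<theta> z * (z - x)$i) * \<Gamma> z l i z0 \<partial>lborel\<bar> \<le> K1 * J"
            using abs_integral_le_kernel[OF compact_cball P(6) P(10) P(3) c\<Gamma>, of p r l i z0] mult_left_mono[OF J\<Gamma>[of l i] K(1)] by linarith
        qed
        finally show ?thesis by (simp add: N_def)
      qed
      have bE2: "\<bar>\<integral>z. \<theta> z * E2 z \<partial>lborel\<bar> \<le> (1/2) * (N * (N * (3 * K2))) * J"
      proof -
        define \<psi> where "\<psi> i j z = \<theta> z * (z - x)$i * (z - x)$j" for i j z
        have b: "\<bar>\<integral>z. \<psi> i j z * \<Gamma> z a b (inc c z0) \<partial>lborel\<bar> \<le> K2 * J" for i j a b c
        proof -
          obtain \<phi>1 \<phi>2 where "C2_bounded (cball p r) K1 (\<lambda>z. \<theta> z * (z - x)$i) \<phi>1 \<phi>2"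
            using C2_bounded_mult[OF \<theta>(1) D[OF _ x(1)] D0] unfolding K1_def by blast
          from C2_bounded_mult[OF this D[OF _ x(1)] D0, of j]
          obtain \<psi>1 \<psi>2 where \<psi>: "C2_bounded (cball p r) K2 (\<psi> i j) \<psi>1 \<psi>2"
            unfolding K1_def K2_def \<psi>_def[abs_def] by blast
          show ?thesis
            using kernel_first_order_bound[OF G \<Phi> \<psi>, of a b c z0, folded \<Gamma>_def] mult_left_mono[OF J\<Gamma>[of a b] K(2)] by linarith
        qed
        have i\<psi>: "integrable lborel (\<lambda>z. \<psi> i j z * \<Gamma> z a b m)" for i j a b m
        proof -
          have "continuous_on UNIV (\<lambda>z. (z - x)$i * (z - x)$j * \<Gamma> z a b m)" by (intro continuous_intros c\<Gamma>)
          from int[OF this] show ?thesis by (simp add: \<psi>_def mult.assoc)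
        qed
        have "(\<lambda>z. \<theta> z * E2 z) = (\<lambda>z. (1/2) * (\<Sum>i\<in>UNIV. \<Sum>j\<in>UNIV. \<psi> i j z * \<Gamma> z i l (inc j z0) + \<psi> i j z * \<Gamma> z j l (inc i z0) - \<psi> i j z * \<Gamma> z j i (inc l z0)))"
          unfolding E2_def \<psi>_def by (simp add: fun_eq_iff sum_distrib_left algebra_simps)
        then have "(\<integral>z. \<theta> z * E2 z \<partial>lborel) = (1/2) * (\<Sum>i\<in>UNIV. \<Sum>j\<in>UNIV. (\<integral>z. \<psi> i j z * \<Gamma> z i l (inc j z0) \<partial>lborel)
            + (\<integral>z. \<psi> i j z * \<Gamma> z j l (inc i z0) \<partial>lborel) - (\<integral>z. \<psi> i j z * \<Gamma> z j i (inc l z0) \<partial>lborel))"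
          using i\<psi> by simp
        also have "\<bar>\<dots>\<bar> \<le> (1/2) * (\<Sum>i\<in>(UNIV::'n set). \<Sum>j\<in>(UNIV::'n set). 3 * (K2 * J))"
          unfolding abs_mult
        proof (intro mult_mono order_trans[OF sum_abs sum_mono])
          fix i j
          show "\<bar>(\<integral>z. \<psi> i j z * \<Gamma> z i l (inc j z0) \<partial>lborel) + (\<integral>z. \<psi> i j z * \<Gamma> z j l (inc i z0) \<partial>lborel)
             - (\<integral>z. \<psi> i j z * \<Gamma> z j i (inc l z0) \<partial>lborel)\<bar> \<le> 3 * (K2 * J)"
            using b[of i j i l j] b[of i j j l i] b[of i j j i l] by linarith
        qed auto
        finally show ?thesis by (simp add: N_def)
      qed
      have bR: "\<bar>\<integral>z. \<theta> z * Rem z \<partial>lborel\<bar> \<le> C1 * I x"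
      proof -
        have "\<bar>\<integral>z. \<theta> z * Rem z \<partial>lborel\<bar> \<le> ((\<Sum>i\<in>UNIV. \<Sum>j\<in>UNIV. \<Sum>k\<in>UNIV. \<Sum>q\<in>UNIV. \<bar>\<kappa> l i j k q\<bar>) * K3) * I x"
          unfolding Rem_def U_def K3_def I_def g_def \<Gamma>_def
          by (rule Taylor_remainder_bound[where \<kappa>="\<kappa> l" and l=l and x=x and D=D and \<Omega>=\<Omega>, OF w \<Phi> \<theta>(1)])
             (fact D[OF _ x(1)] D0 x(2) \<kappa>)+
        also have "\<dots> \<le> C1 * I x" by (intro mult_right_mono C1l I0)
        finally show ?thesis .
      qed
      have "C2 * J = N * K1 * J + (1/2) * (N * (N * (3 * K2))) * J" by (simp add: C2_def distrib_right)
      then show ?thesis unfolding eq using bE1 bE2 bR by linarith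
    qed
    have CC: "C1 * I x + C2 * J \<le> C * (I x + J)" for x
      unfolding C_def distrib_left using I0[of x] J0 by (intro add_mono mult_right_mono) auto
    show "\<exists>w\<in>Sigma_fields. \<forall>x l. norm x \<le> R \<longrightarrow> (\<forall>z\<in>cball p r. \<forall>t\<in>{0..1}. cball (x + t *\<^sub>R (z - x)) s \<subseteq> \<Omega>) \<longrightarrow>
        \<bar>cv (\<lambda>y. u y $ l) (\<Phi> z0) x - w x $ l\<bar> \<le> C * (
          (\<integral>t. indicator {0..1} t * (\<integral>z. indicator (cball p r) z *
              (\<Sum>a\<in>UNIV. \<Sum>b\<in>UNIV. \<bar>cv (\<lambda>y. G y $ a $ b) (\<Phi> z0) (x + t *\<^sub>R (z - x))\<bar>) \<partial>lborel) \<partial>lborel)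
        + (\<integral>z. indicator (cball p r) z * (\<Sum>a\<in>UNIV. \<Sum>b\<in>UNIV. \<bar>cv (\<lambda>y. G y $ a $ b) (\<Phi> z0) z\<bar>) \<partial>lborel))"
    proof (intro bexI[OF _ v(1)] allI impI)
      fix x :: "real^'n" and l assume x: "norm x \<le> R" "\<forall>z\<in>cball p r. \<forall>t\<in>{0..1}. cball (x + t *\<^sub>R (z - x)) s \<subseteq> \<Omega>"
      have "\<bar>cv (\<lambda>y. u y $ l) (\<Phi> z0) x - v x $ l\<bar> \<le> C1 * I x + C2 * J"
        by (rule main[OF x(1) bspec[OF bspec[OF x(2)]]])
      also note CC[of x]
      finally show "\<bar>cv (\<lambda>y. u y $ l) (\<Phi> z0) x - v x $ l\<bar> \<le> C * (
          (\<integral>t. indicator {0..1} t * (\<integral>z. indicator (cball p r) z *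
              (\<Sum>a\<in>UNIV. \<Sum>b\<in>UNIV. \<bar>cv (\<lambda>y. G y $ a $ b) (\<Phi> z0) (x + t *\<^sub>R (z - x))\<bar>) \<partial>lborel) \<partial>lborel)
        + (\<integral>z. indicator (cball p r) z * (\<Sum>a\<in>UNIV. \<Sum>b\<in>UNIV. \<bar>cv (\<lambda>y. G y $ a $ b) (\<Phi> z0) z\<bar>) \<partial>lborel))"
        unfolding I_def J_def g_def \<Gamma>_def .
    qed
  qed
qed

section \<open>Young functions\<close>

lemma young_zero: "young_function A \<Longrightarrow> A 0 = 0"
  by (simp add: young_function_def)

lemma young_convex:
  assumes "young_function A" "0 \<le> s" "0 \<le> t" "0 < l" "l < 1"
  shows "A (l * s + (1 - l) * t) \<le> ennreal l * A s + ennreal (1 - l) * A t"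
  using assms by (simp add: young_function_def)

lemma young_scale:
  assumes A: "young_function A" and "0 \<le> l" "l \<le> 1" "0 \<le> t"
  shows "A (l * t) \<le> ennreal l * A t"
proof -
  consider "l = 0" | "l = 1" | "0 < l" "l < 1" using assms by linarith
  then show ?thesis
  proof cases
    case 3
    then show ?thesis using young_convex[OF A \<open>0 \<le> t\<close> order_refl 3] young_zero[OF A] by simp
  qed (use young_zero[OF A] in auto)
qed

lemma young_mono:
  assumes A: "young_function A" and "0 \<le> s" "s \<le> t"
  shows "A s \<le> A t"
proof (cases "t = 0")
  case False
  have "A s = A ((s / t) * t)" using False by simp
  also have "\<dots> \<le> ennreal (s / t) * A t" by (rule young_scale[OF A]) (use assms False in auto)
  also have "\<dots> \<le> 1 * A t" by (intro mult_right_mono) (use assms False in \<open>auto simp: divide_le_eq_1\<close>)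
  finally show ?thesis by simp
qed (use assms in auto)

lemma young_midpoint:
  assumes A: "young_function A" and "0 \<le> s" "0 \<le> t"
  shows "A ((s + t) / 2) \<le> ennreal (1/2) * A s + ennreal (1/2) * A t"
  using young_convex[OF assms, of "1/2"] by (simp add: add_divide_distrib)

text \<open>Convexity with A(0) = 0 makes A(t)/t nondecreasing, which gives the case t \<ge> s even
  if A(s) is infinite; for t < s the conversion to \<open>ennreal\<close> truncates the left side to
  0. It stands in for a supporting line.\<close>

lemma young_tangent:
  assumes A: "young_function A" and "0 < s"
  shows "A s * ennreal ((t - s) / s) \<le> A t"
proof (cases "s \<le> t")
  case True
  have "A s = A ((s / t) * t)" using True assms by simp
  also have "\<dots> \<le> ennreal (s / t) * A t" by (rule young_scale[OF A]) (use assms True in auto)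
  finally have "A s * ennreal ((t - s) / s) \<le> ennreal (s / t) * A t * ennreal ((t - s) / s)"
    by (intro mult_right_mono) auto
  also have "\<dots> = ennreal ((s / t) * ((t - s) / s)) * A t"
    using True assms by (subst ennreal_mult) (auto simp: mult_ac)
  also have "\<dots> \<le> 1 * A t"
    by (intro mult_right_mono) (use True assms in \<open>auto simp: divide_le_eq_1\<close>)
  finally show ?thesis by simp
next
  case False
  then have "(t - s) / s \<le> 0" using assms by (simp add: divide_nonpos_pos)
  then show ?thesis by (simp add: ennreal_neg)
qed

text \<open>Such a set is empty, the whole line or a half-line. It gives measurability of monotone
  functions with infinite values.\<close>

lemma up_closed_borel:
  fixes S :: "real set"
  assumes "\<And>s t. s \<in> S \<Longrightarrow> s \<le> t \<Longrightarrow> t \<in> S"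
  shows "S \<in> sets borel"
proof -
  consider "S = {}" | "\<not> bdd_below S" | "S \<noteq> {}" "bdd_below S" by blast
  then show ?thesis
  proof cases
    case 2
    have "t \<in> S" for t
    proof -
      obtain s where "s \<in> S" "s < t" using 2 by (auto simp: bdd_below_def not_le)
      then show ?thesis using assms[of s t] by simp
    qed
    then have "S = UNIV" by blast
    then show ?thesis by simp
  next
    case 3
    have "{Inf S<..} \<subseteq> S"
    proof
      fix t assume "t \<in> {Inf S<..}"
      then obtain s where "s \<in> S" "s < t" using 3 by (auto simp: cInf_less_iff)
      then show "t \<in> S" using assms by auto
    qed
    moreover have "S \<subseteq> {Inf S..}" using 3 by (auto intro: cInf_lower)
    ultimately have "S = {Inf S<..} \<or> S = {Inf S..}"
      by (cases "Inf S \<in> S") (auto simp: less_le)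
    then show ?thesis by (elim disjE) (erule ssubst, simp)+
  qed simp
qed

lemma young_measurable:
  assumes A: "young_function A" and f: "f \<in> borel_measurable M" "\<And>x. 0 \<le> f x"
  shows "(\<lambda>x. A (f x)) \<in> borel_measurable M"
proof -
  \<comment> \<open>Nothing is known about A on negative arguments, hence the truncation before
    monotonicity is used.\<close>
  have "(\<lambda>t. A (max 0 t)) \<in> borel_measurable borel"
  proof (rule borel_measurableI_greater)
    fix y
    have "{t. y < A (max 0 t)} \<in> sets borel"
    proof (rule up_closed_borel)
      fix s t :: real assume "s \<in> {t. y < A (max 0 t)}" "s \<le> t"
      moreover have "A (max 0 s) \<le> A (max 0 t)" by (rule young_mono[OF A]) (use \<open>s \<le> t\<close> in auto)
      ultimately show "t \<in> {t. y < A (max 0 t)}" by auto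
    qed
    then show "{x \<in> space borel. y < A (max 0 x)} \<in> sets borel" by simp
  qed
  from measurable_compose[OF f(1) this] show ?thesis using f(2) by (simp add: max_def)
qed

text \<open>Linear growth beyond any point where A is positive; on sets of finite measure it embeds
  the Orlicz space in L^1.\<close>

lemma young_linear_bound:
  assumes A: "young_function A"
  obtains a b where "0 \<le> a" "0 \<le> b" "\<And>t. 0 \<le> t \<Longrightarrow> ennreal t \<le> ennreal a + ennreal b * A t"
proof -
  obtain s where s: "s > 0" "A s \<noteq> 0" using A by (auto simp: young_function_def)
  \<comment> \<open>Truncation at 1 keeps the slope finite when A(s) is infinite.\<close>
  define c where "c = enn2real (min (A s) 1)"
  have "min (A s) 1 < top" by (simp add: min_less_iff_disj)
  then have cA: "ennreal c = min (A s) 1" by (simp add: c_def)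
  have c: "c > 0" 
  proof -
    have "min (A s) 1 > 0" using s by (simp add: zero_less_iff_neq_zero)
    then show ?thesis unfolding cA[symmetric] by simp
  qed
  have "ennreal t \<le> ennreal s + ennreal (s / c) * A t" if "0 \<le> t" for t
  proof (cases "t \<le> s")
    case True
    then show ?thesis by (simp add: add_increasing2 ennreal_leI)
  next
    case False
    have "ennreal c * ennreal ((t - s) / s) \<le> A s * ennreal ((t - s) / s)"
      by (intro mult_right_mono) (auto simp: cA)
    also have "\<dots> \<le> A t" by (rule young_tangent[OF A s(1)])
    finally have "ennreal (s / c) * (ennreal c * ennreal ((t - s) / s)) \<le> ennreal (s / c) * A t"
      by (rule mult_left_mono) auto
    also have "ennreal (s / c) * (ennreal c * ennreal ((t - s) / s)) = ennreal (t - s)"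
      using c s False by (simp add: ennreal_mult[symmetric])
    finally have "ennreal s + ennreal (t - s) \<le> ennreal s + ennreal (s / c) * A t" by (intro add_left_mono)
    then show ?thesis using s False by (simp add: ennreal_plus[symmetric] del: ennreal_plus)
  qed
  then show ?thesis using that[of s "s / c"] s c by simp
qed

text \<open>Scaling down an argument with finite value makes A as small as desired. This is how
  bounded functions are absorbed into a modular.\<close>

lemma young_small:
  assumes A: "young_function A" and e: "e > 0"
  obtains t where "t > 0" "A t \<le> ennreal e"
proof -
  obtain s where s: "s > 0" "A s \<noteq> top" using A by (auto simp: young_function_def)
  define a where "a = enn2real (A s)"
  have a: "A s = ennreal a" "a \<ge> 0" using s(2) by (auto simp: a_def ennreal_enn2real_if top.not_eq_extremum less_top)
  define l where "l = min 1 (e / (a + 1))"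
  have l: "0 < l" "l \<le> 1" "l * a \<le> e"
  proof -
    show "0 < l" "l \<le> 1" using e a by (auto simp: l_def)
    have "l * a \<le> (e / (a + 1)) * a" unfolding l_def by (intro mult_right_mono a) auto
    also have "\<dots> \<le> e" using a e by (simp add: field_simps)
    finally show "l * a \<le> e" .
  qed
  have "A (l * s) \<le> ennreal l * A s" by (rule young_scale[OF A]) (use l s in auto)
  also have "\<dots> = ennreal (l * a)" using l a by (simp add: ennreal_mult)
  also have "\<dots> \<le> ennreal e" using l by (intro ennreal_leI)
  finally show ?thesis using that[of "l * s"] l s by simp
qed

lemma ennreal_integral_le_nn_integral:
  assumes "integrable M f"
  shows "ennreal (\<integral>x. f x \<partial>M) \<le> (\<integral>\<^sup>+x. ennreal (f x) \<partial>M)"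
proof -
  have fin: "(\<integral>\<^sup>+x. ennreal (f x) \<partial>M) < \<infinity>"
    using assms unfolding real_integrable_def by (simp add: top.not_eq_extremum)
  have "(\<integral>x. f x \<partial>M) \<le> enn2real (\<integral>\<^sup>+x. ennreal (f x) \<partial>M)"
    unfolding real_lebesgue_integral_def[OF assms] by simp
  then have "ennreal (\<integral>x. f x \<partial>M) \<le> ennreal (enn2real (\<integral>\<^sup>+x. ennreal (f x) \<partial>M))"
    by (rule ennreal_leI)
  also have "\<dots> = (\<integral>\<^sup>+x. ennreal (f x) \<partial>M)" using fin by simp
  finally show ?thesis .
qed

text \<open>Giving away a factor 2 in Jensen's inequality, the tangent line can be replaced by the explicit
  minorant \<open>t \<mapsto> A s * (t - s) / s\<close>, which also covers infinite values of \<open>A\<close>.\<close>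
lemma young_Jensen:
  assumes A: "young_function A"
    and \<rho>: "integrable M \<rho>" "(\<integral>x. \<rho> x \<partial>M) = 1" "\<And>x. 0 \<le> \<rho> x"
    and f: "f \<in> borel_measurable M" "\<And>x. 0 \<le> f x" "integrable M (\<lambda>x. \<rho> x * f x)"
  shows "A ((\<integral>x. \<rho> x * f x \<partial>M) / 2) \<le> (\<integral>\<^sup>+x. ennreal (\<rho> x) * A (f x) \<partial>M)"
proof -
  \<comment> \<open>With s equal to half the mean, the mean of (f - s)/s is (2s - s)/s = 1, so
    integrating the minorant returns exactly A(s).\<close>
  define s where "s = (\<integral>x. \<rho> x * f x \<partial>M) / 2"
  have "s \<ge> 0" unfolding s_def using \<rho>(3) f(2) by simp
  then consider "s = 0" | "s > 0" by linarith
  then have "A s \<le> (\<integral>\<^sup>+x. ennreal (\<rho> x) * A (f x) \<partial>M)"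
  proof cases
    case 1 then show ?thesis using young_zero[OF A] by simp
  next
    case 2
    have [measurable]: "\<rho> \<in> borel_measurable M" "f \<in> borel_measurable M" using \<rho> f by auto
    have int: "integrable M (\<lambda>x. \<rho> x * ((f x - s) / s))"
      using \<rho>(1) f(3) by (simp add: diff_divide_distrib right_diff_distrib)
    have "(\<integral>x. \<rho> x * ((f x - s) / s) \<partial>M) = ((\<integral>x. \<rho> x * f x \<partial>M) - s * (\<integral>x. \<rho> x \<partial>M)) / s"
    proof -
      have "(\<lambda>x. \<rho> x * ((f x - s) / s)) = (\<lambda>x. (\<rho> x * f x - s * \<rho> x) / s)" by (auto simp: fun_eq_iff algebra_simps)
      then show ?thesis using \<rho>(1) f(3) by simp
    qed
    then have one: "(\<integral>x. \<rho> x * ((f x - s) / s) \<partial>M) = 1"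
      using \<rho>(2) 2 by (simp add: s_def)
    have "A s = A s * ennreal (\<integral>x. \<rho> x * ((f x - s) / s) \<partial>M)" by (simp only: one ennreal_1 mult_1_right)
    also have "\<dots> \<le> A s * (\<integral>\<^sup>+x. ennreal (\<rho> x * ((f x - s) / s)) \<partial>M)"
      by (intro mult_left_mono ennreal_integral_le_nn_integral int) auto
    also have "\<dots> = (\<integral>\<^sup>+x. A s * ennreal (\<rho> x * ((f x - s) / s)) \<partial>M)"
      by (rule nn_integral_cmult[symmetric]) auto
    also have "\<dots> \<le> (\<integral>\<^sup>+x. ennreal (\<rho> x) * A (f x) \<partial>M)"
    proof (rule nn_integral_mono)
      fix x
      have "A s * ennreal (\<rho> x * ((f x - s) / s)) = ennreal (\<rho> x) * (A s * ennreal ((f x - s) / s))"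
        by (simp only: ennreal_mult'[OF \<rho>(3)] mult_ac)
      also have "\<dots> \<le> ennreal (\<rho> x) * A (f x)"
        by (intro mult_left_mono young_tangent[OF A 2]) auto
      finally show "A s * ennreal (\<rho> x * ((f x - s) / s)) \<le> ennreal (\<rho> x) * A (f x)" .
    qed
    finally show ?thesis .
  qed
  then show ?thesis by (simp add: s_def)
qed

text \<open>Jensen for the probability density \<Phi>(x - y) in y, then Fubini: in x the density
  integrates to 1 again. The division by 2 is the price paid in \<open>young_Jensen\<close>.\<close>

lemma young_mollified:
  fixes \<Phi> :: "('n::finite \<Rightarrow> nat) \<Rightarrow> real^'n \<Rightarrow> real"
  assumes A: "young_function A" and f: "integrable lborel f" "\<And>x. 0 \<le> f x"
    and \<Phi>: "kernel_family s \<Phi>" "\<And>x. 0 \<le> \<Phi> z0 x" "(\<integral>x. \<Phi> z0 x \<partial>lborel) = 1"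
  shows "(\<integral>\<^sup>+x. A (cv f (\<Phi> z0) x / 2) \<partial>lborel) \<le> (\<integral>\<^sup>+x. A (f x) \<partial>lborel)"
proof -
  have [measurable]: "f \<in> borel_measurable borel" using f by simp
  have [measurable]: "\<Phi> z0 \<in> borel_measurable borel"
    using kernel_family_continuous[OF \<Phi>(1)] by (rule borel_measurable_continuous_onI)
  have int: "integrable lborel (\<lambda>y. \<Phi> z0 (x - y))" for x
    using integrable_lborel_affine[OF kernel_family_integrable[OF \<Phi>(1), of z0], of "-1" x] by simp
  have one: "(\<integral>y. \<Phi> z0 (x - y) \<partial>lborel) = 1" for x
    using integral_lborel_affine[of "\<Phi> z0" "-1" x] \<Phi>(3) by simp
  have one': "(\<integral>\<^sup>+x. ennreal (\<Phi> z0 (x - y)) \<partial>lborel) = 1" for y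
  proof -
    have "(\<integral>\<^sup>+x. ennreal (\<Phi> z0 x) \<partial>lborel) = (\<integral>\<^sup>+x. ennreal (\<Phi> z0 (x - y)) \<partial>lborel)"
      using nn_integral_lborel_affine[of "\<lambda>x. ennreal (\<Phi> z0 x)" 1 "-y"] by simp
    then show ?thesis
      using nn_integral_eq_integral[OF kernel_family_integrable[OF \<Phi>(1), of z0]] \<Phi>(2,3) by simp
  qed
  define H where "H x = A (f x)" for x
  have [measurable]: "H \<in> borel_measurable borel"
    unfolding H_def[abs_def] by (rule young_measurable[OF A]) (use f in auto)
  have "(\<integral>\<^sup>+x. A (cv f (\<Phi> z0) x / 2) \<partial>lborel) \<le> (\<integral>\<^sup>+x. (\<integral>\<^sup>+y. ennreal (\<Phi> z0 (x - y)) * H y \<partial>lborel) \<partial>lborel)"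
  proof (rule nn_integral_mono)
    fix x
    have "A ((\<integral>y. \<Phi> z0 (x - y) * f y \<partial>lborel) / 2) \<le> (\<integral>\<^sup>+y. ennreal (\<Phi> z0 (x - y)) * H y \<partial>lborel)"
      unfolding H_def by (rule young_Jensen[OF A int one]) (use \<Phi>(2) f cv_integrable[OF f(1) \<Phi>(1), of z0 x] in \<open>auto simp: mult.commute\<close>)
    then show "A (cv f (\<Phi> z0) x / 2) \<le> (\<integral>\<^sup>+y. ennreal (\<Phi> z0 (x - y)) * H y \<partial>lborel)"
      by (simp add: cv_def mult.commute)
  qed
  also have "\<dots> = (\<integral>\<^sup>+y. (\<integral>\<^sup>+x. ennreal (\<Phi> z0 (x - y)) * H y \<partial>lborel) \<partial>lborel)"
    by (rule lborel_pair.Fubini') (intro measurable_lborel_pairI; measurable)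
  also have "\<dots> = (\<integral>\<^sup>+y. H y \<partial>lborel)"
    by (simp add: nn_integral_multc one')
  finally show ?thesis unfolding H_def .
qed

lemma nn_integral_affine_le:
  fixes F :: "'a::euclidean_space \<Rightarrow> ennreal"
  assumes [measurable]: "F \<in> borel_measurable borel" and c: "1/2 \<le> c"
  shows "(\<integral>\<^sup>+x. F (t + c *\<^sub>R x) \<partial>lborel) \<le> ennreal (2 ^ DIM('a)) * (\<integral>\<^sup>+x. F x \<partial>lborel)"
proof -
  have "(\<integral>\<^sup>+x. F (t + c *\<^sub>R x) \<partial>lborel) = ennreal ((2 * (1/2)) ^ DIM('a)) * (\<integral>\<^sup>+x. F (t + c *\<^sub>R x) \<partial>lborel)" by simp
  also have "\<dots> \<le> ennreal ((2 * c) ^ DIM('a)) * (\<integral>\<^sup>+x. F (t + c *\<^sub>R x) \<partial>lborel)"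
    by (intro mult_right_mono ennreal_leI power_mono mult_left_mono c) auto
  also have "\<dots> = ennreal (2 ^ DIM('a)) * (ennreal (\<bar>c\<bar> ^ DIM('a)) * (\<integral>\<^sup>+x. F (t + c *\<^sub>R x) \<partial>lborel))"
    using c by (simp add: power_mult_distrib ennreal_mult mult.assoc)
  also have "ennreal (\<bar>c\<bar> ^ DIM('a)) * (\<integral>\<^sup>+x. F (t + c *\<^sub>R x) \<partial>lborel) = (\<integral>\<^sup>+x. F x \<partial>lborel)"
    using c by (subst nn_integral_lborel_affine[of F c t]) (auto simp: ennreal_power)
  finally show ?thesis .
qed

text \<open>The change of variables is made in \<open>x\<close> for small \<open>t\<close> and in \<open>z\<close> for \<open>t\<close> close to 1, so that
  the Jacobian stays bounded.\<close>
lemma young_segment_average: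
  fixes h :: "real^'n::finite \<Rightarrow> real" and p :: "real^'n"
  assumes A: "young_function A" and h: "continuous_on UNIV h" "\<And>x. 0 \<le> h x" and r: "r > 0"
  defines "b \<equiv> measure lborel (cball p r)"
  shows "(\<integral>\<^sup>+x. indicator (cball 0 R) x * A ((\<integral>t. indicator {0..1} t * (\<integral>z. indicator (cball p r) z * h (x + t *\<^sub>R (z - x)) \<partial>lborel) \<partial>lborel) / (2 * b)) \<partial>lborel)
     \<le> ennreal (2 ^ CARD('n) * (b + measure lborel (cball (0::real^'n) R)) / b) * (\<integral>\<^sup>+x. A (h x) \<partial>lborel)"
proof -
  have b: "b > 0" unfolding b_def using r content_cball_pos[of r p] by simp
  have bE: "emeasure lborel (cball p r) = ennreal b" unfolding b_def
    using emeasure_lborel_cball_finite[of p r] by (simp add: emeasure_eq_ennreal_measure less_top[symmetric])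
  define B where "B = measure lborel (cball (0::real^'n) R)"
  have BE: "emeasure lborel (cball (0::real^'n) R) = ennreal B" unfolding B_def
    using emeasure_lborel_cball_finite[of "0::real^'n" R] by (simp add: emeasure_eq_ennreal_measure less_top[symmetric])
  have [measurable]: "h \<in> borel_measurable borel" using h(1) by (rule borel_measurable_continuous_onI)
  define H where "H x = A (h x)" for x
  have [measurable]: "H \<in> borel_measurable borel"
    unfolding H_def[abs_def] by (rule young_measurable[OF A]) (use h in auto)
  define jB :: "real^'n \<Rightarrow> ennreal" where "jB = indicator (cball p r)"
  define jR :: "real^'n \<Rightarrow> ennreal" where "jR = indicator (cball 0 R)"
  have [measurable]: "jB \<in> borel_measurable borel" unfolding jB_def by (rule borel_measurable_indicator) simp
  have [measurable]: "jR \<in> borel_measurable borel" unfolding jR_def by (rule borel_measurable_indicator) simp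
  have jb: "(\<integral>\<^sup>+z. jB z \<partial>lborel) = ennreal b" "(\<integral>\<^sup>+z. jR z \<partial>lborel) = ennreal B"
    unfolding jB_def jR_def bE[symmetric] BE[symmetric] by (rule nn_integral_indicator; simp)+
  define I where "I = (\<integral>\<^sup>+x. H x \<partial>lborel)"
  define Q where "Q = cball p r \<times> {0..1::real}"
  have Q: "compact Q" unfolding Q_def by (intro compact_Times) auto
  have Qm[measurable]: "Q \<in> sets (borel \<Otimes>\<^sub>M borel)" unfolding Q_def by measurable
  have Qe: "emeasure (lborel \<Otimes>\<^sub>M lborel) Q = ennreal b"
    unfolding Q_def by (subst lborel.emeasure_pair_measure_Times) (auto simp: bE)
  \<comment> \<open>The uniform probability density on ball times unit interval; its mass is that of
    the ball since the interval has length 1.\<close>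
  define \<rho> where "\<rho> q = indicator Q q / b" for q :: "(real^'n) \<times> real"
  have \<rho>0: "\<rho> q \<ge> 0" for q using b by (simp add: \<rho>_def)
  have \<rho>i: "integrable (lborel \<Otimes>\<^sub>M lborel) \<rho>"
    unfolding \<rho>_def using Qe Qm by (intro integrable_divide) (simp add: integrable_indicator_iff cong: measurable_cong_sets sets_pair_measure_cong)
  have \<rho>1: "(\<integral>q. \<rho> q \<partial>(lborel \<Otimes>\<^sub>M lborel)) = 1"
  proof -
    have "measure (lborel \<Otimes>\<^sub>M lborel) Q = b" unfolding measure_def Qe using b by simp
    then show ?thesis unfolding \<rho>_def using b by (simp add: space_pair_measure)
  qed
  define F where "F x q = h (x + snd q *\<^sub>R (fst q - x))" for x and q :: "(real^'n) \<times> real"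
  have Fm: "F x \<in> borel_measurable (lborel \<Otimes>\<^sub>M lborel)" for x
    unfolding F_def by (intro measurable_lborel_pairI) measurable
  have Fi: "integrable (lborel \<Otimes>\<^sub>M lborel) (\<lambda>q. indicator Q q * F x q)" for x
    unfolding F_def by (intro integrable_pair_compact Q continuous_on_compose2[OF h(1)] continuous_intros) auto
  have avg: "(\<integral>q. \<rho> q * F x q \<partial>(lborel \<Otimes>\<^sub>M lborel)) = (\<integral>t. indicator {0..1} t * (\<integral>z. indicator (cball p r) z * h (x + t *\<^sub>R (z - x)) \<partial>lborel) \<partial>lborel) / b" for x
  proof -
    have Fi': "integrable (lborel \<Otimes>\<^sub>M lborel) (\<lambda>(z,t). indicator Q (z,t) * F x (z,t))"
      using Fi[of x] by (simp add: case_prod_unfold)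
    have "(\<integral>q. \<rho> q * F x q \<partial>(lborel \<Otimes>\<^sub>M lborel)) = (\<integral>q. indicator Q q * F x q \<partial>(lborel \<Otimes>\<^sub>M lborel)) / b"
      by (simp add: \<rho>_def)
    also have "(\<integral>q. indicator Q q * F x q \<partial>(lborel \<Otimes>\<^sub>M lborel)) = (\<integral>t. \<integral>z. indicator Q (z,t) * F x (z,t) \<partial>lborel \<partial>lborel)"
      using lborel_pair.integral_snd[OF Fi'] by (simp add: case_prod_unfold)
    also have "\<dots> = (\<integral>t. indicator {0..1} t * (\<integral>z. indicator (cball p r) z * h (x + t *\<^sub>R (z - x)) \<partial>lborel) \<partial>lborel)"
    proof (intro Bochner_Integration.integral_cong refl)
      fix t :: real
      have "(\<integral>z. indicator Q (z,t) * F x (z,t) \<partial>lborel) = (\<integral>z. indicator {0..1} t * (indicator (cball p r) z * h (x + t *\<^sub>R (z - x))) \<partial>lborel)"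
        by (intro Bochner_Integration.integral_cong) (auto simp: Q_def F_def indicator_def)
      then show "(\<integral>z. indicator Q (z,t) * F x (z,t) \<partial>lborel) = indicator {0..1} t * (\<integral>z. indicator (cball p r) z * h (x + t *\<^sub>R (z - x)) \<partial>lborel)" by simp
    qed
    finally show ?thesis .
  qed
  have pt: "A ((\<integral>t. indicator {0..1} t * (\<integral>z. indicator (cball p r) z * h (x + t *\<^sub>R (z - x)) \<partial>lborel) \<partial>lborel) / (2 * b))
     \<le> ennreal (1 / b) * (\<integral>\<^sup>+t. indicator {0..1} t * (\<integral>\<^sup>+z. jB z * H (x + t *\<^sub>R (z - x)) \<partial>lborel) \<partial>lborel)" for x
  proof -
    have [measurable]: "(\<lambda>q. A (F x q)) \<in> borel_measurable (lborel \<Otimes>\<^sub>M lborel)"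
      by (rule young_measurable[OF A Fm]) (simp add: F_def h)
    have "A ((\<integral>q. \<rho> q * F x q \<partial>(lborel \<Otimes>\<^sub>M lborel)) / 2) \<le> (\<integral>\<^sup>+q. ennreal (\<rho> q) * A (F x q) \<partial>(lborel \<Otimes>\<^sub>M lborel))"
    proof (rule young_Jensen[OF A \<rho>i \<rho>1 \<rho>0 Fm])
      show "integrable (lborel \<Otimes>\<^sub>M lborel) (\<lambda>q. \<rho> q * F x q)"
        using integrable_divide[OF Fi[of x], of b] by (simp add: \<rho>_def)
    qed (simp add: F_def h)
    also have "\<dots> = (\<integral>\<^sup>+t. \<integral>\<^sup>+z. ennreal (\<rho> (z,t)) * A (F x (z,t)) \<partial>lborel \<partial>lborel)"
    proof (rule lborel_pair.nn_integral_snd[symmetric])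
      have "\<rho> \<in> borel_measurable (lborel \<Otimes>\<^sub>M lborel)" using \<rho>i by simp
      then show "(\<lambda>q. ennreal (\<rho> q) * A (F x q)) \<in> borel_measurable (lborel \<Otimes>\<^sub>M lborel)" by measurable
    qed
    also have "\<dots> = (\<integral>\<^sup>+t. \<integral>\<^sup>+z. ennreal (1 / b) * (indicator {0..1} t * (jB z * H (x + t *\<^sub>R (z - x)))) \<partial>lborel \<partial>lborel)"
      by (intro nn_integral_cong) (auto simp: \<rho>_def Q_def F_def H_def jB_def indicator_def)
    also have "\<dots> = ennreal (1 / b) * (\<integral>\<^sup>+t. indicator {0..1} t * (\<integral>\<^sup>+z. jB z * H (x + t *\<^sub>R (z - x)) \<partial>lborel) \<partial>lborel)"
      by (simp add: nn_integral_cmult)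
    finally show ?thesis unfolding avg by (simp add: mult.commute)
  qed
  have t_bound: "(\<integral>\<^sup>+x. jR x * (\<integral>\<^sup>+z. jB z * H (x + t *\<^sub>R (z - x)) \<partial>lborel) \<partial>lborel)
      \<le> ennreal (2 ^ CARD('n) * (b + B)) * I" if "t \<in> {0..1}" for t
  proof (cases "t \<le> 1/2")
    case True
    have "(\<integral>\<^sup>+x. jR x * (\<integral>\<^sup>+z. jB z * H (x + t *\<^sub>R (z - x)) \<partial>lborel) \<partial>lborel)
       \<le> (\<integral>\<^sup>+x. (\<integral>\<^sup>+z. jB z * H (x + t *\<^sub>R (z - x)) \<partial>lborel) \<partial>lborel)"
      by (intro nn_integral_mono) (auto simp: jR_def indicator_def)
    also have "\<dots> = (\<integral>\<^sup>+z. (\<integral>\<^sup>+x. jB z * H (x + t *\<^sub>R (z - x)) \<partial>lborel) \<partial>lborel)"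
      by (rule lborel_pair.Fubini') (intro measurable_lborel_pairI; measurable)
    also have "\<dots> = (\<integral>\<^sup>+z. jB z * (\<integral>\<^sup>+x. H (t *\<^sub>R z + (1 - t) *\<^sub>R x) \<partial>lborel) \<partial>lborel)"
      by (subst nn_integral_cmult) (auto simp: algebra_simps)
    also have "\<dots> \<le> (\<integral>\<^sup>+z. jB z * (ennreal (2 ^ DIM(real^'n)) * I) \<partial>lborel)"
      unfolding I_def by (intro nn_integral_mono mult_left_mono nn_integral_affine_le) (use True in auto)
    also have "\<dots> = ennreal b * (ennreal (2 ^ CARD('n)) * I)"
      by (subst nn_integral_multc) (auto simp: jb)
    also have "\<dots> = ennreal (2 ^ CARD('n) * b) * I"
      using b by (simp add: ennreal_mult mult_ac)
    also have "\<dots> \<le> ennreal (2 ^ CARD('n) * (b + B)) * I"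
      by (intro mult_right_mono ennreal_leI mult_left_mono) (auto simp: B_def)
    finally show ?thesis .
  next
    case False
    have "(\<integral>\<^sup>+z. jB z * H (x + t *\<^sub>R (z - x)) \<partial>lborel) \<le> ennreal (2 ^ DIM(real^'n)) * I" for x
    proof -
      have "(\<integral>\<^sup>+z. jB z * H (x + t *\<^sub>R (z - x)) \<partial>lborel) \<le> (\<integral>\<^sup>+z. H ((1 - t) *\<^sub>R x + t *\<^sub>R z) \<partial>lborel)"
        by (intro nn_integral_mono) (auto simp: jB_def indicator_def algebra_simps)
      also have "\<dots> \<le> ennreal (2 ^ DIM(real^'n)) * I"
        unfolding I_def by (intro nn_integral_affine_le) (use False in auto)
      finally show ?thesis .
    qed
    then have "(\<integral>\<^sup>+x. jR x * (\<integral>\<^sup>+z. jB z * H (x + t *\<^sub>R (z - x)) \<partial>lborel) \<partial>lborel)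
       \<le> (\<integral>\<^sup>+x. jR x * (ennreal (2 ^ DIM(real^'n)) * I) \<partial>lborel)"
      by (intro nn_integral_mono mult_left_mono) auto
    also have "\<dots> = ennreal B * (ennreal (2 ^ CARD('n)) * I)"
      by (subst nn_integral_multc) (auto simp: jb)
    also have "\<dots> = ennreal (2 ^ CARD('n) * B) * I"
      by (simp add: ennreal_mult mult_ac B_def)
    also have "\<dots> \<le> ennreal (2 ^ CARD('n) * (b + B)) * I"
      using b by (intro mult_right_mono ennreal_leI mult_left_mono) auto
    finally show ?thesis .
  qed
  have "(\<integral>\<^sup>+x. jR x * A ((\<integral>t. indicator {0..1} t * (\<integral>z. indicator (cball p r) z * h (x + t *\<^sub>R (z - x)) \<partial>lborel) \<partial>lborel) / (2 * b)) \<partial>lborel)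
    \<le> (\<integral>\<^sup>+x. jR x * (ennreal (1 / b) * (\<integral>\<^sup>+t. indicator {0..1} t * (\<integral>\<^sup>+z. jB z * H (x + t *\<^sub>R (z - x)) \<partial>lborel) \<partial>lborel)) \<partial>lborel)"
    by (intro nn_integral_mono mult_left_mono pt) auto
  also have "\<dots> = (\<integral>\<^sup>+x. (\<integral>\<^sup>+t. ennreal (1 / b) * (indicator {0..1} t * (jR x * (\<integral>\<^sup>+z. jB z * H (x + t *\<^sub>R (z - x)) \<partial>lborel))) \<partial>lborel) \<partial>lborel)"
    by (intro nn_integral_cong) (simp add: nn_integral_cmult[symmetric] mult_ac)
  also have "\<dots> = (\<integral>\<^sup>+t. (\<integral>\<^sup>+x. ennreal (1 / b) * (indicator {0..1} t * (jR x * (\<integral>\<^sup>+z. jB z * H (x + t *\<^sub>R (z - x)) \<partial>lborel))) \<partial>lborel) \<partial>lborel)"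
    by (rule lborel_pair.Fubini'[symmetric]) (intro measurable_lborel_pairI; measurable)
  also have "\<dots> = (\<integral>\<^sup>+t. ennreal (1 / b) * (indicator {0..1} t * (\<integral>\<^sup>+x. jR x * (\<integral>\<^sup>+z. jB z * H (x + t *\<^sub>R (z - x)) \<partial>lborel) \<partial>lborel)) \<partial>lborel)"
    by (simp add: nn_integral_cmult)
  also have "\<dots> \<le> (\<integral>\<^sup>+t. ennreal (1 / b) * (indicator {0..1::real} t * (ennreal (2 ^ CARD('n) * (b + B)) * I)) \<partial>lborel)"
  proof (rule nn_integral_mono, rule mult_left_mono)
    fix t :: real
    show "indicator {0..1} t * (\<integral>\<^sup>+x. jR x * (\<integral>\<^sup>+z. jB z * H (x + t *\<^sub>R (z - x)) \<partial>lborel) \<partial>lborel)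
      \<le> indicator {0..1} t * (ennreal (2 ^ CARD('n) * (b + B)) * I)"
      using t_bound[of t] by (auto simp: indicator_def)
  qed auto
  also have "\<dots> = ennreal (1 / b) * (ennreal (2 ^ CARD('n) * (b + B)) * I)"
    by (simp add: nn_integral_cmult nn_integral_multc)
  also have "\<dots> = ennreal (2 ^ CARD('n) * (b + B) / b) * I"
    using b by (simp add: ennreal_mult[symmetric] mult.assoc[symmetric] B_def)
  finally have fin: "(\<integral>\<^sup>+x. jR x * A ((\<integral>t. indicator {0..1} t * (\<integral>z. indicator (cball p r) z * h (x + t *\<^sub>R (z - x)) \<partial>lborel) \<partial>lborel) / (2 * b)) \<partial>lborel)
     \<le> ennreal (2 ^ CARD('n) * (b + B) / b) * I" .
  then show ?thesis by (simp only: I_def B_def H_def jR_def)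
qed


lemma card_cv_component_le:
  fixes \<Phi> :: "('n::finite \<Rightarrow> nat) \<Rightarrow> real^'n \<Rightarrow> real"
  assumes G: "integrable lborel G" and \<Phi>: "kernel_family s \<Phi>" "\<And>x. 0 \<le> \<Phi> z0 x"
  shows "\<bar>cv (\<lambda>y. (G y :: real^'n^'n) $ a $ b) (\<Phi> z0) x\<bar> \<le> cv (\<lambda>y. norm (G y)) (\<Phi> z0) x"
  unfolding cv_def
proof (rule order_trans[OF integral_abs_bound integral_mono_AE'])
  show "integrable lborel (\<lambda>y. norm (G y) * \<Phi> z0 (x - y))"
    by (rule cv_integrable[OF integrable_norm[OF G] \<Phi>(1)])
  have "\<bar>G y $ a $ b\<bar> \<le> norm (G y)" for y
    using component_le_norm_cart[of "G y $ a" b] Finite_Cartesian_Product.norm_nth_le[of "G y" a] by linarith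
  then show "AE y in lborel. \<bar>G y $ a $ b * \<Phi> z0 (x - y)\<bar> \<le> norm (G y) * \<Phi> z0 (x - y)"
    using \<Phi>(2) by (auto simp: abs_mult intro!: mult_right_mono)
qed (use \<Phi>(2) in auto)

text \<open>The pointwise bound consists of a segment average, handled by
  \<open>young_segment_average\<close>, and a constant, handled by Jensen on the ball. The set
  \<open>V\<close> is left open under the choice of w; it is later taken as the set of points whose
  segments keep distance s from the complement.\<close>

theorem mollified_modular_estimate:
  fixes p :: "real^'n::finite"
  assumes n: "CARD('n) \<ge> 3" and A: "young_function A" and r: "r > 0" and R: "R \<ge> 0"
  obtains C where "C > 0"
    "\<And>\<Omega> u G s (\<Phi> :: ('n \<Rightarrow> nat) \<Rightarrow> real^'n \<Rightarrow> real). weak_ED_Borel \<Omega> u G \<Longrightarrow> kernel_family s \<Phi> \<Longrightarrow>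
      (\<And>x. 0 \<le> \<Phi> z0 x) \<Longrightarrow> (\<integral>x. \<Phi> z0 x \<partial>lborel) = 1 \<Longrightarrow>
      (\<And>z. z \<in> cball p r \<Longrightarrow> cball z s \<subseteq> \<Omega>) \<Longrightarrow> (\<integral>\<^sup>+x. A (norm (G x)) \<partial>lborel) \<le> 1 \<Longrightarrow>
      \<exists>w\<in>Sigma_fields. \<forall>V\<in>sets borel. V \<subseteq> cball 0 R \<longrightarrow>
        (\<forall>x\<in>V. \<forall>z\<in>cball p r. \<forall>t\<in>{0..1}. cball (x + t *\<^sub>R (z - x)) s \<subseteq> \<Omega>) \<longrightarrow>
        (\<integral>\<^sup>+x. indicator V x * A (norm ((\<chi> l. cv (\<lambda>y. u y $ l) (\<Phi> z0) x) - w x) / C) \<partial>lborel) \<le> 1"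
proof -
  obtain C1 where C1: "C1 \<ge> 0" "\<And>\<Omega> u G s (\<Phi> :: ('n \<Rightarrow> nat) \<Rightarrow> real^'n \<Rightarrow> real). weak_ED_Borel \<Omega> u G \<Longrightarrow> kernel_family s \<Phi> \<Longrightarrow>
      (\<And>z. z \<in> cball p r \<Longrightarrow> cball z s \<subseteq> \<Omega>) \<Longrightarrow>
      \<exists>w\<in>Sigma_fields. \<forall>x l. norm x \<le> R \<longrightarrow> (\<forall>z\<in>cball p r. \<forall>t\<in>{0..1}. cball (x + t *\<^sub>R (z - x)) s \<subseteq> \<Omega>) \<longrightarrow>
        \<bar>cv (\<lambda>y. u y $ l) (\<Phi> z0) x - w x $ l\<bar> \<le> C1 * (
          (\<integral>t. indicator {0..1} t * (\<integral>z. indicator (cball p r) z *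
              (\<Sum>a\<in>UNIV. \<Sum>b\<in>UNIV. \<bar>cv (\<lambda>y. G y $ a $ b) (\<Phi> z0) (x + t *\<^sub>R (z - x))\<bar>) \<partial>lborel) \<partial>lborel)
        + (\<integral>z. indicator (cball p r) z * (\<Sum>a\<in>UNIV. \<Sum>b\<in>UNIV. \<bar>cv (\<lambda>y. G y $ a $ b) (\<Phi> z0) z\<bar>) \<partial>lborel))"
    using pointwise_Korn_estimate[OF n r R] by blast
  define N where "N = real CARD('n)"
  have N: "N > 0" by (simp add: N_def)
  define b where "b = measure lborel (cball p r)"
  have b: "b > 0" unfolding b_def using r content_cball_pos[of r p] by simp
  have bE: "emeasure lborel (cball p r) = ennreal b" unfolding b_def
    using emeasure_lborel_cball_finite[of p r] by (simp add: emeasure_eq_ennreal_measure less_top[symmetric])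
  define B where "B = measure lborel (cball (0::real^'n) R)"
  have BE: "emeasure lborel (cball (0::real^'n) R) = ennreal B" unfolding B_def
    using emeasure_lborel_cball_finite[of "0::real^'n" R] by (simp add: emeasure_eq_ennreal_measure less_top[symmetric])
  have B0: "B \<ge> 0" by (simp add: B_def)
  define C2 where "C2 = N * (C1 * (N * N)) + 1"
  have C2: "C2 > 0" "N * (C1 * (N * N)) \<le> C2" unfolding C2_def using C1(1) N by (simp_all add: add_nonneg_pos)
  \<comment> \<open>A bound for the total modular of the two parts, increased by 1 so that M \<ge>
    1. Dividing the argument by M divides A by M and brings the modular back to 1.\<close>
  define M where "M = 2 ^ CARD('n) * (b + B) / b + B / b + 1"
  have M: "M \<ge> 1" unfolding M_def using b B0 by simp
  \<comment> \<open>The 8 is a product of three factors 2: from halving in h, from Jensen, and from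
    splitting a sum at the midpoint. The volume b turns the integrals into averages.\<close>
  define C where "C = 8 * b * C2 * M"
  have C: "C > 0" unfolding C_def using b C2 M by simp
  show ?thesis
  proof (rule that[OF C])
    fix \<Omega> u G s and \<Phi> :: "('n \<Rightarrow> nat) \<Rightarrow> real^'n \<Rightarrow> real"
    assume w: "weak_ED_Borel \<Omega> u G" and \<Phi>: "kernel_family s \<Phi>" "\<And>x. 0 \<le> \<Phi> z0 x" "(\<integral>x. \<Phi> z0 x \<partial>lborel) = 1"
      and Bs: "\<And>z. z \<in> cball p r \<Longrightarrow> cball z s \<subseteq> \<Omega>" and one: "(\<integral>\<^sup>+x. A (norm (G x)) \<partial>lborel) \<le> 1"
    have G: "integrable lborel G" using w by (simp add: weak_ED_Borel_def)
    \<comment> \<open>Half of the mollified norm, so that \<open>young_mollified\<close> bounds its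
      modular by that of G.\<close>
    define h where "h x = cv (\<lambda>y. norm (G y)) (\<Phi> z0) x / 2" for x
    have ch: "continuous_on UNIV h" unfolding h_def
      by (intro continuous_intros cv_continuous[OF integrable_norm[OF G] \<Phi>(1)]) auto
    have h0: "h x \<ge> 0" for x unfolding h_def cv_def using \<Phi>(2) by simp
    have Ih: "(\<integral>\<^sup>+x. A (h x) \<partial>lborel) \<le> 1"
      using young_mollified[OF A integrable_norm[OF G] _ \<Phi>] one unfolding h_def by (auto intro: order_trans)
    define g where "g y = (\<Sum>a\<in>UNIV. \<Sum>b\<in>UNIV. \<bar>cv (\<lambda>y. G y $ a $ b) (\<Phi> z0) y\<bar>)" for y
    have Gab: "integrable lborel (\<lambda>y. G y $ a $ b)" for a b
      using G integrable_bounded_linear[OF bounded_linear_vec_nth integrable_bounded_linear[OF bounded_linear_vec_nth]] by blast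
    have cg: "continuous_on UNIV g" unfolding g_def by (intro continuous_intros cv_continuous[OF Gab \<Phi>(1)])
    have gh: "g y \<le> 2 * (N * N) * h y" for y
    proof -
      have "g y \<le> (\<Sum>a\<in>(UNIV::'n set). \<Sum>b\<in>(UNIV::'n set). 2 * h y)"
        unfolding g_def h_def by (intro sum_mono) (simp add: card_cv_component_le[OF G \<Phi>(1,2)])
      then show ?thesis by (simp add: N_def)
    qed
    have g0: "g y \<ge> 0" for y unfolding g_def by (intro sum_nonneg) auto
    define X where "X f x = (\<integral>t. indicator {0..1} t * (\<integral>z. indicator (cball p r) z * f (x + t *\<^sub>R (z - x)) \<partial>lborel) \<partial>lborel)" for f :: "real^'n \<Rightarrow> real" and x
    define Y where "Y f = (\<integral>z. indicator (cball p r) z * f z \<partial>lborel)" for f :: "real^'n \<Rightarrow> real"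
    have ci: "continuous_on UNIV (\<lambda>z. f (x + t *\<^sub>R (z - x)))" if "continuous_on UNIV f" for f :: "real^'n \<Rightarrow> real" and x t
      by (intro continuous_on_compose2[OF that] continuous_intros) auto
    have XY: "X g x \<le> 2 * (N * N) * X h x" "Y g \<le> 2 * (N * N) * Y h" for x
    proof -
      have i: "(\<integral>z. indicator (cball p r) z * g (k z) \<partial>lborel) \<le> 2 * (N * N) * (\<integral>z. indicator (cball p r) z * h (k z) \<partial>lborel)"
        if "continuous_on UNIV k" for k
      proof -
        have "(\<integral>z. indicator (cball p r) z * g (k z) \<partial>lborel) \<le> (\<integral>z. 2 * (N * N) * (indicator (cball p r) z * h (k z)) \<partial>lborel)"
        proof (rule integral_mono)
          show "integrable lborel (\<lambda>z. indicator (cball p r) z * g (k z))"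
            by (intro integrable_indicator_continuous compact_cball continuous_on_compose2[OF cg that]) auto
          show "integrable lborel (\<lambda>z. 2 * (N * N) * (indicator (cball p r) z * h (k z)))"
            by (intro integrable_mult_right integrable_indicator_continuous compact_cball continuous_on_compose2[OF ch that]) auto
        qed (use gh in \<open>auto simp: indicator_def\<close>)
        then show ?thesis by simp
      qed
      show "Y g \<le> 2 * (N * N) * Y h" unfolding Y_def by (rule i[OF continuous_on_id])
      define S where "S = cball p r \<times> {0..1::real}"
      have S: "compact S" unfolding S_def by (intro compact_Times) auto
      have intX: "integrable lborel (\<lambda>t. indicator {0..1} t * (\<integral>z. indicator (cball p r) z * f (x + t *\<^sub>R (z - x)) \<partial>lborel))"
        if f: "continuous_on UNIV f" for f :: "real^'n \<Rightarrow> real"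
      proof -
        have "continuous_on UNIV (\<lambda>q. f (x + snd q *\<^sub>R (fst q - x)))"
          by (intro continuous_on_compose2[OF f] continuous_intros) auto
        from integrable_pair_compact[OF this S]
        have "integrable (lborel \<Otimes>\<^sub>M lborel) (\<lambda>(z,t). indicator {0..1} t * (indicator (cball p r) z * f (x + t *\<^sub>R (z - x))))"
          by (rule back_subst[of "integrable (lborel \<Otimes>\<^sub>M lborel)"]) (auto simp: fun_eq_iff S_def indicator_def)
        from lborel_pair.integrable_snd[OF this] show ?thesis by simp
      qed
      have "X g x \<le> (\<integral>t. 2 * (N * N) * (indicator {0..1} t * (\<integral>z. indicator (cball p r) z * h (x + t *\<^sub>R (z - x)) \<partial>lborel)) \<partial>lborel)"
        unfolding X_def
      proof (rule integral_mono[OF intX[OF cg] integrable_mult_right[OF intX[OF ch]]])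
        fix t :: real
        show "indicator {0..1} t * (\<integral>z. indicator (cball p r) z * g (x + t *\<^sub>R (z - x)) \<partial>lborel)
          \<le> 2 * (N * N) * (indicator {0..1} t * (\<integral>z. indicator (cball p r) z * h (x + t *\<^sub>R (z - x)) \<partial>lborel))"
          using i[of "\<lambda>z. x + t *\<^sub>R (z - x)"] by (auto simp: indicator_def continuous_intros)
      qed
      then show "X g x \<le> 2 * (N * N) * X h x" unfolding X_def by simp
    qed
    have X0: "X h x \<ge> 0" for x unfolding X_def
      by (intro Bochner_Integration.integral_nonneg mult_nonneg_nonneg) (simp_all add: h0 Bochner_Integration.integral_nonneg)
    have Y0: "Y h \<ge> 0" unfolding Y_def by (intro Bochner_Integration.integral_nonneg) (simp add: h0)
    obtain v where v: "v \<in> Sigma_fields" "\<And>x l. norm x \<le> R \<Longrightarrow> (\<forall>z\<in>cball p r. \<forall>t\<in>{0..1}. cball (x + t *\<^sub>R (z - x)) s \<subseteq> \<Omega>) \<Longrightarrow>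
        \<bar>cv (\<lambda>y. u y $ l) (\<Phi> z0) x - v x $ l\<bar> \<le> C1 * (X g x + Y g)"
      using C1(2)[OF w \<Phi>(1) Bs] unfolding X_def Y_def g_def by blast
    have ptw: "norm ((\<chi> l. cv (\<lambda>y. u y $ l) (\<Phi> z0) x) - v x) \<le> 2 * C2 * (X h x + Y h)"
      if "norm x \<le> R" "\<forall>z\<in>cball p r. \<forall>t\<in>{0..1}. cball (x + t *\<^sub>R (z - x)) s \<subseteq> \<Omega>" for x
    proof -
      have "norm ((\<chi> l. cv (\<lambda>y. u y $ l) (\<Phi> z0) x) - v x) \<le> (\<Sum>l\<in>UNIV. \<bar>((\<chi> l. cv (\<lambda>y. u y $ l) (\<Phi> z0) x) - v x) $ l\<bar>)"
        by (rule norm_le_l1_cart)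
      also have "\<dots> \<le> (\<Sum>l\<in>(UNIV::'n set). C1 * (X g x + Y g))"
        by (intro sum_mono) (use v(2)[OF that] in simp)
      also have "\<dots> = N * (C1 * (X g x + Y g))" by (simp add: N_def)
      also have "\<dots> \<le> N * (C1 * (2 * (N * N) * X h x + 2 * (N * N) * Y h))"
        using N C1(1) XY by (intro mult_left_mono add_mono) auto
      also have "\<dots> = 2 * (N * (C1 * (N * N))) * (X h x + Y h)" by (simp add: algebra_simps)
      also have "\<dots> \<le> 2 * C2 * (X h x + Y h)"
        using C2(2) X0[of x] Y0 by (intro mult_right_mono mult_left_mono) auto
      finally show ?thesis .
    qed
    have half: "ennreal (1/2) \<le> 1" unfolding ennreal_1[symmetric] by (rule ennreal_leI) simp
    have pA: "A (norm ((\<chi> l. cv (\<lambda>y. u y $ l) (\<Phi> z0) x) - v x) / C) \<le> ennreal (1 / M) * (A (X h x / (2 * b)) + A (Y h / (2 * b)))"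
      if x: "norm x \<le> R" "\<forall>z\<in>cball p r. \<forall>t\<in>{0..1}. cball (x + t *\<^sub>R (z - x)) s \<subseteq> \<Omega>" for x
    proof -
      have "norm ((\<chi> l. cv (\<lambda>y. u y $ l) (\<Phi> z0) x) - v x) / C \<le> 2 * C2 * (X h x + Y h) / C"
        using ptw[OF x] C by (intro divide_right_mono) auto
      also have "\<dots> = (1 / M) * ((X h x / (2 * b) + Y h / (2 * b)) / 2)"
      proof -
        have "2 * C2 * Z / (8 * b * C2 * M) = (1 / M) * (Z / (2 * b) / 2)" for Z
          using C2(1) b M by (simp add: field_simps)
        then show ?thesis unfolding add_divide_distrib[symmetric] C_def .
      qed
      finally have "A (norm ((\<chi> l. cv (\<lambda>y. u y $ l) (\<Phi> z0) x) - v x) / C) \<le> A ((1 / M) * ((X h x / (2 * b) + Y h / (2 * b)) / 2))"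
        using C by (intro young_mono[OF A]) auto
      also have "\<dots> \<le> ennreal (1 / M) * A ((X h x / (2 * b) + Y h / (2 * b)) / 2)"
        using M b X0[of x] Y0 by (intro young_scale[OF A]) auto
      also have "\<dots> \<le> ennreal (1 / M) * (ennreal (1/2) * A (X h x / (2 * b)) + ennreal (1/2) * A (Y h / (2 * b)))"
        using b X0[of x] Y0 by (intro mult_left_mono young_midpoint[OF A]) auto
      also have "\<dots> \<le> ennreal (1 / M) * (1 * A (X h x / (2 * b)) + 1 * A (Y h / (2 * b)))"
        by (intro mult_left_mono add_mono mult_right_mono half) auto
      finally show ?thesis by simp
    qed
    have Yb: "A (Y h / (2 * b)) \<le> ennreal (1 / b)"
    proof -
      have ii: "integrable lborel (indicator (cball p r) :: real^'n \<Rightarrow> real)" using bE by (simp add: integrable_indicator_iff)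
      have "A ((\<integral>z. (indicator (cball p r) z / b) * h z \<partial>lborel) / 2) \<le> (\<integral>\<^sup>+z. ennreal (indicator (cball p r) z / b) * A (h z) \<partial>lborel)"
      proof (rule young_Jensen[OF A])
        show "integrable lborel (\<lambda>z. indicator (cball p r) z / b :: real)" using ii by simp
        show "(\<integral>z. indicator (cball p r) z / b \<partial>lborel) = 1" using b by (simp add: b_def)
        show "integrable lborel (\<lambda>z. (indicator (cball p r) z / b) * h z)"
          using integrable_divide[OF integrable_indicator_continuous[OF compact_cball ch], of p r b] by simp
      qed (use b h0 ch in \<open>auto intro: borel_measurable_continuous_onI\<close>)
      also have "\<dots> \<le> (\<integral>\<^sup>+z. ennreal (1 / b) * A (h z) \<partial>lborel)"
        using b by (intro nn_integral_mono mult_right_mono ennreal_leI) (auto simp: indicator_def)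
      also have "\<dots> = ennreal (1 / b) * (\<integral>\<^sup>+z. A (h z) \<partial>lborel)"
        using young_measurable[OF A borel_measurable_continuous_onI[OF ch] h0] by (intro nn_integral_cmult) simp
      also have "\<dots> \<le> ennreal (1 / b) * 1" by (intro mult_left_mono Ih) auto
      finally show ?thesis by (simp add: Y_def mult.commute)
    qed
    have Xm: "(\<lambda>x. indicator (cball 0 R) x * A (X h x / (2 * b))) \<in> borel_measurable borel"
    proof (intro borel_measurable_times_ennreal young_measurable[OF A] borel_measurable_indicator)
      have [measurable]: "h \<in> borel_measurable borel" using ch by (rule borel_measurable_continuous_onI)
      define jB where "jB = (indicator (cball p r) :: real^'n \<Rightarrow> real)"
      have [measurable]: "jB \<in> borel_measurable borel" unfolding jB_def by (rule borel_measurable_indicator) simp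
      show "(\<lambda>x. X h x / (2 * b)) \<in> borel_measurable borel"
        unfolding X_def jB_def[symmetric] by measurable
      show "0 \<le> X h x / (2 * b)" for x using X0[of x] b by simp
    qed simp
    show "\<exists>w\<in>Sigma_fields. \<forall>V\<in>sets borel. V \<subseteq> cball 0 R \<longrightarrow>
        (\<forall>x\<in>V. \<forall>z\<in>cball p r. \<forall>t\<in>{0..1}. cball (x + t *\<^sub>R (z - x)) s \<subseteq> \<Omega>) \<longrightarrow>
        (\<integral>\<^sup>+x. indicator V x * A (norm ((\<chi> l. cv (\<lambda>y. u y $ l) (\<Phi> z0) x) - w x) / C) \<partial>lborel) \<le> 1"
    proof (intro bexI[OF _ v(1)] ballI impI)
      fix V :: "(real^'n) set"
      assume V: "V \<in> sets borel" "V \<subseteq> cball 0 R" "\<forall>x\<in>V. \<forall>z\<in>cball p r. \<forall>t\<in>{0..1}. cball (x + t *\<^sub>R (z - x)) s \<subseteq> \<Omega>"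
      have "(\<integral>\<^sup>+x. indicator V x * A (norm ((\<chi> l. cv (\<lambda>y. u y $ l) (\<Phi> z0) x) - v x) / C) \<partial>lborel)
        \<le> (\<integral>\<^sup>+x. ennreal (1 / M) * (indicator (cball 0 R) x * A (X h x / (2 * b)) + ennreal (1 / b) * indicator (cball 0 R) x) \<partial>lborel)"
      proof (rule nn_integral_mono)
        fix x
        show "indicator V x * A (norm ((\<chi> l. cv (\<lambda>y. u y $ l) (\<Phi> z0) x) - v x) / C)
          \<le> ennreal (1 / M) * (indicator (cball 0 R) x * A (X h x / (2 * b)) + ennreal (1 / b) * indicator (cball 0 R) x)"
        proof (cases "x \<in> V")
          case True
          then have x: "x \<in> cball 0 R" "\<forall>z\<in>cball p r. \<forall>t\<in>{0..1}. cball (x + t *\<^sub>R (z - x)) s \<subseteq> \<Omega>" using V by auto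
          then have "A (norm ((\<chi> l. cv (\<lambda>y. u y $ l) (\<Phi> z0) x) - v x) / C) \<le> ennreal (1 / M) * (A (X h x / (2 * b)) + A (Y h / (2 * b)))"
            by (intro pA) auto
          also have "\<dots> \<le> ennreal (1 / M) * (A (X h x / (2 * b)) + ennreal (1 / b))"
            by (intro mult_left_mono add_left_mono Yb) auto
          finally show ?thesis using True x(1) by simp
        qed simp
      qed
      also have "\<dots> = ennreal (1 / M) * ((\<integral>\<^sup>+x. indicator (cball 0 R) x * A (X h x / (2 * b)) \<partial>lborel) + ennreal (1 / b) * ennreal B)"
      proof -
        have m1: "(\<lambda>x. indicator (cball 0 R) x * A (X h x / (2 * b))) \<in> borel_measurable lborel" using Xm by simp
        have m2: "(\<lambda>x. ennreal (1 / b) * indicator (cball (0::real^'n) R) x) \<in> borel_measurable lborel"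
          by (intro borel_measurable_times_ennreal borel_measurable_indicator) auto
        have i: "(\<integral>\<^sup>+x. ennreal (1 / b) * indicator (cball (0::real^'n) R) x \<partial>lborel) = ennreal (1 / b) * ennreal B"
          unfolding BE[symmetric] by (rule nn_integral_cmult_indicator) simp
        show ?thesis
          unfolding i[symmetric] nn_integral_add[OF m1 m2, symmetric]
          by (rule nn_integral_cmult) (intro borel_measurable_add m1 m2)
      qed
      also have "\<dots> \<le> ennreal (1 / M) * (ennreal (2 ^ CARD('n) * (b + B) / b) * 1 + ennreal (1 / b) * ennreal B)"
        using young_segment_average[OF A ch h0 r, of R p] mult_left_mono[OF Ih, of "ennreal (2 ^ CARD('n) * (b + B) / b)"]
        unfolding X_def b_def B_def by (intro mult_left_mono add_right_mono) (auto intro: order_trans)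
      also have "\<dots> = ennreal ((1 / M) * (2 ^ CARD('n) * (b + B) / b + B / b))"
        using M b B0 by (simp add: ennreal_mult[symmetric] ennreal_plus[symmetric] del: ennreal_plus)
      also have "\<dots> \<le> ennreal 1"
      proof (rule ennreal_leI)
        have "(1 / M) * (2 ^ CARD('n) * (b + B) / b + B / b) \<le> (1 / M) * M"
          using M by (intro mult_left_mono) (auto simp: M_def)
        then show "(1 / M) * (2 ^ CARD('n) * (b + B) / b + B / b) \<le> 1" using M by simp
      qed
      finally show "(\<integral>\<^sup>+x. indicator V x * A (norm ((\<chi> l. cv (\<lambda>y. u y $ l) (\<Phi> z0) x) - v x) / C) \<partial>lborel) \<le> 1" by simp
    qed
  qed
qed

section \<open>Conformal Killing fields\<close>

text \<open>The conformal Killing fields are the fields below whose linear part is conformal; keeping the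
  linear part arbitrary makes the parametrization injective.\<close>
type_synonym 'n qcoef = "(real^'n) \<times> (real^'n^'n) \<times> (real^'n)"

definition qf :: "'n::finite qcoef \<Rightarrow> real^'n \<Rightarrow> real^'n" where
  "qf c x = fst c + fst (snd c) *v x + (2 * (snd (snd c) \<bullet> x)) *\<^sub>R x - (norm x)\<^sup>2 *\<^sub>R snd (snd c)"

text \<open>Says that P is a multiple of the identity plus a skew matrix without naming the
  multiple: varying k forces all diagonal entries to agree. The conditions are linear equations, so
  they pass to limits.\<close>

definition conformal :: "real^'n::finite^'n \<Rightarrow> bool" where
  "conformal P \<longleftrightarrow> (\<forall>i j k. P $ i $ j + P $ j $ i = (if i = j then 2 * P $ k $ k else 0))"

lemma qf_add: "qf (c + d) x = qf c x + qf d x"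
  by (simp add: qf_def matrix_vector_mult_add_rdistrib inner_add_left algebra_simps)

lemma qf_scaleR: "qf (r *\<^sub>R c) x = r *\<^sub>R qf c x"
  by (simp add: qf_def scaleR_matrix_vector_assoc[symmetric] algebra_simps)

lemma qf_diff: "qf (c - d) x = qf c x - qf d x"
  using qf_add[of c "(-1) *\<^sub>R d" x] unfolding qf_scaleR by simp

lemma qf_linear: "linear (\<lambda>c. qf c x)"
  by (rule linearI) (simp_all add: qf_add qf_scaleR)

lemma qf_continuous [continuous_intros]: "continuous_on A (qf c)"
  unfolding qf_def[abs_def] by (intro continuous_intros matrix_vector_mult_linear_continuous_on)

lemma qf_measurable [measurable]: "qf c \<in> borel_measurable borel"
  by (intro borel_measurable_continuous_onI qf_continuous)

lemma norm_matrix_vector_le: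
  fixes P :: "real^'n::finite^'m::finite"
  shows "norm (P *v x) \<le> (real CARD('m) * real CARD('n)) * norm P * norm x"
proof -
  have "norm (P *v x) \<le> (\<Sum>i\<in>UNIV. \<bar>(P *v x) $ i\<bar>)" by (rule norm_le_l1_cart)
  also have "\<dots> \<le> (\<Sum>i\<in>(UNIV::'m set). \<Sum>j\<in>(UNIV::'n set). norm P * norm x)"
  proof (intro sum_mono)
    fix i
    have "\<bar>(P *v x) $ i\<bar> \<le> (\<Sum>j\<in>UNIV. \<bar>P $ i $ j * x $ j\<bar>)" unfolding matrix_vector_mult_def by simp
    also have "\<dots> \<le> (\<Sum>j\<in>(UNIV::'n set). norm P * norm x)"
    proof (intro sum_mono)
      fix j
      have "\<bar>P $ i $ j\<bar> \<le> norm P"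
        using component_le_norm_cart[of "P $ i" j] Finite_Cartesian_Product.norm_nth_le[of P i] by linarith
      then show "\<bar>P $ i $ j * x $ j\<bar> \<le> norm P * norm x"
        unfolding abs_mult by (intro mult_mono component_le_norm_cart) auto
    qed
    finally show "\<bar>(P *v x) $ i\<bar> \<le> (\<Sum>j\<in>(UNIV::'n set). norm P * norm x)" .
  qed
  finally show ?thesis by simp
qed

lemma qf_bound:
  fixes R :: real assumes "0 \<le> R"
  obtains K where "K > 0" "\<And>(c::'n::finite qcoef) x. norm x \<le> R \<Longrightarrow> norm (qf c x) \<le> K * norm c"
proof -
  define N where "N = real CARD('n) * real CARD('n)"
  define K where "K = 1 + N * R + 3 * R\<^sup>2"
  have N: "N \<ge> 0" by (simp add: N_def)
  have "norm (qf c x) \<le> K * norm c" if x: "norm x \<le> R" for c :: "'n qcoef" and x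
  proof -
    obtain b P a where c: "c = (b,P,a)" by (cases c)
    have b: "norm b \<le> norm c" "norm P \<le> norm c" "norm a \<le> norm c"
      using norm_fst_le[of b "(P,a)"] norm_snd_le[of "(P,a)" b] norm_fst_le[of P a] norm_snd_le[of a P] unfolding c by linarith+
    have "norm (qf c x) \<le> norm b + norm (P *v x) + norm ((2 * (a \<bullet> x)) *\<^sub>R x) + norm ((norm x)\<^sup>2 *\<^sub>R a)"
      unfolding qf_def c fst_conv snd_conv
      by (intro order_trans[OF norm_triangle_ineq4] add_mono order_trans[OF norm_triangle_ineq] order_refl)
    also have "norm (P *v x) \<le> N * norm c * R"
      unfolding N_def by (rule order_trans[OF norm_matrix_vector_le]) (intro mult_mono b x; simp)
    also have "norm ((2 * (a \<bullet> x)) *\<^sub>R x) \<le> 2 * (norm c * R) * R"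
    proof -
      have "\<bar>a \<bullet> x\<bar> \<le> norm c * R" by (rule order_trans[OF Cauchy_Schwarz_ineq2]) (intro mult_mono b x; simp)
      then show ?thesis unfolding norm_scaleR using assms by (intro mult_mono x) (auto simp: abs_mult)
    qed
    also have "norm ((norm x)\<^sup>2 *\<^sub>R a) \<le> R\<^sup>2 * norm c"
      unfolding norm_scaleR using x by (intro mult_mono b) (auto intro: power_mono)
    finally have "norm (qf c x) \<le> norm b + N * norm c * R + 2 * (norm c * R) * R + R\<^sup>2 * norm c" by simp
    also have "\<dots> \<le> norm c + N * norm c * R + 2 * (norm c * R) * R + R\<^sup>2 * norm c" using b by simp
    also have "\<dots> = K * norm c" by (simp add: K_def algebra_simps power2_eq_square)
    finally show ?thesis .
  qed
  moreover have "K > 0" using N assms by (simp add: K_def add_pos_nonneg)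
  ultimately show ?thesis using that by blast
qed

text \<open>The second symmetric difference at the centre isolates the quadratic part; its inner
  product with y is a multiple of (a.y)|y|^2, so a = 0, and an affine map vanishing on a ball is
  0.\<close>

lemma qf_eq_zero_on_ball:
  fixes c :: "'n::finite qcoef"
  assumes s: "s > 0" and z: "\<And>x. x \<in> ball q s \<Longrightarrow> qf c x = 0"
  shows "c = 0"
proof -
  obtain b P a where c: "c = (b,P,a)" by (cases c)
  have ay: "a \<bullet> y = 0" if y: "norm y < s" for y
  proof -
    have "qf c (q + y) + qf c (q - y) - 2 *\<^sub>R qf c q = 2 *\<^sub>R ((2 * (a \<bullet> y)) *\<^sub>R y - (norm y)\<^sup>2 *\<^sub>R a)"
    proof -
      have n: "(norm (q + y))\<^sup>2 = (norm q)\<^sup>2 + 2 * (q \<bullet> y) + (norm y)\<^sup>2" "(norm (q - y))\<^sup>2 = (norm q)\<^sup>2 - 2 * (q \<bullet> y) + (norm y)\<^sup>2"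
        by (simp_all add: power2_norm_eq_inner inner_add_left inner_add_right inner_diff_left inner_diff_right inner_commute)
      show ?thesis
        unfolding qf_def c fst_conv snd_conv n
        by (simp add: vec_eq_iff matrix_vector_right_distrib matrix_vector_mult_diff_distrib inner_add_right inner_diff_right algebra_simps)
    qed
    moreover have "qf c (q + y) = 0" "qf c (q - y) = 0" "qf c q = 0"
      using y s by (auto intro!: z simp: dist_norm)
    ultimately have "(2 * (a \<bullet> y)) *\<^sub>R y - (norm y)\<^sup>2 *\<^sub>R a = 0" by simp
    then have "((2 * (a \<bullet> y)) *\<^sub>R y - (norm y)\<^sup>2 *\<^sub>R a) \<bullet> y = 0" by simp
    then have "(a \<bullet> y) * (norm y)\<^sup>2 = 0"
      by (simp add: inner_diff_left dot_square_norm algebra_simps)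
    then show ?thesis by auto
  qed
  have a: "a = 0"
  proof (rule ccontr)
    assume "a \<noteq> 0"
    then have "a \<bullet> ((s / 2 / norm a) *\<^sub>R a) = 0" using s by (intro ay) simp
    then show False using \<open>a \<noteq> 0\<close> s by simp
  qed
  have lin: "b + P *v x = 0" if "x \<in> ball q s" for x using z[OF that] by (simp add: qf_def c a)
  have Py: "P *v y = 0" if "norm y < s" for y
    using lin[of "q + y"] lin[of q] that s by (simp add: dist_norm matrix_vector_right_distrib add.assoc[symmetric])
  have "P *v y = 0" for y
  proof (cases "y = 0")
    case False
    have "P *v ((s / 2 / norm y) *\<^sub>R y) = 0" by (rule Py) (use False s in simp)
    then show ?thesis using False s by (simp add: matrix_vector_mult_scaleR)
  qed simp
  then have P: "P = 0" by (simp add: matrix_eq)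
  then have "b = 0" using lin[of q] s by simp
  then show ?thesis using a P c by (simp add: zero_prod_def)
qed

text \<open>The L^1 norm on the ball is a continuous norm on the finite-dimensional coefficient
  space, so it has a positive minimum on the unit sphere. All later control of fields of \<Sigma>
  comes from this.\<close>

lemma qf_norm_equivalence:
  fixes q :: "real^'n::finite"
  assumes s: "s > 0"
  obtains \<kappa> where "\<kappa> > 0" "\<And>c. ennreal (\<kappa> * norm c) \<le> (\<integral>\<^sup>+x. indicator (ball q s) x * ennreal (norm (qf c x)) \<partial>lborel)"
proof -
  define N where "N c = (\<integral>x. indicator (ball q s) x * norm (qf c x) \<partial>lborel)" for c :: "'n qcoef"
  obtain K where K: "K > 0" "\<And>(c::'n qcoef) x. norm x \<le> norm q + s \<Longrightarrow> norm (qf c x) \<le> K * norm c"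
    using qf_bound[of "norm q + s"] s by auto
  have inb: "norm x \<le> norm q + s" if "x \<in> ball q s" for x
    using that norm_triangle_sub[of x q] by (simp add: dist_norm norm_minus_commute)
  have int: "integrable lborel (\<lambda>x. indicator (ball q s) x * norm (qf c x))" for c :: "'n qcoef"
  proof -
    have "integrable lborel (\<lambda>x. indicator (ball q s) x * (K * norm c))"
      by (intro integrable_mult_left integrable_indicator_ball)
    then show ?thesis
      by (rule Bochner_Integration.integrable_bound) (use K inb in \<open>auto simp: indicator_def abs_mult intro: order_trans[OF K(2)]\<close>)
  qed
  define m where "m = measure lborel (ball q s)"
  have Nb: "N c \<le> K * m * norm c" for c :: "'n qcoef"
  proof -
    have "N c \<le> (\<integral>x. indicator (ball q s) x * (K * norm c) \<partial>lborel)"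
      unfolding N_def
      by (intro integral_mono int integrable_mult_left integrable_indicator_ball) (use K inb in \<open>auto simp: indicator_def\<close>)
    then show ?thesis by (simp add: m_def mult_ac)
  qed
  have Nadd: "N (c + d) \<le> N c + N d" for c d :: "'n qcoef"
  proof -
    have "N (c + d) \<le> (\<integral>x. indicator (ball q s) x * norm (qf c x) + indicator (ball q s) x * norm (qf d x) \<partial>lborel)"
      unfolding N_def by (intro integral_mono int Bochner_Integration.integrable_add)
        (auto simp: qf_add norm_triangle_ineq indicator_def)
    then show ?thesis unfolding N_def using int by simp
  qed
  have Nscale: "N (r *\<^sub>R c) = \<bar>r\<bar> * N c" for r and c :: "'n qcoef"
    unfolding N_def qf_scaleR by (simp add: mult.left_commute)
  have Ndiff: "\<bar>N c - N d\<bar> \<le> K * m * norm (c - d)" for c d :: "'n qcoef"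
    using Nadd[of d "c - d"] Nadd[of c "d - c"] Nb[of "c - d"] Nb[of "d - c"] by (simp add: norm_minus_commute)
  have "continuous_on UNIV N"
  proof (rule continuous_onI)
    fix d :: "'n qcoef" and e :: real assume "e > 0"
    have L: "K * m + 1 > 0" using K by (simp add: m_def add_nonneg_pos)
    show "\<exists>\<delta>>0. \<forall>c\<in>UNIV. dist c d < \<delta> \<longrightarrow> dist (N c) (N d) \<le> e"
    proof (intro exI[of _ "e / (K * m + 1)"] conjI ballI impI)
      show "e / (K * m + 1) > 0" using L \<open>e > 0\<close> by simp
      fix c assume "dist c d < e / (K * m + 1)"
      then have "norm (c - d) * (K * m + 1) \<le> e" using L by (simp add: dist_norm pos_less_divide_eq)
      moreover have "\<bar>N c - N d\<bar> \<le> norm (c - d) * (K * m + 1)"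
        by (rule order_trans[OF Ndiff]) (simp add: algebra_simps)
      ultimately show "dist (N c) (N d) \<le> e" by (simp add: dist_real_def)
    qed
  qed
  then have cN: "continuous_on (sphere 0 1) N" by (rule continuous_on_subset) auto
  have "sphere 0 1 \<noteq> ({} :: 'n qcoef set)" using vector_choose_size[of 1] by force
  then obtain c0 :: "'n qcoef" where c0: "norm c0 = 1" "\<And>c. norm c = 1 \<Longrightarrow> N c0 \<le> N c"
    using continuous_attains_inf[OF compact_sphere _ cN] by auto
  have N0: "N c \<ge> 0" for c unfolding N_def by (intro Bochner_Integration.integral_nonneg) auto
  have "N c0 \<noteq> 0"
  proof
    assume "N c0 = 0"
    then have "AE x in lborel. indicator (ball q s) x * norm (qf c0 x) = 0"
      unfolding N_def by (subst (asm) integral_nonneg_eq_0_iff_AE[OF int]) auto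
    then have ae: "AE x in lborel. x \<in> ball q s \<longrightarrow> qf c0 x = 0" by eventually_elim (auto simp: indicator_def)
    have "qf c0 x = 0" if x: "x \<in> ball q s" for x
    proof (rule ccontr)
      assume nz: "qf c0 x \<noteq> 0"
      \<comment> \<open>By continuity, non-vanishing at one point holds on an open set, which cannot
        be null.\<close>
      define W where "W = ball q s \<inter> {y. qf c0 y \<noteq> 0}"
      have oW: "open W" unfolding W_def
        by (intro open_Int open_ball open_Collect_neq continuous_on_const qf_continuous)
      have "W \<in> null_sets lborel"
      proof (rule AE_iff_null_sets[THEN iffD2])
        show "W \<in> sets lborel" using oW by auto
        show "AE x in lborel. x \<notin> W" using ae by eventually_elim (auto simp: W_def)
      qed
      moreover have "W \<noteq> {}" using x nz by (auto simp: W_def)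
      ultimately show False
        using open_not_negligible[OF oW] by (simp add: negligible_iff_null_sets null_sets_completionI)
    qed
    then have "c0 = 0" by (rule qf_eq_zero_on_ball[OF s])
    then show False using c0(1) by simp
  qed
  then have pos: "N c0 > 0" using N0[of c0] by simp
  have "N c0 * norm c \<le> N c" for c
  proof (cases "c = 0")
    case False
    have "N c0 \<le> N ((1 / norm c) *\<^sub>R c)" by (rule c0(2)) (use False in simp)
    then show ?thesis using False unfolding Nscale by (simp add: field_simps)
  qed (use N0 in simp)
  then have "ennreal (N c0 * norm c) \<le> (\<integral>\<^sup>+x. indicator (ball q s) x * ennreal (norm (qf c x)) \<partial>lborel)" for c
  proof -
    have "ennreal (N c0 * norm c) \<le> ennreal (N c)" by (rule ennreal_leI) fact
    also have "\<dots> = (\<integral>\<^sup>+x. ennreal (indicator (ball q s) x * norm (qf c x)) \<partial>lborel)"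
      unfolding N_def by (rule nn_integral_eq_integral[OF int, symmetric]) auto
    also have "\<dots> = (\<integral>\<^sup>+x. indicator (ball q s) x * ennreal (norm (qf c x)) \<partial>lborel)"
      by (intro nn_integral_cong) (auto simp: indicator_def)
    finally show ?thesis .
  qed
  then show ?thesis using that pos by blast
qed

lemma Sigma_fields_qf:
  assumes "w \<in> Sigma_fields" obtains c where "conformal (fst (snd c))" "w = qf c"
proof -
  obtain \<rho> b Q a where w: "w = (\<lambda>x. \<rho> *\<^sub>R x + (b + Q *v x) + (2 * (a \<bullet> x)) *\<^sub>R x - (norm x)\<^sup>2 *\<^sub>R a)" and Q: "transpose Q = - Q"
    using assms unfolding Sigma_fields_def by auto
  have q: "Q $ j $ i = - Q $ i $ j" for i j using arg_cong[OF Q, of "\<lambda>M. M $ i $ j"] by (simp add: transpose_def)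
  have q0: "Q $ i $ i = 0" for i using q[of i i] by simp
  define P where "P = \<rho> *\<^sub>R mat 1 + Q"
  have "conformal P"
    unfolding conformal_def
  proof (intro allI)
    fix i j k
    show "P $ i $ j + P $ j $ i = (if i = j then 2 * P $ k $ k else 0)"
      using q[of i j] by (cases "i = j") (auto simp: P_def mat_def q0)
  qed
  moreover have "w = qf (b, P, a)"
    by (simp add: w qf_def P_def fun_eq_iff matrix_vector_mult_add_rdistrib scaleR_matrix_vector_assoc[symmetric])
  ultimately show ?thesis using that[of "(b,P,a)"] by simp
qed

lemma qf_in_Sigma_fields:
  assumes "conformal (fst (snd c))" shows "qf c \<in> Sigma_fields"
proof -
  obtain b P a where c: "c = (b,P,a)" by (cases c)
  \<comment> \<open>Any index serves here, since conformality makes all diagonal entries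
    equal.\<close>
  define \<rho> where "\<rho> = P $ undefined $ undefined"
  define Q where "Q = P - \<rho> *\<^sub>R mat 1"
  have e: "P $ i $ j + P $ j $ i = (if i = j then 2 * \<rho> else 0)" for i j
    using assms unfolding c conformal_def \<rho>_def fst_conv snd_conv by blast
  have "transpose Q $ i $ j = (- Q) $ i $ j" for i j
    using e[of i j] by (cases "i = j") (auto simp: Q_def transpose_def mat_def)
  then have "transpose Q = - Q" unfolding vec_eq_iff by blast
  moreover have "qf c = (\<lambda>x. \<rho> *\<^sub>R x + (b + Q *v x) + (2 * (a \<bullet> x)) *\<^sub>R x - (norm x)\<^sup>2 *\<^sub>R a)"
    by (simp add: c qf_def Q_def fun_eq_iff matrix_vector_mult_diff_rdistrib scaleR_matrix_vector_assoc[symmetric])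
  ultimately show ?thesis unfolding Sigma_fields_def by blast
qed

text \<open>Keeps limits of coefficients inside \<Sigma> when the mollification is removed.\<close>

lemma conformal_limit:
  assumes "\<And>k. conformal (fst (snd (c k)))" "c \<longlonglongrightarrow> d"
  shows "conformal (fst (snd d))"
  unfolding conformal_def
proof (intro allI)
  fix i j l
  have t: "(\<lambda>k. fst (snd (c k)) $ i $ j) \<longlonglongrightarrow> fst (snd d) $ i $ j" for i j
    by (intro tendsto_vec_nth tendsto_fst tendsto_snd assms)
  have l: "(\<lambda>k. fst (snd (c k)) $ i $ j + fst (snd (c k)) $ j $ i) \<longlonglongrightarrow> fst (snd d) $ i $ j + fst (snd d) $ j $ i"
    by (intro tendsto_add t)
  have r: "(\<lambda>k. if i = j then 2 * fst (snd (c k)) $ l $ l else 0) \<longlonglongrightarrow> (if i = j then 2 * fst (snd d) $ l $ l else 0)"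
    by (auto intro!: tendsto_intros t)
  have "(\<lambda>k. fst (snd (c k)) $ i $ j + fst (snd (c k)) $ j $ i) = (\<lambda>k. if i = j then 2 * fst (snd (c k)) $ l $ l else 0)"
    by (rule ext) (use assms(1) in \<open>unfold conformal_def, blast\<close>)
  from l[unfolded this] r show "fst (snd d) $ i $ j + fst (snd d) $ j $ i = (if i = j then 2 * fst (snd d) $ l $ l else 0)"
    by (rule LIMSEQ_unique)
qed

lemma Sigma_fields_scaleR:
  assumes "w \<in> Sigma_fields" shows "(\<lambda>x. r *\<^sub>R w x) \<in> Sigma_fields"
proof -
  obtain c where c: "conformal (fst (snd c))" "w = qf c" using Sigma_fields_qf[OF assms] .
  have "conformal (fst (snd (r *\<^sub>R c)))"
    unfolding conformal_def
  proof (intro allI)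
    fix i j k
    have "fst (snd c) $ i $ j + fst (snd c) $ j $ i = (if i = j then 2 * fst (snd c) $ k $ k else 0)"
      using c(1) unfolding conformal_def by blast
    from arg_cong[OF this, of "\<lambda>t. r * t"]
    show "fst (snd (r *\<^sub>R c)) $ i $ j + fst (snd (r *\<^sub>R c)) $ j $ i = (if i = j then 2 * fst (snd (r *\<^sub>R c)) $ k $ k else 0)"
      by (auto simp: distrib_left)
  qed
  from qf_in_Sigma_fields[OF this] show ?thesis by (simp add: c(2) qf_scaleR[abs_def])
qed

text \<open>Makes L^1 an instance of the Orlicz estimates; used for bounding mollifications and for
  the blow-up.\<close>

lemma young_ennreal: "young_function ennreal"
  unfolding young_function_def
proof (intro conjI allI impI)
  fix s t l :: real assume "0 \<le> s" "0 \<le> t" "0 < l" "l < 1"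
  then show "ennreal (l * s + (1 - l) * t) \<le> ennreal l * ennreal s + ennreal (1 - l) * ennreal t"
    by (simp add: ennreal_mult[symmetric] ennreal_plus[symmetric] del: ennreal_plus)
next
  fix t :: real
  show "(ennreal \<longlongrightarrow> ennreal t) (at_left t)" by (intro tendsto_ennrealI tendsto_ident_at)
qed (auto intro: exI[of _ 1])

section \<open>Star-shaped domains\<close>

definition mollify :: "(('n::finite \<Rightarrow> nat) \<Rightarrow> real^'n \<Rightarrow> real) \<Rightarrow> real \<Rightarrow> ('n \<Rightarrow> nat) \<Rightarrow> real^'n \<Rightarrow> real" where
  "mollify \<Phi> r = (\<lambda>m x. (1 / r ^ CARD('n)) / r ^ (\<Sum>i\<in>UNIV. m i) * \<Phi> m (x /\<^sub>R r))"

lemma mollify_props: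
  fixes \<Phi> :: "('n::finite \<Rightarrow> nat) \<Rightarrow> real^'n \<Rightarrow> real"
  assumes \<Phi>: "kernel_family 1 \<Phi>" "\<And>x. \<Phi> z0 x \<ge> 0" "(\<integral>x. \<Phi> z0 x \<partial>lborel) = 1" and r: "r > 0"
  shows "kernel_family r (mollify \<Phi> r)" "mollify \<Phi> r z0 x \<ge> 0" "(\<integral>x. mollify \<Phi> r z0 x \<partial>lborel) = 1"
proof -
  show k: "kernel_family r (mollify \<Phi> r)"
    using kernel_family_scale[OF \<Phi>(1) r, of "1 / r ^ CARD('n)"] by (simp add: mollify_def)
  show "mollify \<Phi> r z0 x \<ge> 0" using \<Phi>(2) r by (simp add: mollify_def)
  have "(\<integral>x. mollify \<Phi> r z0 x \<partial>lborel) = (\<bar>r\<bar> ^ DIM(real^'n)) *\<^sub>R (\<integral>x. mollify \<Phi> r z0 (0 + r *\<^sub>R x) \<partial>lborel)"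
    using r kernel_family_continuous[OF k, of UNIV z0]
    by (intro integral_lborel_affine) (auto intro: borel_measurable_continuous_onI)
  also have "\<dots> = 1" using r \<Phi>(3) by (simp add: mollify_def)
  finally show "(\<integral>x. mollify \<Phi> r z0 x \<partial>lborel) = 1" .
qed

text \<open>A bounded kernel in the unit ball turns the error into the mean oscillation that
  \<open>Lebesgue_points_along_sequence\<close> sends to 0 almost everywhere.\<close>

lemma mollify_error:
  fixes \<Phi> :: "('n::finite \<Rightarrow> nat) \<Rightarrow> real^'n \<Rightarrow> real"
  assumes \<Phi>: "kernel_family 1 \<Phi>" "\<And>x. \<Phi> z0 x \<ge> 0" "(\<integral>x. \<Phi> z0 x \<partial>lborel) = 1" and r: "r > 0"
    and f: "integrable lborel f" and K: "\<And>x. \<bar>\<Phi> z0 x\<bar> \<le> K"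
  shows "\<bar>cv f (mollify \<Phi> r z0) x - f x\<bar> \<le> K * (\<integral>y. indicator (ball 0 1) y * norm (f (x + r *\<^sub>R y) - f x) \<partial>lborel)"
proof -
  have [measurable]: "f \<in> borel_measurable borel" using f by simp
  have \<Phi>m[measurable]: "\<Phi> z0 \<in> borel_measurable borel"
    using kernel_family_continuous[OF \<Phi>(1)] by (rule borel_measurable_continuous_onI)
  have mm[measurable]: "mollify \<Phi> r z0 \<in> borel_measurable borel"
    using kernel_family_continuous[OF mollify_props(1)[OF \<Phi> r]] by (rule borel_measurable_continuous_onI)
  have i1: "integrable lborel (\<lambda>y. \<Phi> z0 (- y))"
    using integrable_lborel_affine[OF kernel_family_integrable[OF \<Phi>(1), of z0], of "-1" 0] by simp
  have one: "(\<integral>y. \<Phi> z0 (- y) \<partial>lborel) = 1"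
    using integral_lborel_affine[OF \<Phi>m, of "-1" 0] \<Phi>(3) by simp
  have i2: "integrable lborel (\<lambda>y. f (x + r *\<^sub>R y) * \<Phi> z0 (- y))"
    using cv_integrable[OF integrable_lborel_affine[OF f, of r x] \<Phi>(1), of z0 0] r by simp
  have "cv f (mollify \<Phi> r z0) x = (\<bar>r\<bar> ^ DIM(real^'n)) *\<^sub>R (\<integral>y. f (x + r *\<^sub>R y) * mollify \<Phi> r z0 (x - (x + r *\<^sub>R y)) \<partial>lborel)"
    unfolding cv_def using r by (intro integral_lborel_affine) auto
  also have "\<dots> = (\<integral>y. f (x + r *\<^sub>R y) * \<Phi> z0 (- y) \<partial>lborel)"
    using r by (simp add: mollify_def)
  finally have "cv f (mollify \<Phi> r z0) x - f x = (\<integral>y. f (x + r *\<^sub>R y) * \<Phi> z0 (- y) \<partial>lborel) - (\<integral>y. f x * \<Phi> z0 (- y) \<partial>lborel)"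
    using one by simp
  also have "\<dots> = (\<integral>y. (f (x + r *\<^sub>R y) - f x) * \<Phi> z0 (- y) \<partial>lborel)"
    using i1 i2 by (simp add: left_diff_distrib)
  also have "\<bar>\<dots>\<bar> \<le> (\<integral>y. K * (indicator (ball 0 1) y * norm (f (x + r *\<^sub>R y) - f x)) \<partial>lborel)"
  proof (rule order_trans[OF integral_abs_bound integral_mono_AE'])
    show "integrable lborel (\<lambda>y. K * (indicator (ball 0 1) y * norm (f (x + r *\<^sub>R y) - f x)))"
      using integrable_indicator_shift[OF f, of r x "f x"] r by simp
    show "AE y in lborel. \<bar>(f (x + r *\<^sub>R y) - f x) * \<Phi> z0 (- y)\<bar> \<le> K * (indicator (ball 0 1) y * norm (f (x + r *\<^sub>R y) - f x))"
    proof (rule AE_I2)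
      fix y
      show "\<bar>(f (x + r *\<^sub>R y) - f x) * \<Phi> z0 (- y)\<bar> \<le> K * (indicator (ball 0 1) y * norm (f (x + r *\<^sub>R y) - f x))"
      proof (cases "norm y < 1")
        case True
        then show ?thesis using mult_left_mono[OF K[of "- y"], of "\<bar>f (x + r *\<^sub>R y) - f x\<bar>"] by (simp add: abs_mult mult.commute)
      next
        case False
        then have "\<Phi> z0 (- y) = 0" using \<Phi>(1) by (simp add: kernel_family_def)
        then show ?thesis using False by simp
      qed
    qed
    have "0 \<le> K" using K[of 0] by linarith
    then show "AE y in lborel. 0 \<le> K * (indicator (ball 0 1) y * norm (f (x + r *\<^sub>R y) - f x))" by auto
  qed
  finally show ?thesis by simp
qed

text \<open>The case A(t) = t of \<open>young_mollified\<close>; the factor 2 is inherited from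
  there.\<close>

lemma cv_L1_bound:
  fixes \<Phi> :: "('n::finite \<Rightarrow> nat) \<Rightarrow> real^'n \<Rightarrow> real"
  assumes f: "integrable lborel f" and \<Phi>: "kernel_family s \<Phi>" "\<And>x. 0 \<le> \<Phi> z0 x" "(\<integral>x. \<Phi> z0 x \<partial>lborel) = 1"
  shows "(\<integral>\<^sup>+x. ennreal \<bar>cv f (\<Phi> z0) x\<bar> \<partial>lborel) \<le> 2 * (\<integral>\<^sup>+x. ennreal \<bar>f x\<bar> \<partial>lborel)"
proof -
  have le: "\<bar>cv f (\<Phi> z0) x\<bar> \<le> cv (\<lambda>y. \<bar>f y\<bar>) (\<Phi> z0) x" for x
    unfolding cv_def
  proof (rule order_trans[OF integral_abs_bound integral_mono_AE'])
    show "integrable lborel (\<lambda>y. \<bar>f y\<bar> * \<Phi> z0 (x - y))" by (rule cv_integrable[OF integrable_abs[OF f] \<Phi>(1)])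
  qed (use \<Phi>(2) in \<open>auto simp: abs_mult\<close>)
  have "(\<integral>\<^sup>+x. ennreal \<bar>cv f (\<Phi> z0) x\<bar> \<partial>lborel) \<le> (\<integral>\<^sup>+x. 2 * ennreal (cv (\<lambda>y. \<bar>f y\<bar>) (\<Phi> z0) x / 2) \<partial>lborel)"
  proof (rule nn_integral_mono)
    fix x
    have "ennreal \<bar>cv f (\<Phi> z0) x\<bar> \<le> ennreal (2 * (cv (\<lambda>y. \<bar>f y\<bar>) (\<Phi> z0) x / 2))" using le[of x] by (intro ennreal_leI) simp
    also have "\<dots> = 2 * ennreal (cv (\<lambda>y. \<bar>f y\<bar>) (\<Phi> z0) x / 2)"
      by (subst ennreal_mult') auto
    finally show "ennreal \<bar>cv f (\<Phi> z0) x\<bar> \<le> 2 * ennreal (cv (\<lambda>y. \<bar>f y\<bar>) (\<Phi> z0) x / 2)" .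
  qed
  also have "\<dots> = 2 * (\<integral>\<^sup>+x. ennreal (cv (\<lambda>y. \<bar>f y\<bar>) (\<Phi> z0) x / 2) \<partial>lborel)"
  proof (rule nn_integral_cmult)
    have "(\<lambda>x. cv (\<lambda>y. \<bar>f y\<bar>) (\<Phi> z0) x / 2) \<in> borel_measurable borel"
      by (intro borel_measurable_continuous_onI continuous_intros cv_continuous[OF integrable_abs[OF f] \<Phi>(1)]) auto
    then show "(\<lambda>x. ennreal (cv (\<lambda>y. \<bar>f y\<bar>) (\<Phi> z0) x / 2)) \<in> borel_measurable lborel" by simp
  qed
  also have "\<dots> \<le> 2 * (\<integral>\<^sup>+x. ennreal \<bar>f x\<bar> \<partial>lborel)"
    by (intro mult_left_mono young_mollified[OF young_ennreal integrable_abs[OF f] _ \<Phi>]) auto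
  finally show ?thesis .
qed


section \<open>Points whose segments to a ball stay well inside a domain\<close>

lemma open_forall_compact:
  fixes f :: "'a::euclidean_space \<times> 'b::euclidean_space \<Rightarrow> 'c::topological_space"
  assumes "compact K" "open U" "continuous_on UNIV f"
  shows "open {x. \<forall>k\<in>K. f (k, x) \<in> U}"
proof -
  have c: "closed {x. \<exists>k. k \<in> K \<and> (k, x) \<in> f -` (- U)}"
    by (intro closed_compact_projection assms(1) closed_vimage assms(3)) (use assms(2) in auto)
  have "- {x. \<exists>k. k \<in> K \<and> (k, x) \<in> f -` (- U)} = {x. \<forall>k\<in>K. f (k, x) \<in> U}" by auto
  with open_Compl[OF c] show ?thesis by (simp only:)
qed

text \<open>A condition quantified over the compact set of all triples (z, t, displacement), so
  \<open>open_forall_compact\<close> applies. With s = 0 it is plain visibility of the ball.\<close>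

lemma open_segment_core:
  fixes U :: "'a::euclidean_space set"
  assumes "open U"
  shows "open {x. \<forall>z\<in>cball p r. \<forall>t\<in>{0..1::real}. cball (x + t *\<^sub>R (z - x)) s \<subseteq> U}"
proof -
  define K where "K = cball p r \<times> {0..1::real} \<times> cball (0::'a) s"
  have "open {x. \<forall>k\<in>K. (\<lambda>(k, x). x + fst (snd k) *\<^sub>R (fst k - x) + snd (snd k)) (k, x) \<in> U}"
    unfolding K_def case_prod_unfold
    by (intro open_forall_compact compact_Times assms continuous_intros) auto
  also have "{x. \<forall>k\<in>K. (\<lambda>(k, x). x + fst (snd k) *\<^sub>R (fst k - x) + snd (snd k)) (k, x) \<in> U}
     = {x. \<forall>z\<in>cball p r. \<forall>t\<in>{0..1::real}. cball (x + t *\<^sub>R (z - x)) s \<subseteq> U}"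
  proof (intro Collect_cong iffI ballI subsetI)
    fix x z t y assume a: "\<forall>k\<in>K. (\<lambda>(k, x). x + fst (snd k) *\<^sub>R (fst k - x) + snd (snd k)) (k, x) \<in> U"
      and z: "z \<in> cball p r" "t \<in> {0..1::real}" "y \<in> cball (x + t *\<^sub>R (z - x)) s"
    have "(z, t, y - (x + t *\<^sub>R (z - x))) \<in> K" using z by (auto simp: K_def dist_norm norm_minus_commute)
    from bspec[OF a this] show "y \<in> U" by simp
  next
    fix x k assume a: "\<forall>z\<in>cball p r. \<forall>t\<in>{0..1::real}. cball (x + t *\<^sub>R (z - x)) s \<subseteq> U" and k: "k \<in> K"
    obtain z t e where e: "k = (z, t, e)" by (cases k) auto
    have "x + t *\<^sub>R (z - x) + e \<in> cball (x + t *\<^sub>R (z - x)) s" using k by (auto simp: e K_def dist_norm)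
    then have "x + t *\<^sub>R (z - x) + e \<in> U" using a k unfolding e K_def by blast
    then show "(\<lambda>(k, x). x + fst (snd k) *\<^sub>R (fst k - x) + snd (snd k)) (k, x) \<in> U" by (simp add: e)
  qed
  finally show ?thesis .
qed

text \<open>The union of the segments from x to the ball is compact, so it has positive distance
  from the complement; hence x belongs to the core for all small margins.\<close>

lemma segment_core_eventually:
  fixes U :: "'a::euclidean_space set" and x p :: 'a
  assumes U: "open U" and star: "\<And>z t. z \<in> cball p r \<Longrightarrow> t \<in> {0..1::real} \<Longrightarrow> x + t *\<^sub>R (z - x) \<in> U"
  obtains e where "e > 0" "\<And>s. s \<le> e \<Longrightarrow> \<forall>z\<in>cball p r. \<forall>t\<in>{0..1::real}. cball (x + t *\<^sub>R (z - x)) s \<subseteq> U"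
proof -
  define S where "S = (\<lambda>q. x + snd q *\<^sub>R (fst q - x)) ` (cball p r \<times> {0..1::real})"
  have "compact S" unfolding S_def by (intro compact_continuous_image continuous_intros compact_Times) auto
  moreover have "S \<subseteq> U" using star by (auto simp: S_def)
  ultimately obtain e where e: "e > 0" "(\<Union>y\<in>S. cball y e) \<subseteq> U"
    using compact_subset_open_imp_cball_epsilon_subset[OF _ U] by blast
  have "\<forall>z\<in>cball p r. \<forall>t\<in>{0..1::real}. cball (x + t *\<^sub>R (z - x)) s \<subseteq> U" if "s \<le> e" for s
  proof (intro ballI)
    fix z t assume "z \<in> cball p r" "t \<in> {0..1::real}"
    then have "x + t *\<^sub>R (z - x) \<in> S" by (force simp: S_def)
    then show "cball (x + t *\<^sub>R (z - x)) s \<subseteq> U" using e(2) subset_cball[OF that, of "x + t *\<^sub>R (z - x)"] by blast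
  qed
  then show ?thesis using that e(1) by blast
qed

lemma young_L1_bound:
  fixes S :: "'a::euclidean_space set" and f :: "'a \<Rightarrow> real"
  assumes A: "young_function A" and S: "S \<in> sets borel" "bounded S"
  obtains K where "K \<ge> 0" "\<And>f::'a \<Rightarrow> real. f \<in> borel_measurable borel \<Longrightarrow> (\<And>x. 0 \<le> f x) \<Longrightarrow>
     (\<integral>\<^sup>+x. indicator S x * A (f x) \<partial>lborel) \<le> 1 \<Longrightarrow> (\<integral>\<^sup>+x. indicator S x * ennreal (f x) \<partial>lborel) \<le> ennreal K"
proof -
  obtain a b where ab: "0 \<le> a" "0 \<le> b" "\<And>t. 0 \<le> t \<Longrightarrow> ennreal t \<le> ennreal a + ennreal b * A t"
    using young_linear_bound[OF A] by metis
  obtain R where "\<And>x. x \<in> S \<Longrightarrow> norm x \<le> R" using S(2) by (auto simp: bounded_iff)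
  then have "S \<subseteq> cball 0 R" by auto
  then have "emeasure lborel S \<le> emeasure lborel (cball (0::'a) R)" by (intro emeasure_mono) auto
  then have "emeasure lborel S < \<infinity>" using emeasure_lborel_cball_finite[of "0::'a" R] by simp
  then have m: "enn2real (emeasure lborel S) \<ge> 0" "emeasure lborel S = ennreal (enn2real (emeasure lborel S))" by simp_all
  define m where "m = enn2real (emeasure lborel S)"
  note m = m[folded m_def]
  have "(\<integral>\<^sup>+x. indicator S x * ennreal (f x) \<partial>lborel) \<le> ennreal (a * m + b)"
    if f: "f \<in> borel_measurable borel" "\<And>x. 0 \<le> f x" "(\<integral>\<^sup>+x. indicator S x * A (f x) \<partial>lborel) \<le> 1" for f :: "'a \<Rightarrow> real"
  proof -
    have m1: "(\<lambda>x. ennreal a * indicator S x) \<in> borel_measurable lborel"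
      by (intro borel_measurable_times_ennreal borel_measurable_indicator) (use S in auto)
    have m2: "(\<lambda>x. indicator S x * A (f x)) \<in> borel_measurable lborel"
      by (intro borel_measurable_times_ennreal borel_measurable_indicator young_measurable[OF A]) (use S f in auto)
    have m3: "(\<lambda>x. ennreal b * (indicator S x * A (f x))) \<in> borel_measurable lborel"
      by (intro borel_measurable_times_ennreal m2) auto
    have "(\<integral>\<^sup>+x. indicator S x * ennreal (f x) \<partial>lborel) \<le> (\<integral>\<^sup>+x. ennreal a * indicator S x + ennreal b * (indicator S x * A (f x)) \<partial>lborel)"
      by (intro nn_integral_mono) (use ab(3) f(2) in \<open>auto simp: indicator_def\<close>)
    also have "\<dots> = (\<integral>\<^sup>+x. ennreal a * indicator S x \<partial>lborel) + (\<integral>\<^sup>+x. ennreal b * (indicator S x * A (f x)) \<partial>lborel)"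
      by (rule nn_integral_add[OF m1 m3])
    also have "(\<integral>\<^sup>+x. ennreal a * indicator S x \<partial>lborel) = ennreal a * ennreal m"
      unfolding m(2)[symmetric] by (rule nn_integral_cmult_indicator) (use S in auto)
    also have "(\<integral>\<^sup>+x. ennreal b * (indicator S x * A (f x)) \<partial>lborel) = ennreal b * (\<integral>\<^sup>+x. indicator S x * A (f x) \<partial>lborel)"
      by (rule nn_integral_cmult[OF m2])
    also have "ennreal a * ennreal m + ennreal b * (\<integral>\<^sup>+x. indicator S x * A (f x) \<partial>lborel) \<le> ennreal a * ennreal m + ennreal b * 1"
      by (intro add_left_mono mult_left_mono f(3)) auto
    also have "\<dots> = ennreal (a * m + b)" using ab m by (simp add: ennreal_mult)
    finally show ?thesis .
  qed
  moreover have "a * m + b \<ge> 0" using ab m by simp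
  ultimately show ?thesis using that by blast
qed

text \<open>The mollified estimate holds on cores that eventually contain each point of
  \<open>U\<close>. The coefficients of the fields w_k stay bounded because they are controlled on
  the ball, so a subsequence converges, and Fatou's lemma passes to the limit at Lebesgue
  points.\<close>

theorem star_shaped_Korn:
  fixes U :: "(real^'n::finite) set"
  assumes n: "CARD('n) \<ge> 3" and A: "young_function A" and U: "open U" "bounded U" and r: "r > 0"
    and B: "cball p r \<subseteq> U"
    and star: "\<And>x z t. x \<in> U \<Longrightarrow> z \<in> cball p r \<Longrightarrow> t \<in> {0..1::real} \<Longrightarrow> x + t *\<^sub>R (z - x) \<in> U"
  obtains C where "C > 0" "\<And>u G. weak_ED_Borel U u G \<Longrightarrow> (\<integral>\<^sup>+x. A (norm (G x)) \<partial>lborel) \<le> 1 \<Longrightarrow>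
     \<exists>w\<in>Sigma_fields. (\<integral>\<^sup>+x. indicator U x * A (norm (u x - w x) / C) \<partial>lborel) \<le> 1"
proof -
  obtain R where R: "U \<subseteq> cball 0 R" "R \<ge> 0"
  proof -
    obtain R where "\<And>x. x \<in> U \<Longrightarrow> norm x \<le> R" using U(2) by (auto simp: bounded_iff)
    then have "U \<subseteq> cball 0 (max R 0)" by (auto simp: le_max_iff_disj)
    then show ?thesis using that[of "max R 0"] by simp
  qed
  obtain C0 where C0: "C0 > 0"
    "\<And>\<Omega> u G s (\<Phi> :: ('n \<Rightarrow> nat) \<Rightarrow> real^'n \<Rightarrow> real). weak_ED_Borel \<Omega> u G \<Longrightarrow> kernel_family s \<Phi> \<Longrightarrow>
      (\<And>x. 0 \<le> \<Phi> z0 x) \<Longrightarrow> (\<integral>x. \<Phi> z0 x \<partial>lborel) = 1 \<Longrightarrow>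
      (\<And>z. z \<in> cball p r \<Longrightarrow> cball z s \<subseteq> \<Omega>) \<Longrightarrow> (\<integral>\<^sup>+x. A (norm (G x)) \<partial>lborel) \<le> 1 \<Longrightarrow>
      \<exists>w\<in>Sigma_fields. \<forall>V\<in>sets borel. V \<subseteq> cball 0 R \<longrightarrow>
        (\<forall>x\<in>V. \<forall>z\<in>cball p r. \<forall>t\<in>{0..1}. cball (x + t *\<^sub>R (z - x)) s \<subseteq> \<Omega>) \<longrightarrow>
        (\<integral>\<^sup>+x. indicator V x * A (norm ((\<chi> l. cv (\<lambda>y. u y $ l) (\<Phi> z0) x) - w x) / C0) \<partial>lborel) \<le> 1"
    using mollified_modular_estimate[OF n A r R(2), of p] by blast
  obtain \<Phi> :: "('n \<Rightarrow> nat) \<Rightarrow> real^'n \<Rightarrow> real" where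
    \<Phi>: "kernel_family 1 \<Phi>" "\<And>x. \<Phi> z0 x \<ge> 0" "(\<integral>x. \<Phi> z0 x \<partial>lborel) = 1" using mollifier_exists by blast
  obtain K\<Phi> where K\<Phi>: "K\<Phi> > 0" "\<And>x. \<bar>\<Phi> z0 x\<bar> \<le> K\<Phi>" using kernel_family_bounded[OF \<Phi>(1)] by metis
  obtain \<kappa> where \<kappa>: "\<kappa> > 0" "\<And>c. ennreal (\<kappa> * norm c) \<le> (\<integral>\<^sup>+x. indicator (ball p r) x * ennreal (norm (qf c x)) \<partial>lborel)"
    using qf_norm_equivalence[OF r, of p] by blast
  obtain e0 where e0: "e0 > 0" "\<And>s. s \<le> e0 \<Longrightarrow> \<forall>z\<in>cball p r. \<forall>t\<in>{0..1::real}. cball (p + t *\<^sub>R (z - p)) s \<subseteq> U"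
  proof -
    have "p \<in> U" using B r by auto
    show ?thesis using that segment_core_eventually[OF U(1) star[OF \<open>p \<in> U\<close>]] by blast
  qed
  obtain KA where KA: "KA \<ge> 0" "\<And>f::real^'n \<Rightarrow> real. f \<in> borel_measurable borel \<Longrightarrow> (\<And>x. 0 \<le> f x) \<Longrightarrow>
     (\<integral>\<^sup>+x. indicator (ball p r) x * A (f x) \<partial>lborel) \<le> 1 \<Longrightarrow> (\<integral>\<^sup>+x. indicator (ball p r) x * ennreal (f x) \<partial>lborel) \<le> ennreal KA"
    using young_L1_bound[OF A, of "ball p r"] by auto
  show ?thesis
  \<comment> \<open>The factor 2 turns pointwise convergence of v - w into an eventual inequality,
    to which monotonicity of A applies.\<close>
  proof (rule that[of "2 * C0"])
    show "2 * C0 > 0" using C0(1) by simp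
    fix u G assume w: "weak_ED_Borel U u G" and one: "(\<integral>\<^sup>+x. A (norm (G x)) \<partial>lborel) \<le> 1"
    have u: "integrable lborel u" using w by (simp add: weak_ED_Borel_def)
    have ul: "integrable lborel (\<lambda>y. u y $ l)" for l using u integrable_bounded_linear[OF bounded_linear_vec_nth] by blast
    obtain q :: "nat \<Rightarrow> real" where q: "\<And>k. 0 < q k" "q \<longlonglongrightarrow> 0"
      "AE x in lborel. (\<lambda>k. \<integral>y. indicator (ball 0 1) y * norm (u (x + q k *\<^sub>R y) - u x) \<partial>lborel) \<longlonglongrightarrow> 0"
      using Lebesgue_points_along_sequence[OF u] by blast
    obtain k0 where k0: "\<And>k. k \<ge> k0 \<Longrightarrow> q k \<le> e0"
      using order_tendstoD(2)[OF q(2) e0(1)] by (auto simp: eventually_sequentially intro: less_imp_le)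
    \<comment> \<open>The first radii are dropped so that, for every k, the closed balls of radius
      \<open>s k\<close> around the averaging ball lie in \<open>U\<close>.\<close>
    define s where "s k = q (k + k0)" for k
    have s: "s k > 0" "s k \<le> e0" for k using q k0 by (auto simp: s_def)
    have s0: "s \<longlonglongrightarrow> 0" unfolding s_def using q(2) by (rule LIMSEQ_ignore_initial_segment)
    have sAE: "AE x in lborel. (\<lambda>k. \<integral>y. indicator (ball 0 1) y * norm (u (x + s k *\<^sub>R y) - u x) \<partial>lborel) \<longlonglongrightarrow> 0"
      using q(3) unfolding s_def by eventually_elim (rule LIMSEQ_ignore_initial_segment)
    define M where "M k = mollify \<Phi> (s k)" for k
    have M: "kernel_family (s k) (M k)" "\<And>x. M k z0 x \<ge> 0" "(\<integral>x. M k z0 x \<partial>lborel) = 1" for k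
      unfolding M_def using mollify_props[OF \<Phi> s(1)[of k]] by auto
    define v where "v k x = (\<chi> l. cv (\<lambda>y. u y $ l) (M k z0) x)" for k x
    have cvl: "continuous_on UNIV (\<lambda>x. cv (\<lambda>y. u y $ l) (M k z0) x)" for k l by (rule cv_continuous[OF ul M(1)])
    have cv: "continuous_on UNIV (v k)" for k unfolding v_def by (intro continuous_on_vec_lambda cvl)
    have pB: "cball z (s k) \<subseteq> U" if "z \<in> cball p r" for z k
      using bspec[OF bspec[OF e0(2)[OF s(2)[of k]] that], of 1] by simp
    define V where "V k = {x. \<forall>z\<in>cball p r. \<forall>t\<in>{0..1}. cball (x + t *\<^sub>R (z - x)) (s k) \<subseteq> U} \<inter> U" for k
    have Vo: "open (V k)" for k unfolding V_def by (intro open_Int open_segment_core U)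
    have Vb: "V k \<in> sets borel" for k using Vo by auto
    have "\<exists>c. conformal (fst (snd c)) \<and> (\<integral>\<^sup>+x. indicator (V k) x * A (norm (v k x - qf c x) / C0) \<partial>lborel) \<le> 1" for k
    proof -
      obtain w where w: "w \<in> Sigma_fields" "(\<integral>\<^sup>+x. indicator (V k) x * A (norm (v k x - w x) / C0) \<partial>lborel) \<le> 1"
      proof -
        obtain w where w: "w \<in> Sigma_fields" "\<forall>V\<in>sets borel. V \<subseteq> cball 0 R \<longrightarrow>
            (\<forall>x\<in>V. \<forall>z\<in>cball p r. \<forall>t\<in>{0..1}. cball (x + t *\<^sub>R (z - x)) (s k) \<subseteq> U) \<longrightarrow>
            (\<integral>\<^sup>+x. indicator V x * A (norm (v k x - w x) / C0) \<partial>lborel) \<le> 1"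
          using C0(2)[OF w M(1) M(2) M(3) pB one, of k] unfolding v_def by blast
        have "V k \<subseteq> cball 0 R" using R(1) by (auto simp: V_def)
        moreover have "\<forall>x\<in>V k. \<forall>z\<in>cball p r. \<forall>t\<in>{0..1}. cball (x + t *\<^sub>R (z - x)) (s k) \<subseteq> U"
          by (simp add: V_def)
        ultimately show ?thesis using that[OF w(1)] bspec[OF w(2) Vb[of k]] by blast
      qed
      obtain c where "conformal (fst (snd c))" "w = qf c" using Sigma_fields_qf[OF w(1)] .
      then show ?thesis using w(2) by blast
    qed
    then have "\<forall>k. \<exists>c. conformal (fst (snd c)) \<and> (\<integral>\<^sup>+x. indicator (V k) x * A (norm (v k x - qf c x) / C0) \<partial>lborel) \<le> 1" by blast
    then obtain c where cc: "\<forall>k. conformal (fst (snd (c k))) \<and> (\<integral>\<^sup>+x. indicator (V k) x * A (norm (v k x - qf (c k) x) / C0) \<partial>lborel) \<le> 1"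
      by (rule choice[THEN exE])
    have c: "conformal (fst (snd (c k)))" "(\<integral>\<^sup>+x. indicator (V k) x * A (norm (v k x - qf (c k) x) / C0) \<partial>lborel) \<le> 1" for k
      using cc by blast+
    define d where "d k x = norm (v k x - qf (c k) x) / C0" for k x
    have dm: "d k \<in> borel_measurable borel" for k
      unfolding d_def by (intro borel_measurable_continuous_onI continuous_intros cv) (use C0(1) in auto)
    have d0: "d k x \<ge> 0" for k x using C0(1) by (simp add: d_def)
    have BV: "ball p r \<subseteq> V k" for k
    proof
      fix x assume x: "x \<in> ball p r"
      have "x + t *\<^sub>R (z - x) \<in> cball p r" if "z \<in> cball p r" "t \<in> {0..1}" for z and t :: real
      proof -
        have "(1 - t) *\<^sub>R x + t *\<^sub>R z \<in> cball p r" using that x by (intro convexD_alt convex_cball) auto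
        then show ?thesis by (simp add: algebra_simps)
      qed
      then show "x \<in> V k" unfolding V_def using pB B x by auto
    qed
    define L where "L = (\<integral>\<^sup>+x. ennreal (\<Sum>l\<in>UNIV. \<bar>u x $ l\<bar>) \<partial>lborel)"
    have Lf: "L < \<infinity>"
    proof -
      have "integrable lborel (\<lambda>x. \<Sum>l\<in>UNIV. \<bar>u x $ l\<bar>)" using ul by (intro Bochner_Integration.integrable_sum integrable_abs)
      then show ?thesis unfolding L_def real_integrable_def by (simp add: top.not_eq_extremum)
    qed
    have vL: "(\<integral>\<^sup>+x. ennreal (norm (v k x)) \<partial>lborel) \<le> 2 * L" for k
    proof -
      have "(\<integral>\<^sup>+x. ennreal (norm (v k x)) \<partial>lborel) \<le> (\<integral>\<^sup>+x. (\<Sum>l\<in>UNIV. ennreal \<bar>cv (\<lambda>y. u y $ l) (M k z0) x\<bar>) \<partial>lborel)"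
      proof (rule nn_integral_mono)
        fix x
        have "norm (v k x) \<le> (\<Sum>l\<in>UNIV. \<bar>cv (\<lambda>y. u y $ l) (M k z0) x\<bar>)"
          using norm_le_l1_cart[of "v k x"] by (simp add: v_def)
        then show "ennreal (norm (v k x)) \<le> (\<Sum>l\<in>UNIV. ennreal \<bar>cv (\<lambda>y. u y $ l) (M k z0) x\<bar>)"
          by (subst sum_ennreal) (auto intro: ennreal_leI)
      qed
      also have "\<dots> = (\<Sum>l\<in>UNIV. \<integral>\<^sup>+x. ennreal \<bar>cv (\<lambda>y. u y $ l) (M k z0) x\<bar> \<partial>lborel)"
      proof (rule nn_integral_sum)
        fix l
        have "(\<lambda>x. \<bar>cv (\<lambda>y. u y $ l) (M k z0) x\<bar>) \<in> borel_measurable borel"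
          by (intro borel_measurable_continuous_onI continuous_intros cvl)
        then show "(\<lambda>x. ennreal \<bar>cv (\<lambda>y. u y $ l) (M k z0) x\<bar>) \<in> borel_measurable lborel" by simp
      qed
      also have "\<dots> \<le> (\<Sum>l\<in>UNIV. 2 * (\<integral>\<^sup>+x. ennreal \<bar>u x $ l\<bar> \<partial>lborel))"
        by (intro sum_mono cv_L1_bound[OF ul M])
      also have "\<dots> = 2 * (\<integral>\<^sup>+x. (\<Sum>l\<in>UNIV. ennreal \<bar>u x $ l\<bar>) \<partial>lborel)"
      proof -
        have [measurable]: "(\<lambda>x. u x $ l) \<in> borel_measurable borel" for l using ul[of l] by simp
        show ?thesis by (subst nn_integral_sum) (auto simp: sum_distrib_left)
      qed
      also have "\<dots> = 2 * L" unfolding L_def by (subst sum_ennreal) auto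
      finally show ?thesis .
    qed
    \<comment> \<open>On the ball the field is v minus (v - w): the first is bounded in L^1 by u
      uniformly in k, the second through its modular by \<open>KA\<close>.\<close>
    have cb: "ennreal (\<kappa> * norm (c k)) \<le> ennreal C0 * ennreal KA + 2 * L" for k
    proof -
      have mi: "(\<lambda>x. indicator (ball p r) x * ennreal (d k x)) \<in> borel_measurable lborel"
        by (intro borel_measurable_times_ennreal borel_measurable_indicator measurable_compose[OF _ measurable_ennreal]) (use dm in auto)
      have "(\<integral>\<^sup>+x. indicator (ball p r) x * A (d k x) \<partial>lborel) \<le> (\<integral>\<^sup>+x. indicator (V k) x * A (d k x) \<partial>lborel)"
        by (intro nn_integral_mono) (use BV[of k] in \<open>auto simp: indicator_def\<close>)
      also have "\<dots> \<le> 1" unfolding d_def by (rule c(2))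
      finally have dK: "(\<integral>\<^sup>+x. indicator (ball p r) x * ennreal (d k x) \<partial>lborel) \<le> ennreal KA"
        by (intro KA(2) dm d0)
      have "ennreal (\<kappa> * norm (c k)) \<le> (\<integral>\<^sup>+x. indicator (ball p r) x * ennreal (norm (qf (c k) x)) \<partial>lborel)" by (rule \<kappa>(2))
      also have "\<dots> \<le> (\<integral>\<^sup>+x. ennreal C0 * (indicator (ball p r) x * ennreal (d k x)) + ennreal (norm (v k x)) \<partial>lborel)"
      proof (rule nn_integral_mono)
        fix x
        have "norm (qf (c k) x) \<le> C0 * d k x + norm (v k x)"
          using norm_triangle_ineq4[of "v k x" "v k x - qf (c k) x"] C0(1) by (simp add: d_def)
        then have "ennreal (norm (qf (c k) x)) \<le> ennreal C0 * ennreal (d k x) + ennreal (norm (v k x))"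
          using C0(1) d0[of k x] by (simp add: ennreal_mult[symmetric] ennreal_plus[symmetric] ennreal_leI del: ennreal_plus)
        then show "indicator (ball p r) x * ennreal (norm (qf (c k) x)) \<le> ennreal C0 * (indicator (ball p r) x * ennreal (d k x)) + ennreal (norm (v k x))"
          by (auto simp: indicator_def)
      qed
      also have "\<dots> = (\<integral>\<^sup>+x. ennreal C0 * (indicator (ball p r) x * ennreal (d k x)) \<partial>lborel) + (\<integral>\<^sup>+x. ennreal (norm (v k x)) \<partial>lborel)"
      proof (rule nn_integral_add)
        show "(\<lambda>x. ennreal C0 * (indicator (ball p r) x * ennreal (d k x))) \<in> borel_measurable lborel"
          by (intro borel_measurable_times_ennreal mi) auto
        have "(\<lambda>x. norm (v k x)) \<in> borel_measurable borel" by (intro borel_measurable_continuous_onI continuous_intros cv)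
        then show "(\<lambda>x. ennreal (norm (v k x))) \<in> borel_measurable lborel" by simp
      qed
      also have "(\<integral>\<^sup>+x. ennreal C0 * (indicator (ball p r) x * ennreal (d k x)) \<partial>lborel) = ennreal C0 * (\<integral>\<^sup>+x. indicator (ball p r) x * ennreal (d k x) \<partial>lborel)"
        by (rule nn_integral_cmult[OF mi])
      also have "\<dots> + (\<integral>\<^sup>+x. ennreal (norm (v k x)) \<partial>lborel) \<le> ennreal C0 * ennreal KA + 2 * L"
        by (intro add_mono mult_left_mono dK vL) auto
      finally show ?thesis .
    qed
    have "bounded (range c)"
    proof -
      define X where "X = enn2real (ennreal C0 * ennreal KA + 2 * L)"
      have "ennreal C0 * ennreal KA + 2 * L < \<infinity>" using Lf by (simp add: ennreal_mult_less_top)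
      then have X: "ennreal C0 * ennreal KA + 2 * L = ennreal X" unfolding X_def by simp
      have "norm (c k) \<le> X / \<kappa>" for k
      proof -
        have "\<kappa> * norm (c k) \<le> X" using cb[of k] unfolding X by (simp add: ennreal_le_iff X_def)
        then show ?thesis using \<kappa>(1) by (simp add: pos_le_divide_eq mult.commute)
      qed
      then show ?thesis by (auto simp: bounded_iff)
    qed
    then obtain c' \<iota> where \<iota>: "strict_mono (\<iota> :: nat \<Rightarrow> nat)" "(\<lambda>k. c (\<iota> k)) \<longlonglongrightarrow> c'"
      using bounded_imp_convergent_subsequence[of c] by (auto simp: o_def)
    have conf: "conformal (fst (snd c'))" by (rule conformal_limit[OF c(1) \<iota>(2)])
    have lim: "AE x in lborel. indicator U x * A (norm (u x - qf c' x) / (2 * C0)) \<le> liminf (\<lambda>k. indicator (V (\<iota> k)) x * A (d (\<iota> k) x))"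
      using sAE
    proof eventually_elim
      fix x assume x: "(\<lambda>k. \<integral>y. indicator (ball 0 1) y * norm (u (x + s k *\<^sub>R y) - u x) \<partial>lborel) \<longlonglongrightarrow> 0"
      show "indicator U x * A (norm (u x - qf c' x) / (2 * C0)) \<le> liminf (\<lambda>k. indicator (V (\<iota> k)) x * A (d (\<iota> k) x))"
      proof (cases "x \<in> U \<and> u x - qf c' x \<noteq> 0")
        case True
        have vl: "(\<lambda>k. cv (\<lambda>y. u y $ l) (M k z0) x) \<longlonglongrightarrow> u x $ l" for l
        proof (rule Lim_null[THEN iffD2], rule Lim_null_comparison)
          show "(\<lambda>k. K\<Phi> * (\<integral>y. indicator (ball 0 1) y * norm (u (x + s k *\<^sub>R y) - u x) \<partial>lborel)) \<longlonglongrightarrow> 0"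
            using x by (rule tendsto_mult_right_zero)
          show "\<forall>\<^sub>F k in sequentially. norm (cv (\<lambda>y. u y $ l) (M k z0) x - u x $ l) \<le> K\<Phi> * (\<integral>y. indicator (ball 0 1) y * norm (u (x + s k *\<^sub>R y) - u x) \<partial>lborel)"
          proof (intro always_eventually allI)
            fix k
            have "norm (cv (\<lambda>y. u y $ l) (M k z0) x - u x $ l) \<le> K\<Phi> * (\<integral>y. indicator (ball 0 1) y * norm (u (x + s k *\<^sub>R y) $ l - u x $ l) \<partial>lborel)"
              using mollify_error[OF \<Phi> s(1) ul[of l] K\<Phi>(2), of k x] by (simp add: M_def)
            also have "\<dots> \<le> K\<Phi> * (\<integral>y. indicator (ball 0 1) y * norm (u (x + s k *\<^sub>R y) - u x) \<partial>lborel)"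
            proof (intro mult_left_mono integral_mono)
              show "integrable lborel (\<lambda>y. indicator (ball 0 1) y * norm (u (x + s k *\<^sub>R y) $ l - u x $ l))"
                using integrable_indicator_shift[OF ul[of l], of "s k" x "u x $ l"] s(1)[of k] by simp
              show "integrable lborel (\<lambda>y. indicator (ball 0 1) y * norm (u (x + s k *\<^sub>R y) - u x))"
                using integrable_indicator_shift[OF u, of "s k" x "u x"] s(1)[of k] by simp
              fix y
              show "norm (u (x + s k *\<^sub>R y) $ l - u x $ l) \<le> norm (u (x + s k *\<^sub>R y) - u x)"
                using component_le_norm_cart[of "u (x + s k *\<^sub>R y) - u x" l] by simp
            qed (use K\<Phi> in auto)
            finally show "norm (cv (\<lambda>y. u y $ l) (M k z0) x - u x $ l) \<le> K\<Phi> * (\<integral>y. indicator (ball 0 1) y * norm (u (x + s k *\<^sub>R y) - u x) \<partial>lborel)" .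
          qed
        qed
        have "(\<lambda>k. v k x) \<longlonglongrightarrow> u x"
          by (rule vec_tendstoI) (simp add: v_def vl)
        then have "(\<lambda>k. v (\<iota> k) x) \<longlonglongrightarrow> u x" by (rule LIMSEQ_subseq_LIMSEQ[OF _ \<iota>(1), unfolded o_def])
        moreover have "(\<lambda>k. qf (c (\<iota> k)) x) \<longlonglongrightarrow> qf c' x"
          using bounded_linear.tendsto[OF linear_conv_bounded_linear[THEN iffD1, OF qf_linear] \<iota>(2)] .
        ultimately have "(\<lambda>k. norm (v (\<iota> k) x - qf (c (\<iota> k)) x)) \<longlonglongrightarrow> norm (u x - qf c' x)"
          by (intro tendsto_norm tendsto_diff)
        moreover have "norm (u x - qf c' x) / 2 < norm (u x - qf c' x)" using True by simp
        ultimately have ev1: "\<forall>\<^sub>F k in sequentially. norm (u x - qf c' x) / 2 < norm (v (\<iota> k) x - qf (c (\<iota> k)) x)"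
          by (rule order_tendstoD(1))
        obtain e where e: "e > 0" "\<And>s. s \<le> e \<Longrightarrow> \<forall>z\<in>cball p r. \<forall>t\<in>{0..1::real}. cball (x + t *\<^sub>R (z - x)) s \<subseteq> U"
        proof -
          have "x \<in> U" using True by blast
          show ?thesis using that segment_core_eventually[OF U(1) star[OF \<open>x \<in> U\<close>]] by blast
        qed
        have "(\<lambda>k. s (\<iota> k)) \<longlonglongrightarrow> 0" using LIMSEQ_subseq_LIMSEQ[OF s0 \<iota>(1)] by (simp add: o_def)
        then have "\<forall>\<^sub>F k in sequentially. s (\<iota> k) < e" using e(1) by (rule order_tendstoD(2))
        then have ev2: "\<forall>\<^sub>F k in sequentially. x \<in> V (\<iota> k)"
        proof eventually_elim
          fix k assume "s (\<iota> k) < e"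
          then show "x \<in> V (\<iota> k)" unfolding V_def using e(2)[of "s (\<iota> k)"] True by simp
        qed
        from ev1 ev2 have "\<forall>\<^sub>F k in sequentially. A (norm (u x - qf c' x) / (2 * C0)) \<le> indicator (V (\<iota> k)) x * A (d (\<iota> k) x)"
        proof eventually_elim
          fix k assume k: "norm (u x - qf c' x) / 2 < norm (v (\<iota> k) x - qf (c (\<iota> k)) x)" "x \<in> V (\<iota> k)"
          have "A (norm (u x - qf c' x) / (2 * C0)) \<le> A (d (\<iota> k) x)"
          proof (rule young_mono[OF A])
            have "norm (u x - qf c' x) / (2 * C0) = (norm (u x - qf c' x) / 2) / C0" by simp
            also have "\<dots> \<le> d (\<iota> k) x" unfolding d_def using k(1) C0(1) by (intro divide_right_mono) auto
            finally show "norm (u x - qf c' x) / (2 * C0) \<le> d (\<iota> k) x" .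
          qed (use C0(1) in auto)
          then show "A (norm (u x - qf c' x) / (2 * C0)) \<le> indicator (V (\<iota> k)) x * A (d (\<iota> k) x)" using k(2) by simp
        qed
        then have "A (norm (u x - qf c' x) / (2 * C0)) \<le> liminf (\<lambda>k. indicator (V (\<iota> k)) x * A (d (\<iota> k) x))"
          by (rule Liminf_bounded)
        then show ?thesis using True by simp
      next
        case False
        then show ?thesis using young_zero[OF A] by (auto simp: indicator_def)
      qed
    qed
    have "(\<integral>\<^sup>+x. indicator U x * A (norm (u x - qf c' x) / (2 * C0)) \<partial>lborel) \<le> (\<integral>\<^sup>+x. liminf (\<lambda>k. indicator (V (\<iota> k)) x * A (d (\<iota> k) x)) \<partial>lborel)"
      by (rule nn_integral_mono_AE[OF lim])
    also have "\<dots> \<le> liminf (\<lambda>k. \<integral>\<^sup>+x. indicator (V (\<iota> k)) x * A (d (\<iota> k) x) \<partial>lborel)"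
      by (intro nn_integral_liminf borel_measurable_times_ennreal borel_measurable_indicator young_measurable[OF A])
         (use Vb dm d0 in auto)
    also have "\<dots> \<le> liminf (\<lambda>k. 1::ennreal)"
      by (intro Liminf_mono always_eventually allI) (use c(2) in \<open>simp add: d_def\<close>)
    also have "\<dots> = 1" by (rule Liminf_const) simp
    finally show "\<exists>w\<in>Sigma_fields. (\<integral>\<^sup>+x. indicator U x * A (norm (u x - w x) / (2 * C0)) \<partial>lborel) \<le> 1"
      using qf_in_Sigma_fields[OF conf] by blast
  qed
qed

section \<open>Domains with the cone property\<close>

text \<open>The normalised modular form; homogeneity turns it into a norm inequality. Taking the
  modular of G over the whole space lets the same pair be used on every member of a
  covering.\<close>

definition Korn_on :: "(real \<Rightarrow> ennreal) \<Rightarrow> (real^'n::finite) set \<Rightarrow> bool" where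
  "Korn_on A U \<longleftrightarrow> (\<exists>C>0. \<forall>u G. weak_ED_Borel U u G \<longrightarrow> (\<integral>\<^sup>+x. A (norm (G x)) \<partial>lborel) \<le> 1 \<longrightarrow>
     (\<exists>w\<in>Sigma_fields. (\<integral>\<^sup>+x. indicator U x * A (norm (u x - w x) / C) \<partial>lborel) \<le> 1))"

lemma weak_ED_Borel_mono:
  assumes "weak_ED_Borel U u G" "V \<subseteq> U" shows "weak_ED_Borel V u G"
proof -
  have "test_fun V \<phi> \<Longrightarrow> test_fun U \<phi>" for \<phi> using assms(2) by (auto simp: test_fun_def)
  then show ?thesis using assms(1) unfolding weak_ED_Borel_def by blast
qed

text \<open>Removes a bounded field w from a modular estimate at the price of a larger constant. The
  bound e is arbitrary so that several pieces can be added up to 1.\<close>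

lemma modular_shift:
  fixes S :: "(real^'n::finite) set"
  assumes A: "young_function A" and S: "S \<in> sets borel" "bounded S" and C: "C > 0" and K: "K \<ge> 0" and e: "e > 0"
  obtains C' where "C' > 0" "\<And>f w :: real^'n \<Rightarrow> real^'n. f \<in> borel_measurable borel \<Longrightarrow> w \<in> borel_measurable borel \<Longrightarrow>
     (\<And>x. x \<in> S \<Longrightarrow> norm (w x) \<le> K) \<Longrightarrow> (\<integral>\<^sup>+x. indicator S x * A (norm (f x - w x) / C) \<partial>lborel) \<le> 1 \<Longrightarrow>
     (\<integral>\<^sup>+x. indicator S x * A (norm (f x) / C') \<partial>lborel) \<le> ennreal e"
proof -
  obtain R where "\<And>x. x \<in> S \<Longrightarrow> norm x \<le> R" using S(2) by (auto simp: bounded_iff)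
  then have "S \<subseteq> cball 0 R" by auto
  then have "emeasure lborel S \<le> emeasure lborel (cball (0::real^'n) R)" by (intro emeasure_mono) auto
  then have "emeasure lborel S < \<infinity>" using emeasure_lborel_cball_finite[of "0::real^'n" R] by simp
  then have m: "enn2real (emeasure lborel S) \<ge> 0" "emeasure lborel S = ennreal (enn2real (emeasure lborel S))" by simp_all
  define m where "m = enn2real (emeasure lborel S)"
  note m = m[folded m_def]
  \<comment> \<open>Integrated over S, of measure m, this contributes at most e/2; the + 1 guards
    against m = 0.\<close>
  obtain t where t: "t > 0" "A t \<le> ennreal (e / (2 * (m + 1)))"
    using young_small[OF A, of "e / (2 * (m + 1))"] e m by auto
  define l where "l = min 1 (e / 2)"
  have l: "0 < l" "l \<le> 1" "l \<le> e / 2" using e by (auto simp: l_def)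
  \<comment> \<open>C/l \<le> D makes the first argument at most l times the given one, costing at
    most l \<le> e/2; K/t \<le> D keeps |w|/D below t. The doubling of D further down pays for the
    midpoint inequality.\<close>
  define D where "D = max (C / l) (K / t)"
  have D: "D > 0" "C / l \<le> D" "K / t \<le> D" using C l by (auto simp: D_def less_max_iff_disj)
  have "(\<integral>\<^sup>+x. indicator S x * A (norm (f x) / (2 * D)) \<partial>lborel) \<le> ennreal e"
    if f: "f \<in> borel_measurable borel" and w: "w \<in> borel_measurable borel" and wK: "\<And>x. x \<in> S \<Longrightarrow> norm (w x) \<le> K"
      and i: "(\<integral>\<^sup>+x. indicator S x * A (norm (f x - w x) / C) \<partial>lborel) \<le> 1" for f w :: "real^'n \<Rightarrow> real^'n"
  proof -
    have m1: "(\<lambda>x. indicator S x * A (norm (f x - w x) / C)) \<in> borel_measurable lborel"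
    proof (intro borel_measurable_times_ennreal borel_measurable_indicator young_measurable[OF A])
      show "(\<lambda>x. norm (f x - w x) / C) \<in> borel_measurable lborel" using f w by simp
    qed (use S C in auto)
    have m2: "(\<lambda>x. ennreal l * (indicator S x * A (norm (f x - w x) / C))) \<in> borel_measurable lborel"
      by (intro borel_measurable_times_ennreal m1) auto
    have m3: "(\<lambda>x. ennreal (e / (2 * (m + 1))) * indicator S x) \<in> borel_measurable lborel"
      by (intro borel_measurable_times_ennreal borel_measurable_indicator) (use S in auto)
    have half: "ennreal (1/2) \<le> 1" unfolding ennreal_1[symmetric] by (rule ennreal_leI) simp
    have "(\<integral>\<^sup>+x. indicator S x * A (norm (f x) / (2 * D)) \<partial>lborel)
      \<le> (\<integral>\<^sup>+x. ennreal l * (indicator S x * A (norm (f x - w x) / C)) + ennreal (e / (2 * (m + 1))) * indicator S x \<partial>lborel)"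
    proof (rule nn_integral_mono)
      fix x
      show "indicator S x * A (norm (f x) / (2 * D)) \<le> ennreal l * (indicator S x * A (norm (f x - w x) / C)) + ennreal (e / (2 * (m + 1))) * indicator S x"
      proof (cases "x \<in> S")
        case True
        have a: "norm (f x) / (2 * D) \<le> (norm (f x - w x) / D + norm (w x) / D) / 2"
        proof -
          have "norm (f x) / (2 * D) \<le> (norm (f x - w x) + norm (w x)) / (2 * D)"
            using norm_triangle_ineq[of "f x - w x" "w x"] D(1) by (intro divide_right_mono) auto
          also have "\<dots> = (norm (f x - w x) / D + norm (w x) / D) / 2"
            by (simp add: add_divide_distrib[symmetric] mult.commute)
          finally show ?thesis .
        qed
        have b: "norm (f x - w x) / D \<le> l * (norm (f x - w x) / C)"
        proof -
          have "norm (f x - w x) * C \<le> norm (f x - w x) * (l * D)"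
            using D(2) l(1) by (intro mult_left_mono) (auto simp: pos_divide_le_eq mult.commute)
          then show ?thesis using C D(1) by (simp add: pos_divide_le_eq pos_le_divide_eq mult_ac)
        qed
        have c: "norm (w x) / D \<le> t"
        proof -
          have "norm (w x) \<le> t * D" using wK[OF True] D(3) t(1) by (simp add: pos_divide_le_eq mult.commute)
          then show ?thesis using D(1) by (simp add: pos_divide_le_eq)
        qed
        have "A (norm (f x) / (2 * D)) \<le> A ((norm (f x - w x) / D + norm (w x) / D) / 2)"
          by (rule young_mono[OF A _ a]) (use D in simp)
        also have "\<dots> \<le> ennreal (1/2) * A (norm (f x - w x) / D) + ennreal (1/2) * A (norm (w x) / D)"
          by (rule young_midpoint[OF A]) (use D in auto)
        also have "\<dots> \<le> 1 * A (norm (f x - w x) / D) + 1 * A (norm (w x) / D)"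
          by (intro add_mono mult_right_mono half) auto
        also have "\<dots> \<le> A (l * (norm (f x - w x) / C)) + A t"
          unfolding mult_1 by (intro add_mono young_mono[OF A] b c) (use D in auto)
        also have "\<dots> \<le> ennreal l * A (norm (f x - w x) / C) + ennreal (e / (2 * (m + 1)))"
          by (intro add_mono young_scale[OF A] t(2)) (use l C in auto)
        finally show ?thesis using True by simp
      qed simp
    qed
    also have "\<dots> = (\<integral>\<^sup>+x. ennreal l * (indicator S x * A (norm (f x - w x) / C)) \<partial>lborel) + (\<integral>\<^sup>+x. ennreal (e / (2 * (m + 1))) * indicator S x \<partial>lborel)"
      by (rule nn_integral_add[OF m2 m3])
    also have "(\<integral>\<^sup>+x. ennreal l * (indicator S x * A (norm (f x - w x) / C)) \<partial>lborel) = ennreal l * (\<integral>\<^sup>+x. indicator S x * A (norm (f x - w x) / C) \<partial>lborel)"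
      by (rule nn_integral_cmult[OF m1])
    also have "(\<integral>\<^sup>+x. ennreal (e / (2 * (m + 1))) * indicator S x \<partial>lborel) = ennreal (e / (2 * (m + 1))) * ennreal m"
      unfolding m(2)[symmetric] by (rule nn_integral_cmult_indicator) (use S in auto)
    also have "ennreal l * (\<integral>\<^sup>+x. indicator S x * A (norm (f x - w x) / C) \<partial>lborel) + ennreal (e / (2 * (m + 1))) * ennreal m
       \<le> ennreal l * 1 + ennreal (e / (2 * (m + 1))) * ennreal m"
      by (intro add_right_mono mult_left_mono i) auto
    also have "\<dots> = ennreal (l + e / (2 * (m + 1)) * m)" using l e m by (simp add: ennreal_mult[symmetric] ennreal_plus[symmetric] del: ennreal_plus)
    also have "\<dots> \<le> ennreal e"
    proof (rule ennreal_leI)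
      have "e / (2 * (m + 1)) * m \<le> e / 2" using e m by (simp add: field_simps)
      then show "l + e / (2 * (m + 1)) * m \<le> e" using l(3) by linarith
    qed
    finally show ?thesis .
  qed
  moreover have "2 * D > 0" using D by simp
  ultimately show ?thesis using that[of "2 * D"] by blast
qed

text \<open>A modular bound on a ball gives an L^1 bound there, and the L^1 norm controls the
  coefficients.\<close>

lemma qf_coef_bound:
  fixes q :: "real^'n::finite"
  assumes A: "young_function A" and s: "s > 0" and C: "C > 0"
  obtains K where "K \<ge> 0" "\<And>c. (\<integral>\<^sup>+x. indicator (ball q s) x * A (norm (qf c x) / C) \<partial>lborel) \<le> 1 \<Longrightarrow> norm c \<le> K"
proof -
  obtain \<kappa> where \<kappa>: "\<kappa> > 0" "\<And>c. ennreal (\<kappa> * norm c) \<le> (\<integral>\<^sup>+x. indicator (ball q s) x * ennreal (norm (qf c x)) \<partial>lborel)"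
    using qf_norm_equivalence[OF s, of q] by blast
  obtain KA where KA: "KA \<ge> 0" "\<And>f::real^'n \<Rightarrow> real. f \<in> borel_measurable borel \<Longrightarrow> (\<And>x. 0 \<le> f x) \<Longrightarrow>
     (\<integral>\<^sup>+x. indicator (ball q s) x * A (f x) \<partial>lborel) \<le> 1 \<Longrightarrow> (\<integral>\<^sup>+x. indicator (ball q s) x * ennreal (f x) \<partial>lborel) \<le> ennreal KA"
    using young_L1_bound[OF A, of "ball q s"] by auto
  have "norm c \<le> C * KA / \<kappa>" if i: "(\<integral>\<^sup>+x. indicator (ball q s) x * A (norm (qf c x) / C) \<partial>lborel) \<le> 1" for c
  proof -
    have dm: "(\<lambda>x. norm (qf c x) / C) \<in> borel_measurable borel" by (intro borel_measurable_continuous_onI continuous_intros) (use C in auto)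
    have mi: "(\<lambda>x. indicator (ball q s) x * ennreal (norm (qf c x) / C)) \<in> borel_measurable lborel"
      by (intro borel_measurable_times_ennreal borel_measurable_indicator measurable_compose[OF _ measurable_ennreal]) (use dm in auto)
    have "ennreal (\<kappa> * norm c) \<le> (\<integral>\<^sup>+x. indicator (ball q s) x * ennreal (norm (qf c x)) \<partial>lborel)" by (rule \<kappa>(2))
    also have "\<dots> = (\<integral>\<^sup>+x. ennreal C * (indicator (ball q s) x * ennreal (norm (qf c x) / C)) \<partial>lborel)"
    proof (rule nn_integral_cong)
      fix x
      have "ennreal (norm (qf c x)) = ennreal C * ennreal (norm (qf c x) / C)" using C by (subst ennreal_mult[symmetric]) auto
      then show "indicator (ball q s) x * ennreal (norm (qf c x)) = ennreal C * (indicator (ball q s) x * ennreal (norm (qf c x) / C))"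
        by (simp add: mult.left_commute)
    qed
    also have "\<dots> = ennreal C * (\<integral>\<^sup>+x. indicator (ball q s) x * ennreal (norm (qf c x) / C) \<partial>lborel)"
      by (rule nn_integral_cmult[OF mi])
    also have "\<dots> \<le> ennreal C * ennreal KA"
      by (intro mult_left_mono KA(2) dm i) (use C in auto)
    also have "\<dots> = ennreal (C * KA)" using C KA(1) by (simp add: ennreal_mult)
    finally have "\<kappa> * norm c \<le> C * KA" using C KA(1) by (simp add: ennreal_le_iff)
    then show ?thesis using \<kappa>(1) by (simp add: pos_le_divide_eq mult.commute)
  qed
  moreover have "C * KA / \<kappa> \<ge> 0" using C KA \<kappa> by simp
  ultimately show ?thesis using that by blast
qed

lemma weak_ED_Borel_measurable:
  assumes "weak_ED_Borel U u G" shows "u \<in> borel_measurable borel" "G \<in> borel_measurable borel"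
  using assms unfolding weak_ED_Borel_def by auto

text \<open>On a ball in the overlap both fields approximate u, so the coefficients of their
  difference are bounded by a constant, and then so is the difference on the whole union. Hence the
  field found for \<open>U\<close> also serves on \<open>V\<close>.\<close>

lemma Korn_on_Un:
  fixes U V :: "(real^'n::finite) set"
  assumes A: "young_function A" and U: "open U" "bounded U" "Korn_on A U" and V: "open V" "bounded V" "Korn_on A V"
    and UV: "U \<inter> V \<noteq> {}"
  shows "Korn_on A (U \<union> V)"
proof -
  obtain C1 where C1: "C1 > 0" "\<And>u G. weak_ED_Borel U u G \<Longrightarrow> (\<integral>\<^sup>+x. A (norm (G x)) \<partial>lborel) \<le> 1 \<Longrightarrow>
     \<exists>w\<in>Sigma_fields. (\<integral>\<^sup>+x. indicator U x * A (norm (u x - w x) / C1) \<partial>lborel) \<le> 1"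
    using U(3) unfolding Korn_on_def by blast
  obtain C2 where C2: "C2 > 0" "\<And>u G. weak_ED_Borel V u G \<Longrightarrow> (\<integral>\<^sup>+x. A (norm (G x)) \<partial>lborel) \<le> 1 \<Longrightarrow>
     \<exists>w\<in>Sigma_fields. (\<integral>\<^sup>+x. indicator V x * A (norm (u x - w x) / C2) \<partial>lborel) \<le> 1"
    using V(3) unfolding Korn_on_def by blast
  define C where "C = max C1 C2"
  have C: "C > 0" "C1 \<le> C" "C2 \<le> C" using C1 by (auto simp: C_def)
  have "open (U \<inter> V)" using U V by auto
  then obtain q s where qs: "s > 0" "ball q s \<subseteq> U \<inter> V" using UV openE by blast
  obtain KC where KC: "KC \<ge> 0" "\<And>c. (\<integral>\<^sup>+x. indicator (ball q s) x * A (norm (qf c x) / (2 * C)) \<partial>lborel) \<le> 1 \<Longrightarrow> norm c \<le> KC"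
    using qf_coef_bound[OF A qs(1), of "2 * C" q] C(1) by auto
  have bUV: "bounded (U \<union> V)" using U V by auto
  obtain R where R: "\<And>x. x \<in> U \<union> V \<Longrightarrow> norm x \<le> R" "R \<ge> 0"
  proof -
    obtain R where "\<And>x. x \<in> U \<union> V \<Longrightarrow> norm x \<le> R" using bUV by (auto simp: bounded_iff)
    then show ?thesis using that[of "max R 0"] by (auto simp: le_max_iff_disj)
  qed
  obtain KR where KR: "KR > 0" "\<And>(c::'n qcoef) x. norm x \<le> R \<Longrightarrow> norm (qf c x) \<le> KR * norm c"
    using qf_bound[OF R(2)] by blast
  have KRC: "KR * KC \<ge> 0" using KR KC by simp
  \<comment> \<open>Each set is allotted modular 1/2. The shift is 0 on \<open>U\<close> and the
    difference of the two fields on \<open>V\<close>.\<close>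
  obtain D1 where D1: "D1 > 0" "\<And>f w :: real^'n \<Rightarrow> real^'n. f \<in> borel_measurable borel \<Longrightarrow> w \<in> borel_measurable borel \<Longrightarrow>
     (\<And>x. x \<in> U \<Longrightarrow> norm (w x) \<le> KR * KC) \<Longrightarrow> (\<integral>\<^sup>+x. indicator U x * A (norm (f x - w x) / C1) \<partial>lborel) \<le> 1 \<Longrightarrow>
     (\<integral>\<^sup>+x. indicator U x * A (norm (f x) / D1) \<partial>lborel) \<le> ennreal (1/2)"
    using modular_shift[OF A _ U(2) C1(1) KRC, of "1/2"] U(1) by auto
  obtain D2 where D2: "D2 > 0" "\<And>f w :: real^'n \<Rightarrow> real^'n. f \<in> borel_measurable borel \<Longrightarrow> w \<in> borel_measurable borel \<Longrightarrow>
     (\<And>x. x \<in> V \<Longrightarrow> norm (w x) \<le> KR * KC) \<Longrightarrow> (\<integral>\<^sup>+x. indicator V x * A (norm (f x - w x) / C2) \<partial>lborel) \<le> 1 \<Longrightarrow>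
     (\<integral>\<^sup>+x. indicator V x * A (norm (f x) / D2) \<partial>lborel) \<le> ennreal (1/2)"
    using modular_shift[OF A _ V(2) C2(1) KRC, of "1/2"] V(1) by auto
  define D where "D = max D1 D2"
  have D: "D > 0" "D1 \<le> D" "D2 \<le> D" using D1 by (auto simp: D_def)
  show ?thesis unfolding Korn_on_def
  proof (intro exI[of _ D] conjI D(1) allI impI)
    fix u G assume w: "weak_ED_Borel (U \<union> V) u G" and one: "(\<integral>\<^sup>+x. A (norm (G x)) \<partial>lborel) \<le> 1"
    have um: "u \<in> borel_measurable borel" using weak_ED_Borel_measurable[OF w] by simp
    obtain w1 where w1: "w1 \<in> Sigma_fields" "(\<integral>\<^sup>+x. indicator U x * A (norm (u x - w1 x) / C1) \<partial>lborel) \<le> 1"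
      using C1(2)[OF weak_ED_Borel_mono[OF w] one] by auto
    obtain w2 where w2: "w2 \<in> Sigma_fields" "(\<integral>\<^sup>+x. indicator V x * A (norm (u x - w2 x) / C2) \<partial>lborel) \<le> 1"
      using C2(2)[OF weak_ED_Borel_mono[OF w] one] by auto
    obtain c1 where c1: "w1 = qf c1" using Sigma_fields_qf[OF w1(1)] by blast
    obtain c2 where c2: "w2 = qf c2" using Sigma_fields_qf[OF w2(1)] by blast
    have mA: "(\<lambda>x. indicator W x * A (norm (u x - qf c x) / B)) \<in> borel_measurable lborel" if "open W" "B > 0" for W c B
    proof (intro borel_measurable_times_ennreal borel_measurable_indicator young_measurable[OF A])
      show "(\<lambda>x. norm (u x - qf c x) / B) \<in> borel_measurable lborel" using um by simp
    qed (use that in auto)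
    have "(\<integral>\<^sup>+x. indicator (ball q s) x * A (norm (qf (c2 - c1) x) / (2 * C)) \<partial>lborel)
       \<le> (\<integral>\<^sup>+x. ennreal (1/2) * (indicator U x * A (norm (u x - qf c1 x) / C1)) + ennreal (1/2) * (indicator V x * A (norm (u x - qf c2 x) / C2)) \<partial>lborel)"
    proof (rule nn_integral_mono)
      fix x
      show "indicator (ball q s) x * A (norm (qf (c2 - c1) x) / (2 * C))
         \<le> ennreal (1/2) * (indicator U x * A (norm (u x - qf c1 x) / C1)) + ennreal (1/2) * (indicator V x * A (norm (u x - qf c2 x) / C2))"
      proof (cases "x \<in> ball q s")
        case True
        then have x: "x \<in> U" "x \<in> V" using qs(2) by auto
        have "norm (qf (c2 - c1) x) \<le> norm (u x - qf c1 x) + norm (u x - qf c2 x)"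
          using norm_triangle_ineq4[of "u x - qf c1 x" "u x - qf c2 x"] by (simp add: qf_diff)
        then have "norm (qf (c2 - c1) x) / (2 * C) \<le> (norm (u x - qf c1 x) + norm (u x - qf c2 x)) / (2 * C)"
          using C(1) by (intro divide_right_mono) auto
        also have "\<dots> = (norm (u x - qf c1 x) / C + norm (u x - qf c2 x) / C) / 2"
          by (simp add: add_divide_distrib[symmetric] mult.commute)
        finally have "A (norm (qf (c2 - c1) x) / (2 * C)) \<le> A ((norm (u x - qf c1 x) / C + norm (u x - qf c2 x) / C) / 2)"
          using C(1) by (intro young_mono[OF A]) auto
        also have "\<dots> \<le> ennreal (1/2) * A (norm (u x - qf c1 x) / C) + ennreal (1/2) * A (norm (u x - qf c2 x) / C)"
          using C(1) by (intro young_midpoint[OF A]) auto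
        also have "\<dots> \<le> ennreal (1/2) * A (norm (u x - qf c1 x) / C1) + ennreal (1/2) * A (norm (u x - qf c2 x) / C2)"
          using C C1(1) C2(1) by (intro add_mono mult_left_mono young_mono[OF A] divide_left_mono) auto
        finally show ?thesis using True x by simp
      qed simp
    qed
    also have "\<dots> = (\<integral>\<^sup>+x. ennreal (1/2) * (indicator U x * A (norm (u x - qf c1 x) / C1)) \<partial>lborel) + (\<integral>\<^sup>+x. ennreal (1/2) * (indicator V x * A (norm (u x - qf c2 x) / C2)) \<partial>lborel)"
      by (intro nn_integral_add borel_measurable_times_ennreal mA U V C1 C2) auto
    also have "\<dots> = ennreal (1/2) * (\<integral>\<^sup>+x. indicator U x * A (norm (u x - qf c1 x) / C1) \<partial>lborel) + ennreal (1/2) * (\<integral>\<^sup>+x. indicator V x * A (norm (u x - qf c2 x) / C2) \<partial>lborel)"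
      by (intro arg_cong2[of _ _ _ _ "(+)"] nn_integral_cmult mA U V C1 C2)
    also have "\<dots> \<le> ennreal (1/2) * 1 + ennreal (1/2) * 1"
      using w1(2) w2(2) unfolding c1 c2 by (intro add_mono mult_left_mono) auto
    also have "\<dots> = ennreal (1/2 + 1/2)" by (simp only: mult_1_right ennreal_plus[symmetric] zero_le_divide_1_iff zero_le_numeral)
    finally have "norm (c2 - c1) \<le> KC" by (intro KC(2)) simp
    then have wK: "norm (qf (c2 - c1) x) \<le> KR * KC" if "x \<in> U \<union> V" for x
      by (rule order_trans[OF KR(2)[OF R(1)[OF that]] mult_left_mono]) (use KR(1) in auto)
    have iU: "(\<integral>\<^sup>+x. indicator U x * A (norm (u x - w1 x) / D1) \<partial>lborel) \<le> ennreal (1/2)"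
      by (rule D1(2)[of _ "\<lambda>_. 0"]) (use um w1(2) KRC in \<open>auto simp: c1\<close>)
    have iV: "(\<integral>\<^sup>+x. indicator V x * A (norm (u x - w1 x) / D2) \<partial>lborel) \<le> ennreal (1/2)"
    proof (rule D2(2)[of _ "qf (c2 - c1)"])
      show "(\<integral>\<^sup>+x. indicator V x * A (norm (u x - w1 x - qf (c2 - c1) x) / C2) \<partial>lborel) \<le> 1"
        using w2(2) unfolding c1 c2 qf_diff by simp
    qed (use um wK in \<open>auto simp: c1\<close>)
    have "(\<integral>\<^sup>+x. indicator (U \<union> V) x * A (norm (u x - w1 x) / D) \<partial>lborel)
      \<le> (\<integral>\<^sup>+x. indicator U x * A (norm (u x - w1 x) / D1) + indicator V x * A (norm (u x - w1 x) / D2) \<partial>lborel)"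
    proof (rule nn_integral_mono)
      fix x
      have "A (norm (u x - w1 x) / D) \<le> A (norm (u x - w1 x) / D1)" "A (norm (u x - w1 x) / D) \<le> A (norm (u x - w1 x) / D2)"
        using D D1(1) D2(1) by (auto intro!: young_mono[OF A] divide_left_mono)
      then show "indicator (U \<union> V) x * A (norm (u x - w1 x) / D) \<le> indicator U x * A (norm (u x - w1 x) / D1) + indicator V x * A (norm (u x - w1 x) / D2)"
        by (auto simp: indicator_def intro: add_increasing2 add_increasing)
    qed
    also have "\<dots> = (\<integral>\<^sup>+x. indicator U x * A (norm (u x - w1 x) / D1) \<partial>lborel) + (\<integral>\<^sup>+x. indicator V x * A (norm (u x - w1 x) / D2) \<partial>lborel)"
      unfolding c1 by (intro nn_integral_add mA U V D1 D2)
    also have "\<dots> \<le> ennreal (1/2) + ennreal (1/2)" by (intro add_mono iU iV)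
    also have "\<dots> = ennreal (1/2 + 1/2)" by (simp only: ennreal_plus[symmetric] zero_le_divide_1_iff zero_le_numeral)
    finally show "\<exists>w\<in>Sigma_fields. (\<integral>\<^sup>+x. indicator (U \<union> V) x * A (norm (u x - w x) / D) \<partial>lborel) \<le> 1"
      using w1(1) by (intro bexI[of _ w1]) auto
  qed
qed

text \<open>A subfamily of maximal cardinality with the property must be everything: otherwise
  connectedness yields a further member meeting its union, which \<open>Korn_on_Un\<close> could
  add.\<close>

lemma Korn_on_finite_Union:
  fixes \<F> :: "(real^'n::finite) set set"
  assumes A: "young_function A" and fin: "finite \<F>" and F: "\<And>U. U \<in> \<F> \<Longrightarrow> open U \<and> bounded U \<and> U \<noteq> {} \<and> Korn_on A U"
    and con: "connected (\<Union>\<F>)" and ne: "\<F> \<noteq> {}"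
  shows "Korn_on A (\<Union>\<F>)"
proof -
  define S where "S = {\<G>. \<G> \<subseteq> \<F> \<and> \<G> \<noteq> {} \<and> Korn_on A (\<Union>\<G>)}"
  have "finite S" unfolding S_def by (rule finite_subset[of _ "Pow \<F>"]) (use fin in auto)
  moreover have "S \<noteq> {}"
  proof -
    obtain U where "U \<in> \<F>" using ne by blast
    then have "{U} \<in> S" using F by (simp add: S_def)
    then show ?thesis by blast
  qed
  ultimately obtain \<G> where G: "\<G> \<in> S" "\<And>\<H>. \<H> \<in> S \<Longrightarrow> card \<H> \<le> card \<G>"
  proof -
    assume S: "finite S" "S \<noteq> {}"
    then have "Max (card ` S) \<in> card ` S" by (intro Max_in) auto
    then obtain \<G> where "\<G> \<in> S" "card \<G> = Max (card ` S)" by auto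
    then show ?thesis using that[of \<G>] S(1) by simp
  qed
  have GF: "\<G> \<subseteq> \<F>" "\<G> \<noteq> {}" "Korn_on A (\<Union>\<G>)" using G(1) by (auto simp: S_def)
  have "\<G> = \<F>"
  proof (rule ccontr)
    assume "\<G> \<noteq> \<F>"
    then have ne2: "\<F> - \<G> \<noteq> {}" using GF by blast
    have o: "open (\<Union>\<G>)" "open (\<Union>(\<F> - \<G>))" using F GF by (auto intro!: open_Union)
    have "\<Union>\<G> \<inter> \<Union>(\<F> - \<G>) \<noteq> {}"
    proof
      assume d: "\<Union>\<G> \<inter> \<Union>(\<F> - \<G>) = {}"
      have "\<Union>\<G> \<inter> \<Union>\<F> = {} \<or> \<Union>(\<F> - \<G>) \<inter> \<Union>\<F> = {}"
        by (rule connectedD[OF con o]) (use d in auto)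
      moreover have "\<Union>\<G> \<inter> \<Union>\<F> \<noteq> {}"
      proof -
        obtain X where X: "X \<in> \<G>" "X \<in> \<F>" using GF(1,2) by blast
        then obtain x where "x \<in> X" using F[OF X(2)] by blast
        then show ?thesis using X by blast
      qed
      moreover have "\<Union>(\<F> - \<G>) \<inter> \<Union>\<F> \<noteq> {}"
      proof -
        obtain X where X: "X \<in> \<F>" "X \<notin> \<G>" using ne2 by blast
        then obtain x where "x \<in> X" using F[OF X(1)] by blast
        then show ?thesis using X by blast
      qed
      ultimately show False by simp
    qed
    then obtain U where U: "U \<in> \<F>" "U \<notin> \<G>" "\<Union>\<G> \<inter> U \<noteq> {}" by blast
    have "bounded (\<Union>\<G>)" using F GF fin finite_subset by (intro bounded_Union) auto
    then have "Korn_on A (\<Union>\<G> \<union> U)"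
      using F[OF U(1)] by (intro Korn_on_Un[OF A o(1) _ GF(3) _ _ _ U(3)]) auto
    moreover have "\<Union>\<G> \<union> U = \<Union>(insert U \<G>)" by blast
    ultimately have "insert U \<G> \<in> S" using U GF unfolding S_def by auto
    then have "card (insert U \<G>) \<le> card \<G>" by (rule G(2))
    moreover have "finite \<G>" using GF(1) fin finite_subset by blast
    ultimately show False using U(2) by simp
  qed
  then show ?thesis using GF by simp
qed

lemma finite_cone_contains_cball:
  fixes d :: "'a::euclidean_space"
  assumes "d \<noteq> 0" "h > 0" "0 < \<theta>" "\<theta> < pi / 2"
  obtains c r where "r > 0" "cball c r \<subseteq> finite_cone d h \<theta>"
proof -
  define c where "c = (h / 2 / norm d) *\<^sub>R d"
  have "cos \<theta> < 1" using assms cos_monotone_0_pi[of 0 \<theta>] by simp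
  then have "c \<bullet> d > norm c * norm d * cos \<theta>"
    using assms by (simp add: c_def power2_norm_eq_inner[symmetric] power2_eq_square)
  moreover have "norm c < h" using assms by (simp add: c_def)
  ultimately have "c \<in> finite_cone d h \<theta>" by (simp add: finite_cone_def)
  moreover have "open (finite_cone d h \<theta>)"
    unfolding finite_cone_def Collect_conj_eq by (intro open_Int open_Collect_less continuous_intros)
  ultimately obtain r where "r > 0" "cball c r \<subseteq> finite_cone d h \<theta>" unfolding open_contains_cball by blast
  then show ?thesis by (rule that)
qed

lemma finite_cone_scaleR:
  assumes "y \<in> finite_cone d h \<theta>" "0 < t" "t \<le> 1" shows "t *\<^sub>R y \<in> finite_cone d h \<theta>"
proof -
  have "norm (t *\<^sub>R y) \<le> norm y" using assms mult_left_le_one_le[of "norm y" t] by simp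
  moreover have "t * (norm y * norm d * cos \<theta>) < t * (y \<bullet> d)" using assms by (simp add: finite_cone_def)
  ultimately show ?thesis using assms by (simp add: finite_cone_def mult.assoc)
qed

text \<open>Each point sees a ball of fixed radius inside its cone, with centre in a fixed bounded
  set. Grouping the points by a finite net of centres gives finitely many pieces, each star-shaped
  with respect to one ball.\<close>

theorem cone_property_Korn:
  fixes \<Omega> :: "(real^'n::finite) set"
  assumes n: "CARD('n) \<ge> 3" and A: "young_function A" and \<Omega>: "open \<Omega>" "bounded \<Omega>" "connected \<Omega>" and cone: "cone_property \<Omega>"
  shows "Korn_on A \<Omega>"
proof (cases "\<Omega> = {}")
  case True
  have "qf 0 \<in> Sigma_fields" by (rule qf_in_Sigma_fields) (simp add: conformal_def)
  then show ?thesis unfolding Korn_on_def True by (intro exI[of _ 1]) auto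
next
  case ne: False
  obtain d :: "real^'n" and h \<theta> :: real where c': "d \<noteq> 0 \<and> h > 0 \<and> 0 < \<theta> \<and> \<theta> < pi / 2 \<and>
        (\<forall>x\<in>\<Omega>. \<exists>f. orthogonal_transformation f \<and> (\<lambda>y. x + f y) ` finite_cone d h \<theta> \<subseteq> \<Omega>)"
    using cone unfolding cone_property_def by (elim exE)
  note c = c'[THEN conjunct1] c'[THEN conjunct2, THEN conjunct1] c'[THEN conjunct2, THEN conjunct2, THEN conjunct1]
    c'[THEN conjunct2, THEN conjunct2, THEN conjunct2, THEN conjunct1]
  note c5 = c'[THEN conjunct2, THEN conjunct2, THEN conjunct2, THEN conjunct2]
  obtain c0 r where r: "r > 0" "cball c0 r \<subseteq> finite_cone d h \<theta>" using finite_cone_contains_cball[OF c] .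
  obtain R where R: "\<And>x. x \<in> \<Omega> \<Longrightarrow> norm x \<le> R" using \<Omega>(2) by (auto simp: bounded_iff)
  have cx: "\<exists>p. norm p \<le> R + norm c0 \<and> (\<forall>z\<in>cball p r. \<forall>t\<in>{0..1}. x + t *\<^sub>R (z - x) \<in> \<Omega>)" if x: "x \<in> \<Omega>" for x
  proof -
    obtain f where f: "orthogonal_transformation f" "(\<lambda>y. x + f y) ` finite_cone d h \<theta> \<subseteq> \<Omega>" using bspec[OF c5 x] by (elim exE conjE)
    have lf: "linear f" using f(1) by (rule orthogonal_transformation_linear)
    have nf: "norm (f y) = norm y" for y using f(1) by (rule orthogonal_transformation_norm)
    show ?thesis
    proof (intro exI[of _ "x + f c0"] conjI ballI)
      show "norm (x + f c0) \<le> R + norm c0" using norm_triangle_ineq[of x "f c0"] R[OF x] by (simp add: nf)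
      fix z t assume z: "z \<in> cball (x + f c0) r" and t: "t \<in> {0..1::real}"
      obtain y where y: "z - x = f y" using orthogonal_transformation_surj[OF f(1)] by (rule surjE)
      have "norm (y - c0) = norm (z - (x + f c0))"
        using nf[of "y - c0"] y by (simp add: linear_diff[OF lf] algebra_simps)
      then have yc: "y \<in> finite_cone d h \<theta>" using z r(2) by (auto simp: dist_norm norm_minus_commute)
      show "x + t *\<^sub>R (z - x) \<in> \<Omega>"
      \<comment> \<open>The vertex does not belong to \<open>finite_cone\<close>, so the endpoint x
        is treated by itself.\<close>
      proof (cases "t = 0")
        case False
        then have "t *\<^sub>R y \<in> finite_cone d h \<theta>" using t by (intro finite_cone_scaleR yc) auto
        then show ?thesis using f(2) by (auto simp: y linear_scale[OF lf, symmetric])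
      qed (use x in simp)
    qed
  qed
  \<comment> \<open>Half the radius: a ball of radius r contains the ball of radius r/2 around any
    net point within r/2 of its centre.\<close>
  define \<rho> where "\<rho> = r / 2"
  have \<rho>: "\<rho> > 0" using r by (simp add: \<rho>_def)
  obtain P where P: "finite P" "cball (0::real^'n) (R + norm c0) \<subseteq> (\<Union>p\<in>P. ball p \<rho>)"
  proof -
    have "\<forall>e>0. \<exists>k. finite k \<and> cball (0::real^'n) (R + norm c0) \<subseteq> (\<Union>p\<in>k. ball p e)"
      using compact_cball[of "0::real^'n" "R + norm c0"] unfolding compact_eq_totally_bounded by (rule conjunct2)
    from this[rule_format, OF \<rho>] show ?thesis using that by blast
  qed
  \<comment> \<open>All points that see the ball of centre p along segments within \<Omega>; taking
    the largest such set makes it open and star-shaped.\<close>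
  define W where "W p = {x. \<forall>z\<in>cball p \<rho>. \<forall>t\<in>{0..1}. x + t *\<^sub>R (z - x) \<in> \<Omega>}" for p
  have W\<Omega>: "W p \<subseteq> \<Omega>" for p
  proof
    fix x assume "x \<in> W p"
    then have "\<forall>z\<in>cball p \<rho>. \<forall>t\<in>{0..1}. x + t *\<^sub>R (z - x) \<in> \<Omega>" by (simp only: W_def mem_Collect_eq)
    from bspec[OF bspec[OF this, of p], of 0] show "x \<in> \<Omega>" using \<rho> by simp
  qed
  have Wo: "open (W p)" for p
    using open_segment_core[OF \<Omega>(1), of p \<rho> 0] by (simp add: W_def)
  have Bz: "x + t *\<^sub>R (z - x) \<in> cball p \<rho>" if "x \<in> cball p \<rho>" "z \<in> cball p \<rho>" "t \<in> {0..1}" for x z p :: "real^'n" and t :: real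
  proof -
    have "(1 - t) *\<^sub>R x + t *\<^sub>R z \<in> cball p \<rho>" using that using that by (auto intro!: convexD_alt convex_cball simp del: mem_cball)
    then show ?thesis by (simp add: algebra_simps)
  qed
  have star: "x + t *\<^sub>R (z - x) \<in> W p" if x: "x \<in> W p" and z: "z \<in> cball p \<rho>" and t: "t \<in> {0..1}" for x z p :: "real^'n" and t :: real
    unfolding W_def
  proof (intro CollectI ballI)
    fix z' t' assume z': "z' \<in> cball p \<rho>" and t': "t' \<in> {0..1::real}"
    \<comment> \<open>Moving towards z for time t and then towards z' for time t' is one move of
      length \<tau> towards a convex combination of z and z', which again lies in the ball and is
      therefore visible from x.\<close>
    define \<tau> where "\<tau> = (1 - t') * t + t'"
    have \<tau>: "0 \<le> \<tau>" "\<tau> \<le> 1"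
    proof -
      show "0 \<le> \<tau>" using t t' by (simp add: \<tau>_def)
      have "(1 - t') * t \<le> (1 - t') * 1" using t t' by (intro mult_left_mono) auto
      then show "\<tau> \<le> 1" by (simp add: \<tau>_def)
    qed
    show "x + t *\<^sub>R (z - x) + t' *\<^sub>R (z' - (x + t *\<^sub>R (z - x))) \<in> \<Omega>"
    proof (cases "\<tau> = 0")
      case True
      then have "t' = 0" "t = 0"
        using t t' unfolding \<tau>_def by (auto simp: add_nonneg_eq_0_iff)
      then show ?thesis using x W\<Omega> by auto
    next
      case False
      define z'' where "z'' = z + (t' / \<tau>) *\<^sub>R (z' - z)"
      have "t' \<le> \<tau>" using t t' by (simp add: \<tau>_def)
      then have "z'' \<in> cball p \<rho>" unfolding z''_def using \<tau> False t' by (intro Bz z z') auto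
      then have "x + \<tau> *\<^sub>R (z'' - x) \<in> \<Omega>" using x \<tau> unfolding W_def by auto
      moreover have "x + \<tau> *\<^sub>R (z'' - x) = x + t *\<^sub>R (z - x) + t' *\<^sub>R (z' - (x + t *\<^sub>R (z - x)))"
      proof -
        have "x + \<tau> *\<^sub>R (z'' - x) = x + \<tau> *\<^sub>R (z - x) + t' *\<^sub>R (z' - z)"
          using False by (simp add: z''_def algebra_simps)
        also have "\<dots> = x + t *\<^sub>R (z - x) + t' *\<^sub>R (z' - (x + t *\<^sub>R (z - x)))"
          by (simp add: \<tau>_def algebra_simps)
        finally show ?thesis .
      qed
      ultimately show ?thesis by simp
    qed
  qed
  have BW: "cball p \<rho> \<subseteq> W p" if ne: "W p \<noteq> {}" for p
  proof
    fix y assume y: "y \<in> cball p \<rho>"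
    obtain x where "x \<in> W p" using ne by blast
    from star[OF this y, of 1] show "y \<in> W p" by simp
  qed
  define \<F> where "\<F> = W ` {p \<in> P. W p \<noteq> {}}"
  have U: "\<Union>\<F> = \<Omega>"
  proof
    show "\<Union>\<F> \<subseteq> \<Omega>" using W\<Omega> by (auto simp: \<F>_def)
    show "\<Omega> \<subseteq> \<Union>\<F>"
    proof
      fix x assume x: "x \<in> \<Omega>"
      obtain q where q: "norm q \<le> R + norm c0" "\<forall>z\<in>cball q r. \<forall>t\<in>{0..1}. x + t *\<^sub>R (z - x) \<in> \<Omega>" using cx[OF x] by blast
      then obtain p where p: "p \<in> P" "q \<in> ball p \<rho>" using P(2) by (auto simp: subset_iff)
      have "cball p \<rho> \<subseteq> cball q r"
      proof
        fix z assume "z \<in> cball p \<rho>"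
        then show "z \<in> cball q r" using p(2) dist_triangle[of q z p] by (simp add: \<rho>_def dist_commute)
      qed
      then have "x \<in> W p" using q(2) unfolding W_def by blast
      then show "x \<in> \<Union>\<F>" using p(1) by (auto simp: \<F>_def)
    qed
  qed
  have "Korn_on A (\<Union>\<F>)"
  proof (rule Korn_on_finite_Union[OF A])
    show "finite \<F>" using P(1) by (simp add: \<F>_def)
    show "connected (\<Union>\<F>)" using \<Omega>(3) U by simp
    show "\<F> \<noteq> {}" using U ne by auto
    fix V assume "V \<in> \<F>"
    then obtain p where p: "V = W p" "W p \<noteq> {}" by (auto simp: \<F>_def)
    have b: "bounded (W p)" using W\<Omega> \<Omega>(2) bounded_subset by blast
    have "Korn_on A (W p)"
    proof (rule star_shaped_Korn[OF n A Wo b \<rho> BW[OF p(2)] star])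
      fix C :: real
      assume "C > 0" "\<And>u G. weak_ED_Borel (W p) u G \<Longrightarrow> (\<integral>\<^sup>+x. A (norm (G x)) \<partial>lborel) \<le> 1 \<Longrightarrow>
        \<exists>w\<in>Sigma_fields. (\<integral>\<^sup>+x. indicator (W p) x * A (norm (u x - w x) / C) \<partial>lborel) \<le> 1"
      then show "Korn_on A (W p)" unfolding Korn_on_def by (intro exI[of _ C]) simp
    qed
    then show "open V \<and> bounded V \<and> V \<noteq> {} \<and> Korn_on A V" using Wo b p by simp
  qed
  then show ?thesis using U by simp
qed

section \<open>Test functions and locality of the weak gradient\<close>

lemma test_fun_mono: "test_fun V \<phi> \<Longrightarrow> V \<subseteq> U \<Longrightarrow> test_fun U \<phi>"
  by (auto simp: test_fun_def)

lemma test_fun_outside: "test_fun U \<phi> \<Longrightarrow> x \<notin> U \<Longrightarrow> \<phi> x = 0"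
  using closure_subset[THEN subsetD, of x "{x. \<phi> x \<noteq> 0}"] unfolding test_fun_def by blast

lemma frechet_partial_sum:
  fixes f :: "real^'n::finite \<Rightarrow> real"
  assumes "f differentiable (at x)"
  shows "(f has_derivative (\<lambda>h. \<Sum>j\<in>UNIV. h$j * partial_deriv j f x)) (at x)"
proof -
  have d: "(f has_derivative frechet_derivative f (at x)) (at x)" using assms by (simp add: frechet_derivative_works)
  have l: "linear (frechet_derivative f (at x))" using d by (rule has_derivative_linear)
  have "frechet_derivative f (at x) = (\<lambda>h. \<Sum>j\<in>UNIV. h$j * partial_deriv j f x)"
  proof
    fix h :: "real^'n"
    have e: "(\<Sum>j\<in>UNIV. h$j *\<^sub>R axis j 1) = h"
      using basis_expansion[of h] by (simp add: scalar_mult_eq_scaleR)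
    have "frechet_derivative f (at x) (\<Sum>j\<in>UNIV. h$j *\<^sub>R axis j 1) = (\<Sum>j\<in>UNIV. h$j * partial_deriv j f x)"
      by (simp add: linear_sum[OF l] linear_scale[OF l] partial_deriv_def)
    then show "frechet_derivative f (at x) h = (\<Sum>j\<in>UNIV. h$j * partial_deriv j f x)" unfolding e .
  qed
  then show ?thesis using d by simp
qed

lemma smooth_fun_differentiable: "smooth_fun f \<Longrightarrow> f differentiable (at x)"
  unfolding smooth_fun_def by (erule allE[of _ "[]"]) simp

lemma smooth_fun_partial_differentiable: "smooth_fun f \<Longrightarrow> partial_deriv j f differentiable (at x)"
  unfolding smooth_fun_def by (erule allE[of _ "[j]"]) simp

lemma test_fun_continuous:
  assumes "test_fun U \<phi>"
  shows "continuous_on UNIV \<phi>" "continuous_on UNIV (partial_deriv j \<phi>)"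
proof -
  have s: "smooth_fun \<phi>" using assms unfolding test_fun_def by blast
  show "continuous_on UNIV \<phi>"
    by (intro continuous_at_imp_continuous_on ballI differentiable_imp_continuous_within smooth_fun_differentiable[OF s])
  show "continuous_on UNIV (partial_deriv j \<phi>)"
    by (intro continuous_at_imp_continuous_on ballI differentiable_imp_continuous_within smooth_fun_partial_differentiable[OF s])
qed

lemma test_fun_partial_outside:
  assumes \<phi>: "test_fun U \<phi>" and x: "x \<notin> closure {x. \<phi> x \<noteq> 0}"
  shows "\<phi> x = 0" "partial_deriv j \<phi> x = 0"
proof -
  have z: "\<phi> y = 0" if "y \<in> - closure {x. \<phi> x \<noteq> 0}" for y
    using that closure_subset[THEN subsetD, of y "{x. \<phi> x \<noteq> 0}"] by blast
  show "\<phi> x = 0" using x z by blast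
  have "(\<phi> has_derivative (\<lambda>h. 0)) (at x)"
  proof (rule has_derivative_transform_within_open[OF has_derivative_const])
    show "open (- closure {x. \<phi> x \<noteq> 0})" by (intro open_Compl closed_closure)
    show "x \<in> - closure {x. \<phi> x \<noteq> 0}" using x by blast
    show "\<And>y. y \<in> - closure {x. \<phi> x \<noteq> 0} \<Longrightarrow> 0 = \<phi> y" using z by (rule sym)
  qed
  then have "(\<phi> has_derivative (\<lambda>h. \<Sum>j\<in>UNIV. h$j * 0)) (at x)" by simp
  from partial_deriv_eqI[OF this] show "partial_deriv j \<phi> x = 0" .
qed

lemma test_fun_partial_outside': "test_fun U \<phi> \<Longrightarrow> x \<notin> U \<Longrightarrow> partial_deriv j \<phi> x = 0"
  by (rule test_fun_partial_outside(2)) (assumption, unfold test_fun_def, blast)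

lemma test_fun_bounded_support:
  assumes "test_fun U \<phi>" obtains R where "\<And>x. R < norm x \<Longrightarrow> x \<notin> closure {x. \<phi> x \<noteq> 0}"
proof -
  have "bounded (closure {x. \<phi> x \<noteq> 0})" using assms compact_imp_bounded unfolding test_fun_def by blast
  then obtain R where "\<And>x. x \<in> closure {x. \<phi> x \<noteq> 0} \<Longrightarrow> norm x \<le> R" by (auto simp: bounded_iff)
  then show ?thesis using that[of R] not_le by blast
qed

lemma integrable_times_bounded:
  fixes f g :: "'a::euclidean_space \<Rightarrow> real"
  assumes f: "integrable lborel f" and g: "g \<in> borel_measurable borel" "\<And>x. \<bar>g x\<bar> \<le> K"
  shows "integrable lborel (\<lambda>x. f x * g x)"
proof -
  have "integrable lborel (\<lambda>x. K * f x)" using f by simp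
  then show ?thesis
  proof (rule Bochner_Integration.integrable_bound)
    show "(\<lambda>x. f x * g x) \<in> borel_measurable lborel" using f g by simp
    have "0 \<le> K" using g(2)[of undefined] by linarith
    then show "AE x in lborel. norm (f x * g x) \<le> norm (K * f x)"
      using g(2) by (auto simp: abs_mult mult.commute[of K] intro!: mult_left_mono)
  qed
qed

lemma compact_support_bounded:
  fixes g :: "'a::euclidean_space \<Rightarrow> real"
  assumes "continuous_on UNIV g" "\<And>x. R < norm x \<Longrightarrow> g x = 0"
  obtains K where "\<And>x. \<bar>g x\<bar> \<le> K"
proof -
  have "bounded (g ` cball 0 R)"
    by (intro compact_imp_bounded compact_continuous_image continuous_on_subset[OF assms(1)]) auto
  then obtain K where K: "\<And>z. z \<in> cball 0 R \<Longrightarrow> \<bar>g z\<bar> \<le> K" by (force simp: bounded_iff)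
  have "\<bar>g z\<bar> \<le> max K 0" for z
    using K[of z] assms(2)[of z] by (cases "norm z \<le> R") (auto simp: le_max_iff_disj)
  then show ?thesis by (rule that)
qed

lemma test_fun_integrable:
  assumes \<phi>: "test_fun U \<phi>" and f: "integrable lborel f"
  shows "integrable lborel (\<lambda>x. f x * \<phi> x)" "integrable lborel (\<lambda>x. f x * partial_deriv j \<phi> x)"
proof -
  obtain R where R: "\<And>x. R < norm x \<Longrightarrow> x \<notin> closure {x. \<phi> x \<noteq> 0}" using test_fun_bounded_support[OF \<phi>] by blast
  note c = test_fun_continuous[OF \<phi>]
  have z: "\<phi> x = 0" "partial_deriv j \<phi> x = 0" if "R < norm x" for x
    using test_fun_partial_outside[OF \<phi> R[OF that]] .
  obtain K where K: "\<And>x. \<bar>\<phi> x\<bar> \<le> K"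
    using compact_support_bounded[OF c(1) z(1)] by blast
  show "integrable lborel (\<lambda>x. f x * \<phi> x)"
    by (rule integrable_times_bounded[OF f borel_measurable_continuous_onI[OF c(1)] K])
  obtain K' where K': "\<And>x. \<bar>partial_deriv j \<phi> x\<bar> \<le> K'"
    using compact_support_bounded[OF c(2) z(2)] by blast
  show "integrable lborel (\<lambda>x. f x * partial_deriv j \<phi> x)"
    by (rule integrable_times_bounded[OF f borel_measurable_continuous_onI[OF c(2)] K'])
qed

text \<open>Testing with mollifiers centred at x annihilates the convolutions, which converge to f
  at Lebesgue points.\<close>

lemma fundamental_lemma:
  fixes f :: "real^'n::finite \<Rightarrow> real"
  assumes f: "integrable lborel f" and \<Omega>: "open \<Omega>" and z: "\<And>\<phi>. test_fun \<Omega> \<phi> \<Longrightarrow> (\<integral>x. f x * \<phi> x \<partial>lborel) = 0"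
  shows "AE x in lborel. x \<in> \<Omega> \<longrightarrow> f x = 0"
proof -
  obtain \<Phi> :: "('n \<Rightarrow> nat) \<Rightarrow> real^'n \<Rightarrow> real" where
    \<Phi>: "kernel_family 1 \<Phi>" "\<And>x. \<Phi> z0 x \<ge> 0" "(\<integral>x. \<Phi> z0 x \<partial>lborel) = 1" using mollifier_exists by blast
  obtain K where K: "K > 0" "\<And>x. \<bar>\<Phi> z0 x\<bar> \<le> K" using kernel_family_bounded[OF \<Phi>(1)] by blast
  obtain q :: "nat \<Rightarrow> real" where q: "\<And>k. 0 < q k" "q \<longlonglongrightarrow> 0"
    "AE x in lborel. (\<lambda>k. \<integral>y. indicator (ball 0 1) y * norm (f (x + q k *\<^sub>R y) - f x) \<partial>lborel) \<longlonglongrightarrow> 0"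
    using Lebesgue_points_along_sequence[OF f] by blast
  from q(3) show ?thesis
  proof eventually_elim
    fix x assume x: "(\<lambda>k. \<integral>y. indicator (ball 0 1) y * norm (f (x + q k *\<^sub>R y) - f x) \<partial>lborel) \<longlonglongrightarrow> 0"
    show "x \<in> \<Omega> \<longrightarrow> f x = 0"
    proof
      assume "x \<in> \<Omega>"
      then obtain e where e: "e > 0" "cball x e \<subseteq> \<Omega>" using \<Omega> open_contains_cball by blast
      have "\<forall>\<^sub>F k in sequentially. q k < e" using q(2) e(1) by (rule order_tendstoD(2))
      then have ev: "\<forall>\<^sub>F k in sequentially. \<bar>f x\<bar> \<le> K * (\<integral>y. indicator (ball 0 1) y * norm (f (x + q k *\<^sub>R y) - f x) \<partial>lborel)"
      proof eventually_elim
        fix k assume "q k < e"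
        then have "cball x (q k) \<subseteq> \<Omega>" using e(2) subset_cball[of "q k" e x] by simp
        then have "test_fun \<Omega> (\<lambda>y. mollify \<Phi> (q k) z0 (x - y))"
          by (rule test_fun_reflect[OF mollify_props(1)[OF \<Phi> q(1)]])
        then have "cv f (mollify \<Phi> (q k) z0) x = 0" unfolding cv_def by (rule z)
        then show "\<bar>f x\<bar> \<le> K * (\<integral>y. indicator (ball 0 1) y * norm (f (x + q k *\<^sub>R y) - f x) \<partial>lborel)"
          using mollify_error[OF \<Phi> q(1) f K(2), of k x] by simp
      qed
      have "(\<lambda>k. K * (\<integral>y. indicator (ball 0 1) y * norm (f (x + q k *\<^sub>R y) - f x) \<partial>lborel)) \<longlonglongrightarrow> 0"
        using x by (rule tendsto_mult_right_zero)
      from tendsto_lowerbound[OF this ev] show "f x = 0" by simp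
    qed
  qed
qed

lemma weak_ED_Borel_integrable:
  assumes "weak_ED_Borel U u G"
  shows "integrable lborel (\<lambda>x. u x $ i)" "integrable lborel (\<lambda>x. G x $ i $ j)"
  using assms integrable_bounded_linear[OF bounded_linear_vec_nth]
    integrable_bounded_linear[OF bounded_linear_vec_nth integrable_bounded_linear[OF bounded_linear_vec_nth]]
  unfolding weak_ED_Borel_def by blast+

lemma weak_ED_Borel_eq:
  assumes "weak_ED_Borel (U::(real^'n::finite) set) u G" "test_fun U \<phi>"
  shows "(\<integral>x. G x $ i $ j * \<phi> x \<partial>lborel) =
            - (1/2) * ((\<integral>x. u x $ i * partial_deriv j \<phi> x \<partial>lborel) + (\<integral>x. u x $ j * partial_deriv i \<phi> x \<partial>lborel))
            + (if i = j then (1 / real CARD('n)) * (\<Sum>k\<in>UNIV. \<integral>x. u x $ k * partial_deriv k \<phi> x \<partial>lborel) else 0)"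
  using assms unfolding weak_ED_Borel_def by blast

text \<open>The right side of the weak identity is symmetric and trace-free for every test function.
  The blow-up uses this when the value of G at a point becomes the matrix of a linear comparison
  field.\<close>

lemma weak_ED_Borel_sym_tracefree:
  fixes U :: "(real^'n::finite) set"
  assumes w: "weak_ED_Borel U u G" and U: "open U"
  shows "AE x in lborel. x \<in> U \<longrightarrow> (\<forall>i j. G x $ i $ j = G x $ j $ i) \<and> (\<Sum>i\<in>UNIV. G x $ i $ i) = 0"
proof -
  note int = weak_ED_Borel_integrable[OF w]
  have s: "AE x in lborel. x \<in> U \<longrightarrow> G x $ i $ j - G x $ j $ i = 0" for i j
  proof (rule fundamental_lemma[OF _ U])
    show "integrable lborel (\<lambda>x. G x $ i $ j - G x $ j $ i)" by (intro Bochner_Integration.integrable_diff int)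
    fix \<phi> assume \<phi>: "test_fun U \<phi>"
    have "(\<integral>x. (G x $ i $ j - G x $ j $ i) * \<phi> x \<partial>lborel) = (\<integral>x. G x $ i $ j * \<phi> x \<partial>lborel) - (\<integral>x. G x $ j $ i * \<phi> x \<partial>lborel)"
      using test_fun_integrable(1)[OF \<phi> int(2)] by (simp add: left_diff_distrib)
    then show "(\<integral>x. (G x $ i $ j - G x $ j $ i) * \<phi> x \<partial>lborel) = 0"
      unfolding weak_ED_Borel_eq[OF w \<phi>] by auto
  qed
  have t: "AE x in lborel. x \<in> U \<longrightarrow> (\<Sum>i\<in>UNIV. G x $ i $ i) = 0"
  proof (rule fundamental_lemma[OF _ U])
    show "integrable lborel (\<lambda>x. \<Sum>i\<in>UNIV. G x $ i $ i)" by (intro Bochner_Integration.integrable_sum int)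
    fix \<phi> assume \<phi>: "test_fun U \<phi>"
    have "(\<integral>x. (\<Sum>i\<in>UNIV. G x $ i $ i) * \<phi> x \<partial>lborel) = (\<Sum>i\<in>UNIV. \<integral>x. G x $ i $ i * \<phi> x \<partial>lborel)"
      using test_fun_integrable(1)[OF \<phi> int(2)] by (simp add: sum_distrib_right)
    also have "\<dots> = (\<Sum>i\<in>UNIV. - (\<integral>x. u x $ i * partial_deriv i \<phi> x \<partial>lborel)
        + (1 / real CARD('n)) * (\<Sum>k\<in>UNIV. \<integral>x. u x $ k * partial_deriv k \<phi> x \<partial>lborel))"
      unfolding weak_ED_Borel_eq[OF w \<phi>] by (intro sum.cong) auto
    also have "\<dots> = 0" by (simp add: sum.distrib sum_negf sum_subtractf)
    finally show "(\<integral>x. (\<Sum>i\<in>UNIV. G x $ i $ i) * \<phi> x \<partial>lborel) = 0" .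
  qed
  have "AE x in lborel. \<forall>i\<in>UNIV. \<forall>j\<in>UNIV. x \<in> U \<longrightarrow> G x $ i $ j - G x $ j $ i = 0"
    by (intro AE_finite_allI s) auto
  with t show ?thesis by eventually_elim auto
qed

lemma iter_partial_dilate:
  fixes f :: "real^'n::finite \<Rightarrow> real"
  assumes f: "smooth_fun f"
  shows "iter_partial js (\<lambda>y. f (s *\<^sub>R (y - x))) = (\<lambda>y. s ^ length js * iter_partial js f (s *\<^sub>R (y - x)))"
proof (induction js)
  case (Cons j js)
  have d: "((\<lambda>y. s ^ length js * iter_partial js f (s *\<^sub>R (y - x))) has_derivative
     (\<lambda>h. \<Sum>i\<in>UNIV. h$i * (s ^ length (j # js) * partial_deriv i (iter_partial js f) (s *\<^sub>R (y - x))))) (at y)" for y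
  proof -
    have 1: "((\<lambda>y. s *\<^sub>R (y - x)) has_derivative (\<lambda>h. s *\<^sub>R h)) (at y)" by (auto intro!: derivative_eq_intros)
    have "iter_partial js f differentiable (at (s *\<^sub>R (y - x)))" using f unfolding smooth_fun_def by blast
    from has_derivative_mult_right[OF has_derivative_compose[OF 1 frechet_partial_sum[OF this]], of "s ^ length js"]
    show ?thesis by (rule has_derivative_eq_rhs) (simp add: fun_eq_iff sum_distrib_left mult_ac)
  qed
  show ?case
    by (simp only: iter_partial.simps Cons.IH) (rule ext, rule partial_deriv_eqI[OF d])
qed simp

lemma test_fun_dilate:
  fixes \<phi> :: "real^'n::finite \<Rightarrow> real"
  assumes \<phi>: "test_fun (ball 0 1) \<phi>" and r: "r > 0"
  shows "test_fun (ball x r) (\<lambda>y. \<phi> ((1/r) *\<^sub>R (y - x)))"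
    and "partial_deriv j (\<lambda>y. \<phi> ((1/r) *\<^sub>R (y - x))) y = (1/r) * partial_deriv j \<phi> ((1/r) *\<^sub>R (y - x))"
proof -
  have sm: "smooth_fun \<phi>" using \<phi> by (simp add: test_fun_def)
  show "partial_deriv j (\<lambda>y. \<phi> ((1/r) *\<^sub>R (y - x))) y = (1/r) * partial_deriv j \<phi> ((1/r) *\<^sub>R (y - x))"
    using fun_cong[OF iter_partial_dilate[OF sm, of "[j]" "1/r" x], of y] by simp
  have "smooth_fun (\<lambda>y. \<phi> ((1/r) *\<^sub>R (y - x)))"
    unfolding smooth_fun_def iter_partial_dilate[OF sm]
  proof (intro allI)
    fix js y
    have "iter_partial js \<phi> differentiable (at ((1/r) *\<^sub>R (y - x)))" using sm unfolding smooth_fun_def by blast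
    then have "(\<lambda>y. iter_partial js \<phi> ((1/r) *\<^sub>R (y - x))) differentiable at y"
      by (rule differentiable_compose[of "iter_partial js \<phi>" "\<lambda>y. (1/r) *\<^sub>R (y - x)"]) (intro derivative_intros; simp)
    then show "(\<lambda>y. (1 / r) ^ length js * iter_partial js \<phi> ((1 / r) *\<^sub>R (y - x))) differentiable at y"
      by (intro differentiable_mult) auto
  qed
  moreover define S where "S = closure {x. \<phi> x \<noteq> 0}"
  define S' where "S' = (\<lambda>z. x + r *\<^sub>R z) ` S"
  have S: "compact S" "S \<subseteq> ball 0 1" using \<phi> by (auto simp: test_fun_def S_def)
  have S': "compact S'" unfolding S'_def by (intro compact_continuous_image continuous_intros S)
  have "{y. \<phi> ((1/r) *\<^sub>R (y - x)) \<noteq> 0} \<subseteq> S'"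
  proof
    fix y assume "y \<in> {y. \<phi> ((1/r) *\<^sub>R (y - x)) \<noteq> 0}"
    then have "(1/r) *\<^sub>R (y - x) \<in> S" using closure_subset[of "{x. \<phi> x \<noteq> 0}"] by (auto simp: S_def)
    moreover have "y = x + r *\<^sub>R ((1/r) *\<^sub>R (y - x))" using r by simp
    ultimately show "y \<in> S'" unfolding S'_def by blast
  qed
  then have cl: "closure {y. \<phi> ((1/r) *\<^sub>R (y - x)) \<noteq> 0} \<subseteq> S'" by (rule closure_minimal) (rule compact_imp_closed[OF S'])
  moreover have "S' \<subseteq> ball x r" unfolding S'_def
  proof
    fix y assume "y \<in> (\<lambda>z. x + r *\<^sub>R z) ` S"
    then obtain z where z: "y = x + r *\<^sub>R z" "z \<in> S" by blast
    then have "norm z < 1" using S(2) by auto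
    then show "y \<in> ball x r" using r z(1) by (simp add: dist_norm)
  qed
  moreover have "compact (closure {y. \<phi> ((1/r) *\<^sub>R (y - x)) \<noteq> 0})"
    unfolding compact_eq_bounded_closed
    using bounded_subset[OF compact_imp_bounded[OF S'] cl] by simp
  ultimately show "test_fun (ball x r) (\<lambda>y. \<phi> ((1/r) *\<^sub>R (y - x)))"
    unfolding test_fun_def by blast
qed

section \<open>Vanishing of the gradient outside the support\<close>

lemma borel_measurable_component:
  fixes f :: "'a \<Rightarrow> ('b::real_normed_vector)^'n::finite"
  assumes "f \<in> borel_measurable M" shows "(\<lambda>x. f x $ i) \<in> borel_measurable M"
  by (rule borel_measurable_continuous_on[OF continuous_on_component[OF continuous_on_id] assms])

lemma weak_ED_Borel_scaleR:
  assumes w: "weak_ED_Borel (U::(real^'n::finite) set) u G"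
  shows "weak_ED_Borel U (\<lambda>x. r *\<^sub>R u x) (\<lambda>x. r *\<^sub>R G x)"
proof -
  have u: "(\<integral>x. (r *\<^sub>R u x) $ i * p x \<partial>lborel) = r * (\<integral>x. u x $ i * p x \<partial>lborel)" for i p
    by (simp add: mult.assoc)
  have g: "(\<integral>x. (r *\<^sub>R G x) $ i $ j * p x \<partial>lborel) = r * (\<integral>x. G x $ i $ j * p x \<partial>lborel)" for i j p
    by (simp add: mult.assoc)
  show ?thesis unfolding weak_ED_Borel_def
  proof (intro conjI allI impI)
    show "integrable lborel (\<lambda>x. r *\<^sub>R u x)" "integrable lborel (\<lambda>x. r *\<^sub>R G x)"
      using w unfolding weak_ED_Borel_def by (blast intro: integrable_scaleR_right)+
    fix \<phi> i j assume \<phi>: "test_fun U \<phi>"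
    show "(\<integral>x. (r *\<^sub>R G x) $ i $ j * \<phi> x \<partial>lborel) =
            - (1/2) * ((\<integral>x. (r *\<^sub>R u x) $ i * partial_deriv j \<phi> x \<partial>lborel) + (\<integral>x. (r *\<^sub>R u x) $ j * partial_deriv i \<phi> x \<partial>lborel))
            + (if i = j then (1 / real CARD('n)) * (\<Sum>k\<in>UNIV. \<integral>x. (r *\<^sub>R u x) $ k * partial_deriv k \<phi> x \<partial>lborel) else 0)"
      unfolding u g weak_ED_Borel_eq[OF w \<phi>] sum_distrib_left[symmetric] by (cases "i = j"; simp add: algebra_simps)
  qed
qed

lemma weak_ED_Borel_diff:
  assumes w: "weak_ED_Borel (U::(real^'n::finite) set) u G" and w': "weak_ED_Borel U u' G'"
  shows "weak_ED_Borel U (\<lambda>x. u x - u' x) (\<lambda>x. G x - G' x)"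
  unfolding weak_ED_Borel_def
proof (intro conjI allI impI)
  show "integrable lborel (\<lambda>x. u x - u' x)" "integrable lborel (\<lambda>x. G x - G' x)"
    using w w' unfolding weak_ED_Borel_def by (blast intro: Bochner_Integration.integrable_diff)+
  fix \<phi> i j assume \<phi>: "test_fun U \<phi>"
  note int = weak_ED_Borel_integrable[OF w] weak_ED_Borel_integrable[OF w']
  have u: "(\<integral>x. (u x - u' x) $ i * partial_deriv j \<phi> x \<partial>lborel) =
      (\<integral>x. u x $ i * partial_deriv j \<phi> x \<partial>lborel) - (\<integral>x. u' x $ i * partial_deriv j \<phi> x \<partial>lborel)" for i j
    using test_fun_integrable(2)[OF \<phi> int(1)] test_fun_integrable(2)[OF \<phi> int(3)] by (simp add: left_diff_distrib)
  have g: "(\<integral>x. (G x - G' x) $ i $ j * \<phi> x \<partial>lborel) = (\<integral>x. G x $ i $ j * \<phi> x \<partial>lborel) - (\<integral>x. G' x $ i $ j * \<phi> x \<partial>lborel)"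
    using test_fun_integrable(1)[OF \<phi> int(2)] test_fun_integrable(1)[OF \<phi> int(4)] by (simp add: left_diff_distrib)
  show "(\<integral>x. (G x - G' x) $ i $ j * \<phi> x \<partial>lborel) =
          - (1/2) * ((\<integral>x. (u x - u' x) $ i * partial_deriv j \<phi> x \<partial>lborel) + (\<integral>x. (u x - u' x) $ j * partial_deriv i \<phi> x \<partial>lborel))
          + (if i = j then (1 / real CARD('n)) * (\<Sum>k\<in>UNIV. \<integral>x. (u x - u' x) $ k * partial_deriv k \<phi> x \<partial>lborel) else 0)"
    unfolding u g weak_ED_Borel_eq[OF w \<phi>] weak_ED_Borel_eq[OF w' \<phi>] sum_subtractf by (cases "i = j"; simp add: algebra_simps)
qed

lemma weak_ED_Borel_cong_on:
  fixes U :: "(real^'n::finite) set"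
  assumes w: "weak_ED_Borel U u G" and int: "integrable lborel u'" "integrable lborel G'"
    and e: "AE x in lborel. x \<in> U \<longrightarrow> u' x = u x" "AE x in lborel. x \<in> U \<longrightarrow> G' x = G x"
  shows "weak_ED_Borel U u' G'"
  unfolding weak_ED_Borel_def
proof (intro conjI int allI impI)
  fix \<phi> i j assume \<phi>: "test_fun U \<phi>"
  have m: "\<phi> \<in> borel_measurable borel" "partial_deriv k \<phi> \<in> borel_measurable borel" for k
    by (intro borel_measurable_continuous_onI test_fun_continuous[OF \<phi>])+
  have [measurable]: "u \<in> borel_measurable borel" "G \<in> borel_measurable borel" using weak_ED_Borel_measurable[OF w] .
  have [measurable]: "u' \<in> borel_measurable borel" "G' \<in> borel_measurable borel" using int by simp_all
  have u: "(\<integral>x. u' x $ i * partial_deriv j \<phi> x \<partial>lborel) = (\<integral>x. u x $ i * partial_deriv j \<phi> x \<partial>lborel)" for i j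
  proof (rule integral_cong_AE)
    show "AE x in lborel. u' x $ i * partial_deriv j \<phi> x = u x $ i * partial_deriv j \<phi> x"
      using e(1) by eventually_elim (use test_fun_partial_outside'[OF \<phi>] in fastforce)
  qed (auto intro!: borel_measurable_times borel_measurable_component m)
  have g: "(\<integral>x. G' x $ i $ j * \<phi> x \<partial>lborel) = (\<integral>x. G x $ i $ j * \<phi> x \<partial>lborel)"
  proof (rule integral_cong_AE)
    show "AE x in lborel. G' x $ i $ j * \<phi> x = G x $ i $ j * \<phi> x"
      using e(2) by eventually_elim (use test_fun_outside[OF \<phi>] in fastforce)
  qed (auto intro!: borel_measurable_times borel_measurable_component m)
  show "(\<integral>x. G' x $ i $ j * \<phi> x \<partial>lborel) =
          - (1/2) * ((\<integral>x. u' x $ i * partial_deriv j \<phi> x \<partial>lborel) + (\<integral>x. u' x $ j * partial_deriv i \<phi> x \<partial>lborel))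
          + (if i = j then (1 / real CARD('n)) * (\<Sum>k\<in>UNIV. \<integral>x. u' x $ k * partial_deriv k \<phi> x \<partial>lborel) else 0)"
    unfolding u g by (rule weak_ED_Borel_eq[OF w \<phi>])
qed

text \<open>The factor 1/r compensates the chain rule, so the gradient is only translated and
  dilated and does not scale.\<close>

lemma weak_ED_Borel_affine:
  fixes U :: "(real^'n::finite) set"
  assumes w: "weak_ED_Borel U u G" and U: "ball x r \<subseteq> U" and r: "r > 0"
  shows "weak_ED_Borel (ball 0 1) (\<lambda>y. (1/r) *\<^sub>R u (x + r *\<^sub>R y)) (\<lambda>y. G (x + r *\<^sub>R y))"
  unfolding weak_ED_Borel_def
proof (intro conjI allI impI)
  have int: "integrable lborel u" "integrable lborel G" using w unfolding weak_ED_Borel_def by blast+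
  have r0: "r \<noteq> 0" using r by simp
  show "integrable lborel (\<lambda>y. (1/r) *\<^sub>R u (x + r *\<^sub>R y))" "integrable lborel (\<lambda>y. G (x + r *\<^sub>R y))"
    by (intro integrable_scaleR_right integrable_lborel_affine int r0)+
  fix \<phi> :: "real^'n \<Rightarrow> real" and i j :: 'n assume \<phi>: "test_fun (ball 0 1) \<phi>"
  define \<phi>' where "\<phi>' = (\<lambda>y. \<phi> ((1/r) *\<^sub>R (y - x)))"
  have \<phi>': "test_fun U \<phi>'" unfolding \<phi>'_def by (rule test_fun_mono[OF test_fun_dilate(1)[OF \<phi> r] U])
  have [simp]: "\<phi>' (x + r *\<^sub>R y) = \<phi> y" for y using r by (simp add: \<phi>'_def)
  have [simp]: "partial_deriv j \<phi>' (x + r *\<^sub>R y) = (1/r) * partial_deriv j \<phi> y" for j y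
    using r unfolding \<phi>'_def test_fun_dilate(2)[OF \<phi> r] by simp
  define N where "N = \<bar>r\<bar> ^ DIM(real^'n)"
  have N: "N \<noteq> 0" using r by (simp add: N_def)
  have u: "(\<integral>z. u z $ i * partial_deriv j \<phi>' z \<partial>lborel) = N * (\<integral>y. ((1/r) *\<^sub>R u (x + r *\<^sub>R y)) $ i * partial_deriv j \<phi> y \<partial>lborel)" for i j
  proof -
    have "(\<lambda>z. u z $ i * partial_deriv j \<phi>' z) \<in> borel_measurable borel"
      using test_fun_integrable(2)[OF \<phi>' weak_ED_Borel_integrable(1)[OF w]] by simp
    from integral_lborel_affine[OF this r0, of x] show ?thesis by (simp add: N_def mult_ac)
  qed
  have g: "(\<integral>z. G z $ i $ j * \<phi>' z \<partial>lborel) = N * (\<integral>y. G (x + r *\<^sub>R y) $ i $ j * \<phi> y \<partial>lborel)"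
  proof -
    have "(\<lambda>z. G z $ i $ j * \<phi>' z) \<in> borel_measurable borel"
      using test_fun_integrable(1)[OF \<phi>' weak_ED_Borel_integrable(2)[OF w]] by simp
    from integral_lborel_affine[OF this r0, of x] show ?thesis by (simp add: N_def)
  qed
  let ?v = "\<lambda>y. (1/r) *\<^sub>R u (x + r *\<^sub>R y)"
  have "N * (\<integral>y. G (x + r *\<^sub>R y) $ i $ j * \<phi> y \<partial>lborel) = N *
          (- (1/2) * ((\<integral>y. ?v y $ i * partial_deriv j \<phi> y \<partial>lborel) + (\<integral>y. ?v y $ j * partial_deriv i \<phi> y \<partial>lborel))
          + (if i = j then (1 / real CARD('n)) * (\<Sum>k\<in>UNIV. \<integral>y. ?v y $ k * partial_deriv k \<phi> y \<partial>lborel) else 0))"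
    using weak_ED_Borel_eq[OF w \<phi>', of i j] unfolding u g sum_distrib_left[symmetric] by (cases "i = j") (simp_all only: if_True if_False algebra_simps simp_thms)
  then show "(\<integral>y. G (x + r *\<^sub>R y) $ i $ j * \<phi> y \<partial>lborel) =
          (- (1/2) * ((\<integral>y. ?v y $ i * partial_deriv j \<phi> y \<partial>lborel) + (\<integral>y. ?v y $ j * partial_deriv i \<phi> y \<partial>lborel))
          + (if i = j then (1 / real CARD('n)) * (\<Sum>k\<in>UNIV. \<integral>y. ?v y $ k * partial_deriv k \<phi> y \<partial>lborel) else 0))"
    using N by (simp only: mult_cancel_left simp_thms)
qed

text \<open>A symmetric trace-free matrix is its own deviatoric symmetric gradient. The cut-off
  provides integrability and is invisible to test functions of the ball.\<close>

lemma weak_ED_Borel_linear: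
  fixes M :: "real^'n::finite^'n"
  assumes M: "\<And>i j. M $ i $ j = M $ j $ i" "(\<Sum>i\<in>UNIV. M $ i $ i) = 0"
  shows "weak_ED_Borel (ball 0 1) (\<lambda>y. indicator (ball 0 1) y *\<^sub>R (M *v y)) (\<lambda>y. indicator (ball 0 1) y *\<^sub>R M)"
  unfolding weak_ED_Borel_def
proof (intro conjI allI impI)
  have c: "continuous_on UNIV (\<lambda>y. M *v y)" by (intro matrix_vector_mult_linear_continuous_on)
  show "integrable lborel (\<lambda>y::real^'n. indicator (ball 0 1) y *\<^sub>R M)"
    by (intro integrable_scaleR_left integrable_indicator_ball)
  have "integrable lborel (\<lambda>y. indicator (cball 0 1) y *\<^sub>R (M *v y))"
    by (intro borel_integrable_compact continuous_on_subset[OF c]) auto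
  then show "integrable lborel (\<lambda>y. indicator (ball 0 1) y *\<^sub>R (M *v y))"
  proof (rule Bochner_Integration.integrable_bound)
    have "(\<lambda>y. M *v y) \<in> borel_measurable borel" using c by (rule borel_measurable_continuous_onI)
    then show "(\<lambda>y. indicator (ball 0 1) y *\<^sub>R (M *v y)) \<in> borel_measurable lborel"
      by (auto intro!: borel_measurable_scaleR borel_measurable_indicator)
  qed (auto simp: indicator_def)
  fix \<phi> :: "real^'n \<Rightarrow> real" and i j :: 'n assume \<phi>: "test_fun (ball 0 1) \<phi>"
  have s: "smooth_fun \<phi>" using \<phi> by (simp add: test_fun_def)
  have g: "(\<integral>y. (indicator (ball 0 1) y *\<^sub>R M) $ i $ j * \<phi> y \<partial>lborel) = M $ i $ j * (\<integral>y. \<phi> y \<partial>lborel)" for i j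
  proof -
    have e: "(indicator (ball 0 1) y *\<^sub>R M) $ i $ j * \<phi> y = M $ i $ j * \<phi> y" for y
      using test_fun_outside[OF \<phi>, of y] by (auto simp: indicator_def)
    show ?thesis unfolding e by simp
  qed
  have u: "(\<integral>y. (indicator (ball 0 1) y *\<^sub>R (M *v y)) $ i * partial_deriv j \<phi> y \<partial>lborel) = - (M $ i $ j * (\<integral>y. \<phi> y \<partial>lborel))" for i j
  proof -
    have e: "(indicator (ball 0 1) y *\<^sub>R (M *v y)) $ i * partial_deriv j \<phi> y = partial_deriv j \<phi> y * (M *v y) $ i" for y
      using test_fun_partial_outside'[OF \<phi>, of y j] by (auto simp: indicator_def)
    have "(\<integral>y. \<phi> y * M $ i $ j \<partial>lborel) = - (\<integral>y. partial_deriv j \<phi> y * (M *v y) $ i \<partial>lborel)"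
    proof (rule integration_by_parts[where R=1 and ?\<psi>1.0="\<lambda>j. partial_deriv j \<phi>" and ?f1.0="\<lambda>j z. M $ i $ j"])
      show "(\<phi> has_derivative (\<lambda>h. \<Sum>j\<in>UNIV. h$j * partial_deriv j \<phi> z)) (at z)" for z
        by (rule frechet_partial_sum[OF smooth_fun_differentiable[OF s]])
      show "continuous_on UNIV (partial_deriv j \<phi>)" for j by (rule test_fun_continuous(2)[OF \<phi>])
      show "\<phi> z = 0" if "1 < norm z" for z using test_fun_outside[OF \<phi>, of z] that by simp
      show "partial_deriv j \<phi> z = 0" if "1 < norm z" for j z using test_fun_partial_outside'[OF \<phi>, of z j] that by simp
      show "((\<lambda>y. (M *v y) $ i) has_derivative (\<lambda>h. \<Sum>j\<in>UNIV. h$j * M $ i $ j)) (at z)" for z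
        unfolding matrix_vector_mult_def
        by (auto intro!: derivative_eq_intros bounded_linear_imp_has_derivative[OF bounded_linear_vec_nth] simp: mult.commute)
    qed auto
    then show ?thesis unfolding e by (simp add: mult.commute)
  qed
  have t: "(\<Sum>k\<in>UNIV. - (M $ k $ k * (\<integral>y. \<phi> y \<partial>lborel))) = 0"
    using M(2) by (simp add: sum_negf sum_distrib_right[symmetric])
  show "(\<integral>y. (indicator (ball 0 1) y *\<^sub>R M) $ i $ j * \<phi> y \<partial>lborel) =
          - (1/2) * ((\<integral>y. (indicator (ball 0 1) y *\<^sub>R (M *v y)) $ i * partial_deriv j \<phi> y \<partial>lborel)
             + (\<integral>y. (indicator (ball 0 1) y *\<^sub>R (M *v y)) $ j * partial_deriv i \<phi> y \<partial>lborel))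
          + (if i = j then (1 / real CARD('n)) * (\<Sum>k\<in>UNIV. \<integral>y. (indicator (ball 0 1) y *\<^sub>R (M *v y)) $ k * partial_deriv k \<phi> y \<partial>lborel) else 0)"
    unfolding u g t by (simp add: M(1)[of j i])
qed

text \<open>Symmetric trace-free and conformal matrices meet only in 0. Quantitatively, the skew
  part of P cancels in sums over transposed entries, and its diagonal cancels in differences of
  diagonal entries of M + P.\<close>

lemma dev_sym_norm_bound:
  fixes M P :: "real^'n::finite^'n"
  assumes M: "\<And>i j. M $ i $ j = M $ j $ i" "(\<Sum>i\<in>UNIV. M $ i $ i) = 0" and P: "conformal P"
  shows "norm M \<le> 2 * real CARD('n) * real CARD('n) * norm (M + P)"
proof -
  define N where "N = norm (M + P)"
  have cN: "\<bar>M $ i $ j + P $ i $ j\<bar> \<le> N" for i j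
  proof -
    have "\<bar>(M + P) $ i $ j\<bar> \<le> norm ((M + P) $ i)" by (rule component_le_norm_cart)
    also have "\<dots> \<le> N" unfolding N_def by (rule Finite_Cartesian_Product.norm_nth_le)
    finally show ?thesis by simp
  qed
  have p: "P $ i $ j + P $ j $ i = (if i = j then 2 * P $ k $ k else 0)" for i j k using P unfolding conformal_def by blast
  have b: "\<bar>M $ i $ j\<bar> \<le> 2 * N" for i j
  proof (cases "i = j")
    case False
    have "2 * M $ i $ j = (M $ i $ j + P $ i $ j) + (M $ j $ i + P $ j $ i)" using p[of i j i] False M(1)[of i j] by simp
    then show ?thesis using cN[of i j] cN[of j i] by linarith
  next
    case True
    have "real CARD('n) * M $ i $ i = (\<Sum>k\<in>UNIV. M $ i $ i - M $ k $ k)" by (simp add: sum_subtractf M(2))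
    also have "\<bar>\<dots>\<bar> \<le> (\<Sum>k\<in>(UNIV::'n set). 2 * N)"
    proof (rule order_trans[OF sum_abs sum_mono])
      fix k show "\<bar>M $ i $ i - M $ k $ k\<bar> \<le> 2 * N" using p[of i i k] cN[of i i] cN[of k k] by (simp; linarith)
    qed
    finally have "\<bar>M $ i $ i\<bar> * real CARD('n) \<le> 2 * N * real CARD('n)" by (simp add: abs_mult mult_ac)
    then show ?thesis using True mult_right_le_imp_le[of "\<bar>M $ i $ i\<bar>" "real CARD('n)" "2 * N"] by simp
  qed
  have "norm M \<le> (\<Sum>i\<in>UNIV. norm (M $ i))" unfolding norm_vec_def[of M] by (rule L2_set_le_sum) auto
  also have "\<dots> \<le> (\<Sum>i\<in>(UNIV::'n set). \<Sum>j\<in>(UNIV::'n set). 2 * N)"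
    by (intro sum_mono order_trans[OF norm_le_l1_cart sum_mono] b)
  finally show ?thesis by (simp add: N_def mult_ac)
qed

lemma Korn_on_ball:
  assumes n: "CARD('n::finite) \<ge> 3" and A: "young_function A" and R: "R > 0"
  shows "Korn_on A (ball (0::real^'n) R)"
proof (rule star_shaped_Korn[OF n A open_ball bounded_ball, of "R/2" 0 0 R])
  show "cball (0::real^'n) (R/2) \<subseteq> ball 0 R" using R by auto
  fix x z :: "real^'n" and t :: real assume "x \<in> ball 0 R" "z \<in> cball 0 (R/2)" "t \<in> {0..1}"
  then have "(1 - t) *\<^sub>R x + t *\<^sub>R z \<in> ball 0 R" using R by (intro convexD_alt[OF convex_ball]) auto
  then show "x + t *\<^sub>R (z - x) \<in> ball 0 R" by (simp add: algebra_simps del: mem_ball)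
next
  fix C :: real
  assume "C > 0" "\<And>u G. weak_ED_Borel (ball (0::real^'n) R) u G \<Longrightarrow> (\<integral>\<^sup>+x. A (norm (G x)) \<partial>lborel) \<le> 1 \<Longrightarrow>
        \<exists>w\<in>Sigma_fields. (\<integral>\<^sup>+x. indicator (ball 0 R) x * A (norm (u x - w x) / C) \<partial>lborel) \<le> 1"
  then show ?thesis unfolding Korn_on_def by (intro exI[of _ C]) simp
qed (use R in simp)

lemma norm_fst_le_norm: "norm (fst p) \<le> norm p"
  by (cases p) (simp add: norm_fst_le)

lemma norm_snd_le_norm: "norm (snd p) \<le> norm p"
  by (cases p) (simp add: norm_snd_le)

text \<open>At a point x outside \<Omega>, let M be the value of G. The rescaled field minus My has
  a small gradient in L^1, hence is close to some w in \<Sigma>; but the rescaled field vanishes on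
  most of the ball. So My + w is small, while its linear part is M plus a conformal matrix, which
  cannot cancel M.\<close>

lemma blow_up_zero:
  fixes U \<Omega> :: "(real^'n::finite) set"
  assumes n: "CARD('n) \<ge> 3" and w: "weak_ED_Borel U u G" and U: "open U" and \<Omega>: "\<Omega> \<in> sets borel" "bounded \<Omega>"
    and u0: "\<And>x. x \<notin> \<Omega> \<Longrightarrow> u x = 0"
  shows "AE x in lborel. x \<in> U \<longrightarrow> x \<notin> \<Omega> \<longrightarrow> G x = 0"
proof -
  obtain C where C: "C > 0" "\<And>u G. weak_ED_Borel (ball (0::real^'n) 1) u G \<Longrightarrow> (\<integral>\<^sup>+x. ennreal (norm (G x)) \<partial>lborel) \<le> 1 \<Longrightarrow>
        \<exists>w\<in>Sigma_fields. (\<integral>\<^sup>+x. indicator (ball 0 1) x * ennreal (norm (u x - w x) / C) \<partial>lborel) \<le> 1"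
    using Korn_on_ball[OF n young_ennreal zero_less_one] unfolding Korn_on_def by blast
  obtain \<kappa> where \<kappa>: "\<kappa> > 0" "\<And>c::'n qcoef. ennreal (\<kappa> * norm c) \<le> (\<integral>\<^sup>+x. indicator (ball 0 1) x * ennreal (norm (qf c x)) \<partial>lborel)"
    using qf_norm_equivalence[of 1 "0::real^'n"] by auto
  obtain K where K: "K > 0" "\<And>(c::'n qcoef) x. norm x \<le> 1 \<Longrightarrow> norm (qf c x) \<le> K * norm c"
    using qf_bound[of 1] by auto
  have int: "integrable lborel u" "integrable lborel G" using w unfolding weak_ED_Borel_def by blast+
  \<comment> \<open>Pairing the gradient with the indicator gives one sequence of radii and one set
    of Lebesgue points for both.\<close>
  define f where "f = (\<lambda>x. (G x, indicator \<Omega> x :: real))"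
  have "emeasure lborel \<Omega> < \<infinity>" using \<Omega>(2) by (rule emeasure_bounded_finite)
  then have i\<Omega>: "integrable lborel (indicator \<Omega> :: real^'n \<Rightarrow> real)" using \<Omega>(1) by (simp add: integrable_indicator_iff)
  have "integrable lborel (\<lambda>x. (G x, 0::real) + (0, indicator \<Omega> x))"
    by (intro Bochner_Integration.integrable_add
        integrable_bounded_linear[OF bounded_linear_Pair[OF bounded_linear_ident bounded_linear_zero] int(2)]
        integrable_bounded_linear[OF bounded_linear_Pair[OF bounded_linear_zero bounded_linear_ident] i\<Omega>])
  then have f: "integrable lborel f" by (simp add: f_def)
  obtain q :: "nat \<Rightarrow> real" where q: "\<And>k. 0 < q k" "q \<longlonglongrightarrow> 0"
    "AE x in lborel. (\<lambda>k. \<integral>y. indicator (ball 0 1) y * norm (f (x + q k *\<^sub>R y) - f x) \<partial>lborel) \<longlonglongrightarrow> 0"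
    using Lebesgue_points_along_sequence[OF f] by blast
  \<comment> \<open>The dimensional factor is that of \<open>dev_sym_norm_bound\<close>; 2C/\<kappa>
    bounds the coefficients of My + w once half of them has been absorbed.\<close>
  define B where "B = 2 * real CARD('n) * real CARD('n) * (2 * C / \<kappa>)"
  from q(3) weak_ED_Borel_sym_tracefree[OF w U] show ?thesis
  proof eventually_elim
    fix x
    assume D0: "(\<lambda>k. \<integral>y. indicator (ball 0 1) y * norm (f (x + q k *\<^sub>R y) - f x) \<partial>lborel) \<longlonglongrightarrow> 0"
      and st: "x \<in> U \<longrightarrow> (\<forall>i j. G x $ i $ j = G x $ j $ i) \<and> (\<Sum>i\<in>UNIV. G x $ i $ i) = 0"
    define D where "D k = (\<integral>y. indicator (ball 0 1) y * norm (f (x + q k *\<^sub>R y) - f x) \<partial>lborel)" for k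
    have D: "D \<longlonglongrightarrow> 0" using D0 unfolding D_def .
    show "x \<in> U \<longrightarrow> x \<notin> \<Omega> \<longrightarrow> G x = 0"
    proof (intro impI)
      assume x: "x \<in> U" "x \<notin> \<Omega>"
      define M where "M = G x"
      have M: "M $ i $ j = M $ j $ i" "(\<Sum>i\<in>UNIV. M $ i $ i) = 0" for i j using st x(1) unfolding M_def by blast+
      obtain e where e: "e > 0" "ball x e \<subseteq> U" using U x(1) open_contains_ball by blast
      have bound: "norm M \<le> B * (D k + q k)" if qe: "q k < e" and Dk: "K * D k < \<kappa> / 2" for k
      proof -
        define r where "r = q k"
        have r: "r > 0" "r \<noteq> 0" using q(1)[of k] by (simp_all add: r_def)
        \<comment> \<open>The scale by which the blow-up is normalised to modular 1; adding r keeps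
          it positive when the oscillation vanishes.\<close>
        define l where "l = D k + r"
        define E where "E y = indicator (ball 0 1) y * norm (f (x + r *\<^sub>R y) - f x)" for y
        have E: "integrable lborel E" "D k = (\<integral>y. E y \<partial>lborel)" "E y \<ge> 0" for y
          unfolding E_def D_def r_def[symmetric] by (auto intro: integrable_indicator_shift[OF f r(2)])
        have DE: "(\<integral>\<^sup>+y. ennreal (E y) \<partial>lborel) = ennreal (D k)" unfolding E(2) by (rule nn_integral_eq_integral) (use E in auto)
        have D0: "0 \<le> D k" unfolding E(2) using E(3) by simp
        have l: "l > 0" "D k \<le> l" using D0 r by (simp_all add: l_def)
        define v where "v y = (1/r) *\<^sub>R u (x + r *\<^sub>R y) - indicator (ball 0 1) y *\<^sub>R (M *v y)" for y
        \<comment> \<open>The difference of gradients is controlled only in the unit ball, so it is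
          cut off there; the weak relation in the ball is unaffected.\<close>
        define H where "H y = indicator (ball 0 1) y *\<^sub>R (G (x + r *\<^sub>R y) - M)" for y
        have bU: "ball x r \<subseteq> U" using e(2) qe by (auto simp: r_def)
        have w1: "weak_ED_Borel (ball 0 1) v (\<lambda>y. G (x + r *\<^sub>R y) - indicator (ball 0 1) y *\<^sub>R M)"
          unfolding v_def by (rule weak_ED_Borel_diff[OF weak_ED_Borel_affine[OF w bU r(1)] weak_ED_Borel_linear[OF M]])
        have Hm: "H \<in> borel_measurable borel"
        proof -
          have "(\<lambda>y. G (x + r *\<^sub>R y)) \<in> borel_measurable borel" using integrable_lborel_affine[OF int(2) r(2), of x] by simp
          then show ?thesis unfolding H_def by (intro borel_measurable_scaleR borel_measurable_diff borel_measurable_indicator) auto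
        qed
        have HE: "norm (H y) \<le> E y" for y
        proof -
          have "norm (G (x + r *\<^sub>R y) - M) \<le> norm (f (x + r *\<^sub>R y) - f x)"
            using norm_fst_le_norm[of "f (x + r *\<^sub>R y) - f x"] by (simp add: f_def M_def)
          then show ?thesis by (simp add: H_def E_def indicator_def)
        qed
        have Hi: "integrable lborel H"
          by (rule Bochner_Integration.integrable_bound[OF E(1)]) (use Hm HE E(3) in auto)
        have vi: "integrable lborel v" using w1 unfolding weak_ED_Borel_def by blast
        have "weak_ED_Borel (ball 0 1) v H"
          by (rule weak_ED_Borel_cong_on[OF w1 vi Hi]) (auto simp: H_def)
        then have w2: "weak_ED_Borel (ball 0 1) (\<lambda>y. (1/l) *\<^sub>R v y) (\<lambda>y. (1/l) *\<^sub>R H y)" by (rule weak_ED_Borel_scaleR)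
        have "(\<integral>\<^sup>+y. ennreal (norm ((1/l) *\<^sub>R H y)) \<partial>lborel) \<le> (\<integral>\<^sup>+y. ennreal (1/l) * ennreal (E y) \<partial>lborel)"
        proof (rule nn_integral_mono)
          fix y
          have "norm ((1/l) *\<^sub>R H y) \<le> (1/l) * E y" using HE[of y] l by (simp add: divide_right_mono)
          then show "ennreal (norm ((1/l) *\<^sub>R H y)) \<le> ennreal (1/l) * ennreal (E y)"
            using l E(3) by (simp add: ennreal_mult[symmetric] ennreal_leI)
        qed
        also have "\<dots> = ennreal (1/l) * ennreal (D k)" unfolding DE[symmetric] by (rule nn_integral_cmult) (use E(1) in simp)
        also have "\<dots> = ennreal (D k / l)" using l D0 by (simp add: ennreal_mult[symmetric])
        also have "\<dots> \<le> 1" using l D0 by (simp add: ennreal_le_1)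
        finally obtain w where w: "w \<in> Sigma_fields"
          "(\<integral>\<^sup>+y. indicator (ball 0 1) y * ennreal (norm ((1/l) *\<^sub>R v y - w y) / C) \<partial>lborel) \<le> 1" using C(2)[OF w2] by blast
        obtain c0 where c0: "conformal (fst (snd c0))" "w = qf c0" using Sigma_fields_qf[OF w(1)] .
        define cM :: "'n qcoef" where "cM = (0, M, 0)"
        define c where "c = cM + l *\<^sub>R c0"
        have qc: "qf c y = M *v y + l *\<^sub>R w y" for y
          unfolding c_def qf_add qf_scaleR c0(2)[symmetric] by (simp add: cM_def qf_def)
        let ?I = "\<lambda>y. indicator (ball 0 1) y * ennreal (norm ((1/l) *\<^sub>R v y - w y) / C)"
        have Im: "?I \<in> borel_measurable lborel"
        proof -
          have "v \<in> borel_measurable lborel" "w \<in> borel_measurable lborel" using vi qf_measurable[of c0] c0(2) by auto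
          then have "(\<lambda>y. norm ((1/l) *\<^sub>R v y - w y) / C) \<in> borel_measurable lborel" by simp
          then show ?thesis by (intro borel_measurable_times_ennreal borel_measurable_indicator measurable_compose[OF _ measurable_ennreal]) auto
        qed
        have "ennreal (\<kappa> * norm c) \<le> (\<integral>\<^sup>+y. indicator (ball 0 1) y * ennreal (norm (qf c y)) \<partial>lborel)" by (rule \<kappa>(2))
        also have "\<dots> \<le> (\<integral>\<^sup>+y. ennreal (l * C) * ?I y + ennreal (K * norm c) * ennreal (E y) \<partial>lborel)"
        proof (rule nn_integral_mono)
          fix y :: "real^'n"
          show "indicator (ball 0 1) y * ennreal (norm (qf c y)) \<le> ennreal (l * C) * ?I y + ennreal (K * norm c) * ennreal (E y)"
          proof (cases "y \<in> ball 0 1")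
            case y: True
            show ?thesis
            proof (cases "x + r *\<^sub>R y \<in> \<Omega>")
              case True
              \<comment> \<open>Where the rescaled point lies in \<Omega> the field is not known to
                vanish, but the indicator jumps by 1, so E is at least 1 and the trivial bound for
                the field can be charged to the oscillation.\<close>
              have "(1::real) \<le> norm (snd (f (x + r *\<^sub>R y) - f x))" using True x by (simp add: f_def)
              also have "\<dots> \<le> E y" using y norm_snd_le_norm[of "f (x + r *\<^sub>R y) - f x"] by (simp add: E_def)
              finally have "K * norm c * 1 \<le> K * norm c * E y" using K(1) by (intro mult_left_mono) auto
              moreover have "norm (qf c y) \<le> K * norm c" using y by (intro K(2)) simp
              ultimately have "norm (qf c y) \<le> K * norm c * E y" by simp
              then have "ennreal (norm (qf c y)) \<le> ennreal (K * norm c) * ennreal (E y)"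
                using K(1) E(3) by (simp add: ennreal_mult[symmetric] ennreal_leI)
              then show ?thesis using y by (auto intro: add_increasing simp del: mem_ball)
            next
              case False
              have vy: "v y = - (M *v y)" using y u0[OF False] by (simp add: v_def del: mem_ball)
              have "qf c y = - (l *\<^sub>R ((1/l) *\<^sub>R v y - w y))" using l by (simp add: qc vy scaleR_diff_right)
              then have "norm (qf c y) = l * norm ((1/l) *\<^sub>R v y - w y)" using l by (simp only: norm_minus_cancel norm_scaleR)
              also have "\<dots> = (l * C) * (norm ((1/l) *\<^sub>R v y - w y) / C)" using C(1) by simp
              finally have "ennreal (norm (qf c y)) = ennreal (l * C) * ennreal (norm ((1/l) *\<^sub>R v y - w y) / C)"
                using l C(1) by (simp only: ennreal_mult[symmetric] divide_nonneg_nonneg mult_nonneg_nonneg less_imp_le norm_ge_zero)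
              then show ?thesis using y by (simp del: mem_ball)
            qed
          qed simp
        qed
        also have "\<dots> = ennreal (l * C) * (\<integral>\<^sup>+y. ?I y \<partial>lborel) + ennreal (K * norm c) * (\<integral>\<^sup>+y. ennreal (E y) \<partial>lborel)"
        proof -
          have Em: "(\<lambda>y. ennreal (E y)) \<in> borel_measurable lborel" using E(1) by simp
          show ?thesis
            by (subst nn_integral_add) (simp_all only: nn_integral_cmult[OF Im] nn_integral_cmult[OF Em] borel_measurable_times_ennreal Im Em measurable_const space_borel UNIV_I)
        qed
        also have "\<dots> \<le> ennreal (l * C) * 1 + ennreal (K * norm c) * ennreal (D k)"
          unfolding DE by (intro add_right_mono mult_left_mono w(2)) auto
        also have "\<dots> = ennreal (l * C + K * norm c * D k)"
          using l C K D0 by (simp add: ennreal_mult[symmetric] ennreal_plus[symmetric] del: ennreal_plus)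
        finally have 1: "\<kappa> * norm c \<le> l * C + K * norm c * D k"
          using l C K D0 by (subst (asm) ennreal_le_iff) auto
        \<comment> \<open>For small oscillation the part charged to \<Omega> is absorbed by half of
          the left side.\<close>
        have "K * D k * norm c \<le> \<kappa> / 2 * norm c" using Dk by (intro mult_right_mono) auto
        with 1 have "\<kappa> / 2 * norm c \<le> l * C" by (simp add: mult_ac)
        then have nc: "norm c \<le> 2 * C / \<kappa> * l" using \<kappa>(1) by (simp add: field_simps)
        have cf: "conformal (l *\<^sub>R fst (snd c0))"
          unfolding conformal_def
        proof (intro allI)
          fix i j k
          have "fst (snd c0) $ i $ j + fst (snd c0) $ j $ i = (if i = j then 2 * fst (snd c0) $ k $ k else 0)"
            using c0(1) unfolding conformal_def by blast
          from arg_cong[OF this, of "\<lambda>z. l * z"]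
          show "(l *\<^sub>R fst (snd c0)) $ i $ j + (l *\<^sub>R fst (snd c0)) $ j $ i = (if i = j then 2 * (l *\<^sub>R fst (snd c0)) $ k $ k else 0)"
            by (simp add: distrib_left split: if_splits)
        qed
        have "M + l *\<^sub>R fst (snd c0) = fst (snd c)" by (simp add: c_def cM_def)
        then have "norm M \<le> 2 * real CARD('n) * real CARD('n) * norm (fst (snd c))"
          using dev_sym_norm_bound[OF M cf] by simp
        also have "\<dots> \<le> 2 * real CARD('n) * real CARD('n) * (2 * C / \<kappa> * l)"
        proof (rule mult_left_mono)
          have "norm (fst (snd c)) \<le> norm c" using norm_fst_le_norm[of "snd c"] norm_snd_le_norm[of c] by (rule order_trans)
          then show "norm (fst (snd c)) \<le> 2 * C / \<kappa> * l" using nc by linarith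
        qed simp
        finally show ?thesis by (simp add: B_def l_def r_def mult.assoc)
      qed
      have "(\<lambda>k. K * D k) \<longlonglongrightarrow> 0" using D by (rule tendsto_mult_right_zero)
      then have "\<forall>\<^sub>F k in sequentially. K * D k < \<kappa> / 2" by (rule order_tendstoD(2)) (use \<kappa>(1) in simp)
      moreover have "\<forall>\<^sub>F k in sequentially. q k < e" using q(2) e(1) by (rule order_tendstoD(2))
      ultimately have ev: "\<forall>\<^sub>F k in sequentially. norm M \<le> B * (D k + q k)" by eventually_elim (rule bound)
      have "(\<lambda>k. B * (D k + q k)) \<longlonglongrightarrow> 0" using tendsto_mult_right_zero[OF tendsto_add_zero[OF D q(2)], of B] .
      from tendsto_lowerbound[OF this ev] show "G x = 0" by (simp add: M_def)
    qed
  qed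
qed

section \<open>Luxemburg norms\<close>

lemma nn_integral_lebesgue_on_eq:
  fixes f :: "'a::euclidean_space \<Rightarrow> ennreal"
  assumes S: "S \<in> sets borel" and e: "AE x in lborel. x \<in> S \<longrightarrow> f x = g x"
  shows "(\<integral>\<^sup>+x. f x \<partial>lebesgue_on S) = (\<integral>\<^sup>+x. indicator S x * g x \<partial>lborel)"
proof -
  have S': "S \<in> sets lebesgue" using S by simp
  have "(\<integral>\<^sup>+x. f x \<partial>lebesgue_on S) = (\<integral>\<^sup>+x. f x * indicator S x \<partial>lebesgue)"
    by (rule nn_integral_restrict_space) (use S' in simp)
  also have "\<dots> = (\<integral>\<^sup>+x. f x * indicator S x \<partial>lborel)" by (rule nn_integral_completion)
  also have "\<dots> = (\<integral>\<^sup>+x. indicator S x * g x \<partial>lborel)"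
  proof (rule nn_integral_cong_AE)
    show "AE x in lborel. f x * indicator S x = indicator S x * g x"
      using e by eventually_elim (auto simp: indicator_def)
  qed
  finally show ?thesis .
qed

lemma integral_lebesgue_on_eq:
  fixes f g :: "'a::euclidean_space \<Rightarrow> real"
  assumes S: "S \<in> sets borel" and g: "g \<in> borel_measurable lborel" and f: "integrable (lebesgue_on S) f"
    and e: "AE x in lborel. x \<in> S \<longrightarrow> f x = g x" and z: "\<And>x. x \<notin> S \<Longrightarrow> g x = 0"
  shows "(\<integral>x. f x \<partial>lebesgue_on S) = (\<integral>x. g x \<partial>lborel)"
proof -
  have S': "S \<inter> space lebesgue \<in> sets lebesgue" using S by simp
  have "(\<integral>x. f x \<partial>lebesgue_on S) = (\<integral>x. indicator S x *\<^sub>R f x \<partial>lebesgue)" by (rule integral_restrict_space[OF S'])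
  also have "\<dots> = (\<integral>x. g x \<partial>lebesgue)"
  proof (rule integral_cong_AE)
    show "(\<lambda>x. indicator S x *\<^sub>R f x) \<in> borel_measurable lebesgue"
      using f unfolding integrable_restrict_space[OF S'] by (rule borel_measurable_integrable)
    show "g \<in> borel_measurable lebesgue" using g by (rule measurable_completion)
    show "AE x in lebesgue. indicator S x *\<^sub>R f x = g x"
      unfolding AE_completion_iff using e by eventually_elim (use z in \<open>auto simp: indicator_def\<close>)
  qed
  also have "\<dots> = (\<integral>x. g x \<partial>lborel)" using g by (rule integral_completion)
  finally show ?thesis .
qed

lemma lebesgue_measurable_Borel_version:
  fixes g :: "'a::euclidean_space \<Rightarrow> 'b::euclidean_space"
  assumes g: "g \<in> borel_measurable lebesgue"
  obtains h where "h \<in> borel_measurable borel" "AE x in lborel. g x = h x"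
proof -
  have "\<forall>b\<in>Basis. \<exists>k. k \<in> borel_measurable lborel \<and> (AE x in lborel. g x \<bullet> b = k x)"
  proof
    fix b :: 'b assume "b \<in> Basis"
    have "(\<lambda>x. g x \<bullet> b) \<in> borel_measurable lebesgue" using g by simp
    from completion_ex_borel_measurable_real[OF this]
    show "\<exists>k. k \<in> borel_measurable lborel \<and> (AE x in lborel. g x \<bullet> b = k x)" by blast
  qed
  then obtain k where k: "\<And>b. b \<in> Basis \<Longrightarrow> k b \<in> borel_measurable lborel" "\<And>b. b \<in> Basis \<Longrightarrow> AE x in lborel. g x \<bullet> b = k b x"
    unfolding bchoice_iff by blast
  define h where "h x = (\<Sum>b\<in>Basis. k b x *\<^sub>R b)" for x
  have "AE x in lborel. \<forall>b\<in>Basis. g x \<bullet> b = k b x" by (intro AE_finite_allI k(2)) auto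
  then have "AE x in lborel. g x = h x"
  proof eventually_elim
    fix x assume "\<forall>b\<in>Basis. g x \<bullet> b = k b x"
    then have "h x = (\<Sum>b\<in>Basis. (g x \<bullet> b) *\<^sub>R b)" unfolding h_def by (intro sum.cong) auto
    then show "g x = h x" by (simp only: euclidean_representation)
  qed
  moreover have "h \<in> borel_measurable borel"
  proof -
    have "h \<in> borel_measurable lborel" unfolding h_def[abs_def]
      by (intro borel_measurable_sum borel_measurable_scaleR k(1)) auto
    then show ?thesis by simp
  qed
  ultimately show ?thesis using that by blast
qed

text \<open>On the bounded set \<open>S\<close> the Orlicz condition implies integrability by
  \<open>young_L1_bound\<close>; cutting off outside then gives a field on the whole space that can
  be mollified.\<close>

lemma orlicz_Borel_version:
  fixes u :: "'a::euclidean_space \<Rightarrow> 'b::euclidean_space"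
  assumes A: "young_function A" and u: "u \<in> orlicz_space A V" and V: "V \<in> sets borel"
    and S: "S \<in> sets borel" "bounded S" "S \<subseteq> V"
  obtains u' where "integrable lborel u'" "\<And>x. x \<notin> S \<Longrightarrow> u' x = 0" "AE x in lborel. x \<in> S \<longrightarrow> u x = u' x"
proof -
  obtain l where l: "l > 0" "(\<integral>\<^sup>+x. A (norm (u x) / l) \<partial>lebesgue_on V) \<le> 1" using u unfolding orlicz_space_def by blast
  have "u \<in> borel_measurable (lebesgue_on V)" using u unfolding orlicz_space_def by blast
  then have "(\<lambda>x. if x \<in> V then u x else 0) \<in> borel_measurable lebesgue" by (rule borel_measurable_if_I) (use V in simp)
  then obtain h where h: "h \<in> borel_measurable borel" "AE x in lborel. (if x \<in> V then u x else 0) = h x"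
    using lebesgue_measurable_Borel_version by blast
  have uh: "AE x in lborel. x \<in> V \<longrightarrow> u x = h x" using h(2) by eventually_elim auto
  define u' where "u' x = indicator S x *\<^sub>R h x" for x
  have m: "u' \<in> borel_measurable borel"
    unfolding u'_def using h(1) S(1) by (intro borel_measurable_scaleR borel_measurable_indicator) auto
  have e: "AE x in lborel. x \<in> S \<longrightarrow> u x = u' x" using uh by eventually_elim (use S(3) in \<open>auto simp: u'_def\<close>)
  have "(\<integral>\<^sup>+x. indicator S x * A (norm (u' x) / l) \<partial>lborel) \<le> (\<integral>\<^sup>+x. indicator V x * A (norm (h x) / l) \<partial>lborel)"
    by (rule nn_integral_mono) (use S(3) in \<open>auto simp: indicator_def u'_def\<close>)
  also have "\<dots> = (\<integral>\<^sup>+x. A (norm (u x) / l) \<partial>lebesgue_on V)"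
  proof (rule nn_integral_lebesgue_on_eq[OF V, symmetric])
    show "AE x in lborel. x \<in> V \<longrightarrow> A (norm (u x) / l) = A (norm (h x) / l)" using uh by eventually_elim auto
  qed
  also have "\<dots> \<le> 1" by (rule l(2))
  finally have one: "(\<integral>\<^sup>+x. indicator S x * A (norm (u' x) / l) \<partial>lborel) \<le> 1" .
  obtain K where K: "K \<ge> 0" "\<And>f::'a \<Rightarrow> real. f \<in> borel_measurable borel \<Longrightarrow> (\<And>x. 0 \<le> f x) \<Longrightarrow>
     (\<integral>\<^sup>+x. indicator S x * A (f x) \<partial>lborel) \<le> 1 \<Longrightarrow> (\<integral>\<^sup>+x. indicator S x * ennreal (f x) \<partial>lborel) \<le> ennreal K"
    using young_L1_bound[OF A S(1,2)] by blast
  have um: "(\<lambda>x. norm (u' x) / l) \<in> borel_measurable borel" using m by simp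
  have "(\<integral>\<^sup>+x. ennreal (norm (u' x) / l) \<partial>lborel) = (\<integral>\<^sup>+x. indicator S x * ennreal (norm (u' x) / l) \<partial>lborel)"
    by (rule nn_integral_cong) (simp add: u'_def indicator_def)
  also have "\<dots> \<le> ennreal K" by (rule K(2)[OF um _ one]) (use l(1) in simp)
  finally have "(\<integral>\<^sup>+x. ennreal (norm (u' x) / l) \<partial>lborel) < \<infinity>" using order_le_less_trans by fastforce
  then have "integrable lborel (\<lambda>x. norm (u' x) / l)" using um l(1) by (simp add: integrable_iff_bounded)
  from integrable_mult_right[OF this, of l] have "integrable lborel (\<lambda>x. norm (u' x))" using l(1) by simp
  then have "integrable lborel u'" using m by (simp add: integrable_norm_iff)
  moreover have "u' x = 0" if "x \<notin> S" for x using that by (simp add: u'_def)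
  ultimately show ?thesis using e that by blast
qed

text \<open>The two sets are kept apart for extensions by zero: there the identity is given on the
  whole space, but integrable representatives exist only for bounded pieces.\<close>

lemma weak_EDgrad_Borel:
  fixes V :: "(real^'n::finite) set"
  assumes w: "weak_EDgrad V u G" and V: "V \<in> sets borel" and S: "S \<subseteq> V"
    and int: "integrable lborel u'" "integrable lborel G'"
    and e: "AE x in lborel. x \<in> S \<longrightarrow> u x = u' x" "AE x in lborel. x \<in> S \<longrightarrow> G x = G' x"
  shows "weak_ED_Borel S u' G'"
  unfolding weak_ED_Borel_def
proof (intro conjI int allI impI)
  fix \<phi> i j assume \<phi>: "test_fun S \<phi>"
  have \<phi>V: "test_fun V \<phi>" by (rule test_fun_mono[OF \<phi> S])
  have m: "\<phi> \<in> borel_measurable borel" "partial_deriv k \<phi> \<in> borel_measurable borel" for k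
    by (intro borel_measurable_continuous_onI test_fun_continuous[OF \<phi>])+
  have mu: "u' \<in> borel_measurable borel" "G' \<in> borel_measurable borel" using int by simp_all
  note W = w[unfolded weak_EDgrad_def, rule_format, OF \<phi>V]
  have u: "(\<integral>x. u x $ i * partial_deriv j \<phi> x \<partial>lebesgue_on V) = (\<integral>x. u' x $ i * partial_deriv j \<phi> x \<partial>lborel)" for i j
  proof (rule integral_lebesgue_on_eq[OF V])
    show "(\<lambda>x. u' x $ i * partial_deriv j \<phi> x) \<in> borel_measurable lborel"
      using mu by (auto intro!: borel_measurable_times borel_measurable_component m)
    show "integrable (lebesgue_on V) (\<lambda>x. u x $ i * partial_deriv j \<phi> x)" using W by blast
    show "AE x in lborel. x \<in> V \<longrightarrow> u x $ i * partial_deriv j \<phi> x = u' x $ i * partial_deriv j \<phi> x"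
      using e(1) by eventually_elim (use test_fun_partial_outside'[OF \<phi>] in fastforce)
    show "u' x $ i * partial_deriv j \<phi> x = 0" if "x \<notin> V" for x using test_fun_partial_outside'[OF \<phi>V that] by simp
  qed
  have g: "(\<integral>x. G x $ i $ j * \<phi> x \<partial>lebesgue_on V) = (\<integral>x. G' x $ i $ j * \<phi> x \<partial>lborel)" for i j
  proof (rule integral_lebesgue_on_eq[OF V])
    show "(\<lambda>x. G' x $ i $ j * \<phi> x) \<in> borel_measurable lborel"
      using mu by (auto intro!: borel_measurable_times borel_measurable_component m)
    show "integrable (lebesgue_on V) (\<lambda>x. G x $ i $ j * \<phi> x)" using W by blast
    show "AE x in lborel. x \<in> V \<longrightarrow> G x $ i $ j * \<phi> x = G' x $ i $ j * \<phi> x"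
      using e(2) by eventually_elim (use test_fun_outside[OF \<phi>] in fastforce)
    show "G' x $ i $ j * \<phi> x = 0" if "x \<notin> V" for x using test_fun_outside[OF \<phi>V that] by simp
  qed
  show "(\<integral>x. G' x $ i $ j * \<phi> x \<partial>lborel) =
          - (1/2) * ((\<integral>x. u' x $ i * partial_deriv j \<phi> x \<partial>lborel) + (\<integral>x. u' x $ j * partial_deriv i \<phi> x \<partial>lborel))
          + (if i = j then (1 / real CARD('n)) * (\<Sum>k\<in>UNIV. \<integral>x. u' x $ k * partial_deriv k \<phi> x \<partial>lborel) else 0)"
    using W unfolding u g by blast
qed

lemma lux_norm_le:
  assumes "l > 0" "(\<integral>\<^sup>+x. A (norm (u x) / l) \<partial>lebesgue_on \<Omega>) \<le> 1"
  shows "lux_norm A \<Omega> u \<le> l"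
  unfolding lux_norm_def by (rule cInf_lower) (use assms in \<open>auto intro!: bdd_belowI[of _ 0]\<close>)

text \<open>The bound involves the unspecified real \<open>Inf {}\<close>, the value of the norm outside the Orlicz space.\<close>
lemma lux_norm_lower_bound: "min 0 (Inf {}) \<le> lux_norm A \<Omega> u"
proof (cases "{l::real. l > 0 \<and> (\<integral>\<^sup>+ x. A (norm (u x) / l) \<partial>lebesgue_on \<Omega>) \<le> 1} = {}")
  case True
  show ?thesis unfolding lux_norm_def True by simp
next
  case False
  then have "0 \<le> lux_norm A \<Omega> u" unfolding lux_norm_def by (rule cInf_greatest) auto
  then show ?thesis by simp
qed

text \<open>It suffices to treat each admissible l, whether or not the infimum is attained;
  membership of G in the Orlicz space makes the set of admissible l nonempty.\<close>

lemma le_mult_lux_norm: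
  assumes G: "G \<in> orlicz_space A \<Omega>" and C: "C > 0"
    and le: "\<And>l. l > 0 \<Longrightarrow> (\<integral>\<^sup>+x. A (norm (G x) / l) \<partial>lebesgue_on \<Omega>) \<le> 1 \<Longrightarrow> a \<le> C * l"
  shows "a \<le> C * lux_norm A \<Omega> G"
proof -
  have "a / C \<le> lux_norm A \<Omega> G" unfolding lux_norm_def
  proof (rule cInf_greatest)
    show "{l::real. l > 0 \<and> (\<integral>\<^sup>+ x. A (norm (G x) / l) \<partial>lebesgue_on \<Omega>) \<le> 1} \<noteq> {}"
      using G unfolding orlicz_space_def by blast
    fix l assume "l \<in> {l::real. l > 0 \<and> (\<integral>\<^sup>+ x. A (norm (G x) / l) \<partial>lebesgue_on \<Omega>) \<le> 1}"
    then have "a \<le> C * l" by (intro le) auto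
    then show "a / C \<le> l" using C by (simp add: divide_le_eq mult.commute)
  qed
  then show ?thesis using C by (simp add: divide_le_eq mult.commute)
qed

lemma Borel_modular_eq:
  fixes G G' :: "'a::euclidean_space \<Rightarrow> 'b::euclidean_space"
  assumes A: "young_function A" and \<Omega>: "\<Omega> \<in> sets borel" and e: "AE x in lborel. x \<in> \<Omega> \<longrightarrow> G x = G' x"
    and z: "\<And>x. x \<notin> \<Omega> \<Longrightarrow> G' x = 0" and l: "l > 0"
  shows "(\<integral>\<^sup>+x. A (norm ((1/l) *\<^sub>R G' x)) \<partial>lborel) = (\<integral>\<^sup>+x. A (norm (G x) / l) \<partial>lebesgue_on \<Omega>)"
proof -
  have "(\<integral>\<^sup>+x. A (norm (G x) / l) \<partial>lebesgue_on \<Omega>) = (\<integral>\<^sup>+x. indicator \<Omega> x * A (norm (G' x) / l) \<partial>lborel)"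
    by (rule nn_integral_lebesgue_on_eq[OF \<Omega>]) (use e in eventually_elim, auto)
  also have "\<dots> = (\<integral>\<^sup>+x. A (norm ((1/l) *\<^sub>R G' x)) \<partial>lborel)"
    by (rule nn_integral_cong) (use z l young_zero[OF A] in \<open>auto simp: indicator_def\<close>)
  finally show ?thesis ..
qed

text \<open>For each admissible l the pair (u/l, G/l) satisfies the normalised estimate, and
  \<Sigma> is a cone, so its field can be multiplied back by l.\<close>

lemma Korn_on_lux_norm:
  fixes \<Omega> :: "(real^'n::finite) set"
  assumes A: "young_function A" and \<Omega>: "bounded \<Omega>" "open \<Omega>" and K: "Korn_on A \<Omega>"
  shows "\<exists>C::real. \<forall>u G. u \<in> ED_space A \<Omega> \<longrightarrow> G \<in> orlicz_space A \<Omega> \<longrightarrow> weak_EDgrad \<Omega> u G \<longrightarrow>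
            (INF w\<in>Sigma_fields. lux_norm A \<Omega> (\<lambda>x. u x - w x)) \<le> C * lux_norm A \<Omega> G"
proof -
  obtain C where C: "C > 0" "\<And>u G. weak_ED_Borel \<Omega> u G \<Longrightarrow> (\<integral>\<^sup>+x. A (norm (G x)) \<partial>lborel) \<le> 1 \<Longrightarrow>
        \<exists>w\<in>Sigma_fields. (\<integral>\<^sup>+x. indicator \<Omega> x * A (norm (u x - w x) / C) \<partial>lborel) \<le> 1"
    using K unfolding Korn_on_def by blast
  have b\<Omega>: "\<Omega> \<in> sets borel" using \<Omega>(2) by simp
  show ?thesis
  proof (intro exI[of _ C] allI impI)
    fix u :: "real^'n \<Rightarrow> real^'n" and G :: "real^'n \<Rightarrow> real^'n^'n"
    assume "u \<in> ED_space A \<Omega>" and G: "G \<in> orlicz_space A \<Omega>" and w: "weak_EDgrad \<Omega> u G"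
    then have u: "u \<in> orlicz_space A \<Omega>" unfolding ED_space_def by blast
    obtain u' where u': "integrable lborel u'" "\<And>x. x \<notin> \<Omega> \<Longrightarrow> u' x = 0" "AE x in lborel. x \<in> \<Omega> \<longrightarrow> u x = u' x"
      using orlicz_Borel_version[OF A u b\<Omega> b\<Omega> \<Omega>(1) order_refl] by blast
    obtain G' where G': "integrable lborel G'" "\<And>x. x \<notin> \<Omega> \<Longrightarrow> G' x = 0" "AE x in lborel. x \<in> \<Omega> \<longrightarrow> G x = G' x"
      using orlicz_Borel_version[OF A G b\<Omega> b\<Omega> \<Omega>(1) order_refl] by blast
    have w': "weak_ED_Borel \<Omega> u' G'" by (rule weak_EDgrad_Borel[OF w b\<Omega> order_refl u'(1) G'(1) u'(3) G'(3)])
    show "(INF w\<in>Sigma_fields. lux_norm A \<Omega> (\<lambda>x. u x - w x)) \<le> C * lux_norm A \<Omega> G"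
    proof (rule le_mult_lux_norm[OF G C(1)])
      fix l :: real assume l: "l > 0" and one: "(\<integral>\<^sup>+x. A (norm (G x) / l) \<partial>lebesgue_on \<Omega>) \<le> 1"
      have "(\<integral>\<^sup>+x. A (norm ((1/l) *\<^sub>R G' x)) \<partial>lborel) \<le> 1"
        by (rule ord_eq_le_trans[OF Borel_modular_eq[OF A b\<Omega> G'(3,2) l] one])
      then obtain w where w: "w \<in> Sigma_fields" "(\<integral>\<^sup>+x. indicator \<Omega> x * A (norm ((1/l) *\<^sub>R u' x - w x) / C) \<partial>lborel) \<le> 1"
        using C(2)[OF weak_ED_Borel_scaleR[OF w']] by blast
      have e: "norm (u' x - l *\<^sub>R w x) / (C * l) = norm ((1/l) *\<^sub>R u' x - w x) / C" for x
      proof -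
        have "u' x - l *\<^sub>R w x = l *\<^sub>R ((1/l) *\<^sub>R u' x - w x)" using l by (simp add: scaleR_diff_right)
        then have "norm (u' x - l *\<^sub>R w x) = l * norm ((1/l) *\<^sub>R u' x - w x)" using l by (simp only: norm_scaleR)
        then show ?thesis using l by simp
      qed
      have "(\<integral>\<^sup>+x. A (norm (u x - l *\<^sub>R w x) / (C * l)) \<partial>lebesgue_on \<Omega>)
          = (\<integral>\<^sup>+x. indicator \<Omega> x * A (norm (u' x - l *\<^sub>R w x) / (C * l)) \<partial>lborel)"
        by (rule nn_integral_lebesgue_on_eq[OF b\<Omega>]) (use u'(3) in eventually_elim, auto)
      also have "\<dots> \<le> 1" unfolding e by (rule w(2))
      finally have "lux_norm A \<Omega> (\<lambda>x. u x - l *\<^sub>R w x) \<le> C * l" using C(1) l by (intro lux_norm_le) auto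
      \<comment> \<open>The infimum of reals needs a lower bound, which
        \<open>lux_norm_lower_bound\<close> provides uniformly in w, an empty set of admissible l
        included.\<close>
      moreover have "(INF w\<in>Sigma_fields. lux_norm A \<Omega> (\<lambda>x. u x - w x)) \<le> lux_norm A \<Omega> (\<lambda>x. u x - l *\<^sub>R w x)"
        by (rule cINF_lower2[OF _ Sigma_fields_scaleR[OF w(1), of l] order_refl])
           (auto intro!: bdd_belowI2 lux_norm_lower_bound)
      ultimately show "(INF w\<in>Sigma_fields. lux_norm A \<Omega> (\<lambda>x. u x - w x)) \<le> C * l" by linarith
    qed
  qed
qed

text \<open>The gradient \<open>G\<close> is given only in \<Omega>, whereas the estimate in the
  large ball involves the gradient \<open>G1\<close> of the extension. The two agree in \<Omega> by
  the fundamental lemma and \<open>G1\<close> vanishes elsewhere in the ball by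
  \<open>blow_up_zero\<close>, so the modular of \<open>G\<close> over \<Omega> is all that
  enters.\<close>

lemma zero_extension_lux_norm:
  fixes \<Omega> :: "(real^'n::finite) set"
  assumes n: "CARD('n) \<ge> 3" and A: "young_function A" and \<Omega>: "bounded \<Omega>" "open \<Omega>"
  shows "\<exists>C::real. \<forall>u G. u \<in> ED0_space A \<Omega> \<longrightarrow> G \<in> orlicz_space A \<Omega> \<longrightarrow> weak_EDgrad \<Omega> u G \<longrightarrow>
            lux_norm A \<Omega> u \<le> C * lux_norm A \<Omega> G"
proof -
  have b\<Omega>: "\<Omega> \<in> sets borel" using \<Omega>(2) by simp
  obtain R where R: "R > 0" "\<And>x. x \<in> \<Omega> \<Longrightarrow> norm x \<le> R" using \<Omega>(1) unfolding bounded_pos by blast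
  \<comment> \<open>Large enough to contain \<Omega> and also a unit ball disjoint from it.\<close>
  define U where "U = ball (0::real^'n) (R + 3)"
  have U: "open U" "bounded U" "U \<in> sets borel" by (simp_all add: U_def)
  have \<Omega>U: "\<Omega> \<subseteq> U" using R(2) by (force simp: U_def)
  \<comment> \<open>At distance R + 1 the open unit ball consists of points of norm above R, so it
    misses \<Omega>, and of norm below R + 2, so it lies in \<open>U\<close>.\<close>
  obtain p :: "real^'n" where p: "norm p = R + 1" using vector_choose_size[of "R + 1"] R(1) by auto
  have pU: "ball p 1 \<subseteq> U" "ball p 1 \<inter> \<Omega> = {}"
  proof -
    show "ball p 1 \<subseteq> U"
    proof
      fix y assume "y \<in> ball p 1"
      then show "y \<in> U" using norm_triangle_ineq2[of y p] p by (simp add: U_def dist_norm norm_minus_commute)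
    qed
    show "ball p 1 \<inter> \<Omega> = {}"
    proof -
      have "y \<notin> \<Omega>" if "y \<in> ball p 1" for y
        using norm_triangle_ineq2[of p y] p R(2)[of y] that by (auto simp: dist_norm)
      then show ?thesis by blast
    qed
  qed
  have "Korn_on A U" unfolding U_def by (rule Korn_on_ball[OF n A]) (use R(1) in simp)
  then obtain C where C: "C > 0" "\<And>u G. weak_ED_Borel U u G \<Longrightarrow> (\<integral>\<^sup>+x. A (norm (G x)) \<partial>lborel) \<le> 1 \<Longrightarrow>
        \<exists>w\<in>Sigma_fields. (\<integral>\<^sup>+x. indicator U x * A (norm (u x - w x) / C) \<partial>lborel) \<le> 1"
    unfolding Korn_on_def by blast
  obtain K0 where K0: "K0 \<ge> 0" "\<And>c. (\<integral>\<^sup>+x. indicator (ball p 1) x * A (norm (qf c x) / C) \<partial>lborel) \<le> 1 \<Longrightarrow> norm c \<le> K0"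
    using qf_coef_bound[OF A zero_less_one C(1)] by blast
  obtain K where K: "K > 0" "\<And>(c::'n qcoef) x. norm x \<le> R \<Longrightarrow> norm (qf c x) \<le> K * norm c"
    using qf_bound[of R] R(1) by auto
  have KK: "K * K0 \<ge> 0" using K K0 by simp
  obtain C' where C': "C' > 0" "\<And>f w :: real^'n \<Rightarrow> real^'n. f \<in> borel_measurable borel \<Longrightarrow> w \<in> borel_measurable borel \<Longrightarrow>
     (\<And>x. x \<in> \<Omega> \<Longrightarrow> norm (w x) \<le> K * K0) \<Longrightarrow> (\<integral>\<^sup>+x. indicator \<Omega> x * A (norm (f x - w x) / C) \<partial>lborel) \<le> 1 \<Longrightarrow>
     (\<integral>\<^sup>+x. indicator \<Omega> x * A (norm (f x) / C') \<partial>lborel) \<le> ennreal 1"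
    using modular_shift[OF A b\<Omega> \<Omega>(1) C(1) KK zero_less_one] by blast
  show ?thesis
  proof (intro exI[of _ C'] allI impI)
    fix u :: "real^'n \<Rightarrow> real^'n" and G :: "real^'n \<Rightarrow> real^'n^'n"
    assume u: "u \<in> ED0_space A \<Omega>" and G: "G \<in> orlicz_space A \<Omega>" and w: "weak_EDgrad \<Omega> u G"
    define v where "v = (\<lambda>x. if x \<in> \<Omega> then u x else 0)"
    obtain G0 where v: "v \<in> orlicz_space A UNIV" and G0: "G0 \<in> orlicz_space A UNIV" "weak_EDgrad UNIV v G0"
      using u unfolding ED0_space_def ED_space_def v_def by blast
    have bU: "(UNIV :: (real^'n) set) \<in> sets borel" by simp
    obtain u' where u': "integrable lborel u'" "\<And>x. x \<notin> \<Omega> \<Longrightarrow> u' x = 0" "AE x in lborel. x \<in> \<Omega> \<longrightarrow> v x = u' x"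
      using orlicz_Borel_version[OF A v bU b\<Omega> \<Omega>(1) subset_UNIV] by blast
    obtain G1 where G1: "integrable lborel G1" "\<And>x. x \<notin> U \<Longrightarrow> G1 x = 0" "AE x in lborel. x \<in> U \<longrightarrow> G0 x = G1 x"
      using orlicz_Borel_version[OF A G0(1) bU U(3,2) subset_UNIV] by blast
    obtain G' where G': "integrable lborel G'" "\<And>x. x \<notin> \<Omega> \<Longrightarrow> G' x = 0" "AE x in lborel. x \<in> \<Omega> \<longrightarrow> G x = G' x"
      using orlicz_Borel_version[OF A G b\<Omega> b\<Omega> \<Omega>(1) order_refl] by blast
    have uu: "AE x in lborel. x \<in> \<Omega> \<longrightarrow> u x = u' x" using u'(3) by eventually_elim (simp add: v_def)
    have vu: "AE x in lborel. x \<in> U \<longrightarrow> v x = u' x" using u'(3) by eventually_elim (use u'(2) in \<open>auto simp: v_def\<close>)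
    have w1: "weak_ED_Borel U u' G1" by (rule weak_EDgrad_Borel[OF G0(2) bU subset_UNIV u'(1) G1(1) vu G1(3)])
    have w2: "weak_ED_Borel \<Omega> u' G'" by (rule weak_EDgrad_Borel[OF w b\<Omega> order_refl u'(1) G'(1) uu G'(3)])
    have w3: "weak_ED_Borel \<Omega> (\<lambda>x. u' x - u' x) (\<lambda>x. G' x - G1 x)"
      by (rule weak_ED_Borel_diff[OF w2 weak_ED_Borel_mono[OF w1 \<Omega>U]])
    have "AE x in lborel. x \<in> \<Omega> \<longrightarrow> (G' x - G1 x) $ i $ j = 0" for i j
    proof (rule fundamental_lemma[OF weak_ED_Borel_integrable(2)[OF w3] \<Omega>(2)])
      fix \<phi> assume "test_fun \<Omega> \<phi>"
      from weak_ED_Borel_eq[OF w3 this, of i j]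
      show "(\<integral>x. (G' x - G1 x) $ i $ j * \<phi> x \<partial>lborel) = 0" by (simp split: if_splits)
    qed
    then have "AE x in lborel. \<forall>i\<in>UNIV. \<forall>j\<in>UNIV. x \<in> \<Omega> \<longrightarrow> (G' x - G1 x) $ i $ j = 0"
      by (intro AE_finite_allI) auto
    then have "AE x in lborel. x \<in> \<Omega> \<longrightarrow> G' x = G1 x" by eventually_elim (auto simp: vec_eq_iff)
    moreover have "AE x in lborel. x \<in> U \<longrightarrow> x \<notin> \<Omega> \<longrightarrow> G1 x = 0"
      by (rule blow_up_zero[OF n w1 U(1) b\<Omega> \<Omega>(1) u'(2)])
    ultimately have GG: "AE x in lborel. x \<in> U \<longrightarrow> G' x = G1 x" by eventually_elim (use G'(2) in auto)
    have w4: "weak_ED_Borel U u' G'" by (rule weak_ED_Borel_cong_on[OF w1 u'(1) G'(1) _ GG]) simp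
    have um: "u' \<in> borel_measurable borel" using u'(1) by simp
    show "lux_norm A \<Omega> u \<le> C' * lux_norm A \<Omega> G"
    proof (rule le_mult_lux_norm[OF G C'(1)])
      fix l :: real assume l: "l > 0" and one: "(\<integral>\<^sup>+x. A (norm (G x) / l) \<partial>lebesgue_on \<Omega>) \<le> 1"
      have "(\<integral>\<^sup>+x. A (norm ((1/l) *\<^sub>R G' x)) \<partial>lborel) \<le> 1"
        by (rule ord_eq_le_trans[OF Borel_modular_eq[OF A b\<Omega> G'(3,2) l] one])
      then obtain w where w: "w \<in> Sigma_fields" "(\<integral>\<^sup>+x. indicator U x * A (norm ((1/l) *\<^sub>R u' x - w x) / C) \<partial>lborel) \<le> 1"
        using C(2)[OF weak_ED_Borel_scaleR[OF w4]] by blast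
      obtain c where c: "w = qf c" using Sigma_fields_qf[OF w(1)] by blast
      \<comment> \<open>The extended field vanishes on this ball, so the estimate there bounds w
        alone and thereby its coefficients, independently of u.\<close>
      have "(\<integral>\<^sup>+x. indicator (ball p 1) x * A (norm (qf c x) / C) \<partial>lborel)
          \<le> (\<integral>\<^sup>+x. indicator U x * A (norm ((1/l) *\<^sub>R u' x - w x) / C) \<partial>lborel)"
      proof (rule nn_integral_mono)
        fix x show "indicator (ball p 1) x * A (norm (qf c x) / C) \<le> indicator U x * A (norm ((1/l) *\<^sub>R u' x - w x) / C)"
        proof (cases "x \<in> ball p 1")
          case True
          then have "x \<in> U" "u' x = 0" using pU u'(2) by blast+
          then show ?thesis using True by (simp add: c del: mem_ball)
        qed simp
      qed
      then have nc: "norm c \<le> K0" using w(2) by (intro K0(2)) (rule order_trans)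
      have "(\<integral>\<^sup>+x. indicator \<Omega> x * A (norm ((1/l) *\<^sub>R u' x - w x) / C) \<partial>lborel)
          \<le> (\<integral>\<^sup>+x. indicator U x * A (norm ((1/l) *\<^sub>R u' x - w x) / C) \<partial>lborel)"
        by (rule nn_integral_mono) (use \<Omega>U in \<open>auto simp: indicator_def\<close>)
      then have "(\<integral>\<^sup>+x. indicator \<Omega> x * A (norm ((1/l) *\<^sub>R u' x - w x) / C) \<partial>lborel) \<le> 1"
        using w(2) by (rule order_trans)
      then have "(\<integral>\<^sup>+x. indicator \<Omega> x * A (norm ((1/l) *\<^sub>R u' x) / C') \<partial>lborel) \<le> ennreal 1"
      proof (rule C'(2)[rotated 3])
        show "(\<lambda>x. (1/l) *\<^sub>R u' x) \<in> borel_measurable borel" using um by simp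
        show "w \<in> borel_measurable borel" unfolding c by (rule qf_measurable)
        fix x assume "x \<in> \<Omega>"
        then have "norm (w x) \<le> K * norm c" unfolding c by (intro K(2) R(2))
        also have "\<dots> \<le> K * K0" using nc K(1) by (intro mult_left_mono) auto
        finally show "norm (w x) \<le> K * K0" .
      qed
      moreover have "norm ((1/l) *\<^sub>R u' x) / C' = norm (u' x) / (C' * l)" for x using l by simp
      moreover have "(\<integral>\<^sup>+x. A (norm (u x) / (C' * l)) \<partial>lebesgue_on \<Omega>) = (\<integral>\<^sup>+x. indicator \<Omega> x * A (norm (u' x) / (C' * l)) \<partial>lborel)"
        by (rule nn_integral_lebesgue_on_eq[OF b\<Omega>]) (use uu in eventually_elim, auto)
      ultimately have "(\<integral>\<^sup>+x. A (norm (u x) / (C' * l)) \<partial>lebesgue_on \<Omega>) \<le> 1" using l by (simp add: mult.commute)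
      then show "lux_norm A \<Omega> u \<le> C' * l" using C'(1) l by (intro lux_norm_le) auto
    qed
  qed
qed

theorem theorem4p9:
  fixes \<Omega> :: "(real^'n) set" and A :: "real \<Rightarrow> ennreal"
  assumes "CARD('n) \<ge> 3" and "bounded \<Omega>" and "open \<Omega>" and "young_function A"
  shows "(\<exists>C::real. \<forall>u G. u \<in> ED0_space A \<Omega> \<longrightarrow> G \<in> orlicz_space A \<Omega> \<longrightarrow> weak_EDgrad \<Omega> u G \<longrightarrow>
            lux_norm A \<Omega> u \<le> C * lux_norm A \<Omega> G)
       \<and> (connected \<Omega> \<and> cone_property \<Omega> \<longrightarrow>
          (\<exists>C::real. \<forall>u G. u \<in> ED_space A \<Omega> \<longrightarrow> G \<in> orlicz_space A \<Omega> \<longrightarrow> weak_EDgrad \<Omega> u G \<longrightarrow>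
            (INF w\<in>Sigma_fields. lux_norm A \<Omega> (\<lambda>x. u x - w x)) \<le> C * lux_norm A \<Omega> G))"
proof (intro conjI impI)
  show "\<exists>C::real. \<forall>u G. u \<in> ED0_space A \<Omega> \<longrightarrow> G \<in> orlicz_space A \<Omega> \<longrightarrow> weak_EDgrad \<Omega> u G \<longrightarrow>
            lux_norm A \<Omega> u \<le> C * lux_norm A \<Omega> G"
    by (rule zero_extension_lux_norm[OF assms(1,4,2,3)])
  assume "connected \<Omega> \<and> cone_property \<Omega>"
  then have "Korn_on A \<Omega>" by (intro cone_property_Korn[OF assms(1,4,3,2)]) auto
  then show "\<exists>C::real. \<forall>u G. u \<in> ED_space A \<Omega> \<longrightarrow> G \<in> orlicz_space A \<Omega> \<longrightarrow> weak_EDgrad \<Omega> u G \<longrightarrow>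
            (INF w\<in>Sigma_fields. lux_norm A \<Omega> (\<lambda>x. u x - w x)) \<le> C * lux_norm A \<Omega> G"
    by (rule Korn_on_lux_norm[OF assms(4,2,3)])
qed

end
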